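(* Let $(X_i,T_i)$, $i=1,2$, be minimal Cantor systems each with finitely many ergodic (invariant Borel probability) measures. If $(X_1,T_1)$ and $(X_2,T_2)$ are speedup equivalent, then $(X_1,T_1)$ and $(X_2,T_2)$ are orbit equivalent.
   Context: A Cantor space is a nonempty compact, metrizable, perfect, zero-dimensional space. A minimal Cantor system $(X,T)$ is a Cantor space $X$ with a homeomorphism $T:X\to X$ all of whose orbits $\{T^n(x):n\in\mathbb{Z}\}$ are dense. $\mathbb{Z}^+$ denotes the positive integers. $(Y,S)$ is a speedup of $(X,T)$ if there is a function $p:X\to\mathbb{Z}^+$ such that $(Y,S)$ is topologically conjugate to $(X,T')$, where $T'(x)=T^{p(x)}(x)$ for all $x\in X$. Two minimal Cantor systems are speedup equivalent if each is a speedup of the other. Two minimal Cantor systems $(X,T)$ and $(Y,S)$ are orbit equivalent if $(Y,S)$ is topologically conjugate to some $T':X\to X$ such that $T$ and $T'$ have the same orbits. *)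

theory Defs
  imports "HOL-Analysis.Analysis" "HOL-Probability.Probability"
begin

text \<open>Spaces are abstract topologies, and maps are total HOL functions of which only the
  values on the carrier \<^term>\<open>topspace X\<close> matter.\<close>

definition Cantor_space :: "'a topology \<Rightarrow> bool" where
  "Cantor_space X \<longleftrightarrow>
     topspace X \<noteq> {} \<and> compact_space X \<and> metrizable_space X \<and>
     X derived_set_of (topspace X) = topspace X \<and> X dim_le 0"

text \<open>Integer iterates \<open>T\<^sup>n\<close>; the inverse is taken relative to the carrier, so this is meant
  for maps that are bijective on \<^term>\<open>topspace X\<close>.\<close>

definition int_iterate :: "'a topology \<Rightarrow> ('a \<Rightarrow> 'a) \<Rightarrow> int \<Rightarrow> 'a \<Rightarrow> 'a" where
  "int_iterate X T n =
     (if 0 \<le> n then T ^^ nat n else inv_into (topspace X) T ^^ nat (- n))"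

definition full_orbit :: "'a topology \<Rightarrow> ('a \<Rightarrow> 'a) \<Rightarrow> 'a \<Rightarrow> 'a set" where
  "full_orbit X T x = {int_iterate X T n x | n. True}"

definition minimal_Cantor_system :: "'a topology \<Rightarrow> ('a \<Rightarrow> 'a) \<Rightarrow> bool" where
  "minimal_Cantor_system X T \<longleftrightarrow>
     Cantor_space X \<and> homeomorphic_map X X T \<and>
     (\<forall>x\<in>topspace X. X closure_of (full_orbit X T x) = topspace X)"

definition top_conjugate ::
    "'a topology \<Rightarrow> ('a \<Rightarrow> 'a) \<Rightarrow> 'b topology \<Rightarrow> ('b \<Rightarrow> 'b) \<Rightarrow> bool" where
  "top_conjugate X T Y S \<longleftrightarrow>
     (\<exists>h. homeomorphic_map X Y h \<and> (\<forall>x\<in>topspace X. h (T x) = S (h x)))"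

definition speedup_of ::
    "'b topology \<Rightarrow> ('b \<Rightarrow> 'b) \<Rightarrow> 'a topology \<Rightarrow> ('a \<Rightarrow> 'a) \<Rightarrow> bool" where
  "speedup_of Y S X T \<longleftrightarrow>
     (\<exists>p :: 'a \<Rightarrow> nat. (\<forall>x\<in>topspace X. 0 < p x) \<and>
        top_conjugate Y S X (\<lambda>x. (T ^^ p x) x))"

definition speedup_equivalent ::
    "'a topology \<Rightarrow> ('a \<Rightarrow> 'a) \<Rightarrow> 'b topology \<Rightarrow> ('b \<Rightarrow> 'b) \<Rightarrow> bool" where
  "speedup_equivalent X T Y S \<longleftrightarrow> speedup_of X T Y S \<and> speedup_of Y S X T"

text \<open>When \<open>S\<close> is a homeomorphism of \<open>Y\<close>, the conjugacy makes \<open>T'\<close> a homeomorphism of \<open>X\<close>,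
  so that its integer iterates are meaningful.\<close>

definition orbit_equivalent ::
    "'a topology \<Rightarrow> ('a \<Rightarrow> 'a) \<Rightarrow> 'b topology \<Rightarrow> ('b \<Rightarrow> 'b) \<Rightarrow> bool" where
  "orbit_equivalent X T Y S \<longleftrightarrow>
     (\<exists>T' \<in> topspace X \<rightarrow> topspace X. top_conjugate Y S X T' \<and>
        (\<forall>x\<in>topspace X. full_orbit X T' x = full_orbit X T x))"

definition invariant_Borel_prob :: "'a topology \<Rightarrow> ('a \<Rightarrow> 'a) \<Rightarrow> 'a measure \<Rightarrow> bool" where
  "invariant_Borel_prob X T M \<longleftrightarrow>
     space M = topspace X \<and> sets M = sigma_sets (topspace X) {U. openin X U} \<and>
     prob_space M \<and> T \<in> M \<rightarrow>\<^sub>M M \<and> distr M M T = M"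

definition ergodic_measure :: "'a topology \<Rightarrow> ('a \<Rightarrow> 'a) \<Rightarrow> 'a measure \<Rightarrow> bool" where
  "ergodic_measure X T M \<longleftrightarrow>
     invariant_Borel_prob X T M \<and>
     (\<forall>A\<in>sets M. T -` A \<inter> space M = A \<longrightarrow> measure M A = 0 \<or> measure M A = 1)"

end

theory Submission
  imports Defs
begin

text \<open>After a conjugation the second system is a map \<open>S x = T\<^sup>p\<^sup>(\<^sup>x\<^sup>) x\<close> on the space of \<open>T\<close>.
  Since \<open>p\<close> is countably valued with closed level sets, \<open>T\<close>-invariant measures are \<open>S\<close>-invariant.
  Extreme invariant means on clopen sets are pairwise almost disjointly supported, so distinct extreme
  \<open>T\<close>-means decompose into disjoint sets of extreme \<open>S\<close>-means. Counting in both directions of the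
  speedup equivalence shows that \<open>S\<close> and \<open>T\<close> have the same extreme means.

  An orbit equivalence of \<open>S\<close> and \<open>T\<close> is then built by a back-and-forth argument on nested towers over
  clopen bases that shrink to a closed set \<open>Y\<close>. At each stage the columns of the finer towers of one system
  are assembled from the columns of the other; the number of columns of type \<open>v\<close> needed is a tower sum of
  a function \<open>\<xi>\<^sub>v\<close> on which every common mean agrees with the measure of the column base, hence is positive.
  The identities between these numbers have to hold exactly over the integers. They are solved by adding
  generic functions \<open>h - h \<circ> S\<close>, invisible to the means, so that the functions in play have integer-valued dual
  functionals. In the limit, columns account for the orbit relation
  except for the steps \<open>x, S x\<close> with \<open>S x \<in> Y\<close>, which are matched separately.\<close>

section \<open>Clopen sets and locally constant functions\<close>

text \<open>Equality of all invariant means determines an integer-valued function only up to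
  functions of mean zero, whereas matching columns needs equal counts in every single tower. Towers
  shrinking to one point would leave no freedom to remove the discrepancy: there the tower sums of h
  - h o S eventually vanish. With a perfect \<open>Y\<close> the orbits are cut along many points;
  the towers then describe an AF-type subrelation of the orbit relation, whose group of
  integer-valued functions modulo vanishing tower sums has infinitely many independent elements of
  mean zero. They absorb the discrepancy. The price is that orbits fall apart at \<open>Y\<close>,
  so the gluing across \<open>Y\<close> has to be carried along as extra data consistent with the
  columns. Finiteness turns two one-sided comparisons into an equality: the invariant means of each
  system embed in those of the other, which alone does not make them equal, but with finitely many
  extreme means an injection in each direction leaves each extreme mean only itself as a
  component.\<close>

definition clopen_in :: "'a topology \<Rightarrow> 'a set \<Rightarrow> bool" where
  "clopen_in X A \<longleftrightarrow> openin X A \<and> closedin X A"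

text \<open>These are the continuous maps into a discrete set. The finite range, which compactness
  would supply, is part of the definition so that the closure properties hold in every topological
  space.\<close>

definition loc_const :: "'a topology \<Rightarrow> ('a \<Rightarrow> 'c) \<Rightarrow> bool" where
  "loc_const X g \<longleftrightarrow> finite (g ` topspace X) \<and> (\<forall>c. clopen_in X {x\<in>topspace X. g x = c})"

abbreviation ind :: "'a set \<Rightarrow> 'a \<Rightarrow> int" where
  "ind A x \<equiv> (if x \<in> A then 1 else 0)"

lemma clopen_in_subset: "clopen_in X A \<Longrightarrow> A \<subseteq> topspace X"
  by (simp add: clopen_in_def openin_subset)

lemma clopen_in_empty [simp]: "clopen_in X {}" and clopen_in_topspace [simp]: "clopen_in X (topspace X)"
  by (auto simp: clopen_in_def)

lemma clopen_in_Int: "clopen_in X A \<Longrightarrow> clopen_in X B \<Longrightarrow> clopen_in X (A \<inter> B)"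
  by (auto simp: clopen_in_def)

lemma clopen_in_Un: "clopen_in X A \<Longrightarrow> clopen_in X B \<Longrightarrow> clopen_in X (A \<union> B)"
  by (auto simp: clopen_in_def)

lemma clopen_in_Diff: "clopen_in X A \<Longrightarrow> clopen_in X B \<Longrightarrow> clopen_in X (A - B)"
  by (auto simp: clopen_in_def)

lemma clopen_in_UN: "finite I \<Longrightarrow> (\<And>i. i \<in> I \<Longrightarrow> clopen_in X (A i)) \<Longrightarrow> clopen_in X (\<Union>i\<in>I. A i)"
  by (auto simp: clopen_in_def intro: closedin_Union)

lemma loc_const_Collect:
  assumes "loc_const X g" shows "clopen_in X {x\<in>topspace X. P (g x)}"
proof -
  have "{x\<in>topspace X. P (g x)} = (\<Union>c\<in>{c\<in>g ` topspace X. P c}. {x\<in>topspace X. g x = c})"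
    by auto
  moreover have "clopen_in X \<dots>"
    using assms by (intro clopen_in_UN) (auto simp: loc_const_def)
  ultimately show ?thesis by simp
qed

lemma loc_constI:
  assumes "finite I" "\<And>x. x \<in> topspace X \<Longrightarrow> g x \<in> I" "\<And>c. c \<in> I \<Longrightarrow> clopen_in X {x\<in>topspace X. g x = c}"
  shows "loc_const X g"
  unfolding loc_const_def
proof (intro conjI allI)
  show "finite (g ` topspace X)" using assms(1,2) by (auto intro: finite_subset)
  fix c show "clopen_in X {x\<in>topspace X. g x = c}"
  proof (cases "c \<in> I")
    case False
    then have "{x\<in>topspace X. g x = c} = {}" using assms(2) by auto
    then show ?thesis by (simp only: clopen_in_empty)
  qed (use assms(3) in auto)
qed

lemma loc_const_const [simp]: "loc_const X (\<lambda>x. c)"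
  by (rule loc_constI[where I = "{c}"]) auto

lemma loc_const_comp: "loc_const X g \<Longrightarrow> loc_const X (\<lambda>x. F (g x))"
  by (rule loc_constI[where I = "F ` g ` topspace X"])
     (auto intro: loc_const_Collect[where P = "\<lambda>y. F y = _"] simp: loc_const_def)

lemma loc_const_Pair:
  assumes "loc_const X g" "loc_const X h" shows "loc_const X (\<lambda>x. (g x, h x))"
proof (rule loc_constI[where I = "g ` topspace X \<times> h ` topspace X"])
  show "finite (g ` topspace X \<times> h ` topspace X)" using assms by (auto simp: loc_const_def)
  fix c
  have "{x\<in>topspace X. (g x, h x) = c} = {x\<in>topspace X. g x = fst c} \<inter> {x\<in>topspace X. h x = snd c}"
    by auto
  then show "clopen_in X {x\<in>topspace X. (g x, h x) = c}"
    using assms by (simp add: clopen_in_Int loc_const_def)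
qed auto

lemma loc_const_comp2: "loc_const X g \<Longrightarrow> loc_const X h \<Longrightarrow> loc_const X (\<lambda>x. F (g x) (h x))"
  using loc_const_comp[OF loc_const_Pair, of X g h "\<lambda>(a, b). F a b"] by simp

lemma loc_const_ind: "clopen_in X A \<Longrightarrow> loc_const X (\<lambda>x. x \<in> A)"
proof (rule loc_constI[where I = UNIV])
  fix c assume A: "clopen_in X A"
  have "{x\<in>topspace X. (x \<in> A) = c} = (if c then A else topspace X - A)"
    using clopen_in_subset[OF A] by auto
  then show "clopen_in X {x\<in>topspace X. (x \<in> A) = c}" using A by (simp add: clopen_in_Diff)
qed auto

lemma loc_const_ind_int: "clopen_in X A \<Longrightarrow> loc_const X (ind A)"
  by (rule loc_const_comp[OF loc_const_ind, where F = "\<lambda>b. if b then 1 else 0"])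

lemma loc_const_map: "(\<And>i. i \<in> set is \<Longrightarrow> loc_const X (G i)) \<Longrightarrow> loc_const X (\<lambda>x. map (\<lambda>i. G i x) is)"
  by (induction "is") (auto intro!: loc_const_comp2[where F = "(#)"])

lemma loc_const_sum: "finite I \<Longrightarrow> (\<And>i. i \<in> I \<Longrightarrow> loc_const X (G i)) \<Longrightarrow> loc_const X (\<lambda>x. \<Sum>i\<in>I. G i x)"
proof (induction I rule: finite_induct)
  case (insert i I)
  then have "loc_const X (\<lambda>x. G i x + (\<Sum>i\<in>I. G i x))" by (intro loc_const_comp2[where F = "(+)"]) auto
  then show ?case using insert by simp
qed simp

lemma loc_const_cong:
  assumes "loc_const X f" and eq: "\<And>x. x \<in> topspace X \<Longrightarrow> f x = g x" shows "loc_const X g"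
proof -
  have "{x\<in>topspace X. f x = c} = {x\<in>topspace X. g x = c}" for c using eq by auto
  moreover have "f ` topspace X = g ` topspace X" using eq by auto
  ultimately show ?thesis using assms(1) by (simp add: loc_const_def)
qed

lemma clopen_in_vimage:
  assumes "homeomorphic_map X Y h" "clopen_in Y A" shows "clopen_in X {x\<in>topspace X. h x \<in> A}"
  using assms by (auto simp: clopen_in_def homeomorphic_eq_everything_map
      openin_continuous_map_preimage closedin_continuous_map_preimage)

lemma clopen_in_image:
  assumes "homeomorphic_map X Y h" "clopen_in X A" shows "clopen_in Y (h ` A)"
  using assms unfolding clopen_in_def
  by (meson homeomorphic_map_closedness_eq homeomorphic_map_openness_eq)

lemma loc_const_vimage:
  assumes h: "homeomorphic_map X Y h" and "loc_const Y g" shows "loc_const X (\<lambda>x. g (h x))"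
proof (rule loc_constI[where I = "g ` topspace Y"])
  have hm: "\<And>x. x \<in> topspace X \<Longrightarrow> h x \<in> topspace Y"
    using h by (auto simp: homeomorphic_eq_everything_map continuous_map_def)
  show "finite (g ` topspace Y)" using assms by (auto simp: loc_const_def)
  show "g (h x) \<in> g ` topspace Y" if "x \<in> topspace X" for x using hm that by auto
  fix c
  have "{x\<in>topspace X. g (h x) = c} = {x\<in>topspace X. h x \<in> {y\<in>topspace Y. g y = c}}" using hm by auto
  then show "clopen_in X {x\<in>topspace X. g (h x) = c}"
    using clopen_in_vimage[OF h, of "{y\<in>topspace Y. g y = c}"] assms(2) by (simp only: loc_const_def)
qed

section \<open>Countable clopen bases of a Cantor space\<close>

locale cantor =
  fixes X :: "'a topology"
  assumes cantor: "Cantor_space X"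
begin

abbreviation "XX \<equiv> topspace X"

lemma compact: "compact_space X" and metrizable: "metrizable_space X" and nonempty: "XX \<noteq> {}"
  and zero_dim: "X dim_le 0" and perfect: "X derived_set_of XX = XX"
  using cantor unfolding Cantor_space_def by blast+

lemma Hausdorff: "Hausdorff_space X"
  using metrizable metrizable_imp_Hausdorff_space by blast

lemma clopen_in_base: "openin X U \<Longrightarrow> x \<in> U \<Longrightarrow> \<exists>V. clopen_in X V \<and> x \<in> V \<and> V \<subseteq> U"
proof -
  assume U: "openin X U" "x \<in> U"
  let ?P = "\<lambda>U. closedin X U \<and> openin X U"
  have "neighbourhood_base_of ?P X"
    using zero_dim by (simp only: dimension_le_0_neighbourhood_base_of_clopen)
  then have "\<forall>W x. openin X W \<and> x \<in> W \<longrightarrow> (\<exists>U. ?P U \<and> x \<in> U \<and> U \<subseteq> W)"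
    by (subst (asm) open_neighbourhood_base_of) simp_all
  with U obtain V where "?P V" "x \<in> V" "V \<subseteq> U" by meson
  then show ?thesis by (intro exI[of _ V]) (simp add: clopen_in_def)
qed

lemma clopen_in_separate: "x \<in> XX \<Longrightarrow> y \<in> XX \<Longrightarrow> x \<noteq> y \<Longrightarrow> \<exists>V. clopen_in X V \<and> x \<in> V \<and> y \<notin> V"
proof -
  assume *: "x \<in> XX" "y \<in> XX" "x \<noteq> y"
  then obtain U where U: "openin X U" "x \<in> U" "y \<notin> U"
    using Hausdorff_imp_t1_space[OF Hausdorff] unfolding t1_space_def by blast
  obtain V where "clopen_in X V" "x \<in> V" "V \<subseteq> U" using clopen_in_base[OF U(1,2)] by blast
  then show ?thesis using U(3) by blast
qed

lemma open_infinite: assumes "openin X U" "U \<noteq> {}" shows "infinite U"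
proof
  assume fin: "finite U"
  obtain x where x: "x \<in> U" using assms by auto
  have xX: "x \<in> XX" using x assms openin_subset by blast
  have "t1_space X" using Hausdorff by (rule Hausdorff_imp_t1_space)
  moreover have "finite (U - {x})" "U - {x} \<subseteq> XX" using fin openin_subset[OF assms(1)] by auto
  ultimately have "closedin X (U - {x})" by (simp add: t1_space_closedin_finite)
  then have "openin X (U - (U - {x}))" using assms by blast
  moreover have "U - (U - {x}) = {x}" using x by auto
  ultimately have "openin X {x}" by simp
  moreover have "x \<in> X derived_set_of XX" using perfect xX by simp
  ultimately show False unfolding in_derived_set_of by blast
qed

text \<open>If the radius is below a Lebesgue number of the cover of the space by \<open>A\<close>
  and its complement, each ball lies on one side, so \<open>A\<close> is a union of balls around
  points of a finite net. Each of the countably many nets yields only finitely many such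
  unions.\<close>

lemma countable_clopen_in: "countable {A. clopen_in X A}"
proof -
  obtain M d where "Metric_space M d" and X: "X = Metric_space.mtopology M d"
    using metrizable by (auto simp: metrizable_space_def)
  then interpret Metric_space M d by simp
  have cM: "compactin mtopology M"
    using compact X by (simp add: compact_space_def)
  have "\<forall>n::nat. \<exists>K. finite K \<and> K \<subseteq> M \<and> M \<subseteq> (\<Union>x\<in>K. mball x (1 / (real n + 1)))"
  proof
    fix n :: nat
    have "0 < 1 / (real n + 1)" by simp
    then show "\<exists>K. finite K \<and> K \<subseteq> M \<and> M \<subseteq> (\<Union>x\<in>K. mball x (1 / (real n + 1)))"
      using compactin_imp_mtotally_bounded[OF cM] unfolding mtotally_bounded_def by simp
  qed
  from choice[OF this] obtain K :: "nat \<Rightarrow> 'a set" where K': "\<forall>n::nat. finite (K n) \<and> K n \<subseteq> M \<and> M \<subseteq> (\<Union>x\<in>K n. mball x (1 / (real n + 1)))"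
    by (rule exE)
  then have K: "\<And>n::nat. finite (K n)" "\<And>n. K n \<subseteq> M" "\<And>n. M \<subseteq> (\<Union>x\<in>K n. mball x (1 / (real n + 1)))"
    by simp_all
  define F where "F n = (\<lambda>J. \<Union>x\<in>J. mball x (1 / (real n + 1))) ` Pow (K n)" for n :: nat
  have "{A. clopen_in X A} \<subseteq> (\<Union>n. F n)"
  proof
    fix A assume "A \<in> {A. clopen_in X A}"
    then have A: "openin mtopology A" "openin mtopology (M - A)" "A \<subseteq> M"
      using X clopen_in_subset[of X A] by (auto simp: clopen_in_def closedin_def)
    obtain e where e: "e > 0" "\<And>x. x \<in> M \<Longrightarrow> mball x e \<subseteq> A \<or> mball x e \<subseteq> M - A"
    proof -
      have "\<exists>e>0. \<forall>x\<in>M. \<exists>U\<in>{A, M - A}. mball x e \<subseteq> U"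
        using A by (intro lebesgue_number[OF cM]) auto
      then show ?thesis using that by blast
    qed
    obtain n where "1 / real (Suc n) < e" by (rule nat_approx_posE[OF e(1)])
    then have n: "1 / (real n + 1) < e" by (simp add: add.commute)
    define J where "J = {x\<in>K n. mball x (1 / (real n + 1)) \<inter> A \<noteq> {}}"
    have "mball x (1 / (real n + 1)) \<subseteq> A" if xJ: "x \<in> J" for x
    proof -
      have "mball x (1 / (real n + 1)) \<subseteq> mball x e" using n by (intro mball_subset_concentric less_imp_le) (simp add: add.commute)
      moreover have "x \<in> M" using xJ K(2)[of n] unfolding J_def by auto
      moreover obtain y where "y \<in> mball x (1 / (real n + 1))" "y \<in> A"
        using xJ unfolding J_def by (auto simp del: in_mball)
      ultimately show ?thesis using e(2)[of x] by auto
    qed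
    moreover have "A \<subseteq> (\<Union>x\<in>J. mball x (1 / (real n + 1)))"
    proof
      fix a assume a: "a \<in> A"
      then obtain x where "x \<in> K n" "a \<in> mball x (1 / (real n + 1))"
        using K(3)[of n] A(3) by (auto simp: add.commute)
      then have "x \<in> J" using a unfolding J_def by auto
      then show "a \<in> (\<Union>x\<in>J. mball x (1 / (real n + 1)))" using \<open>a \<in> mball x _\<close> by (rule UN_I)
    qed
    ultimately have "A = (\<Union>x\<in>J. mball x (1 / (real n + 1)))" by (intro equalityI UN_least)
    then have "A \<in> F n" unfolding F_def by (rule image_eqI) (simp add: J_def)
    then show "A \<in> (\<Union>n. F n)" by (rule UN_I[OF UNIV_I])
  qed
  moreover have "countable (\<Union>n. F n)"
    by (rule countable_UN) (simp_all add: F_def K(1) countable_finite)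
  ultimately show ?thesis by (rule countable_subset)
qed

definition clopen_enum :: "nat \<Rightarrow> 'a set" where "clopen_enum = from_nat_into {A. clopen_in X A}"

lemma clopen_in_clopen_enum: "clopen_in X (clopen_enum i)"
proof -
  have "{A. clopen_in X A} \<noteq> {}" using clopen_in_empty[of X] by blast
  then have "from_nat_into {A. clopen_in X A} i \<in> {A. clopen_in X A}" by (rule from_nat_into)
  then show ?thesis by (simp add: clopen_enum_def)
qed

lemma clopen_enum_surj: "clopen_in X A \<Longrightarrow> \<exists>i. clopen_enum i = A"
  using from_nat_into_surj[OF countable_clopen_in, of A] unfolding clopen_enum_def by simp

text \<open>Along an enumeration of all clopen sets, \<open>profile k\<close> names the atoms of a refining sequence of
  clopen partitions that separates points.\<close>

definition profile :: "nat \<Rightarrow> 'a \<Rightarrow> bool list" where "profile k x = map (\<lambda>i. x \<in> clopen_enum i) [0..<k]"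

lemma loc_const_profile: "loc_const X (profile k)"
  unfolding profile_def by (intro loc_const_map loc_const_ind clopen_in_clopen_enum)

lemma profile_eq: "profile k x = profile k y \<longleftrightarrow> (\<forall>i<k. x \<in> clopen_enum i \<longleftrightarrow> y \<in> clopen_enum i)"
  by (auto simp: profile_def)

lemma profile_mono: "profile k x = profile k y \<Longrightarrow> k' \<le> k \<Longrightarrow> profile k' x = profile k' y"
  by (auto simp: profile_eq)

text \<open>Each of the finitely many level sets occurs in the enumeration, so a profile long enough
  to contain all their indices determines \<open>g\<close>.\<close>

lemma loc_const_profile_ev:
  assumes "loc_const X g"
  shows "\<exists>K. \<forall>k\<ge>K. \<forall>x\<in>XX. \<forall>y\<in>XX. profile k x = profile k y \<longrightarrow> g x = g y"
proof -
  have "\<forall>c. \<exists>i. clopen_enum i = {x\<in>XX. g x = c}" using assms clopen_enum_surj unfolding loc_const_def by blast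
  from choice[OF this] obtain i where i: "\<And>c. clopen_enum (i c) = {x\<in>XX. g x = c}" by blast
  have fin: "finite (i ` g ` XX)" using assms by (auto simp: loc_const_def)
  then obtain K where K: "\<forall>j\<in>i ` g ` XX. j < K"
    by (metis finite_nat_set_iff_bounded)
  have "g x = g y" if "k \<ge> K" "x \<in> XX" "y \<in> XX" "profile k x = profile k y" for k x y
  proof -
    have "i (g x) < k" using K that by auto
    then have "x \<in> clopen_enum (i (g x)) \<longleftrightarrow> y \<in> clopen_enum (i (g x))" using that by (auto simp: profile_eq)
    then show ?thesis using that i by auto
  qed
  then show ?thesis by blast
qed

lemma profile_separate:
  assumes "x \<in> XX" "y \<in> XX" "x \<noteq> y" shows "\<exists>K. \<forall>k\<ge>K. profile k x \<noteq> profile k y"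
proof -
  obtain V where "clopen_in X V" "x \<in> V" "y \<notin> V" using clopen_in_separate[OF assms] by blast
  then obtain i where "x \<in> clopen_enum i" "y \<notin> clopen_enum i" using clopen_enum_surj[of V] by auto
  then have "profile k x \<noteq> profile k y" if "k \<ge> Suc i" for k
    unfolding profile_eq using that Suc_le_lessD by blast
  then show ?thesis by blast
qed

text \<open>Serves to prescribe finitely many labels that must all occur on an infinite set which
  may be neither open nor closed. Distinct points of \<open>A\<close>, one for each label, are
  separated by a long profile, and labels are constant on its atoms.\<close>

lemma loc_const_split:
  assumes "A \<subseteq> XX" "infinite A" "finite Om" "Om \<noteq> {}"
  shows "\<exists>g. loc_const X g \<and> (\<forall>x. g x \<in> Om) \<and> g ` A = Om"
proof -
  obtain B where B: "B \<subseteq> A" "card B = card Om" "finite B"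
    using infinite_arbitrarily_large[OF assms(2)] by metis
  then obtain q where q: "bij_betw q Om B"
    using finite_same_card_bij[OF assms(3) B(3)] by auto
  have "\<forall>p\<in>B \<times> B. \<exists>K. fst p \<noteq> snd p \<longrightarrow> (\<forall>k\<ge>K. profile k (fst p) \<noteq> profile k (snd p))"
  proof
    fix p assume p: "p \<in> B \<times> B"
    show "\<exists>K. fst p \<noteq> snd p \<longrightarrow> (\<forall>k\<ge>K. profile k (fst p) \<noteq> profile k (snd p))"
    proof (cases "fst p = snd p")
      case False
      then show ?thesis using profile_separate[of "fst p" "snd p"] p B(1) assms(1) by force
    qed simp
  qed
  from bchoice[OF this] obtain K
    where K: "\<forall>p\<in>B \<times> B. fst p \<noteq> snd p \<longrightarrow> (\<forall>k\<ge>K p. profile k (fst p) \<noteq> profile k (snd p))"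
    by blast
  define k where "k = Max (K ` (B \<times> B))"
  have inj: "x = y" if "x \<in> B" "y \<in> B" "profile k x = profile k y" for x y
  proof (rule ccontr)
    assume ne: "x \<noteq> y"
    have "k \<ge> K (x, y)" unfolding k_def using B(3) that by (intro Max_ge) auto
    then show False using K that ne by fastforce
  qed
  obtain o0 where o0: "o0 \<in> Om" using assms by auto
  \<comment> \<open>Atoms that contain no chosen point get the arbitrary label \<open>o0\<close>,
    which keeps all values inside \<open>Om\<close>.\<close>
  define G where "G a = (if \<exists>w\<in>Om. a = profile k (q w) then (SOME w. w \<in> Om \<and> a = profile k (q w)) else o0)" for a
  have GOm: "G a \<in> Om" for a
    unfolding G_def using o0 by (auto intro: someI2_ex)
  have Gq: "G (profile k (q w)) = w" if w: "w \<in> Om" for w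
  proof -
    have "G (profile k (q w)) = (SOME v. v \<in> Om \<and> profile k (q w) = profile k (q v))"
      using w by (auto simp: G_def)
    also have "\<dots> = w"
      using w q inj by (intro some_equality) (auto simp: bij_betw_def inj_on_def)
    finally show ?thesis .
  qed
  have "w \<in> (\<lambda>x. G (profile k x)) ` A" if "w \<in> Om" for w
    using Gq[OF that] B(1) q that by (intro image_eqI[of _ _ "q w"]) (auto simp: bij_betw_def)
  then have "(\<lambda>x. G (profile k x)) ` A = Om" using GOm by blast
  moreover have "loc_const X (\<lambda>x. G (profile k x))" by (rule loc_const_comp[OF loc_const_profile])
  ultimately show ?thesis using GOm by (intro exI[of _ "\<lambda>x. G (profile k x)"]) auto
qed

lemma clopen_in_nest:
  assumes "\<And>n. clopen_in X (A n)" "\<And>n. A n \<noteq> {}" "\<And>n. A (Suc n) \<subseteq> A n"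
  shows "(\<Inter>n. A n) \<noteq> {}"
  using assms by (intro compact_space_imp_nest[OF compact]) (auto simp: clopen_in_def decseq_Suc_iff)

end

section \<open>Return times and towers\<close>

locale minimal_system =
  fixes X :: "'a topology" and S :: "'a \<Rightarrow> 'a"
  assumes ms: "minimal_Cantor_system X S"

sublocale minimal_system \<subseteq> cantor X
  using ms by unfold_locales (simp add: minimal_Cantor_system_def)

context minimal_system
begin

lemma hom: "homeomorphic_map X X S"
  using ms by (simp add: minimal_Cantor_system_def)

lemma dense: "x \<in> XX \<Longrightarrow> X closure_of (full_orbit X S x) = XX"
  using ms by (simp add: minimal_Cantor_system_def)

lemma S_bij: "bij_betw S XX XX"
  using homeomorphic_imp_surjective_map[OF hom] homeomorphic_imp_injective_map[OF hom]
  by (simp add: bij_betw_def)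

lemma S_in: "x \<in> XX \<Longrightarrow> S x \<in> XX"
  using S_bij by (auto simp: bij_betw_def)

lemma S_inj: "x \<in> XX \<Longrightarrow> y \<in> XX \<Longrightarrow> S x = S y \<Longrightarrow> x = y"
  using S_bij by (auto simp: bij_betw_def inj_on_def)

lemma Sn_in: "x \<in> XX \<Longrightarrow> (S ^^ n) x \<in> XX"
  by (induction n) (auto intro: S_in)

lemma Sn_bij: "bij_betw (S ^^ n) XX XX"
proof (induction n)
  case (Suc n)
  show ?case using bij_betw_trans[OF Suc S_bij] by (simp only: funpow.simps)
qed (simp add: bij_betw_def)

lemma Sn_inj: "x \<in> XX \<Longrightarrow> y \<in> XX \<Longrightarrow> (S ^^ n) x = (S ^^ n) y \<Longrightarrow> x = y"
  using Sn_bij by (auto simp: bij_betw_def inj_on_def)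

lemma Sn_surj: "x \<in> XX \<Longrightarrow> \<exists>y\<in>XX. x = (S ^^ n) y"
  using Sn_bij[of n] unfolding bij_betw_def by blast

lemma Sn_add: "(S ^^ (m + n)) x = (S ^^ m) ((S ^^ n) x)"
  by (simp add: funpow_add)

lemma Sn_hom: "homeomorphic_map X X (S ^^ n)"
proof (induction n)
  case 0
  then show ?case by (simp add: homeomorphic_map_id id_def[symmetric])
next
  case (Suc n)
  show ?case using homeomorphic_map_compose[OF Suc hom] by (simp only: funpow.simps)
qed

lemma loc_const_Sn: "loc_const X g \<Longrightarrow> loc_const X (\<lambda>x. g ((S ^^ n) x))"
  by (rule loc_const_vimage[OF Sn_hom])

text \<open>Replaces negative iterates by forward powers applied to the other point; most orbit
  arguments can then be run without the inverse map.\<close>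

lemma full_orbit_iff:
  assumes x: "x \<in> XX"
  shows "y \<in> full_orbit X S x \<longleftrightarrow> y \<in> XX \<and> (\<exists>n. y = (S ^^ n) x \<or> x = (S ^^ n) y)"
proof -
  let ?I = "inv_into XX S"
  have I: "?I u \<in> XX \<and> S (?I u) = u" if "u \<in> XX" for u
    using S_bij that by (simp add: bij_betw_def inv_into_into f_inv_into_f)
  have In: "(?I ^^ n) u \<in> XX \<and> (S ^^ n) ((?I ^^ n) u) = u" if "u \<in> XX" for u n
  proof (induction n)
    case (Suc n)
    have "(S ^^ Suc n) ((?I ^^ Suc n) u) = (S ^^ n) (S (?I ((?I ^^ n) u)))"
      by (simp add: funpow_swap1)
    then show ?case using I Suc by simp
  qed (use that in simp)
  show ?thesis
  proof
    assume "y \<in> full_orbit X S x"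
    then obtain n where n: "y = int_iterate X S n x" by (auto simp: full_orbit_def)
    show "y \<in> XX \<and> (\<exists>n. y = (S ^^ n) x \<or> x = (S ^^ n) y)"
    proof (cases "0 \<le> n")
      case True
      then show ?thesis using n x Sn_in by (auto simp: int_iterate_def)
    next
      case False
      then have "y = (?I ^^ nat (-n)) x" using n by (simp add: int_iterate_def)
      then show ?thesis using In[OF x, of "nat (-n)"] by (metis (no_types))
    qed
  next
    assume y: "y \<in> XX \<and> (\<exists>n. y = (S ^^ n) x \<or> x = (S ^^ n) y)"
    then obtain n where n: "y = (S ^^ n) x \<or> x = (S ^^ n) y" by blast
    then show "y \<in> full_orbit X S x"
    proof
      assume "y = (S ^^ n) x"
      then have "y = int_iterate X S (int n) x" by (simp add: int_iterate_def)
      then show ?thesis by (auto simp: full_orbit_def)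
    next
      assume xn: "x = (S ^^ n) y"
      have "(S ^^ n) y = (S ^^ n) ((?I ^^ n) x)"
        by (simp only: conjunct2[OF In[OF x]] xn[symmetric])
      then have yn: "y = (?I ^^ n) x" by (rule Sn_inj[OF conjunct1[OF y] conjunct1[OF In[OF x]]])
      have "y = int_iterate X S (- int n) x"
      proof (cases "n = 0")
        case True
        then show ?thesis using xn by (simp add: int_iterate_def)
      next
        case False
        then show ?thesis using yn by (simp add: int_iterate_def)
      qed
      then show ?thesis by (auto simp: full_orbit_def)
    qed
  qed
qed

text \<open>The sets of points whose orbit misses \<open>U\<close> at all times between -n and n are
  clopen and decreasing, and density of orbits makes their intersection empty; compactness gives one
  \<open>N\<close> that serves all points.\<close>

lemma uniform_hitting_time:
  assumes U: "clopen_in X U" "U \<noteq> {}"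
  shows "\<exists>L. \<forall>x\<in>XX. \<exists>i<L. (S ^^ i) x \<in> U"
proof -
  define A where "A n = {x\<in>XX. \<forall>m\<le>n. (S ^^ m) x \<notin> U \<and> x \<notin> (S ^^ m) ` U}" for n
  have cA: "clopen_in X (A n)" for n
  proof -
    have "A n = XX - (\<Union>m\<in>{..n}. {x\<in>XX. (S ^^ m) x \<in> U} \<union> (S ^^ m) ` U)"
      by (auto simp: A_def)
    then show ?thesis
      using clopen_in_vimage[OF Sn_hom U(1)] clopen_in_image[OF Sn_hom U(1)]
      by (auto intro!: clopen_in_Diff clopen_in_UN clopen_in_Un)
  qed
  have "\<exists>n. A n = {}"
  proof (rule ccontr)
    assume "\<nexists>n. A n = {}"
    moreover have "A (Suc n) \<subseteq> A n" for n by (intro subsetI) (simp add: A_def le_Suc_eq)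
    ultimately have "(\<Inter>n. A n) \<noteq> {}" using cA by (intro clopen_in_nest) auto
    then obtain x where x: "\<And>n. x \<in> A n" by auto
    have xX: "x \<in> XX" using x[of 0] by (simp add: A_def)
    obtain u where u: "u \<in> U" using U by auto
    then have "u \<in> X closure_of (full_orbit X S x)" using dense[OF xX] U clopen_in_subset by blast
    then obtain y where y: "y \<in> full_orbit X S x" "y \<in> U"
      using U(1) u unfolding in_closure_of clopen_in_def by blast
    then obtain n where "y = (S ^^ n) x \<or> x = (S ^^ n) y" using full_orbit_iff[OF xX] by auto
    then show False using x[of n] y(2) by (auto simp: A_def)
  qed
  then obtain N where N: "A N = {}" by blast
  have "\<exists>i<2 * N + 1. (S ^^ i) x \<in> U" if x: "x \<in> XX" for x
  proof -
    \<comment> \<open>A hit at a time in [-N, N] seen from \<open>(S ^^ N) x\<close> is a hit at a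
      time in [0, 2N] seen from \<open>x\<close>; this makes the hitting time one-sided.\<close>
    have "(S ^^ N) x \<notin> A N" using N by simp
    then obtain m where m: "m \<le> N" "(S ^^ m) ((S ^^ N) x) \<in> U \<or> (S ^^ N) x \<in> (S ^^ m) ` U"
      using Sn_in[OF x] by (auto simp: A_def)
    from m(2) show ?thesis
    proof
      assume "(S ^^ m) ((S ^^ N) x) \<in> U"
      then show ?thesis using m(1) by (intro exI[of _ "m + N"]) (simp add: Sn_add)
    next
      assume "(S ^^ N) x \<in> (S ^^ m) ` U"
      then obtain u where u: "u \<in> U" "(S ^^ N) x = (S ^^ m) u" by auto
      have "(S ^^ m) ((S ^^ (N - m)) x) = (S ^^ m) u" using u(2) m(1) Sn_add[of m "N - m" x] by simp
      then have "(S ^^ (N - m)) x = u"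
        using Sn_inj Sn_in[OF x] u(1) clopen_in_subset[OF U(1)] by blast
      then show ?thesis using u(1) by (intro exI[of _ "N - m"]) auto
    qed
  qed
  then show ?thesis by blast
qed

lemma infinite_XX: "infinite XX"
  using open_infinite[of XX] nonempty by simp

text \<open>A periodic orbit would be finite, hence closed with nonempty open complement, and could
  not enter that complement as minimality demands.\<close>

lemma aperiodic:
  assumes x: "x \<in> XX" and n: "0 < n" shows "(S ^^ n) x \<noteq> x"
proof
  assume p: "(S ^^ n) x = x"
  define F where "F = (\<lambda>i. (S ^^ i) x) ` {..<n}"
  have F: "(S ^^ j) x \<in> F" for j
    using funpow_mod_eq[OF p, of j] n unfolding F_def by (metis imageI lessThan_iff mod_less_divisor)
  have "finite F" "F \<subseteq> XX" using Sn_in[OF x] by (auto simp: F_def)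
  then have "closedin X F" using Hausdorff_imp_t1_space[OF Hausdorff] by (simp add: t1_space_closedin_finite)
  then have "openin X (XX - F)" by blast
  moreover have "XX - F \<noteq> {}" using infinite_XX \<open>finite F\<close> finite_subset by fastforce
  ultimately obtain U where U: "clopen_in X U" "U \<noteq> {}" "U \<subseteq> XX - F" using clopen_in_base by blast
  then obtain i where "(S ^^ i) x \<in> U" using uniform_hitting_time[OF U(1,2)] x by blast
  then show False using F[of i] U(3) by blast
qed

definition return_time :: "'a set \<Rightarrow> 'a \<Rightarrow> nat" where
  "return_time Z x = (LEAST n. 0 < n \<and> (S ^^ n) x \<in> Z)"

definition tower_sum :: "'a set \<Rightarrow> ('a \<Rightarrow> int) \<Rightarrow> 'a \<Rightarrow> int" where
  "tower_sum Z f z = (\<Sum>j<return_time Z z. f ((S ^^ j) z))"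

definition tower_base :: "'a set \<Rightarrow> 'a \<Rightarrow> 'a" where
  "tower_base Z x = (SOME z. z \<in> Z \<and> (\<exists>j<return_time Z z. x = (S ^^ j) z))"

definition tower_level :: "'a set \<Rightarrow> 'a \<Rightarrow> nat" where
  "tower_level Z x = (SOME j. j < return_time Z (tower_base Z x) \<and> x = (S ^^ j) (tower_base Z x))"

text \<open>The word of a base point records the height of its tower, as the length, and the
  partition atom met at each level. Base points with equal words span a column of a Kakutani-Rokhlin
  partition, whose cells are named by \<open>tower_cell\<close>.\<close>

definition tower_word :: "nat \<Rightarrow> 'a set \<Rightarrow> 'a \<Rightarrow> bool list list" where
  "tower_word k Z z = map (\<lambda>j. profile k ((S ^^ j) z)) [0..<return_time Z z]"

definition tower_cell :: "nat \<Rightarrow> 'a set \<Rightarrow> 'a \<Rightarrow> bool list list \<times> nat" where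
  "tower_cell k Z x = (tower_word k Z (tower_base Z x), tower_level Z x)"

lemma length_tower_word [simp]: "length (tower_word k Z z) = return_time Z z"
  by (simp add: tower_word_def)

lemma tower_word_eq: "tower_word k Z z = tower_word k Z z' \<longleftrightarrow>
    return_time Z z = return_time Z z' \<and> (\<forall>j<return_time Z z. profile k ((S ^^ j) z) = profile k ((S ^^ j) z'))"
proof
  assume *: "tower_word k Z z = tower_word k Z z'"
  then have r: "return_time Z z = return_time Z z'" using length_tower_word by metis
  moreover have "profile k ((S ^^ j) z) = profile k ((S ^^ j) z')" if "j < return_time Z z" for j
    using arg_cong[OF *, of "\<lambda>w. w ! j"] that r by (simp add: tower_word_def)
  ultimately show "return_time Z z = return_time Z z' \<and> (\<forall>j<return_time Z z. profile k ((S ^^ j) z) = profile k ((S ^^ j) z'))" by blast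
qed (simp add: tower_word_def)

end

section \<open>Towers over one clopen base\<close>

locale base_set = minimal_system +
  fixes Z assumes cZ: "clopen_in X Z" and neZ: "Z \<noteq> {}"
begin

lemma Z_sub: "z \<in> Z \<Longrightarrow> z \<in> XX"
  using clopen_in_subset[OF cZ] by auto

lemma return_time_ex: "\<exists>R. \<forall>x\<in>XX. \<exists>n. 0 < n \<and> n \<le> R \<and> (S ^^ n) x \<in> Z"
proof -
  obtain L where L: "\<forall>x\<in>XX. \<exists>i<L. (S ^^ i) x \<in> Z" using uniform_hitting_time[OF cZ neZ] by blast
  have "\<exists>n. 0 < n \<and> n \<le> L \<and> (S ^^ n) x \<in> Z" if x: "x \<in> XX" for x
  proof -
    obtain i where "i < L" "(S ^^ i) (S x) \<in> Z" using L S_in[OF x] by auto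
    then show ?thesis by (intro exI[of _ "Suc i"]) (simp add: funpow_swap1)
  qed
  then show ?thesis by blast
qed

lemma return_time_pos: "x \<in> XX \<Longrightarrow> 0 < return_time Z x" and return_time_in: "x \<in> XX \<Longrightarrow> (S ^^ return_time Z x) x \<in> Z"
proof -
  assume "x \<in> XX"
  then have "\<exists>n. 0 < n \<and> (S ^^ n) x \<in> Z" using return_time_ex by blast
  then have "0 < return_time Z x \<and> (S ^^ return_time Z x) x \<in> Z" unfolding return_time_def by (rule LeastI_ex)
  then show "0 < return_time Z x" "(S ^^ return_time Z x) x \<in> Z" by simp_all
qed

lemma return_time_le: "0 < n \<Longrightarrow> (S ^^ n) x \<in> Z \<Longrightarrow> return_time Z x \<le> n"
  unfolding return_time_def by (intro Least_le) simp

lemma return_time_min: "0 < j \<Longrightarrow> j < return_time Z x \<Longrightarrow> (S ^^ j) x \<notin> Z"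
  using return_time_le[of j x] by auto

lemma return_time_bound: "\<exists>R. \<forall>x\<in>XX. return_time Z x \<le> R"
proof -
  obtain R where R: "\<forall>x\<in>XX. \<exists>n. 0 < n \<and> n \<le> R \<and> (S ^^ n) x \<in> Z" using return_time_ex by blast
  have "return_time Z x \<le> R" if x: "x \<in> XX" for x
  proof -
    obtain n where "0 < n" "n \<le> R" "(S ^^ n) x \<in> Z" using R x by blast
    then show ?thesis using return_time_le[of n x] by simp
  qed
  then show ?thesis by blast
qed

lemma return_time_eqI: "0 < n \<Longrightarrow> (S ^^ n) x \<in> Z \<Longrightarrow> (\<And>j. 0 < j \<Longrightarrow> j < n \<Longrightarrow> (S ^^ j) x \<notin> Z) \<Longrightarrow> return_time Z x = n"
  unfolding return_time_def by (intro Least_equality) (auto simp: not_less[symmetric])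

text \<open>Start \<open>L\<close> steps before \<open>x\<close>: a visit to \<open>Z\<close> occurs
  on the way, and the last one is the base below \<open>x\<close>, since no return happens in
  between.\<close>

lemma tower_ex: assumes x: "x \<in> XX" shows "\<exists>z\<in>Z. \<exists>j<return_time Z z. x = (S ^^ j) z"
proof -
  obtain L where L: "\<forall>x\<in>XX. \<exists>i<L. (S ^^ i) x \<in> Z" using uniform_hitting_time[OF cZ neZ] by blast
  obtain y where y: "y \<in> XX" "x = (S ^^ L) y" using Sn_surj[OF x] by blast
  define I where "I = {i. i \<le> L \<and> (S ^^ i) y \<in> Z}"
  have I: "finite I" "I \<noteq> {}" using L y(1) unfolding I_def by (auto dest!: bspec[of _ _ y] intro: less_imp_le)
  define i where "i = Max I"
  have i: "i \<le> L" "(S ^^ i) y \<in> Z" using Max_in[OF I] by (auto simp: I_def i_def)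
  have mx: "j \<le> i" if "j \<le> L" "(S ^^ j) y \<in> Z" for j
    using Max_ge[OF I(1), of j] that by (auto simp: I_def i_def)
  have "L - i < return_time Z ((S ^^ i) y)"
  proof (rule ccontr)
    assume "\<not> L - i < return_time Z ((S ^^ i) y)"
    moreover have "(S ^^ (return_time Z ((S ^^ i) y) + i)) y \<in> Z"
      using return_time_in Z_sub i(2) by (simp add: Sn_add)
    ultimately have "return_time Z ((S ^^ i) y) + i \<le> i" using i(1) by (intro mx) auto
    then show False using return_time_pos[OF Z_sub[OF i(2)]] by simp
  qed
  moreover have "x = (S ^^ (L - i)) ((S ^^ i) y)" using y(2) i(1) Sn_add[of "L - i" i y] by simp
  ultimately show ?thesis using i(2) by blast
qed

lemma tower_unique:
  assumes "z \<in> Z" "z' \<in> Z" "j < return_time Z z" "j' < return_time Z z'" "(S ^^ j) z = (S ^^ j') z'"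
  shows "z = z' \<and> j = j'"
proof -
  have *: "z = z' \<and> j = j'" if "z \<in> Z" "z' \<in> Z" "j < return_time Z z" "j' < return_time Z z'" "(S ^^ j) z = (S ^^ j') z'" "j \<le> j'"
    for z z' j j'
  proof -
    have "(S ^^ j) z = (S ^^ j) ((S ^^ (j' - j)) z')" using that Sn_add[of j "j' - j" z'] by simp
    then have zz: "z = (S ^^ (j' - j)) z'" using Sn_inj Z_sub Sn_in that by meson
    then have "j' = j" using return_time_min[of "j' - j" z'] that by force
    then show ?thesis using zz by simp
  qed
  show ?thesis
  proof (cases "j \<le> j'")
    case True then show ?thesis using * assms by blast
  next
    case False then show ?thesis using *[of z' z j' j] assms by auto
  qed
qed

lemma tower_base_props: assumes "x \<in> XX"
  shows "tower_base Z x \<in> Z" "tower_level Z x < return_time Z (tower_base Z x)" "x = (S ^^ tower_level Z x) (tower_base Z x)"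
proof -
  have "\<exists>z. z \<in> Z \<and> (\<exists>j<return_time Z z. x = (S ^^ j) z)" using tower_ex[OF assms] by blast
  then have b: "tower_base Z x \<in> Z \<and> (\<exists>j<return_time Z (tower_base Z x). x = (S ^^ j) (tower_base Z x))"
    unfolding tower_base_def by (rule someI_ex)
  then have "\<exists>j. j < return_time Z (tower_base Z x) \<and> x = (S ^^ j) (tower_base Z x)" by blast
  then have "tower_level Z x < return_time Z (tower_base Z x) \<and> x = (S ^^ tower_level Z x) (tower_base Z x)"
    unfolding tower_level_def by (rule someI_ex)
  with b show "tower_base Z x \<in> Z" "tower_level Z x < return_time Z (tower_base Z x)" "x = (S ^^ tower_level Z x) (tower_base Z x)" by blast+
qed

lemma tower_base_eq: assumes "z \<in> Z" "j < return_time Z z" shows "tower_base Z ((S ^^ j) z) = z" "tower_level Z ((S ^^ j) z) = j"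
proof -
  have "(S ^^ j) z \<in> XX" using Sn_in Z_sub assms by blast
  from tower_base_props[OF this] show "tower_base Z ((S ^^ j) z) = z" "tower_level Z ((S ^^ j) z) = j"
    using tower_unique[OF _ assms(1) _ assms(2)] by metis+
qed

lemma tower_base_Z: assumes "z \<in> Z" shows "tower_base Z z = z" "tower_level Z z = 0"
  using tower_base_eq[OF assms, of 0] return_time_pos[OF Z_sub[OF assms]] by simp_all

lemma tower_base_S: assumes "x \<in> XX" "S x \<notin> Z" shows "tower_base Z (S x) = tower_base Z x" "tower_level Z (S x) = Suc (tower_level Z x)"
proof -
  note b = tower_base_props[OF assms(1)]
  have Sx: "S x = (S ^^ Suc (tower_level Z x)) (tower_base Z x)" using b(3) by simp
  have "Suc (tower_level Z x) \<noteq> return_time Z (tower_base Z x)" using Sx return_time_in[OF Z_sub[OF b(1)]] assms(2) by metis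
  then have lt: "Suc (tower_level Z x) < return_time Z (tower_base Z x)" using b(2) by simp
  show "tower_base Z (S x) = tower_base Z x" "tower_level Z (S x) = Suc (tower_level Z x)"
    using tower_base_eq[OF b(1) lt] Sx by simp_all
qed

lemma tower_level_last: assumes "x \<in> XX" "S x \<in> Z" shows "Suc (tower_level Z x) = return_time Z (tower_base Z x)"
proof -
  note b = tower_base_props[OF assms(1)]
  have "(S ^^ Suc (tower_level Z x)) (tower_base Z x) \<in> Z" using b(3) assms(2) by simp
  then have "return_time Z (tower_base Z x) \<le> Suc (tower_level Z x)" by (intro return_time_le) auto
  then show ?thesis using b(2) by simp
qed

text \<open>Return times are bounded, so they are read off a finite itinerary with respect to
  \<open>Z\<close>.\<close>

lemma loc_const_return_time: "loc_const X (return_time Z)"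
proof -
  obtain R where R: "\<forall>x\<in>XX. return_time Z x \<le> R" using return_time_bound by blast
  define F where "F m = (LEAST n. 0 < n \<and> n \<le> R \<and> m ! n)" for m :: "bool list"
  have "loc_const X (\<lambda>x. F (map (\<lambda>j. (S ^^ j) x \<in> Z) [0..<Suc R]))"
    by (intro loc_const_comp[where F = F] loc_const_map loc_const_Sn[OF loc_const_ind[OF cZ]])
  moreover have "F (map (\<lambda>j. (S ^^ j) x \<in> Z) [0..<Suc R]) = return_time Z x" if x: "x \<in> XX" for x
  proof -
    have nth: "n \<le> R \<Longrightarrow> map (\<lambda>j. (S ^^ j) x \<in> Z) [0..<Suc R] ! n \<longleftrightarrow> (S ^^ n) x \<in> Z" for n
      by (simp del: upt_Suc)
    have "return_time Z x \<le> R" using R x by blast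
    have "(LEAST n. 0 < n \<and> n \<le> R \<and> map (\<lambda>j. (S ^^ j) x \<in> Z) [0..<Suc R] ! n) = return_time Z x"
    proof (rule Least_equality)
      show "0 < return_time Z x \<and> return_time Z x \<le> R \<and> map (\<lambda>j. (S ^^ j) x \<in> Z) [0..<Suc R] ! return_time Z x"
        using return_time_pos[OF x] return_time_in[OF x] nth[OF \<open>return_time Z x \<le> R\<close>] \<open>return_time Z x \<le> R\<close> by (simp only:)
      fix n assume n: "0 < n \<and> n \<le> R \<and> map (\<lambda>j. (S ^^ j) x \<in> Z) [0..<Suc R] ! n"
      then have "(S ^^ n) x \<in> Z" using nth[of n] by (simp only:)
      then show "return_time Z x \<le> n" using n return_time_le[of n x] by (simp only:)
    qed
    then show ?thesis by (simp only: F_def)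
  qed
  ultimately show ?thesis by (rule loc_const_cong)
qed

lemma loc_const_tower_word: "loc_const X (tower_word k Z)"
proof -
  obtain R where R: "\<forall>x\<in>XX. return_time Z x \<le> R" using return_time_bound by blast
  have "loc_const X (\<lambda>x. take (return_time Z x) (map (\<lambda>j. profile k ((S ^^ j) x)) [0..<R]))"
    by (intro loc_const_comp2[where F = take] loc_const_return_time loc_const_map loc_const_Sn loc_const_profile)
  moreover have "take (return_time Z x) (map (\<lambda>j. profile k ((S ^^ j) x)) [0..<R]) = tower_word k Z x" if "x \<in> XX" for x
    using R that by (simp add: tower_word_def take_map)
  ultimately show ?thesis by (rule loc_const_cong)
qed

lemma loc_const_tower_cell: "loc_const X (tower_cell k Z)"
proof -
  obtain R where R: "\<forall>x\<in>XX. return_time Z x \<le> R" using return_time_bound by blast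
  show ?thesis
  proof (rule loc_constI)
  show "finite (tower_word k Z ` XX \<times> {..R})" using loc_const_tower_word by (auto simp: loc_const_def)
  show "tower_cell k Z x \<in> tower_word k Z ` XX \<times> {..R}" if "x \<in> XX" for x
  proof -
    have "return_time Z (tower_base Z x) \<le> R" using R Z_sub tower_base_props(1)[OF that] by blast
    then show ?thesis using tower_base_props(1,2)[OF that] Z_sub by (simp add: tower_cell_def)
  qed
  fix c :: "bool list list \<times> nat"
  have eq: "{x\<in>XX. tower_cell k Z x = c} = (S ^^ snd c) ` (Z \<inter> {z\<in>XX. tower_word k Z z = fst c \<and> snd c < return_time Z z})" (is "?L = ?R")
  proof
    show "?L \<subseteq> ?R"
    proof
      fix x assume x: "x \<in> ?L"
      then have "x \<in> XX" by simp
      note b = tower_base_props[OF this]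
      have "tower_word k Z (tower_base Z x) = fst c" "tower_level Z x = snd c" using x by (auto simp: tower_cell_def)
      then have "tower_base Z x \<in> Z \<inter> {z\<in>XX. tower_word k Z z = fst c \<and> snd c < return_time Z z}" "x = (S ^^ snd c) (tower_base Z x)"
        using b Z_sub by simp_all
      then show "x \<in> ?R" by (rule rev_image_eqI)
    qed
    show "?R \<subseteq> ?L"
    proof
      fix x assume "x \<in> ?R"
      then obtain z where z: "z \<in> Z" "tower_word k Z z = fst c" "snd c < return_time Z z" "x = (S ^^ snd c) z" by auto
      then show "x \<in> ?L" using tower_base_eq[OF z(1,3)] Sn_in[OF Z_sub[OF z(1)]] by (simp add: tower_cell_def)
    qed
  qed
  have "loc_const X (\<lambda>z. (tower_word k Z z, return_time Z z))" by (rule loc_const_Pair[OF loc_const_tower_word loc_const_return_time])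
  from loc_const_Collect[OF this, of "\<lambda>p. fst p = fst c \<and> snd c < snd p"]
  have "clopen_in X {z\<in>XX. tower_word k Z z = fst c \<and> snd c < return_time Z z}" by (simp only: fst_conv snd_conv)
  then show "clopen_in X {x\<in>XX. tower_cell k Z x = c}"
    unfolding eq by (intro clopen_in_image[OF Sn_hom] clopen_in_Int[OF cZ])
  qed
qed

end

section \<open>Refining a tower\<close>

context minimal_system
begin

definition cell_const :: "nat \<Rightarrow> 'a set \<Rightarrow> ('a \<Rightarrow> 'c) \<Rightarrow> bool" where
  "cell_const k Z f \<longleftrightarrow> (\<forall>x\<in>XX. \<forall>y\<in>XX. tower_cell k Z x = tower_cell k Z y \<longrightarrow> f x = f y)"

text \<open>The last three clauses are what makes the integer-valued invariant functionals plentiful: every tower sum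
  over \<open>Z\<close> is a difference of two sums over \<open>Z'\<close>; some \<open>ind U - ind U \<circ> S\<close> is detected by a pair of
  columns that no cell-constant function distinguishes; every column word splits, so that the
  intersection of the bases is perfect.\<close>

definition tower_refines :: "nat \<Rightarrow> 'a set \<Rightarrow> nat \<Rightarrow> 'a set \<Rightarrow> nat \<Rightarrow> bool" where
  "tower_refines n Z k Z' k' \<longleftrightarrow> Z' \<subseteq> Z \<and> (\<forall>z\<in>Z'. n \<le> return_time Z' z) \<and> k < k' \<and>
     (\<forall>x\<in>XX. \<forall>y\<in>XX. profile k' x = profile k' y \<longrightarrow> (x \<in> Z \<longleftrightarrow> y \<in> Z)) \<and>
     (\<forall>z\<in>Z. \<exists>z1\<in>Z'. \<exists>z2\<in>Z'. \<forall>f. cell_const k Z f \<longrightarrow> tower_sum Z' f z1 - tower_sum Z' f z2 = tower_sum Z f z) \<and>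
     (\<exists>z1\<in>Z'. \<exists>z2\<in>Z'. \<exists>U. clopen_in X U \<and> (\<forall>f. cell_const k Z f \<longrightarrow> tower_sum Z' f z1 = tower_sum Z' f z2) \<and>
        cell_const k' Z' (\<lambda>x. ind U x - ind U (S x)) \<and>
        tower_sum Z' (\<lambda>x. ind U x - ind U (S x)) z1 - tower_sum Z' (\<lambda>x. ind U x - ind U (S x)) z2 = 1) \<and>
     (\<forall>z\<in>Z. \<exists>z1\<in>Z'. \<exists>z2\<in>Z'. tower_word k Z z1 = tower_word k Z z \<and> tower_word k Z z2 = tower_word k Z z \<and> tower_word k' Z' z1 \<noteq> tower_word k' Z' z2)"

lemma profile_separate_finite:
  assumes "finite F" "F \<subseteq> XX" "x \<in> XX" "x \<notin> F"
  shows "\<exists>K. \<forall>k\<ge>K. \<forall>y\<in>F. profile k y \<noteq> profile k x"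
  using assms
proof (induction F rule: finite_induct)
  case (insert y F)
  then obtain K where K: "\<forall>k\<ge>K. \<forall>y\<in>F. profile k y \<noteq> profile k x" by auto
  obtain K' where "\<forall>k\<ge>K'. profile k y \<noteq> profile k x" using profile_separate[of y x] insert.prems by auto
  then show ?case using K by (intro exI[of _ "max K K'"]) auto
qed auto

text \<open>Aperiodicity separates \<open>x\<close> from its next iterates by a profile. If a point
  sharing the itinerary of \<open>x\<close> for \<open>H\<close> steps came back after
  \<open>j\<close> steps to another such point, the profile of \<open>x\<close> would recur at time
  \<open>j\<close>.\<close>

lemma small_base:
  assumes Z: "clopen_in X Z" "Z \<noteq> {}"
  shows "\<exists>W. clopen_in X W \<and> W \<noteq> {} \<and> W \<subseteq> Z \<and> (\<forall>x\<in>W. \<forall>j. 0 < j \<and> j < H \<longrightarrow> (S ^^ j) x \<notin> W)"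
proof -
  obtain x where x: "x \<in> Z" using Z by auto
  have xX: "x \<in> XX" using x clopen_in_subset[OF Z(1)] by auto
  define F where "F = (\<lambda>j. (S ^^ j) x) ` {0<..<H}"
  have "x \<notin> F"
  proof
    assume "x \<in> F"
    then obtain j where "0 < j" "x = (S ^^ j) x" by (auto simp: F_def)
    then show False using aperiodic[OF xX, of j] by simp
  qed
  moreover have "F \<subseteq> XX" using Sn_in[OF xX] by (auto simp: F_def)
  moreover have "finite F" by (simp add: F_def)
  ultimately obtain K where K: "\<forall>k\<ge>K. \<forall>y\<in>F. profile k y \<noteq> profile k x" using profile_separate_finite xX by blast
  define it where "it y = map (\<lambda>j. profile K ((S ^^ j) y)) [0..<Suc H]" for y
  have lit: "loc_const X it" unfolding it_def by (intro loc_const_map loc_const_Sn loc_const_profile)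
  have it: "profile K ((S ^^ j) y) = profile K ((S ^^ j) x)" if "it y = it x" "j \<le> H" for j y
    using that by (simp add: it_def del: upt_Suc)
  define W where "W = Z \<inter> {y\<in>XX. it y = it x}"
  have "clopen_in X W" unfolding W_def by (rule clopen_in_Int[OF Z(1) loc_const_Collect[OF lit]])
  moreover have "x \<in> W" using x xX by (simp add: W_def)
  moreover have "(S ^^ j) y \<notin> W" if y: "y \<in> W" and j: "0 < j" "j < H" for y j
  proof
    assume W: "(S ^^ j) y \<in> W"
    have "profile K ((S ^^ j) x) = profile K ((S ^^ j) y)" using it[of y j] y j by (simp add: W_def)
    also have "\<dots> = profile K x" using it[of "(S ^^ j) y" 0] W by (simp add: W_def)
    finally show False using K j by (auto simp: F_def)
  qed
  moreover have "W \<subseteq> Z" by (auto simp: W_def)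
  ultimately show ?thesis by blast
qed

lemma uniform_hits:
  assumes "finite V" "\<And>w. w \<in> V \<Longrightarrow> clopen_in X (B w) \<and> B w \<noteq> {}"
  shows "\<exists>L. \<forall>w\<in>V. \<forall>x\<in>XX. \<exists>i<L. (S ^^ i) x \<in> B w"
  using assms
proof (induction V rule: finite_induct)
  case (insert w V)
  then obtain L where L: "\<forall>w\<in>V. \<forall>x\<in>XX. \<exists>i<L. (S ^^ i) x \<in> B w" by auto
  obtain L' where L': "\<forall>x\<in>XX. \<exists>i<L'. (S ^^ i) x \<in> B w" using uniform_hitting_time[of "B w"] insert.prems by auto
  have "\<exists>i<max L L'. (S ^^ i) x \<in> B v" if v: "v \<in> insert w V" and x: "x \<in> XX" for v x
  proof (cases "v = w")
    case True
    then obtain i where "i < L'" "(S ^^ i) x \<in> B v" using L' x by blast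
    then show ?thesis by (intro exI[of _ i]) simp
  next
    case False
    then obtain i where "i < L" "(S ^^ i) x \<in> B v" using L x v by blast
    then show ?thesis by (intro exI[of _ i]) simp
  qed
  then show ?case by blast
qed auto

end

context base_set
begin

lemma profile_tower_cell: assumes "x \<in> XX" "y \<in> XX" "tower_cell k Z x = tower_cell k Z y" shows "profile k x = profile k y"
proof -
  note a = tower_base_props[OF assms(1)] and b = tower_base_props[OF assms(2)]
  have w: "tower_word k Z (tower_base Z x) = tower_word k Z (tower_base Z y)" and p: "tower_level Z x = tower_level Z y"
    using assms(3) by (simp_all add: tower_cell_def)
  have "profile k ((S ^^ tower_level Z x) (tower_base Z x)) = profile k ((S ^^ tower_level Z x) (tower_base Z y))"
    using w a(2) unfolding tower_word_eq by blast
  then show ?thesis using a(3) b(3) p by simp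
qed

lemma cell_const_profile: "(\<And>x y. x \<in> XX \<Longrightarrow> y \<in> XX \<Longrightarrow> profile k x = profile k y \<Longrightarrow> f x = f y) \<Longrightarrow> cell_const k Z f"
  using profile_tower_cell unfolding cell_const_def by blast

lemma cell_const_loc_const: assumes "cell_const k Z f" shows "loc_const X f"
proof -
  define F where "F c = f (SOME y. y \<in> XX \<and> tower_cell k Z y = c)" for c
  have "F (tower_cell k Z x) = f x" if "x \<in> XX" for x
  proof -
    have "\<exists>y. y \<in> XX \<and> tower_cell k Z y = tower_cell k Z x" using that by blast
    then have "(SOME y. y \<in> XX \<and> tower_cell k Z y = tower_cell k Z x) \<in> XX \<and>
        tower_cell k Z (SOME y. y \<in> XX \<and> tower_cell k Z y = tower_cell k Z x) = tower_cell k Z x" by (rule someI_ex)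
    then show ?thesis using assms that unfolding F_def cell_const_def by blast
  qed
  then show ?thesis by (rule loc_const_cong[OF loc_const_comp[OF loc_const_tower_cell]])
qed

lemma tower_cell_Z: "z \<in> Z \<Longrightarrow> j < return_time Z z \<Longrightarrow> tower_cell k Z ((S ^^ j) z) = (tower_word k Z z, j)"
  by (simp add: tower_cell_def tower_base_eq)

lemma cell_const_base:
  assumes "cell_const k Z f" "z \<in> Z" "z' \<in> Z" "tower_word k Z z = tower_word k Z z'" "j < return_time Z z"
  shows "f ((S ^^ j) z) = f ((S ^^ j) z')"
proof -
  have r: "return_time Z z = return_time Z z'" using assms(4) by (simp add: tower_word_eq)
  have "tower_cell k Z ((S ^^ j) z) = tower_cell k Z ((S ^^ j) z')"
    using tower_cell_Z[OF assms(2)] tower_cell_Z[OF assms(3)] assms(4,5) r by simp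
  then show ?thesis using assms(1) Sn_in Z_sub assms(2,3) unfolding cell_const_def by blast
qed

lemma tower_sum_word:
  assumes "cell_const k Z f" "z \<in> Z" "z' \<in> Z" "tower_word k Z z = tower_word k Z z'"
  shows "tower_sum Z f z = tower_sum Z f z'"
proof -
  have "return_time Z z = return_time Z z'" using assms(4) by (simp add: tower_word_eq)
  then show ?thesis unfolding tower_sum_def using cell_const_base[OF assms] by simp
qed

lemma clopen_in_word: "clopen_in X {z\<in>Z. tower_word k Z z = w}"
proof -
  have "{z\<in>Z. tower_word k Z z = w} = Z \<inter> {z\<in>XX. tower_word k Z z = w}" using Z_sub by auto
  then show ?thesis using clopen_in_Int[OF cZ loc_const_Collect[OF loc_const_tower_word, of "\<lambda>v. v = w"]] by simp
qed

lemma finite_words: "finite (tower_word k Z ` Z)"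
  using loc_const_tower_word[of k] Z_sub unfolding loc_const_def by (meson finite_subset image_mono subsetI)

end

text \<open>Start from a sparse base \<open>W\<close> and one excursion from it, long enough to
  contain every word of \<open>Z\<close> with room to spare. Above the points of \<open>W0\<close>,
  which all follow this excursion, exactly one further level is added to the base, and this level
  varies with the point. Two cuts that differ by one pass through a tower over \<open>Z\<close> give
  sums whose difference is the sum over that tower; two copies of the same cut give columns that
  only a new clopen set can tell apart.\<close>

lemma (in base_set) tower_refines_ex: "\<exists>Z' k'. clopen_in X Z' \<and> Z' \<noteq> {} \<and> tower_refines n Z k Z' k'"
proof -
  obtain L where L: "\<forall>w\<in>tower_word k Z ` Z. \<forall>x\<in>XX. \<exists>i<L. (S ^^ i) x \<in> {z\<in>Z. tower_word k Z z = w}"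
    using uniform_hits[OF finite_words[of k], of "\<lambda>w. {z\<in>Z. tower_word k Z z = w}"] clopen_in_word by blast
  obtain R where R: "\<forall>x\<in>XX. return_time Z x \<le> R" using return_time_bound by blast
  \<comment> \<open>Room for \<open>n\<close> levels below the cut, a wait of less than
    \<open>L\<close> for a given word, one pass of length at most \<open>R\<close> through its
    tower, and \<open>n\<close> levels above the cut.\<close>
  define H where "H = n + L + R + n + 2"
  obtain W where W: "clopen_in X W" "W \<noteq> {}" "W \<subseteq> Z" "\<forall>x\<in>W. \<forall>j. 0 < j \<and> j < H \<longrightarrow> (S ^^ j) x \<notin> W"
    using small_base[OF cZ neZ] by blast
  interpret W: base_set X S W by unfold_locales (rule W)+
  have retH: "H \<le> return_time W x" if "x \<in> W" for x
    using W.return_time_pos[OF W.Z_sub[OF that]] W.return_time_in[OF W.Z_sub[OF that]] W(4) that not_le by blast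
  obtain x0 where x0: "x0 \<in> W" using W(2) by auto
  define r where "r = return_time W x0"
  have rH: "H \<le> r" using retH[OF x0] by (simp add: r_def)
  define it where "it x = (return_time W x, map (\<lambda>j. ((S ^^ j) x \<in> Z, tower_word k Z ((S ^^ j) x))) [0..<r])" for x
  have lit: "loc_const X it" unfolding it_def
    by (intro loc_const_Pair W.loc_const_return_time loc_const_map loc_const_Sn[OF loc_const_ind[OF cZ]] loc_const_Sn[OF loc_const_tower_word])
  \<comment> \<open>\<open>it\<close> records the return to \<open>W\<close> and the visits to
    \<open>Z\<close> with their words during the excursion, so all points of \<open>W0\<close> run
    through the same cells as \<open>x0\<close>.\<close>
  define W0 where "W0 = W \<inter> {x\<in>XX. it x = it x0}"
  have cW0: "clopen_in X W0" unfolding W0_def by (rule clopen_in_Int[OF W(1) loc_const_Collect[OF lit]])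
  have x0X: "x0 \<in> XX" using x0 W.Z_sub by blast
  have x0W0: "x0 \<in> W0" using x0 x0X by (simp add: W0_def)
  have W0W: "x \<in> W" and W0X: "x \<in> XX" and W0r: "return_time W x = r" if "x \<in> W0" for x
    using that by (auto simp: W0_def it_def r_def)
  have W0it: "((S ^^ j) x \<in> Z \<longleftrightarrow> (S ^^ j) x0 \<in> Z) \<and> tower_word k Z ((S ^^ j) x) = tower_word k Z ((S ^^ j) x0)"
    if "x \<in> W0" "j < r" for x j
    using that by (auto simp: W0_def it_def)
  have cells: "tower_cell k Z ((S ^^ j) x) = tower_cell k Z ((S ^^ j) x0)" if x: "x \<in> W0" and "j < r" for x j
    using that(2)
  proof (induction j)
    case 0
    have "x \<in> Z" "x0 \<in> Z" using x x0 W0W W(3) by auto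
    then show ?case using W0it[OF x 0] by (simp add: tower_cell_def tower_base_Z)
  next
    case (Suc j)
    then have IH: "tower_cell k Z ((S ^^ j) x) = tower_cell k Z ((S ^^ j) x0)" by simp
    have X: "(S ^^ j) x \<in> XX" "(S ^^ j) x0 \<in> XX" using Sn_in W0X[OF x] x0X by blast+
    show ?case
    proof (cases "(S ^^ Suc j) x0 \<in> Z")
      case True
      then have "(S ^^ Suc j) x \<in> Z" using W0it[OF x Suc.prems] by blast
      then show ?thesis using True W0it[OF x Suc.prems] by (simp only: tower_cell_def tower_base_Z)
    next
      case False
      then have "S ((S ^^ j) x) \<notin> Z" "S ((S ^^ j) x0) \<notin> Z" using W0it[OF x Suc.prems] by simp_all
      then show ?thesis using IH tower_base_S[OF X(1)] tower_base_S[OF X(2)] by (simp add: tower_cell_def)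
    qed
  qed
  have flev: "f ((S ^^ j) x) = f ((S ^^ j) x0)" if "cell_const k Z f" "x \<in> W0" "j < r" for x j and f :: "'a \<Rightarrow> int"
    using that(1) cells[OF that(2,3)] Sn_in[OF W0X[OF that(2)]] Sn_in[OF x0X] unfolding cell_const_def by blast
  \<comment> \<open>Cutting the excursion at such a level leaves both pieces of height at least
    \<open>n\<close>, and the cut lies in \<open>Z\<close>.\<close>
  define I where "I = {t. n < t \<and> t + n < r \<and> (S ^^ t) x0 \<in> Z}"
  have finI: "finite I" by (rule finite_subset[of _ "{..<r}"]) (auto simp: I_def)
  have Ir: "0 < t" "n < t" "t + n < r" "t < r" if "t \<in> I" for t using that by (auto simp: I_def)
  have cover: "\<exists>t\<in>I. t + return_time Z ((S ^^ t) x0) \<in> I \<and> tower_word k Z ((S ^^ t) x0) = tower_word k Z z" if z: "z \<in> Z" for z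
  proof -
    obtain i where i: "i < L" "(S ^^ i) ((S ^^ Suc n) x0) \<in> Z" "tower_word k Z ((S ^^ i) ((S ^^ Suc n) x0)) = tower_word k Z z"
      using L z Sn_in[OF x0X, of "Suc n"] by blast
    define t where "t = i + Suc n"
    have tZ: "(S ^^ t) x0 \<in> Z" and tw: "tower_word k Z ((S ^^ t) x0) = tower_word k Z z"
      using i(2,3) unfolding t_def Sn_add by simp_all
    have tX: "(S ^^ t) x0 \<in> XX" using Z_sub[OF tZ] .
    have "return_time Z ((S ^^ t) x0) \<le> R" using R tX by blast
    moreover have "(S ^^ (t + return_time Z ((S ^^ t) x0))) x0 \<in> Z"
      using return_time_in[OF tX] by (simp add: Sn_add add.commute[of t])
    ultimately have "t \<in> I" "t + return_time Z ((S ^^ t) x0) \<in> I"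
      using rH i(1) tZ by (auto simp: I_def t_def H_def)
    then show ?thesis using tw by blast
  qed
  have neI: "I \<noteq> {}" using cover neZ by blast
  have "infinite W0" using open_infinite[of W0] cW0 x0W0 by (auto simp: clopen_in_def)
  \<comment> \<open>The first component of \<open>g x\<close> is the level at which the excursion of
    \<open>x\<close> is cut; the Boolean makes two copies of each cut.\<close>
  then obtain g :: "'a \<Rightarrow> nat \<times> bool" where g: "loc_const X g" "\<And>x. g x \<in> I \<times> UNIV" "g ` W0 = I \<times> UNIV"
  proof -
    have "finite (I \<times> (UNIV :: bool set))" "I \<times> (UNIV :: bool set) \<noteq> {}" using finI neI by auto
    from loc_const_split[OF clopen_in_subset[OF cW0] \<open>infinite W0\<close> this] show ?thesis using that by blast
  qed
  have pick: "\<exists>x\<in>W0. g x = (t, b)" if "t \<in> I" for t b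
  proof -
    have "(t, b) \<in> g ` W0" using that g(3) by simp
    then show ?thesis by (metis imageE)
  qed
  have gI: "fst (g x) \<in> I" for x using g(2)[of x] by (simp add: mem_Times_iff)
  define C where "C = (\<Union>t\<in>I. (S ^^ t) ` (W0 \<inter> {x\<in>XX. fst (g x) = t}))"
  define Z' where "Z' = W \<union> C"
  have cC: "clopen_in X C" unfolding C_def
    by (intro clopen_in_UN finI clopen_in_image[OF Sn_hom] clopen_in_Int[OF cW0 loc_const_Collect[OF g(1)]])
  have cZ': "clopen_in X Z'" unfolding Z'_def by (rule clopen_in_Un[OF W(1) cC])
  have neZ': "Z' \<noteq> {}" using W(2) by (simp add: Z'_def)
  interpret Z': base_set X S Z' by unfold_locales (rule cZ' neZ')+
  have CI: "(S ^^ fst (g x)) x \<in> C" if "x \<in> W0" for x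
    unfolding C_def using that gI W0X[OF that] by blast
  have CE: "\<exists>x\<in>W0. y = (S ^^ fst (g x)) x" if "y \<in> C" for y
    using that unfolding C_def by blast
  have sub: "Z' \<subseteq> Z"
  proof
    fix y assume "y \<in> Z'"
    then consider "y \<in> W" | "y \<in> C" by (auto simp: Z'_def)
    then show "y \<in> Z"
    proof cases
      case 2
      then obtain x where x: "x \<in> W0" "y = (S ^^ fst (g x)) x" using CE by blast
      have "(S ^^ fst (g x)) x0 \<in> Z" using gI[of x] by (simp add: I_def)
      then show ?thesis using x W0it[OF x(1) Ir(4)[OF gI]] by blast
    qed (use W(3) in auto)
  qed
  have visit: "x \<in> W0 \<and> j = fst (g x)" if x: "x \<in> W" and j: "0 < j" "j < return_time W x" and y: "(S ^^ j) x \<in> Z'" for x j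
  proof -
    have "(S ^^ j) x \<notin> W" using W.return_time_min[OF j] .
    then obtain x' where x': "x' \<in> W0" "(S ^^ j) x = (S ^^ fst (g x')) x'"
      using y CE unfolding Z'_def by blast
    have "x = x' \<and> j = fst (g x')"
      using W.tower_unique[OF x W0W[OF x'(1)] j(2) _ x'(2)] Ir(4)[OF gI] W0r[OF x'(1)] by simp
    then show ?thesis using x' by simp
  qed
  have ret0: "return_time Z' x = fst (g x)" if x: "x \<in> W0" for x
  proof (rule Z'.return_time_eqI)
    show "0 < fst (g x)" using Ir(1)[OF gI] .
    show "(S ^^ fst (g x)) x \<in> Z'" using CI[OF x] by (simp add: Z'_def)
    fix j assume j: "0 < j" "j < fst (g x)"
    then have "j < return_time W x" using Ir(4)[OF gI, of x] W0r[OF x] by simp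
    then show "(S ^^ j) x \<notin> Z'" using visit[OF W0W[OF x] j(1)] j(2) by blast
  qed
  have retn: "n \<le> return_time Z' z" if z: "z \<in> Z'" for z
  proof -
    let ?m = "return_time Z' z"
    have m: "0 < ?m" "(S ^^ ?m) z \<in> Z'" using Z'.return_time_pos Z'.return_time_in Z'.Z_sub[OF z] by blast+
    consider "z \<in> W" | "z \<in> C" using z by (auto simp: Z'_def)
    then show ?thesis
    proof cases
      case 1
      show ?thesis
      proof (cases "?m < return_time W z")
        case True
        then have "?m = fst (g z)" using visit[OF 1 m(1)] m(2) by blast
        then show ?thesis using Ir(2)[OF gI, of z] by simp
      qed (use retH[OF 1] in \<open>simp add: H_def\<close>)
    next
      case 2
      then obtain x where x: "x \<in> W0" "z = (S ^^ fst (g x)) x" using CE by blast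
      have mv: "(S ^^ (?m + fst (g x))) x \<in> Z'" using m(2) x(2) by (simp add: Sn_add)
      have "\<not> ?m + fst (g x) < r"
      proof
        assume "?m + fst (g x) < r"
        then have "?m + fst (g x) = fst (g x)"
          using visit[OF W0W[OF x(1)] _ _ mv] W0r[OF x(1)] m(1) by simp
        then show False using m(1) by simp
      qed
      then show ?thesis using Ir(3)[OF gI, of x] by simp
    qed
  qed
  obtain t0 where t0: "t0 \<in> I" using neI by blast
  \<comment> \<open>\<open>U t\<close> consists of the cut points at level \<open>t\<close> marked
    True. An excursion meets it only at its own cut, so the sum of
    \<open>ind (U t0) x - ind (U t0) (S x)\<close> up to the cut telescopes to -1 for the marked
    copy and to 0 for the other one.\<close>
  define U where "U t = (S ^^ t) ` (W0 \<inter> {x\<in>XX. g x = (t, True)})" for t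
  have cU: "clopen_in X (U t)" for t
    unfolding U_def by (intro clopen_in_image[OF Sn_hom] clopen_in_Int[OF cW0 loc_const_Collect[OF g(1)]])
  have inU: "(S ^^ t) x \<in> U t \<longleftrightarrow> g x = (t, True)" if x: "x \<in> W0" for x t
  proof
    assume "(S ^^ t) x \<in> U t"
    then obtain y where "y \<in> W0" "g y = (t, True)" "(S ^^ t) x = (S ^^ t) y" unfolding U_def by blast
    then show "g x = (t, True)" using Sn_inj W0X x by blast
  next
    assume "g x = (t, True)"
    then show "(S ^^ t) x \<in> U t" unfolding U_def using x W0X[OF x] by blast
  qed
  have WU: "x \<notin> U t" if "x \<in> W" "t \<in> I" for x t
  proof
    assume "x \<in> U t"
    then obtain y where y: "y \<in> W0" "x = (S ^^ t) y" unfolding U_def by blast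
    then show False using W.return_time_min[of t y] Ir[OF that(2)] W0r[OF y(1)] that(1) by simp
  qed
  let ?fU = "\<lambda>x. ind (U t0) x - ind (U t0) (S x)"
  have lcfU: "loc_const X ?fU"
    using loc_const_comp2[OF loc_const_ind_int[OF cU] loc_const_Sn[OF loc_const_ind_int[OF cU], of 1], where F = "(-)"] by simp
  have "loc_const X (\<lambda>x. (x \<in> Z, ?fU x, map (\<lambda>t. x \<in> U t) [0..<r]))"
    by (intro loc_const_Pair loc_const_ind[OF cZ] lcfU loc_const_map loc_const_ind[OF cU])
  from loc_const_profile_ev[OF this] obtain k0 where k0: "\<forall>k\<ge>k0. \<forall>x\<in>XX. \<forall>y\<in>XX. profile k x = profile k y \<longrightarrow>
      (x \<in> Z, ?fU x, map (\<lambda>t. x \<in> U t) [0..<r]) = (y \<in> Z, ?fU y, map (\<lambda>t. y \<in> U t) [0..<r])"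
    by blast
  define k' where "k' = max k0 (Suc k)"
  have k': "(x \<in> Z \<longleftrightarrow> y \<in> Z) \<and> ?fU x = ?fU y \<and> (\<forall>t<r. x \<in> U t \<longleftrightarrow> y \<in> U t)"
    if "x \<in> XX" "y \<in> XX" "profile k' x = profile k' y" for x y
  proof -
    have "(x \<in> Z, ?fU x, map (\<lambda>t. x \<in> U t) [0..<r]) = (y \<in> Z, ?fU y, map (\<lambda>t. y \<in> U t) [0..<r])"
      using k0 that unfolding k'_def by (meson max.cobounded1)
    then show ?thesis unfolding prod.inject map_eq_conv by simp
  qed
  have W0Z': "x \<in> Z'" if "x \<in> W0" for x using W0W[OF that] by (simp add: Z'_def)
  have ts: "tower_sum Z' f x = (\<Sum>j<fst (g x). f ((S ^^ j) x0))" if "cell_const k Z f" "x \<in> W0" for f :: "'a \<Rightarrow> int" and x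
    unfolding tower_sum_def ret0[OF that(2)]
    using flev[OF that(1,2)] Ir(4)[OF gI, of x] by (intro sum.cong) simp_all
  have tsU: "tower_sum Z' ?fU x = (if g x = (t0, True) then -1 else 0)" if x: "x \<in> W0" "fst (g x) = t0" for x
  proof -
    have "tower_sum Z' ?fU x = (\<Sum>j<t0. ind (U t0) ((S ^^ j) x) - ind (U t0) ((S ^^ Suc j) x))"
      unfolding tower_sum_def ret0[OF x(1)] x(2) by simp
    also have "\<dots> = ind (U t0) x - ind (U t0) ((S ^^ t0) x)"
      using sum_lessThan_telescope[of "\<lambda>j. - ind (U t0) ((S ^^ j) x)" t0] by simp
    finally show ?thesis using WU[OF W0W[OF x(1)] t0] inU[OF x(1), of t0] by simp
  qed
  have split: "(\<Sum>j<t + m. F j) - (\<Sum>j<t. F j) = (\<Sum>j<m. F (j + t))" for t m and F :: "nat \<Rightarrow> int"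
    by (induction m) (simp_all add: add.commute)
  have gen: "\<exists>z1\<in>Z'. \<exists>z2\<in>Z'. \<forall>f. cell_const k Z f \<longrightarrow> tower_sum Z' f z1 - tower_sum Z' f z2 = tower_sum Z f z" if z: "z \<in> Z" for z
  proof -
    obtain t where t: "t \<in> I" "t + return_time Z ((S ^^ t) x0) \<in> I" "tower_word k Z ((S ^^ t) x0) = tower_word k Z z"
      using cover[OF z] by blast
    obtain x1 where x1: "x1 \<in> W0" "g x1 = (t + return_time Z ((S ^^ t) x0), True)" using pick[OF t(2)] by blast
    obtain x2 where x2: "x2 \<in> W0" "g x2 = (t, True)" using pick[OF t(1)] by blast
    have "tower_sum Z' f x1 - tower_sum Z' f x2 = tower_sum Z f z" if f: "cell_const k Z f" for f
    proof -
      have "tower_sum Z' f x1 - tower_sum Z' f x2 =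
          (\<Sum>j<t + return_time Z ((S ^^ t) x0). f ((S ^^ j) x0)) - (\<Sum>j<t. f ((S ^^ j) x0))"
        using ts[OF f x1(1)] ts[OF f x2(1)] x1(2) x2(2) by simp
      also have "\<dots> = (\<Sum>j<return_time Z ((S ^^ t) x0). f ((S ^^ (j + t)) x0))"
        by (rule split)
      also have "\<dots> = tower_sum Z f ((S ^^ t) x0)" by (simp add: tower_sum_def Sn_add)
      also have "\<dots> = tower_sum Z f z" using t by (intro tower_sum_word[OF f _ z]) (auto simp: I_def)
      finally show ?thesis .
    qed
    then show ?thesis using W0Z' x1(1) x2(1) by blast
  qed
  have dup: "\<exists>z1\<in>Z'. \<exists>z2\<in>Z'. \<exists>U. clopen_in X U \<and> (\<forall>f. cell_const k Z f \<longrightarrow> tower_sum Z' f z1 = tower_sum Z' f z2) \<and>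
        cell_const k' Z' (\<lambda>x. ind U x - ind U (S x)) \<and>
        tower_sum Z' (\<lambda>x. ind U x - ind U (S x)) z1 - tower_sum Z' (\<lambda>x. ind U x - ind U (S x)) z2 = 1"
  proof -
    obtain x1 where x1: "x1 \<in> W0" "g x1 = (t0, False)" using pick[OF t0] by blast
    obtain x2 where x2: "x2 \<in> W0" "g x2 = (t0, True)" using pick[OF t0] by blast
    have "cell_const k' Z' ?fU" by (rule Z'.cell_const_profile) (use k' in blast)
    moreover have "tower_sum Z' ?fU x1 - tower_sum Z' ?fU x2 = 1" using tsU[OF x1(1)] tsU[OF x2(1)] x1(2) x2(2) by simp
    moreover have "\<forall>f. cell_const k Z f \<longrightarrow> tower_sum Z' f x1 = tower_sum Z' f x2"
      using ts[OF _ x1(1)] ts[OF _ x2(1)] x1(2) x2(2) by simp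
    ultimately show ?thesis using W0Z'[OF x1(1)] W0Z'[OF x2(1)] cU[of t0] by blast
  qed
  have kids: "\<exists>z1\<in>Z'. \<exists>z2\<in>Z'. tower_word k Z z1 = tower_word k Z z \<and> tower_word k Z z2 = tower_word k Z z \<and> tower_word k' Z' z1 \<noteq> tower_word k' Z' z2"
    if z: "z \<in> Z" for z
  proof -
    obtain t where t: "t \<in> I" "tower_word k Z ((S ^^ t) x0) = tower_word k Z z" using cover[OF z] by blast
    obtain x1 where x1: "x1 \<in> W0" "g x1 = (t, False)" using pick[OF t(1)] by blast
    obtain x2 where x2: "x2 \<in> W0" "g x2 = (t, True)" using pick[OF t(1)] by blast
    have w: "tower_word k Z ((S ^^ t) x1) = tower_word k Z z" "tower_word k Z ((S ^^ t) x2) = tower_word k Z z"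
      using W0it[OF x1(1) Ir(4)[OF t(1)]] W0it[OF x2(1) Ir(4)[OF t(1)]] t(2) by simp_all
    have zz: "(S ^^ t) x1 \<in> Z'" "(S ^^ t) x2 \<in> Z'"
      using CI[OF x1(1)] CI[OF x2(1)] x1(2) x2(2) by (simp_all add: Z'_def)
    \<comment> \<open>The two cut points lie on opposite sides of \<open>U t\<close>, which profiles
      of length \<open>k'\<close> resolve.\<close>
    have "profile k' ((S ^^ t) x1) \<noteq> profile k' ((S ^^ t) x2)"
      using k'[OF Z'.Z_sub[OF zz(1)] Z'.Z_sub[OF zz(2)]] inU[OF x1(1), of t] inU[OF x2(1), of t] x1(2) x2(2)
        Ir(4)[OF t(1)] by auto
    then have "tower_word k' Z' ((S ^^ t) x1) \<noteq> tower_word k' Z' ((S ^^ t) x2)"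
      unfolding tower_word_eq using Z'.return_time_pos[OF Z'.Z_sub[OF zz(1)]] by (auto intro!: exI[of _ 0])
    then show ?thesis using w zz by blast
  qed
  have "tower_refines n Z k Z' k'"
    unfolding tower_refines_def
  proof (intro conjI ballI impI)
    show "k < k'" by (simp add: k'_def)
  qed (fact sub, fact retn, use k' in blast, fact gen, fact dup, fact kids)
  then show ?thesis using cZ' neZ' by blast
qed

section \<open>Sequences of towers and invariant functionals\<close>

locale tower_sequence = minimal_system +
  fixes Z :: "nat \<Rightarrow> 'a set" and k :: "nat \<Rightarrow> nat"
  assumes cZ: "clopen_in X (Z n)" and neZ: "Z n \<noteq> {}"
    and st: "tower_refines (Suc n) (Z n) (k n) (Z (Suc n)) (k (Suc n))"
    and Z0: "Z 0 = XX"

lemma (in minimal_system) tower_ex: "\<exists>Z k. tower_sequence X S Z k"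
proof -
  have "\<exists>f. \<forall>n. (clopen_in X (fst (f n)) \<and> fst (f n) \<noteq> {} \<and> (n = 0 \<longrightarrow> fst (f n) = XX)) \<and>
      tower_refines (Suc n) (fst (f n)) (snd (f n)) (fst (f (Suc n))) (snd (f (Suc n)))"
  proof (rule dependent_nat_choice)
    show "\<exists>p :: 'a set \<times> nat. clopen_in X (fst p) \<and> fst p \<noteq> {} \<and> (0 = (0::nat) \<longrightarrow> fst p = XX)"
      using nonempty by (intro exI[of _ "(XX, 0)"]) simp
    fix p :: "'a set \<times> nat" and n :: nat
    assume p: "clopen_in X (fst p) \<and> fst p \<noteq> {} \<and> (n = 0 \<longrightarrow> fst p = XX)"
    interpret base_set X S "fst p" using p by unfold_locales auto
    obtain Z' k' where "clopen_in X Z'" "Z' \<noteq> {}" "tower_refines (Suc n) (fst p) (snd p) Z' k'" using tower_refines_ex by blast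
    then show "\<exists>q. (clopen_in X (fst q) \<and> fst q \<noteq> {} \<and> (Suc n = 0 \<longrightarrow> fst q = XX)) \<and>
        tower_refines (Suc n) (fst p) (snd p) (fst q) (snd q)"
      by (intro exI[of _ "(Z', k')"]) simp
  qed
  then obtain f where f: "\<forall>n. (clopen_in X (fst (f n)) \<and> fst (f n) \<noteq> {} \<and> (n = 0 \<longrightarrow> fst (f n) = XX)) \<and>
      tower_refines (Suc n) (fst (f n)) (snd (f n)) (fst (f (Suc n))) (snd (f (Suc n)))" by blast
  have "tower_sequence X S (\<lambda>n. fst (f n)) (\<lambda>n. snd (f n))" by unfold_locales (use f in auto)
  then show ?thesis by blast
qed

sublocale tower_sequence \<subseteq> B: base_set X S "Z n" for n
  by unfold_locales (rule cZ neZ)+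

text \<open>An orbit segment from \<open>Z\<close> to \<open>Z\<close> is a concatenation of
  complete passes through towers.\<close>

lemma (in base_set) tower_sum_zero:
  assumes "\<And>z. z \<in> Z \<Longrightarrow> tower_sum Z f z = 0" "z \<in> Z" "(S ^^ n) z \<in> Z"
  shows "(\<Sum>j<n. f ((S ^^ j) z)) = 0"
  using assms(2,3)
proof (induction n arbitrary: z rule: less_induct)
  case (less n)
  let ?r = "return_time Z z"
  show ?case
  proof (cases "n = 0")
    case False
    then have r: "0 < ?r" "?r \<le> n" using return_time_pos[OF Z_sub[OF less.prems(1)]] return_time_le less.prems(2) by auto
    have "(S ^^ (n - ?r)) ((S ^^ ?r) z) \<in> Z" using less.prems(2) r Sn_add[of "n - ?r" ?r z] by simp
    then have IH: "(\<Sum>j<n - ?r. f ((S ^^ j) ((S ^^ ?r) z))) = 0"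
      using less.IH[of "n - ?r" "(S ^^ ?r) z"] r return_time_in[OF Z_sub[OF less.prems(1)]] by simp
    have split: "(\<Sum>j<a + m. F j) = (\<Sum>j<a. F j) + (\<Sum>j<m. F (j + a))" for a m and F :: "nat \<Rightarrow> int"
      by (induction m) (simp_all add: add.commute)
    have "(\<Sum>j<n. f ((S ^^ j) z)) = tower_sum Z f z + (\<Sum>j<n - ?r. f ((S ^^ j) ((S ^^ ?r) z)))"
      using split[of "\<lambda>j. f ((S ^^ j) z)" ?r "n - ?r"] r(2) by (simp add: tower_sum_def Sn_add)
    then show ?thesis using IH assms(1) less.prems(1) by simp
  qed simp
qed

context tower_sequence
begin

definition Y :: "'a set" where "Y = (\<Inter>n. Z n)"

abbreviation "lv n \<equiv> cell_const (k n) (Z n)"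
abbreviation "ts n \<equiv> tower_sum (Z n)"
abbreviation "ce n \<equiv> tower_cell (k n) (Z n)"
abbreviation "wo n \<equiv> tower_word (k n) (Z n)"
abbreviation "rt n \<equiv> return_time (Z n)"
abbreviation "ba n \<equiv> tower_base (Z n)"
abbreviation "po n \<equiv> tower_level (Z n)"

lemma Z_mono: "m \<le> n \<Longrightarrow> Z n \<subseteq> Z m"
  by (rule lift_Suc_antimono_le[of Z]) (use st in \<open>auto simp: tower_refines_def\<close>)

lemma k_ge: "n \<le> k n"
proof (induction n)
  case (Suc n)
  have "k n < k (Suc n)" using st[of n] by (simp add: tower_refines_def)
  then show ?case using Suc by simp
qed simp

lemma Y_sub: "Y \<subseteq> Z n" "Y \<subseteq> XX"
  using B.Z_sub[of _ n] by (auto simp: Y_def)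

lemma rt_ge: "z \<in> Z n \<Longrightarrow> n \<le> rt n z"
  using st[of "n - 1"] by (cases n) (auto simp: tower_refines_def)

lemma profile_Z: "x \<in> XX \<Longrightarrow> y \<in> XX \<Longrightarrow> profile (k (Suc n)) x = profile (k (Suc n)) y \<Longrightarrow> x \<in> Z n \<longleftrightarrow> y \<in> Z n"
  using st[of n] unfolding tower_refines_def by blast

text \<open>The finer profile decides membership in \<open>Z n\<close>, so equal words over
  \<open>Z (Suc n)\<close> are cut by \<open>Z n\<close> at the same levels. A pass through a tower
  over \<open>Z n\<close> cannot run past the top, because the return to \<open>Z (Suc n)\<close> is
  also a return to \<open>Z n\<close>; hence the words over \<open>Z n\<close> agree as
  well.\<close>

lemma ce_Suc:
  assumes "x \<in> XX" "y \<in> XX" "ce (Suc n) x = ce (Suc n) y" shows "ce n x = ce n y"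
proof -
  define z where "z = ba (Suc n) x"
  define z' where "z' = ba (Suc n) y"
  define R where "R = rt (Suc n) z"
  note x = B.tower_base_props[OF assms(1), of "Suc n", folded z_def R_def]
  note y = B.tower_base_props[OF assms(2), of "Suc n", folded z'_def]
  have w: "wo (Suc n) z = wo (Suc n) z'" and p: "po (Suc n) x = po (Suc n) y"
    using assms(3) by (simp_all add: tower_cell_def z_def z'_def)
  have R': "rt (Suc n) z' = R" and A: "\<And>j. j < R \<Longrightarrow> profile (k (Suc n)) ((S ^^ j) z) = profile (k (Suc n)) ((S ^^ j) z')"
    using w unfolding tower_word_eq R_def by simp_all
  have zX: "z \<in> XX" "z' \<in> XX" using x(1) y(1) B.Z_sub by blast+
  have SZ: "(S ^^ j) z \<in> Z n \<longleftrightarrow> (S ^^ j) z' \<in> Z n" if "j < R" for j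
    using profile_Z[OF Sn_in[OF zX(1)] Sn_in[OF zX(2)] A[OF that]] .
  have SR: "(S ^^ R) z \<in> Z n" "(S ^^ R) z' \<in> Z n"
    using B.return_time_in[OF zX(1), of "Suc n"] B.return_time_in[OF zX(2), of "Suc n"] R' Z_mono[of n "Suc n"]
    unfolding R_def by auto
  have "k n \<le> k (Suc n)" using st[of n] by (simp add: tower_refines_def)
  then have A': "profile (k n) ((S ^^ j) z) = profile (k n) ((S ^^ j) z')" if "j < R" for j
    using profile_mono[OF A[OF that]] by simp
  have wdeq: "wo n ((S ^^ j) z) = wo n ((S ^^ j) z')" if j: "j < R" "(S ^^ j) z \<in> Z n" for j
  proof -
    define m where "m = rt n ((S ^^ j) z)"
    have jX: "(S ^^ j) z \<in> XX" using Sn_in[OF zX(1)] .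
    have "(S ^^ (R - j)) ((S ^^ j) z) \<in> Z n" using SR(1) j(1) Sn_add[of "R - j" j z] by simp
    then have mR: "m \<le> R - j" unfolding m_def using j(1) by (intro B.return_time_le) auto
    have m0: "0 < m" unfolding m_def using B.return_time_pos[OF jX] .
    have V: "(S ^^ i) ((S ^^ j) z) \<in> Z n \<longleftrightarrow> (S ^^ i) ((S ^^ j) z') \<in> Z n" if "i \<le> m" for i
    proof (cases "i + j < R")
      case True
      then show ?thesis using SZ[of "i + j"] by (simp add: Sn_add)
    next
      case False
      then have "i + j = R" using that mR j(1) by simp
      then have "(S ^^ i) ((S ^^ j) z) = (S ^^ R) z" "(S ^^ i) ((S ^^ j) z') = (S ^^ R) z'"
        using Sn_add[of i j] by auto
      then show ?thesis using SR by simp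
    qed
    have "rt n ((S ^^ j) z') = m"
    proof (rule B.return_time_eqI[OF m0])
      show "(S ^^ m) ((S ^^ j) z') \<in> Z n" using V[of m] B.return_time_in[OF jX, of n] unfolding m_def by simp
      show "(S ^^ i) ((S ^^ j) z') \<notin> Z n" if "0 < i" "i < m" for i
        using V[of i] B.return_time_min[OF that(1), of n "(S ^^ j) z"] that unfolding m_def by simp
    qed
    moreover have "profile (k n) ((S ^^ i) ((S ^^ j) z)) = profile (k n) ((S ^^ i) ((S ^^ j) z'))" if "i < m" for i
      using A'[of "i + j"] that mR by (simp add: Sn_add)
    ultimately show ?thesis unfolding tower_word_eq m_def by simp
  qed
  have "ce n ((S ^^ j) z) = ce n ((S ^^ j) z')" if "j < R" for j
    using that
  proof (induction j)
    case 0
    have "z \<in> Z n" "z' \<in> Z n" using x(1) y(1) Z_mono[of n "Suc n"] by auto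
    then show ?case using wdeq[of 0] 0 by (simp add: tower_cell_def B.tower_base_Z)
  next
    case (Suc j)
    then have IH: "ce n ((S ^^ j) z) = ce n ((S ^^ j) z')" by simp
    show ?case
    proof (cases "(S ^^ Suc j) z \<in> Z n")
      case True
      then have "(S ^^ Suc j) z' \<in> Z n" using SZ[OF Suc.prems] by blast
      then show ?thesis using True wdeq[OF Suc.prems True] by (simp only: tower_cell_def B.tower_base_Z)
    next
      case False
      then have "S ((S ^^ j) z) \<notin> Z n" "S ((S ^^ j) z') \<notin> Z n" using SZ[OF Suc.prems] by simp_all
      then show ?thesis using IH B.tower_base_S[OF Sn_in[OF zX(1)]] B.tower_base_S[OF Sn_in[OF zX(2)]]
        by (simp add: tower_cell_def)
    qed
  qed
  then show ?thesis using x(2,3) y(3) p by metis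
qed

lemma ce_mono: "m \<le> n \<Longrightarrow> x \<in> XX \<Longrightarrow> y \<in> XX \<Longrightarrow> ce n x = ce n y \<Longrightarrow> ce m x = ce m y"
  by (induction rule: inc_induct) (use ce_Suc in blast)+

lemma lv_mono: "m \<le> n \<Longrightarrow> lv m f \<Longrightarrow> lv n f"
  unfolding cell_const_def using ce_mono[of m n] by blast

lemma lv_ev: assumes "loc_const X f" shows "\<exists>N. \<forall>n\<ge>N. lv n f"
proof -
  obtain K where K: "\<forall>k\<ge>K. \<forall>x\<in>XX. \<forall>y\<in>XX. profile k x = profile k y \<longrightarrow> f x = f y" using loc_const_profile_ev[OF assms] by blast
  have "lv n f" if "n \<ge> K" for n
    using K k_ge[of n] that by (intro B.cell_const_profile) (meson order_trans)
  then show ?thesis by blast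
qed

lemma wo_mono: assumes "m \<le> n" "z \<in> Z n" "z' \<in> Z n" "wo n z = wo n z'" shows "wo m z = wo m z'"
proof -
  have "ce n z = ce n z'" using assms by (simp add: tower_cell_def B.tower_base_Z)
  then have "ce m z = ce m z'" using ce_mono[OF assms(1)] B.Z_sub assms(2,3) by blast
  moreover have "z \<in> Z m" "z' \<in> Z m" using Z_mono[OF assms(1)] assms(2,3) by auto
  ultimately show ?thesis by (simp add: tower_cell_def B.tower_base_Z)
qed

lemma ts_zero_mono:
  assumes "\<And>z. z \<in> Z n \<Longrightarrow> ts n f z = 0" "n \<le> m" "z \<in> Z m" shows "ts m f z = 0"
proof -
  have "(S ^^ rt m z) z \<in> Z n" using B.return_time_in[OF B.Z_sub[OF assms(3)]] Z_mono[OF assms(2)] by blast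
  then show ?thesis unfolding tower_sum_def
    using assms Z_mono[OF assms(2)] by (intro B.tower_sum_zero[of n]) auto
qed

text \<open>The tower sum of \<open>h - h \<circ> S\<close> over \<open>z\<close> is the difference of \<open>h\<close> at \<open>z\<close> and at its return to the base, so these
  functionals need not annihilate \<open>h - h \<circ> S\<close> when \<open>h\<close> is not constant on the intersection of the bases.\<close>

definition inv_functional :: "(('a \<Rightarrow> int) \<Rightarrow> int) \<Rightarrow> bool" where
  "inv_functional \<phi> \<longleftrightarrow> (\<forall>f g. loc_const X f \<longrightarrow> loc_const X g \<longrightarrow> \<phi> (\<lambda>x. f x + g x) = \<phi> f + \<phi> g) \<and>
     (\<forall>f N. loc_const X f \<longrightarrow> (\<forall>z\<in>Z N. ts N f z = 0) \<longrightarrow> \<phi> f = 0)"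

lemma inv_functional_add: "inv_functional \<phi> \<Longrightarrow> loc_const X f \<Longrightarrow> loc_const X g \<Longrightarrow> \<phi> (\<lambda>x. f x + g x) = \<phi> f + \<phi> g"
  by (simp add: inv_functional_def)

lemma inv_functional_zero: "inv_functional \<phi> \<Longrightarrow> loc_const X f \<Longrightarrow> (\<And>z. z \<in> Z N \<Longrightarrow> ts N f z = 0) \<Longrightarrow> \<phi> f = 0"
  unfolding inv_functional_def by blast

lemma inv_functional_0: "inv_functional \<phi> \<Longrightarrow> \<phi> (\<lambda>x. 0) = 0"
  by (rule inv_functional_zero[where N = 0]) (simp_all add: tower_sum_def)

lemma loc_const_uminus: "loc_const X f \<Longrightarrow> loc_const X (\<lambda>x. - f x :: int)"
  by (rule loc_const_comp)

lemma loc_const_add: "loc_const X f \<Longrightarrow> loc_const X g \<Longrightarrow> loc_const X (\<lambda>x. f x + g x :: int)"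
  by (rule loc_const_comp2)

lemma loc_const_diff: "loc_const X f \<Longrightarrow> loc_const X g \<Longrightarrow> loc_const X (\<lambda>x. f x - g x :: int)"
  by (rule loc_const_comp2)

lemma loc_const_mult: "loc_const X f \<Longrightarrow> loc_const X (\<lambda>x. a * f x :: int)"
  by (rule loc_const_comp)

lemma inv_functional_uminus: assumes "inv_functional \<phi>" "loc_const X f" shows "\<phi> (\<lambda>x. - f x) = - \<phi> f"
  using inv_functional_add[OF assms(1) assms(2) loc_const_uminus[OF assms(2)]] inv_functional_0[OF assms(1)] by simp

lemma inv_functional_diff: assumes "inv_functional \<phi>" "loc_const X f" "loc_const X g" shows "\<phi> (\<lambda>x. f x - g x) = \<phi> f - \<phi> g"
  using inv_functional_add[OF assms(1,2) loc_const_uminus[OF assms(3)]] inv_functional_uminus[OF assms(1,3)] by simp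

lemma inv_functional_mult: assumes "inv_functional \<phi>" "loc_const X f" shows "\<phi> (\<lambda>x. a * f x) = a * \<phi> f"
proof (induction a rule: int_induct[where k = 0])
  case (step1 i)
  then show ?case using inv_functional_add[OF assms(1) loc_const_mult[OF assms(2)] assms(2)] by (simp add: distrib_right)
next
  case (step2 i)
  then show ?case using inv_functional_diff[OF assms(1) loc_const_mult[OF assms(2)] assms(2)] by (simp add: left_diff_distrib)
qed (simp add: inv_functional_0[OF assms(1)])

lemma inv_functional_sum:
  assumes "inv_functional \<phi>" "finite I" "\<And>i. i \<in> I \<Longrightarrow> loc_const X (f i)"
  shows "\<phi> (\<lambda>x. \<Sum>i\<in>I. f i x) = (\<Sum>i\<in>I. \<phi> (f i))"
  using assms(2,3)
proof (induction I rule: finite_induct)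
  case (insert i I)
  then show ?case using inv_functional_add[OF assms(1), of "f i" "\<lambda>x. \<Sum>i\<in>I. f i x"] loc_const_sum[of I X f] by simp
qed (simp add: inv_functional_0[OF assms(1)])

lemma inv_functional_cong_ts:
  assumes "inv_functional \<phi>" "loc_const X f" "loc_const X g" "\<And>z. z \<in> Z N \<Longrightarrow> ts N f z = ts N g z"
  shows "\<phi> f = \<phi> g"
proof -
  have "\<phi> (\<lambda>x. f x - g x) = 0"
    using assms(4) by (intro inv_functional_zero[OF assms(1) loc_const_diff[OF assms(2,3)], of N])
      (simp add: tower_sum_def sum_subtractf)
  then show ?thesis using inv_functional_diff[OF assms(1-3)] by simp
qed

lemma inv_functional_comb:
  assumes "inv_functional \<phi>" "inv_functional \<psi>" shows "inv_functional (\<lambda>f. \<phi> f + a * \<psi> f)"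
  unfolding inv_functional_def
proof (intro conjI allI impI)
  fix f g :: "'a \<Rightarrow> int" assume "loc_const X f" "loc_const X g"
  then show "\<phi> (\<lambda>x. f x + g x) + a * \<psi> (\<lambda>x. f x + g x) = \<phi> f + a * \<psi> f + (\<phi> g + a * \<psi> g)"
    using inv_functional_add[OF assms(1)] inv_functional_add[OF assms(2)] by (simp add: algebra_simps)
next
  fix f :: "'a \<Rightarrow> int" and N assume f: "loc_const X f" "\<forall>z\<in>Z N. ts N f z = 0"
  have "\<phi> f = 0" "\<psi> f = 0" using f(2) by (auto intro: inv_functional_zero[OF assms(1) f(1), of N] inv_functional_zero[OF assms(2) f(1), of N])
  then show "\<phi> f + a * \<psi> f = 0" by simp
qed

lemma inv_functional_const0: "inv_functional (\<lambda>f. 0)"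
  by (simp add: inv_functional_def)

lemma inv_functional_sum_comb:
  assumes "finite I" "\<And>i. i \<in> I \<Longrightarrow> inv_functional (\<psi> i)"
  shows "inv_functional (\<lambda>f. \<Sum>i\<in>I. a i * \<psi> i f)"
  using assms
proof (induction I rule: finite_induct)
  case (insert i I)
  then have "inv_functional (\<lambda>f. (\<Sum>i\<in>I. a i * \<psi> i f) + a i * \<psi> i f)" by (intro inv_functional_comb) auto
  then show ?case using insert by (simp add: add.commute)
qed (simp add: inv_functional_const0)

text \<open>The tower sum at \<open>z\<close> is not itself invariant: it need not vanish on
  functions whose sums over a deeper base vanish, as \<open>z\<close> need not lie in that base. It
  is rewritten as a difference of sums at two points of the next base, which changes nothing on
  functions of level \<open>n\<close>; iterating pushes the evaluation into ever deeper
  bases.\<close>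

lemma functional_ex:
  assumes "z \<in> Z n"
  shows "\<exists>\<phi>. inv_functional \<phi> \<and> (\<forall>f. lv n f \<longrightarrow> \<phi> f = ts n f z)"
proof -
  have "\<forall>n z. \<exists>p. z \<in> Z n \<longrightarrow> fst p \<in> Z (Suc n) \<and> snd p \<in> Z (Suc n) \<and>
      (\<forall>f. lv n f \<longrightarrow> ts (Suc n) f (fst p) - ts (Suc n) f (snd p) = ts n f z)"
  proof (intro allI)
    fix n z
    show "\<exists>p. z \<in> Z n \<longrightarrow> fst p \<in> Z (Suc n) \<and> snd p \<in> Z (Suc n) \<and>
      (\<forall>f. lv n f \<longrightarrow> ts (Suc n) f (fst p) - ts (Suc n) f (snd p) = ts n f z)"
    proof (cases "z \<in> Z n")
      case True
      then obtain z1 z2 where "z1 \<in> Z (Suc n)" "z2 \<in> Z (Suc n)"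
        "\<forall>f. lv n f \<longrightarrow> ts (Suc n) f z1 - ts (Suc n) f z2 = ts n f z"
        using st[of n] unfolding tower_refines_def by blast
      then show ?thesis by (intro exI[of _ "(z1, z2)"]) simp
    qed simp
  qed
  then obtain p where p: "\<And>n z. z \<in> Z n \<Longrightarrow> fst (p n z) \<in> Z (Suc n) \<and> snd (p n z) \<in> Z (Suc n) \<and>
      (\<forall>f. lv n f \<longrightarrow> ts (Suc n) f (fst (p n z)) - ts (Suc n) f (snd (p n z)) = ts n f z)"
    by metis
  \<comment> \<open>\<open>A m n z\<close> is a signed sum of tower sums over 2^m points of
    \<open>Z (n + m)\<close>. On a fixed locally constant function it stops changing once
    \<open>n + m\<close> reaches the level of the function.\<close>
  define A where "A = rec_nat (\<lambda>n z f. ts n f z)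
     (\<lambda>m r n z f. r (Suc n) (fst (p n z)) f - r (Suc n) (snd (p n z)) f)"
  have A0: "A 0 n z f = ts n f z" for n z f by (simp add: A_def)
  have AS: "A (Suc m) n z f = A m (Suc n) (fst (p n z)) f - A m (Suc n) (snd (p n z)) f" for m n z f
    by (simp add: A_def)
  have Aadd: "A m n z (\<lambda>x. f x + g x) = A m n z f + A m n z g" for m n z f g
    by (induction m arbitrary: n z) (simp_all add: A0 AS tower_sum_def sum.distrib)
  have Alv: "A m n z f = ts n f z" if "z \<in> Z n" "lv n f" for m n z f
    using that
  proof (induction m arbitrary: n z)
    case (Suc m)
    have "lv (Suc n) f" using lv_mono[OF _ Suc.prems(2), of "Suc n"] by simp
    then show ?case using Suc p[OF Suc.prems(1)] by (simp add: AS)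
  qed (simp add: A0)
  have Aev: "\<exists>c. \<forall>m\<ge>d. A m n z f = c" if "z \<in> Z n" "lv (n + d) f" for d n z f
    using that
  proof (induction d arbitrary: n z)
    case 0
    then show ?case using Alv by auto
  next
    case (Suc d)
    note pp = p[OF Suc.prems(1)]
    obtain c1 where c1: "\<forall>m\<ge>d. A m (Suc n) (fst (p n z)) f = c1"
      using Suc.IH[of "fst (p n z)" "Suc n"] pp Suc.prems(2) by auto
    obtain c2 where c2: "\<forall>m\<ge>d. A m (Suc n) (snd (p n z)) f = c2"
      using Suc.IH[of "snd (p n z)" "Suc n"] pp Suc.prems(2) by auto
    have "A m n z f = c1 - c2" if "m \<ge> Suc d" for m
      using that c1 c2 by (cases m) (auto simp: AS)
    then show ?case by blast
  qed
  have Azero: "A m n z f = 0" if "z \<in> Z n" "\<forall>z\<in>Z N. ts N f z = 0" "N \<le> n + m" for m n z N f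
    using that
  proof (induction m arbitrary: n z)
    case 0
    then show ?case using ts_zero_mono[of N f n z] by (simp add: A0)
  next
    case (Suc m)
    then show ?case using p[OF Suc.prems(1)] by (simp add: AS)
  qed
  define \<phi> where "\<phi> f = (THE c. \<exists>M. \<forall>m\<ge>M. A m n z f = c)" for f
  have \<phi>I: "\<phi> f = c" if "\<forall>m\<ge>M. A m n z f = c" for f c M
    unfolding \<phi>_def
  proof (rule the_equality)
    show "\<exists>M. \<forall>m\<ge>M. A m n z f = c" using that by blast
    fix c' assume "\<exists>M. \<forall>m\<ge>M. A m n z f = c'"
    then obtain M' where "\<forall>m\<ge>M'. A m n z f = c'" by blast
    then have "A (max M M') n z f = c'" "A (max M M') n z f = c"
      using that by (auto dest!: spec[of _ "max M M'"])
    then show "c' = c" by simp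
  qed
  have ev: "\<exists>c M. \<forall>m\<ge>M. A m n z f = c" if f: "loc_const X f" for f
  proof -
    obtain N where "\<forall>n\<ge>N. lv n f" using lv_ev[OF f] by blast
    then have "lv (n + N) f" by simp
    then show ?thesis using Aev[OF assms] by blast
  qed
  have "inv_functional \<phi>"
    unfolding inv_functional_def
  proof (intro conjI allI impI)
    fix f g :: "'a \<Rightarrow> int" assume "loc_const X f" "loc_const X g"
    then obtain c M d K where c: "\<forall>m\<ge>M. A m n z f = c" and d: "\<forall>m\<ge>K. A m n z g = d"
      using ev by meson
    have "\<forall>m\<ge>max M K. A m n z (\<lambda>x. f x + g x) = c + d" using c d by (simp add: Aadd)
    then show "\<phi> (\<lambda>x. f x + g x) = \<phi> f + \<phi> g" using \<phi>I[OF c] \<phi>I[OF d] \<phi>I[of "max M K"] by metis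
  next
    fix f N assume "loc_const X f" "\<forall>z\<in>Z N. ts N f z = 0"
    then have "\<forall>m\<ge>N. A m n z f = 0" using Azero[OF assms] by simp
    then show "\<phi> f = 0" by (rule \<phi>I)
  qed
  moreover have "\<phi> f = ts n f z" if "lv n f" for f
    by (rule \<phi>I[of 0]) (use Alv[OF assms that] in blast)
  ultimately show ?thesis by blast
qed

text \<open>The functional is the difference of the evaluations at two columns, one level deeper,
  that functions of level \<open>n\<close> cannot distinguish.\<close>

lemma separating_functional_ex:
  "\<exists>\<phi> U. inv_functional \<phi> \<and> clopen_in X U \<and> (\<forall>g. lv n g \<longrightarrow> \<phi> g = 0) \<and> \<phi> (\<lambda>x. ind U x - ind U (S x)) = 1"
proof -
  obtain z1 z2 U where z: "z1 \<in> Z (Suc n)" "z2 \<in> Z (Suc n)" and U: "clopen_in X U"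
    "\<forall>f. lv n f \<longrightarrow> ts (Suc n) f z1 = ts (Suc n) f z2"
    "lv (Suc n) (\<lambda>x. ind U x - ind U (S x))"
    "ts (Suc n) (\<lambda>x. ind U x - ind U (S x)) z1 - ts (Suc n) (\<lambda>x. ind U x - ind U (S x)) z2 = 1"
    using st[of n] unfolding tower_refines_def by blast
  obtain \<phi> where \<phi>: "inv_functional \<phi>" "\<And>f. lv (Suc n) f \<Longrightarrow> \<phi> f = ts (Suc n) f z1" using functional_ex[OF z(1)] by blast
  obtain \<psi> where \<psi>: "inv_functional \<psi>" "\<And>f. lv (Suc n) f \<Longrightarrow> \<psi> f = ts (Suc n) f z2" using functional_ex[OF z(2)] by blast
  have "inv_functional (\<lambda>f. \<phi> f + (-1) * \<psi> f)" by (rule inv_functional_comb[OF \<phi>(1) \<psi>(1)])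
  moreover have "\<phi> g + (-1) * \<psi> g = 0" if "lv n g" for g
    using U(2) that lv_mono[OF _ that, of "Suc n"] \<phi>(2) \<psi>(2) by simp
  moreover have "\<phi> (\<lambda>x. ind U x - ind U (S x)) + (-1) * \<psi> (\<lambda>x. ind U x - ind U (S x)) = 1"
    using U(3,4) \<phi>(2) \<psi>(2) by simp
  ultimately show ?thesis using U(1) by blast
qed

text \<open>The perturbations h - h o S are chosen one after the other, each at a level so deep that
  its separating functional annihilates all earlier functions. The resulting triangular system is
  made diagonal by correcting the earlier functionals.\<close>

lemma independent_perturbations:
  assumes "finite V" "\<And>w. w \<in> V \<Longrightarrow> lv n (t w)"
  shows "\<exists>\<tau> \<phi>. \<forall>w\<in>V. loc_const X (\<tau> w) \<and> inv_functional (\<phi> w) \<and> (\<forall>g. lv n g \<longrightarrow> \<phi> w g = 0) \<and>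
     (\<forall>v\<in>V. \<phi> w (\<tau> v) = (if v = w then 1 else 0)) \<and>
     (\<exists>h. loc_const X h \<and> \<tau> w = (\<lambda>x. t w x + (h x - h (S x))))"
  using assms
proof (induction V rule: finite_induct)
  case (insert w V)
  then obtain \<tau> \<phi> where IH: "\<forall>w\<in>V. loc_const X (\<tau> w) \<and> inv_functional (\<phi> w) \<and> (\<forall>g. lv n g \<longrightarrow> \<phi> w g = 0) \<and>
     (\<forall>v\<in>V. \<phi> w (\<tau> v) = (if v = w then 1 else 0)) \<and>
     (\<exists>h. loc_const X h \<and> \<tau> w = (\<lambda>x. t w x + (h x - h (S x))))" by auto
  have "\<forall>v\<in>V. \<exists>N. \<forall>n\<ge>N. lv n (\<tau> v)" using IH lv_ev by blast
  then obtain N where N: "\<And>v n. v \<in> V \<Longrightarrow> n \<ge> N v \<Longrightarrow> lv n (\<tau> v)" by metis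
  define m where "m = Max (insert n (N ` V))"
  have m: "n \<le> m" "\<And>v. v \<in> V \<Longrightarrow> lv m (\<tau> v)"
    using insert.hyps(1) N unfolding m_def by auto
  obtain \<psi> U where \<psi>: "inv_functional \<psi>" "clopen_in X U" "\<And>g. lv m g \<Longrightarrow> \<psi> g = 0" "\<psi> (\<lambda>x. ind U x - ind U (S x)) = 1"
    using separating_functional_ex[of m] by blast
  let ?f = "\<lambda>x. ind U x - ind U (S x)"
  have lcU: "loc_const X (ind U)" by (rule loc_const_ind_int[OF \<psi>(2)])
  have lcf: "loc_const X ?f" using loc_const_diff[OF lcU loc_const_Sn[OF lcU, of 1]] by simp
  have tw: "lv n (t w)" using insert.prems by simp
  have lct: "loc_const X (t w)" using B.cell_const_loc_const[OF tw] .
  define \<tau>' where "\<tau>' = \<tau>(w := \<lambda>x. t w x + ?f x)"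
  \<comment> \<open>Subtracting this multiple of \<open>\<psi>\<close> makes the old functional
    vanish on the new \<open>\<tau>' w\<close>; on the old functions nothing changes, because
    \<open>\<psi>\<close> vanishes there.\<close>
  define \<phi>' where "\<phi>' v = (if v = w then \<psi> else (\<lambda>g. \<phi> v g + (- \<phi> v ?f) * \<psi> g))" for v
  have \<psi>w: "\<psi> (\<tau>' w) = 1"
    using inv_functional_add[OF \<psi>(1) lct lcf] \<psi>(3)[OF lv_mono[OF m(1) tw]] \<psi>(4) by (simp add: \<tau>'_def)
  show ?case
  proof (intro exI[of _ \<tau>'] exI[of _ \<phi>'] ballI conjI allI impI)
    fix v assume v: "v \<in> insert w V"
    show "loc_const X (\<tau>' v)" using v IH loc_const_add[OF lct lcf] by (auto simp: \<tau>'_def)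
    show "inv_functional (\<phi>' v)"
    proof (cases "v = w")
      case False
      then have "inv_functional (\<phi> v)" using v IH by auto
      then show ?thesis using inv_functional_comb[OF _ \<psi>(1), of "\<phi> v" "- \<phi> v ?f"] False by (simp add: \<phi>'_def)
    qed (simp add: \<phi>'_def \<psi>(1))
    show "\<phi>' v g = 0" if g: "lv n g" for g
      using v IH g \<psi>(3)[OF lv_mono[OF m(1) g]] by (auto simp: \<phi>'_def)
    show "\<exists>h. loc_const X h \<and> \<tau>' v = (\<lambda>x. t v x + (h x - h (S x)))"
      using v IH lcU by (auto simp: \<tau>'_def)
    fix u assume u: "u \<in> insert w V"
    show "\<phi>' v (\<tau>' u) = (if u = v then 1 else 0)"
    proof (cases "v = w")
      case True
      show ?thesis
      proof (cases "u = w")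
        case False
        then show ?thesis using u True \<psi>(3)[OF m(2)] by (auto simp: \<phi>'_def \<tau>'_def)
      qed (simp add: True \<phi>'_def \<psi>w)
    next
      case False
      then have vV: "v \<in> V" using v by simp
      then have iv: "inv_functional (\<phi> v)" and zv: "\<phi> v (t w) = 0" using IH tw by auto
      show ?thesis
      proof (cases "u = w")
        case True
        have "\<phi> v (\<tau>' w) = \<phi> v ?f" using inv_functional_add[OF iv lct lcf] zv by (simp add: \<tau>'_def)
        then show ?thesis using True False \<psi>w by (simp add: \<phi>'_def)
      next
        case u': False
        then have uV: "u \<in> V" using u by simp
        then show ?thesis using IH vV False u' \<psi>(3)[OF m(2)[OF uV]] by (simp add: \<phi>'_def \<tau>'_def)
      qed
    qed
  qed
qed simp

text \<open>Each word splits into words of the next base, so nested nonempty clopen word classes can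
  be chosen below the given one; compactness yields a common point, which lies in every
  \<open>Z m\<close>.\<close>

lemma Y_in_word: assumes "z \<in> Z n" shows "\<exists>y\<in>Y. wo n y = wo n z"
proof -
  have "\<exists>f. \<forall>m. (f m \<in> Z (n + m) \<and> (m = 0 \<longrightarrow> f m = z)) \<and> wo (n + m) (f (Suc m)) = wo (n + m) (f m)"
  proof (rule dependent_nat_choice)
    show "\<exists>x. x \<in> Z (n + 0) \<and> (0 = (0::nat) \<longrightarrow> x = z)" using assms by simp
    fix x m assume "x \<in> Z (n + m) \<and> (m = 0 \<longrightarrow> x = z)"
    then obtain z1 where "z1 \<in> Z (Suc (n + m))" "wo (n + m) z1 = wo (n + m) x"
      using st[of "n + m"] unfolding tower_refines_def by blast
    then show "\<exists>y. (y \<in> Z (n + Suc m) \<and> (Suc m = 0 \<longrightarrow> y = z)) \<and> wo (n + m) y = wo (n + m) x" by auto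
  qed
  then obtain f where f: "\<And>m. f m \<in> Z (n + m)" "f 0 = z" "\<And>m. wo (n + m) (f (Suc m)) = wo (n + m) (f m)"
    by blast
  define A where "A m = {x\<in>Z (n + m). wo (n + m) x = wo (n + m) (f m)}" for m
  have "A (Suc m) \<subseteq> A m" for m
  proof
    fix x assume "x \<in> A (Suc m)"
    then have x: "x \<in> Z (Suc (n + m))" "wo (Suc (n + m)) x = wo (Suc (n + m)) (f (Suc m))" by (simp_all add: A_def)
    then have "wo (n + m) x = wo (n + m) (f m)"
      using wo_mono[of "n + m" "Suc (n + m)" x "f (Suc m)"] f(1)[of "Suc m"] f(3)[of m] by simp
    then show "x \<in> A m" using x Z_mono[of "n + m" "Suc (n + m)"] by (auto simp: A_def)
  qed
  moreover have "clopen_in X (A m)" "A m \<noteq> {}" for m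
  proof -
    show "clopen_in X (A m)" unfolding A_def by (rule B.clopen_in_word)
    show "A m \<noteq> {}" using f(1)[of m] by (auto simp: A_def)
  qed
  ultimately have "(\<Inter>m. A m) \<noteq> {}" by (intro clopen_in_nest)
  then obtain y where y: "\<And>m. y \<in> A m" by blast
  have "y \<in> Z m" for m using y[of m] Z_mono[of m "n + m"] by (auto simp: A_def)
  then have "y \<in> Y" by (simp add: Y_def)
  then show ?thesis using y[of 0] f(2) by (auto simp: A_def)
qed

lemma Y_nonempty: "Y \<noteq> {}"
  using Y_in_word[of _ 0] neZ[of 0] by blast

text \<open>If \<open>Q \<inter> Y\<close> were finite, a long profile would isolate
  \<open>y\<close> in it. But the word of \<open>y\<close> contains two different words of the next
  base, and each of these is met by \<open>Y\<close>; both meeting points would have to be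
  \<open>y\<close>.\<close>

lemma Y_perfect: assumes Q: "clopen_in X Q" and y: "y \<in> Q \<inter> Y" shows "infinite (Q \<inter> Y)"
proof
  assume fin: "finite (Q \<inter> Y)"
  define F where "F = Q \<inter> Y - {y}"
  have yX: "y \<in> XX" using y Y_sub by auto
  obtain K where K: "\<forall>k\<ge>K. \<forall>x\<in>F. profile k x \<noteq> profile k y"
    using profile_separate_finite[of F y] fin y Y_sub yX unfolding F_def by blast
  obtain K' where K': "\<forall>k\<ge>K'. \<forall>x\<in>XX. \<forall>y\<in>XX. profile k x = profile k y \<longrightarrow> (x \<in> Q) = (y \<in> Q)"
    using loc_const_profile_ev[OF loc_const_ind[OF Q]] by blast
  define n where "n = max K K'"
  have kn: "k n \<ge> K" "k n \<ge> K'" using k_ge[of n] by (auto simp: n_def)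
  have yZ: "y \<in> Z n" using y Y_sub by auto
  obtain z1 z2 where z: "z1 \<in> Z (Suc n)" "z2 \<in> Z (Suc n)" "wo n z1 = wo n y" "wo n z2 = wo n y"
      "wo (Suc n) z1 \<noteq> wo (Suc n) z2"
    using st[of n] yZ unfolding tower_refines_def by blast
  have *: "x = y" if x: "x \<in> Y" "z \<in> Z (Suc n)" "wo (Suc n) x = wo (Suc n) z" "wo n z = wo n y" for x z
  proof -
    have xZ: "x \<in> Z (Suc n)" "x \<in> Z n" and xX: "x \<in> XX" using x(1) Y_sub by auto
    have "wo n x = wo n y" using wo_mono[OF _ xZ(1) x(2,3), of n] x(4) by simp
    then have "profile (k n) x = profile (k n) y"
      unfolding tower_word_eq using B.return_time_pos[OF xX, of n] by (auto dest!: spec[of _ 0])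
    moreover from this have "x \<in> Q" using K' kn xX yX y by blast
    ultimately show "x = y" using K kn(1) x(1) unfolding F_def by blast
  qed
  obtain y1 where y1: "y1 \<in> Y" "wo (Suc n) y1 = wo (Suc n) z1" using Y_in_word[OF z(1)] by blast
  obtain y2 where y2: "y2 \<in> Y" "wo (Suc n) y2 = wo (Suc n) z2" using Y_in_word[OF z(2)] by blast
  have "y1 = y" "y2 = y" using *[OF y1(1) z(1) y1(2) z(3)] *[OF y2(1) z(2) y2(2) z(4)] .
  then show False using y1 y2 z(5) by simp
qed

text \<open>Once \<open>Z n\<close> has shrunk past \<open>S x\<close>, the step from
  \<open>x\<close> no longer leaves its tower; only the steps into \<open>Y\<close> remain to be
  treated apart.\<close>

lemma same_tower_ev:
  assumes "x \<in> XX" "S x \<notin> Y" shows "\<exists>N. \<forall>n\<ge>N. ba n x = ba n (S x)"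
proof -
  obtain N where "S x \<notin> Z N" using assms(2) by (auto simp: Y_def)
  then have "ba n x = ba n (S x)" if "n \<ge> N" for n
  proof -
    have "S x \<notin> Z n" using \<open>S x \<notin> Z N\<close> Z_mono[OF that] by blast
    then show ?thesis using B.tower_base_S(1)[OF assms(1)] by simp
  qed
  then show ?thesis by blast
qed

lemma avoid_Y: assumes "clopen_in X Q" "Q \<inter> Y = {}" shows "\<exists>N. \<forall>n\<ge>N. Q \<inter> Z n = {}"
proof (rule ccontr)
  assume *: "\<nexists>N. \<forall>n\<ge>N. Q \<inter> Z n = {}"
  have ne: "Q \<inter> Z n \<noteq> {}" for n
  proof
    assume "Q \<inter> Z n = {}"
    then have "\<forall>m\<ge>n. Q \<inter> Z m = {}" using Z_mono by blast
    then show False using * by blast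
  qed
  then have "(\<Inter>n. Q \<inter> Z n) \<noteq> {}"
  proof (intro clopen_in_nest clopen_in_Int[OF assms(1) cZ])
    show "Q \<inter> Z n \<noteq> {}" for n by (rule ne)
    show "Q \<inter> Z (Suc n) \<subseteq> Q \<inter> Z n" for n using Z_mono[of n "Suc n"] by auto
  qed
  then show False using assms(2) by (auto simp: Y_def)
qed

end

section \<open>Columns\<close>

lemma fibre_bij:
  assumes "finite A" "finite B" "\<And>c. card {a\<in>A. f a = c} = card {b\<in>B. g b = c}"
  shows "\<exists>\<theta>. bij_betw \<theta> A B \<and> (\<forall>a\<in>A. g (\<theta> a) = f a)"
proof -
  have "\<forall>c. \<exists>\<theta>. bij_betw \<theta> {a\<in>A. f a = c} {b\<in>B. g b = c}"
    using assms by (intro allI finite_same_card_bij) auto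
  then obtain \<theta> where \<theta>: "\<And>c. bij_betw (\<theta> c) {a\<in>A. f a = c} {b\<in>B. g b = c}" by metis
  define h where "h a = \<theta> (f a) a" for a
  have h: "h a \<in> B \<and> g (h a) = f a" if "a \<in> A" for a
    using bij_betwE[OF \<theta>[of "f a"]] that by (auto simp: h_def)
  have "inj_on h A"
  proof (rule inj_onI)
    fix a a' assume a: "a \<in> A" "a' \<in> A" "h a = h a'"
    then have "f a = f a'" using h by metis
    then show "a = a'" using a bij_betw_imp_inj_on[OF \<theta>[of "f a"]] by (auto simp: h_def inj_on_def)
  qed
  moreover have "b \<in> h ` A" if b: "b \<in> B" for b
  proof -
    have "b \<in> \<theta> (g b) ` {a\<in>A. f a = g b}" using bij_betw_imp_surj_on[OF \<theta>[of "g b"]] b by auto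
    then obtain a where "a \<in> A" "f a = g b" "b = \<theta> (g b) a" by auto
    then have "b = h a" by (simp add: h_def)
    then show ?thesis using \<open>a \<in> A\<close> by blast
  qed
  ultimately have "bij_betw h A B" using h by (auto simp: bij_betw_def)
  then show ?thesis using h by blast
qed

lemma fibre_bij_swap:
  assumes "bij_betw \<theta> A B" "\<forall>a\<in>A. g (\<theta> a) = f a" "a0 \<in> A" "b0 \<in> B" "g b0 = f a0"
  shows "\<exists>\<theta>'. bij_betw \<theta>' A B \<and> (\<forall>a\<in>A. g (\<theta>' a) = f a) \<and> \<theta>' a0 = b0 \<and>
     (\<forall>a\<in>A. \<theta> a \<noteq> \<theta> a0 \<longrightarrow> \<theta> a \<noteq> b0 \<longrightarrow> \<theta>' a = \<theta> a)"
proof -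
  define s where "s y = (if y = \<theta> a0 then b0 else if y = b0 then \<theta> a0 else y)" for y
  have "\<theta> a0 \<in> B" using assms(1,3) by (auto simp: bij_betw_def)
  then have "bij_betw s B B"
    using assms(4) by (intro bij_betwI[where g = s]) (auto simp: s_def)
  then have "bij_betw (s \<circ> \<theta>) A B" by (rule bij_betw_trans[OF assms(1)])
  moreover have "g (s (\<theta> a)) = f a" if "a \<in> A" for a
  proof (cases "\<theta> a = \<theta> a0")
    case True
    then have "f a = f a0" using assms(2,3) that by metis
    then show ?thesis using True assms(5) by (simp add: s_def)
  next
    case False
    then show ?thesis using assms(2,3,5) that by (auto simp: s_def)
  qed
  ultimately show ?thesis by (intro exI[of _ "s \<circ> \<theta>"]) (simp add: s_def)
qed

text \<open>Two values are prescribed because a tower will be pinned at its bottom and at its top.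
  Each is enforced by a transposition inside a fibre, and the second transposition leaves the first
  value in place.\<close>

lemma fibre_bij2:
  assumes "finite A" "finite B" "\<And>c. card {a\<in>A. f a = c} = card {b\<in>B. g b = c}"
    and "a0 \<in> A" "a1 \<in> A" "a0 \<noteq> a1" "b0 \<in> B" "b1 \<in> B" "b0 \<noteq> b1" "g b0 = f a0" "g b1 = f a1"
  shows "\<exists>\<theta>. bij_betw \<theta> A B \<and> (\<forall>a\<in>A. g (\<theta> a) = f a) \<and> \<theta> a0 = b0 \<and> \<theta> a1 = b1"
proof -
  obtain \<theta> where "bij_betw \<theta> A B" "\<forall>a\<in>A. g (\<theta> a) = f a" using fibre_bij[OF assms(1-3)] by blast
  from fibre_bij_swap[OF this assms(4,7,10)]
  obtain \<eta> where \<eta>: "bij_betw \<eta> A B" "\<forall>a\<in>A. g (\<eta> a) = f a" "\<eta> a0 = b0" by blast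
  from fibre_bij_swap[OF \<eta>(1,2) assms(5,8,11)]
  obtain \<zeta> where \<zeta>: "bij_betw \<zeta> A B" "\<forall>a\<in>A. g (\<zeta> a) = f a" "\<zeta> a1 = b1"
    "\<forall>a\<in>A. \<eta> a \<noteq> \<eta> a1 \<longrightarrow> \<eta> a \<noteq> b1 \<longrightarrow> \<zeta> a = \<eta> a" by blast
  have "\<eta> a0 \<noteq> \<eta> a1" using bij_betw_imp_inj_on[OF \<eta>(1)] assms(4-6) by (auto simp: inj_on_def)
  then have "\<zeta> a0 = b0" using \<zeta>(4) assms(4,9) \<eta>(3) by metis
  then show ?thesis using \<zeta> by blast
qed

text \<open>The \<open>E\<close>-classes are columns, and the label \<open>(c, i)\<close> marks level \<open>i\<close> of a column of type \<open>c\<close> with height \<open>kk c\<close>.\<close>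

definition column_labels :: "'p set \<Rightarrow> ('p \<Rightarrow> 'w \<times> nat) \<Rightarrow> ('p \<Rightarrow> 'p \<Rightarrow> bool) \<Rightarrow> 'w set \<Rightarrow> ('w \<Rightarrow> nat) \<Rightarrow> bool" where
  "column_labels P lab E C kk \<longleftrightarrow> (\<forall>p\<in>P. E p p) \<and> (\<forall>p\<in>P. \<forall>q\<in>P. E p q \<longrightarrow> E q p) \<and>
     (\<forall>p\<in>P. \<forall>q\<in>P. \<forall>r\<in>P. E p q \<longrightarrow> E q r \<longrightarrow> E p r) \<and>
     (\<forall>p\<in>P. \<exists>c\<in>C. bij_betw lab {q\<in>P. E p q} ({c} \<times> {..<kk c}))"

lemma column_labelsD:
  assumes "column_labels P lab E C kk"
  shows "p \<in> P \<Longrightarrow> E p p" "p \<in> P \<Longrightarrow> q \<in> P \<Longrightarrow> E p q \<Longrightarrow> E q p"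
    "p \<in> P \<Longrightarrow> q \<in> P \<Longrightarrow> r \<in> P \<Longrightarrow> E p q \<Longrightarrow> E q r \<Longrightarrow> E p r"
    "p \<in> P \<Longrightarrow> fst (lab p) \<in> C \<and> snd (lab p) < kk (fst (lab p))"
    "p \<in> P \<Longrightarrow> q \<in> P \<Longrightarrow> E p q \<Longrightarrow> fst (lab p) = fst (lab q)"
    "p \<in> P \<Longrightarrow> q \<in> P \<Longrightarrow> E p q \<Longrightarrow> lab p = lab q \<Longrightarrow> p = q"
    "p \<in> P \<Longrightarrow> i < kk (fst (lab p)) \<Longrightarrow> \<exists>q\<in>P. E p q \<and> lab q = (fst (lab p), i)"
proof -
  show r: "p \<in> P \<Longrightarrow> E p p" and "p \<in> P \<Longrightarrow> q \<in> P \<Longrightarrow> E p q \<Longrightarrow> E q p"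
    "p \<in> P \<Longrightarrow> q \<in> P \<Longrightarrow> r \<in> P \<Longrightarrow> E p q \<Longrightarrow> E q r \<Longrightarrow> E p r"
    using assms unfolding column_labels_def by blast+
  have b: "\<exists>c\<in>C. bij_betw lab {q\<in>P. E p q} ({c} \<times> {..<kk c})" if "p \<in> P"
    using assms that unfolding column_labels_def by blast
  have cc: "fst (lab p) = c" if "p \<in> P" "bij_betw lab {q\<in>P. E p q} ({c} \<times> {..<kk c})" for c
    using bij_betwE[OF that(2)] that(1) r[OF that(1)] by auto
  have b': "bij_betw lab {q\<in>P. E p q} ({fst (lab p)} \<times> {..<kk (fst (lab p))}) \<and> fst (lab p) \<in> C"
    if "p \<in> P" using b[OF that] cc[OF that] by metis
  have m: "lab q \<in> {fst (lab p)} \<times> {..<kk (fst (lab p))}" if "p \<in> P" "q \<in> P" "E p q" for q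
    using bij_betwE[OF conjunct1[OF b'[OF that(1)]]] that(2,3) by blast
  show "p \<in> P \<Longrightarrow> fst (lab p) \<in> C \<and> snd (lab p) < kk (fst (lab p))"
    using m[of p] b' r by (simp add: mem_Times_iff)
  show "p \<in> P \<Longrightarrow> q \<in> P \<Longrightarrow> E p q \<Longrightarrow> fst (lab p) = fst (lab q)"
    using m[of q] by (simp add: mem_Times_iff)
  show "p \<in> P \<Longrightarrow> q \<in> P \<Longrightarrow> E p q \<Longrightarrow> lab p = lab q \<Longrightarrow> p = q"
    using inj_onD[OF bij_betw_imp_inj_on[OF conjunct1[OF b']], of p q] r by simp
  show "p \<in> P \<Longrightarrow> i < kk (fst (lab p)) \<Longrightarrow> \<exists>q\<in>P. E p q \<and> lab q = (fst (lab p), i)"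
  proof -
    assume p: "p \<in> P" "i < kk (fst (lab p))"
    have "(fst (lab p), i) \<in> lab ` {q\<in>P. E p q}"
      using bij_betw_imp_surj_on[OF conjunct1[OF b'[OF p(1)]]] p(2) by simp
    then show ?thesis by auto
  qed
qed

lemma column_labelsI:
  assumes "\<And>p. p \<in> P \<Longrightarrow> E p p" "\<And>p q. p \<in> P \<Longrightarrow> q \<in> P \<Longrightarrow> E p q \<Longrightarrow> E q p"
    "\<And>p q r. p \<in> P \<Longrightarrow> q \<in> P \<Longrightarrow> r \<in> P \<Longrightarrow> E p q \<Longrightarrow> E q r \<Longrightarrow> E p r"
    "\<And>p. p \<in> P \<Longrightarrow> fst (lab p) \<in> C \<and> snd (lab p) < kk (fst (lab p))"
    "\<And>p q. p \<in> P \<Longrightarrow> q \<in> P \<Longrightarrow> E p q \<Longrightarrow> fst (lab p) = fst (lab q)"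
    "\<And>p q. p \<in> P \<Longrightarrow> q \<in> P \<Longrightarrow> E p q \<Longrightarrow> lab p = lab q \<Longrightarrow> p = q"
    "\<And>p i. p \<in> P \<Longrightarrow> i < kk (fst (lab p)) \<Longrightarrow> \<exists>q\<in>P. E p q \<and> lab q = (fst (lab p), i)"
  shows "column_labels P lab E C kk"
  unfolding column_labels_def
proof (intro conjI ballI impI)
  fix p assume p: "p \<in> P"
  have "bij_betw lab {q\<in>P. E p q} ({fst (lab p)} \<times> {..<kk (fst (lab p))})"
    unfolding bij_betw_def
  proof
    show "inj_on lab {q \<in> P. E p q}"
    proof (rule inj_onI)
      fix q r assume "q \<in> {q \<in> P. E p q}" "r \<in> {q \<in> P. E p q}" "lab q = lab r"
      then show "q = r" using assms(2)[OF p] assms(3)[of q p r] assms(6)[of q r] p by blast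
    qed
    show "lab ` {q \<in> P. E p q} = {fst (lab p)} \<times> {..<kk (fst (lab p))}"
    proof
      show "lab ` {q \<in> P. E p q} \<subseteq> {fst (lab p)} \<times> {..<kk (fst (lab p))}"
      proof
        fix l assume "l \<in> lab ` {q \<in> P. E p q}"
        then obtain q where "q \<in> P" "E p q" "l = lab q" by blast
        then show "l \<in> {fst (lab p)} \<times> {..<kk (fst (lab p))}"
          using assms(4)[of q] assms(5)[OF p, of q] by (simp add: mem_Times_iff)
      qed
      show "{fst (lab p)} \<times> {..<kk (fst (lab p))} \<subseteq> lab ` {q \<in> P. E p q}"
      proof
        fix l assume "l \<in> {fst (lab p)} \<times> {..<kk (fst (lab p))}"
        then have "l = (fst (lab p), snd l)" "snd l < kk (fst (lab p))" by auto
        then show "l \<in> lab ` {q \<in> P. E p q}" using assms(7)[OF p, of "snd l"] by (metis (mono_tags, lifting) imageI mem_Collect_eq)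
      qed
    qed
  qed
  then show "\<exists>c\<in>C. bij_betw lab {q\<in>P. E p q} ({c} \<times> {..<kk c})" using assms(4)[OF p] by blast
qed (use assms(1-3) in blast)+

text \<open>A column is determined by its bottom, so equal numbers of bottoms of each type suffice
  for a bijection that maps columns to columns; the levels then follow from the labels. The two
  pinned points lie in different columns on both sides, so their bottoms can be pinned
  simultaneously.\<close>

lemma column_bijection_ex:
  fixes P :: "'p set" and Q :: "'q set" and la :: "'p \<Rightarrow> 'w \<times> nat" and lb :: "'q \<Rightarrow> 'w \<times> nat"
  assumes P: "column_labels P la E C kk" "finite P" and Q: "column_labels Q lb F C kk" "finite Q"
    and card: "\<And>c. c \<in> C \<Longrightarrow> card {p\<in>P. la p = (c, 0)} = card {q\<in>Q. lb q = (c, 0)}"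
    and p: "p0 \<in> P" "p1 \<in> P" "\<not> E p0 p1" and q: "q0 \<in> Q" "q1 \<in> Q" "\<not> F q0 q1"
    and l: "la p0 = lb q0" "la p1 = lb q1"
  shows "\<exists>\<Theta>. bij_betw \<Theta> P Q \<and> (\<forall>p\<in>P. lb (\<Theta> p) = la p) \<and> (\<forall>p\<in>P. \<forall>p'\<in>P. E p p' \<longleftrightarrow> F (\<Theta> p) (\<Theta> p')) \<and>
     \<Theta> p0 = q0 \<and> \<Theta> p1 = q1"
proof -
  note PD = column_labelsD[OF P(1)] and QD = column_labelsD[OF Q(1)]
  define BP where "BP = {p\<in>P. snd (la p) = 0}"
  define BQ where "BQ = {q\<in>Q. snd (lb q) = 0}"
  have "\<exists>b\<in>P. E p b \<and> la b = (fst (la p), 0)" if "p \<in> P" for p using PD(7)[OF that, of 0] PD(4)[OF that] by auto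
  then obtain bp where bp: "\<And>p. p \<in> P \<Longrightarrow> bp p \<in> P \<and> E p (bp p) \<and> la (bp p) = (fst (la p), 0)" by metis
  have "\<exists>b\<in>Q. F q b \<and> lb b = (fst (lb q), 0)" if "q \<in> Q" for q using QD(7)[OF that, of 0] QD(4)[OF that] by auto
  then obtain bq where bq: "\<And>q. q \<in> Q \<Longrightarrow> bq q \<in> Q \<and> F q (bq q) \<and> lb (bq q) = (fst (lb q), 0)" by metis
  have bpE: "bp p = bp p' \<longleftrightarrow> E p p'" if "p \<in> P" "p' \<in> P" for p p'
  proof
    assume "bp p = bp p'"
    then show "E p p'" using bp[OF that(1)] bp[OF that(2)] PD(2,3) that by metis
  next
    assume E: "E p p'"
    have "E (bp p) (bp p')" using bp[OF that(1)] bp[OF that(2)] PD(2,3) that E by meson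
    then show "bp p = bp p'" using bp[OF that(1)] bp[OF that(2)] PD(5)[OF that E] PD(6) by simp
  qed
  have bqF: "bq q = bq q' \<longleftrightarrow> F q q'" if "q \<in> Q" "q' \<in> Q" for q q'
  proof
    assume "bq q = bq q'"
    then show "F q q'" using bq[OF that(1)] bq[OF that(2)] QD(2,3) that by metis
  next
    assume E: "F q q'"
    have "F (bq q) (bq q')" using bq[OF that(1)] bq[OF that(2)] QD(2,3) that E by meson
    then show "bq q = bq q'" using bq[OF that(1)] bq[OF that(2)] QD(5)[OF that E] QD(6) by simp
  qed
  have bpB: "bp p \<in> BP" if "p \<in> P" for p using bp[OF that] by (simp add: BP_def)
  have bqB: "bq q \<in> BQ" if "q \<in> Q" for q using bq[OF that] by (simp add: BQ_def)
  have cardB: "card {a\<in>BP. la a = l} = card {b\<in>BQ. lb b = l}" for l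
  proof (cases "snd l = 0 \<and> fst l \<in> C")
    case True
    then have "{a\<in>BP. la a = l} = {p\<in>P. la p = (fst l, 0)}" "{b\<in>BQ. lb b = l} = {q\<in>Q. lb q = (fst l, 0)}"
      by (auto simp: BP_def BQ_def prod_eq_iff)
    then show ?thesis using card True by simp
  next
    case False
    have "card {a\<in>BP. la a = l} = 0" using False PD(4) unfolding card_eq_0_iff by (auto simp: BP_def)
    moreover have "card {b\<in>BQ. lb b = l} = 0" using False QD(4) unfolding card_eq_0_iff by (auto simp: BQ_def)
    ultimately show ?thesis by (rule trans[OF _ sym])
  qed
  have "finite BP" "finite BQ" using P(2) Q(2) by (auto simp: BP_def BQ_def)
  from fibre_bij2[OF this cardB bpB[OF p(1)] bpB[OF p(2)] _ bqB[OF q(1)] bqB[OF q(2)]]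
  obtain \<theta> where \<theta>: "bij_betw \<theta> BP BQ" "\<forall>a\<in>BP. lb (\<theta> a) = la a" "\<theta> (bp p0) = bq q0" "\<theta> (bp p1) = bq q1"
    using bpE[OF p(1,2)] bqF[OF q(1,2)] p(3) q(3) bp[OF p(1)] bp[OF p(2)] bq[OF q(1)] bq[OF q(2)] l by auto
  have \<theta>Q: "\<theta> (bp p) \<in> Q \<and> lb (\<theta> (bp p)) = (fst (la p), 0)" if "p \<in> P" for p
    using bij_betwE[OF \<theta>(1)] \<theta>(2) bpB[OF that] bp[OF that] by (auto simp: BQ_def)
  have "\<exists>q\<in>Q. F (\<theta> (bp p)) q \<and> lb q = la p" if "p \<in> P" for p
    using QD(7)[of "\<theta> (bp p)" "snd (la p)"] \<theta>Q[OF that] PD(4)[OF that] by auto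
  then obtain \<Theta> where \<Theta>: "\<And>p. p \<in> P \<Longrightarrow> \<Theta> p \<in> Q \<and> F (\<theta> (bp p)) (\<Theta> p) \<and> lb (\<Theta> p) = la p" by metis
  have \<Theta>b: "bq (\<Theta> p) = \<theta> (bp p)" if "p \<in> P" for p
  proof -
    have "F (\<theta> (bp p)) (bq (\<Theta> p))" using \<Theta>[OF that] bq[of "\<Theta> p"] QD(3) \<theta>Q[OF that] by meson
    moreover have "lb (bq (\<Theta> p)) = (fst (la p), 0)" using \<Theta>[OF that] bq[of "\<Theta> p"] by simp
    ultimately show ?thesis using QD(6) \<theta>Q[OF that] \<Theta>[OF that] bq[of "\<Theta> p"] by metis
  qed
  have EF: "E p p' \<longleftrightarrow> F (\<Theta> p) (\<Theta> p')" if "p \<in> P" "p' \<in> P" for p p'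
  proof -
    have "E p p' \<longleftrightarrow> \<theta> (bp p) = \<theta> (bp p')"
      using bpE[OF that] bij_betw_imp_inj_on[OF \<theta>(1)] bpB[OF that(1)] bpB[OF that(2)] by (auto simp: inj_on_def)
    also have "\<dots> \<longleftrightarrow> F (\<Theta> p) (\<Theta> p')" using \<Theta>b[OF that(1)] \<Theta>b[OF that(2)] bqF \<Theta> that by metis
    finally show ?thesis .
  qed
  have uni: "\<Theta> p = q" if "p \<in> P" "q \<in> Q" "la p = lb q" "\<theta> (bp p) = bq q" for p q
  proof -
    have "F (\<Theta> p) q" using bqF[of "\<Theta> p" q] \<Theta>b[OF that(1)] \<Theta>[OF that(1)] that by simp
    then show ?thesis using QD(6) \<Theta>[OF that(1)] that by metis
  qed
  have "inj_on \<Theta> P"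
  proof (rule inj_onI)
    fix p p' assume pp: "p \<in> P" "p' \<in> P" "\<Theta> p = \<Theta> p'"
    then have "E p p'" using EF \<Theta> QD(1) by metis
    moreover have "la p = la p'" using pp \<Theta> by metis
    ultimately show "p = p'" using PD(6) pp by blast
  qed
  moreover have "q \<in> \<Theta> ` P" if q: "q \<in> Q" for q
  proof -
    have "bq q \<in> \<theta> ` BP" using bij_betw_imp_surj_on[OF \<theta>(1)] bqB[OF q] by simp
    then obtain b where b: "b \<in> BP" "\<theta> b = bq q" by auto
    have bP: "b \<in> P" and lb: "la b = (fst (lb q), 0)" using b \<theta>(2) bq[OF q] by (auto simp: BP_def)
    then obtain p where p: "p \<in> P" "E b p" "la p = lb q" using PD(7)[OF bP, of "snd (lb q)"] QD(4)[OF q] by (metis fst_conv prod.collapse)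
    have "bp b = b" using bp[OF bP] lb PD(6)[OF bP, of "bp b"] by simp
    then have "bp p = b" using bpE[OF bP p(1)] p(2) by simp
    then have "\<Theta> p = q" using uni[OF p(1) q p(3)] b by simp
    then show ?thesis using p(1) by blast
  qed
  ultimately have "bij_betw \<Theta> P Q" using \<Theta> by (auto simp: bij_betw_def)
  moreover have "\<Theta> p0 = q0" "\<Theta> p1 = q1" using uni p q l \<theta>(3,4) by auto
  ultimately show ?thesis using EF \<Theta> by blast
qed

text \<open>A column of type \<open>c\<close> has exactly one point on its bottom level, so tower
  sums of this function count the columns of that type in a tower.\<close>

definition bottom_ind :: "('a \<Rightarrow> 'w \<times> nat) \<Rightarrow> 'w \<Rightarrow> 'a \<Rightarrow> int" where
  "bottom_ind lab c x = (if lab x = (c, 0) then 1 else 0)"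

section \<open>Columns inside the towers of a sequence\<close>

context tower_sequence
begin

text \<open>A column system of level \<open>m\<close>: columns stay inside towers over \<open>Z m\<close>, and the labelling as well as the
  relation \<open>E\<close> can be read off the tower word.\<close>

definition column_system :: "nat \<Rightarrow> ('a \<Rightarrow> 'w \<times> nat) \<Rightarrow> ('a \<Rightarrow> 'a \<Rightarrow> bool) \<Rightarrow> 'w set \<Rightarrow> ('w \<Rightarrow> nat) \<Rightarrow> bool" where
  "column_system m lab E C kk \<longleftrightarrow> (\<forall>x\<in>XX. \<forall>y\<in>XX. E x y \<longrightarrow> ba m x = ba m y) \<and> lv m lab \<and>
     (\<forall>z\<in>Z m. \<forall>z'\<in>Z m. wo m z = wo m z' \<longrightarrow>
        (\<forall>p<rt m z. \<forall>q<rt m z. E ((S ^^ p) z) ((S ^^ q) z) \<longrightarrow> E ((S ^^ p) z') ((S ^^ q) z'))) \<and>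
     column_labels XX lab E C kk \<and> (\<forall>c\<in>C. \<exists>x\<in>XX. lab x = (c, 0)) \<and> finite C"

lemma ba_funpow:
  assumes "z \<in> Z m" shows "po m ((S ^^ p) z) \<le> p \<and> ba m ((S ^^ p) z) = (S ^^ (p - po m ((S ^^ p) z))) z"
proof (induction p)
  case 0
  then show ?case using B.tower_base_Z[OF assms] by simp
next
  case (Suc p)
  have X: "(S ^^ p) z \<in> XX" using Sn_in B.Z_sub[OF assms] by blast
  show ?case
  proof (cases "(S ^^ Suc p) z \<in> Z m")
    case True
    then show ?thesis using B.tower_base_Z[OF True] by simp
  next
    case False
    then have "S ((S ^^ p) z) \<notin> Z m" by simp
    from B.tower_base_S[OF X this] show ?thesis using Suc by simp
  qed
qed

text \<open>Since \<open>Z n\<close> is contained in \<open>Z m\<close>, a tower over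
  \<open>Z m\<close> that meets a tower over \<open>Z n\<close> is contained in it; columns thus
  remain inside towers and are still read off the longer words.\<close>

lemma column_system_mono: assumes s: "column_system m lab E C kk" and mn: "m \<le> n" shows "column_system n lab E C kk"
proof -
  have S1: "\<And>x y. x \<in> XX \<Longrightarrow> y \<in> XX \<Longrightarrow> E x y \<Longrightarrow> ba m x = ba m y" and S2: "lv m lab"
    and S3: "\<And>z z' p q. z \<in> Z m \<Longrightarrow> z' \<in> Z m \<Longrightarrow> wo m z = wo m z' \<Longrightarrow> p < rt m z \<Longrightarrow> q < rt m z \<Longrightarrow>
        E ((S ^^ p) z) ((S ^^ q) z) \<Longrightarrow> E ((S ^^ p) z') ((S ^^ q) z')"
    using s unfolding column_system_def by blast+
  have T1: "ba n x = ba n y" if x: "x \<in> XX" and y: "y \<in> XX" and E: "E x y" for x y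
  proof -
    note bx = B.tower_base_props[OF x, of n]
    define z where "z = ba n x"
    define p where "p = po n x"
    have xz: "x = (S ^^ p) z" and zn: "z \<in> Z n" and pr: "p < rt n z" using bx by (simp_all add: z_def p_def)
    have zm: "z \<in> Z m" using zn Z_mono[OF mn] by blast
    define i where "i = po m x"
    have i: "i \<le> p" "ba m x = (S ^^ (p - i)) z" using ba_funpow[OF zm, of p] unfolding i_def xz[symmetric] by simp_all
    note by' = B.tower_base_props[OF y, of m]
    have b: "ba m y = (S ^^ (p - i)) z" using S1[OF x y E] i(2) by simp
    have bX: "(S ^^ (p - i)) z \<in> XX" using Sn_in B.Z_sub[OF zn] by blast
    have "(S ^^ (rt n z - (p - i))) ((S ^^ (p - i)) z) \<in> Z m"
      using B.return_time_in[OF B.Z_sub[OF zn], of n] Z_mono[OF mn] pr Sn_add[of "rt n z - (p - i)" "p - i" z] by auto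
    then have "rt m ((S ^^ (p - i)) z) \<le> rt n z - (p - i)" using pr by (intro B.return_time_le) auto
    then have lt: "po m y + (p - i) < rt n z" using by'(2) b by simp
    have "y = (S ^^ (po m y + (p - i))) z" using by'(3) b Sn_add by metis
    then show ?thesis using B.tower_base_eq(1)[OF zn lt] by (simp add: z_def)
  qed
  have T3: "E ((S ^^ p) z') ((S ^^ q) z')"
    if z: "z \<in> Z n" and z': "z' \<in> Z n" and w: "wo n z = wo n z'" and p: "p < rt n z" and q: "q < rt n z"
      and E: "E ((S ^^ p) z) ((S ^^ q) z)" for z z' p q
  proof -
    have zm: "z \<in> Z m" "z' \<in> Z m" using z z' Z_mono[OF mn] by auto
    have X: "(S ^^ j) z \<in> XX" "(S ^^ j) z' \<in> XX" for j using Sn_in B.Z_sub z z' by blast+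
    have r: "rt n z = rt n z'" using w by (simp add: tower_word_eq)
    have c: "ce m ((S ^^ j) z) = ce m ((S ^^ j) z')" if "j < rt n z" for j
      using ce_mono[OF mn X] B.tower_cell_Z[OF z that] B.tower_cell_Z[OF z', of j] that r w by simp
    define i where "i = po m ((S ^^ p) z)"
    define j where "j = po m ((S ^^ q) z)"
    have i: "i \<le> p" "ba m ((S ^^ p) z) = (S ^^ (p - i)) z" using ba_funpow[OF zm(1), of p] by (simp_all add: i_def)
    have j: "j \<le> q" "ba m ((S ^^ q) z) = (S ^^ (q - j)) z" using ba_funpow[OF zm(1), of q] by (simp_all add: j_def)
    have "(S ^^ (p - i)) z = (S ^^ (q - j)) z" using S1[OF X(1) X(1) E] i j by simp
    then have eq: "p - i = q - j" using B.tower_unique[OF z z, of "p - i" "q - j"] p q by simp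
    have i': "po m ((S ^^ p) z') = i" "po m ((S ^^ q) z') = j" using c[OF p] c[OF q] by (simp_all add: tower_cell_def i_def j_def)
    define b where "b = (S ^^ (p - i)) z"
    define b' where "b' = (S ^^ (p - i)) z'"
    have bb: "ba m ((S ^^ p) z') = b'" using ba_funpow[OF zm(2), of p] i' by (simp add: b'_def)
    have wb: "wo m b = wo m b'" using c[OF p] i(2) bb by (simp add: tower_cell_def b_def)
    have bm: "b \<in> Z m" "b' \<in> Z m" using B.tower_base_props(1)[OF X(1), of m p] B.tower_base_props(1)[OF X(2), of m p] i(2) bb by (simp_all add: b_def)
    have ij: "i + (p - i) = p" "j + (p - i) = q" using i(1) j(1) eq by simp_all
    have pq: "(S ^^ i) b = (S ^^ p) z" "(S ^^ j) b = (S ^^ q) z" "(S ^^ i) b' = (S ^^ p) z'" "(S ^^ j) b' = (S ^^ q) z'"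
      unfolding b_def b'_def Sn_add[symmetric] ij by (rule refl)+
    have "i < rt m b" "j < rt m b"
      using B.tower_base_props(2)[OF X(1), of m p] B.tower_base_props(2)[OF X(1), of m q] i j eq by (simp_all add: i_def j_def b_def)
    then show ?thesis using S3[OF bm wb, of i j] E pq by simp
  qed
  show ?thesis
    using s T1 T3 lv_mono[OF mn S2] unfolding column_system_def by blast
qed

lemma column_system_labels:
  assumes s: "column_system m lab E C kk" and z: "z \<in> Z m"
  shows "column_labels {..<rt m z} (\<lambda>j. lab ((S ^^ j) z)) (\<lambda>i j. E ((S ^^ i) z) ((S ^^ j) z)) C kk"
proof -
  have c: "column_labels XX lab E C kk" and S1: "\<And>x y. x \<in> XX \<Longrightarrow> y \<in> XX \<Longrightarrow> E x y \<Longrightarrow> ba m x = ba m y"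
    using s unfolding column_system_def by blast+
  note D = column_labelsD[OF c]
  have X: "(S ^^ j) z \<in> XX" for j using Sn_in B.Z_sub[OF z] by blast
  show ?thesis
  proof (rule column_labelsI)
    show "E ((S ^^ p) z) ((S ^^ p) z)" for p using D(1)[OF X] .
    show "E ((S ^^ p) z) ((S ^^ q) z) \<Longrightarrow> E ((S ^^ q) z) ((S ^^ p) z)" for p q using D(2)[OF X X] .
    show "E ((S ^^ p) z) ((S ^^ q) z) \<Longrightarrow> E ((S ^^ q) z) ((S ^^ r) z) \<Longrightarrow> E ((S ^^ p) z) ((S ^^ r) z)" for p q r
      using D(3)[OF X X X] .
    show "fst (lab ((S ^^ p) z)) \<in> C \<and> snd (lab ((S ^^ p) z)) < kk (fst (lab ((S ^^ p) z)))" for p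
      using D(4)[OF X] .
    show "E ((S ^^ p) z) ((S ^^ q) z) \<Longrightarrow> fst (lab ((S ^^ p) z)) = fst (lab ((S ^^ q) z))" for p q
      using D(5)[OF X X] .
  next
    fix p q assume "p \<in> {..<rt m z}" "q \<in> {..<rt m z}" "E ((S ^^ p) z) ((S ^^ q) z)" "lab ((S ^^ p) z) = lab ((S ^^ q) z)"
    then show "p = q" using D(6)[OF X X] B.tower_unique[OF z z] by blast
  next
    fix p i assume p: "p \<in> {..<rt m z}" "i < kk (fst (lab ((S ^^ p) z)))"
    then obtain y where y: "y \<in> XX" "E ((S ^^ p) z) y" "lab y = (fst (lab ((S ^^ p) z)), i)" using D(7)[OF X] by blast
    have "ba m y = z" using S1[OF X y(1,2)] B.tower_base_eq(1)[OF z, of p] p(1) by simp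
    then have "y = (S ^^ po m y) z" "po m y < rt m z" using B.tower_base_props[OF y(1), of m] by simp_all
    then show "\<exists>q\<in>{..<rt m z}. E ((S ^^ p) z) ((S ^^ q) z) \<and> lab ((S ^^ q) z) = (fst (lab ((S ^^ p) z)), i)"
      using y by (intro bexI[of _ "po m y"]) auto
  qed
qed

text \<open>The extreme case in which every tower is a single column; one side of each refinement
  step ends up in this form.\<close>

lemma natural_column_system:
  "column_system M (ce M) (\<lambda>x y. ba M x = ba M y) (wo M ` Z M) length"
proof -
  have "column_labels XX (ce M) (\<lambda>x y. ba M x = ba M y) (wo M ` Z M) length"
  proof (rule column_labelsI)
    fix p assume p: "p \<in> XX"
    note b = B.tower_base_props[OF p, of M]
    show "fst (ce M p) \<in> wo M ` Z M \<and> snd (ce M p) < length (fst (ce M p))"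
      using b by (simp add: tower_cell_def)
    fix q assume q: "q \<in> XX" "ba M p = ba M q" "ce M p = ce M q"
    then show "p = q" using b B.tower_base_props[OF q(1), of M] by (simp add: tower_cell_def)
  next
    fix p i assume p: "p \<in> XX" "i < length (fst (ce M p))"
    note b = B.tower_base_props[OF p(1), of M]
    have i: "i < rt M (ba M p)" using p(2) by (simp add: tower_cell_def)
    show "\<exists>q\<in>XX. ba M p = ba M q \<and> ce M q = (fst (ce M p), i)"
      using B.tower_base_eq[OF b(1) i] Sn_in[OF B.Z_sub[OF b(1)], of i]
      by (intro bexI[of _ "(S ^^ i) (ba M p)"]) (simp_all add: tower_cell_def)
  qed (simp_all add: tower_cell_def)
  moreover have "\<exists>x\<in>XX. ce M x = (c, 0)" if c: "c \<in> wo M ` Z M" for c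
  proof -
    obtain z where z: "z \<in> Z M" "c = wo M z" using c by blast
    then show ?thesis using B.Z_sub[OF z(1)] B.tower_base_Z[OF z(1)] by (intro bexI[of _ z]) (simp_all add: tower_cell_def)
  qed
  ultimately show ?thesis
    unfolding column_system_def using B.finite_words[of "k M" M] by (auto simp: B.tower_base_eq cell_const_def tower_word_eq)
qed

lemma ts_bottom_ind:
  assumes "z \<in> Z n" shows "ts n (bottom_ind lab c) z = int (card {j\<in>{..<rt n z}. lab ((S ^^ j) z) = (c, 0)})"
proof -
  have "ts n (bottom_ind lab c) z = (\<Sum>j\<in>{..<rt n z}. if lab ((S ^^ j) z) = (c, 0) then 1 else 0)"
    by (simp add: tower_sum_def bottom_ind_def)
  also have "\<dots> = (\<Sum>j\<in>{j\<in>{..<rt n z}. lab ((S ^^ j) z) = (c, 0)}. 1)"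
    by (rule sum.inter_filter[symmetric]) simp
  finally show ?thesis by simp
qed

lemma loc_const_bottom_ind: "loc_const X lab \<Longrightarrow> loc_const X (bottom_ind lab c)"
  using loc_const_comp[of X lab "\<lambda>l. if l = (c, 0) then 1 else 0"] by (simp add: bottom_ind_def[abs_def])

lemma ts_natural:
  assumes "z \<in> Z M" shows "ts M (bottom_ind (ce M) w) z = (if wo M z = w then 1 else 0)"
proof -
  have "ts M (bottom_ind (ce M) w) z = (\<Sum>j<rt M z. if j = 0 then (if wo M z = w then 1 else 0) else 0)"
    unfolding tower_sum_def by (intro sum.cong) (auto simp: bottom_ind_def B.tower_cell_Z[OF assms])
  then show ?thesis using B.return_time_pos[OF B.Z_sub[OF assms], of M] by (simp add: sum.delta)
qed

text \<open>When the columns are whole towers, evaluation at one tower of type \<open>c\<close> is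
  already dual to the bottom indicators.\<close>

lemma natural_dual:
  "\<exists>\<phi>. \<forall>c\<in>wo M ` Z M. inv_functional (\<phi> c) \<and> (\<forall>d\<in>wo M ` Z M. \<phi> c (bottom_ind (ce M) d) = (if c = d then 1 else 0))"
proof -
  have "\<exists>\<phi>. inv_functional \<phi> \<and> (\<forall>d. \<phi> (bottom_ind (ce M) d) = (if c = d then 1 else 0))" if c: "c \<in> wo M ` Z M" for c
  proof -
    obtain z where z: "z \<in> Z M" "c = wo M z" using c by blast
    obtain \<phi> where \<phi>: "inv_functional \<phi>" "\<And>f. lv M f \<Longrightarrow> \<phi> f = ts M f z" using functional_ex[OF z(1)] by blast
    have "lv M (bottom_ind (ce M) d)" for d by (simp add: cell_const_def bottom_ind_def)
    then show ?thesis using \<phi> ts_natural[OF z(1)] z(2) by auto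
  qed
  then show ?thesis by metis
qed

end

text \<open>\<open>EV\<close> stands for the integrals against the extreme means, reduced to the
  properties that the column argument uses. The last one says that positive means force positive
  long orbit sums, uniformly in the starting point. Two systems with the same extreme means share
  one \<open>EV\<close>, which then satisfies the axioms for both maps.\<close>

locale valued_towers = tower_sequence +
  fixes EV :: "(('a \<Rightarrow> int) \<Rightarrow> real) set"
  assumes ev_add: "e \<in> EV \<Longrightarrow> loc_const X f \<Longrightarrow> loc_const X g \<Longrightarrow> e (\<lambda>x. f x + g x) = e f + e g"
    and ev_S: "e \<in> EV \<Longrightarrow> loc_const X f \<Longrightarrow> e (\<lambda>x. f (S x)) = e f"
    and ev_pos: "e \<in> EV \<Longrightarrow> clopen_in X A \<Longrightarrow> A \<noteq> {} \<Longrightarrow> 0 < e (ind A)"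
    and ev_cong: "e \<in> EV \<Longrightarrow> (\<And>x. x \<in> topspace X \<Longrightarrow> f x = g x) \<Longrightarrow> e f = e g"
    and ev_ev: "loc_const X f \<Longrightarrow> (\<And>e. e \<in> EV \<Longrightarrow> 0 < e f) \<Longrightarrow>
       \<exists>N. \<forall>n\<ge>N. \<forall>x\<in>topspace X. 0 < (\<Sum>i<n. f ((S ^^ i) x))"
begin

lemma ev_0: "e \<in> EV \<Longrightarrow> e (\<lambda>x. 0) = 0"
  using ev_add[of e "\<lambda>x. 0" "\<lambda>x. 0"] by simp

lemma ev_diff: assumes "e \<in> EV" "loc_const X f" "loc_const X g" shows "e (\<lambda>x. f x - g x) = e f - e g"
  using ev_add[OF assms(1) loc_const_diff[OF assms(2,3)] assms(3)] by simp

lemma ev_mult: assumes "e \<in> EV" "loc_const X f" shows "e (\<lambda>x. a * f x) = real_of_int a * e f"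
proof (induction a rule: int_induct[where k = 0])
  case (step1 i)
  then show ?case using ev_add[OF assms(1) loc_const_mult[OF assms(2)] assms(2)] by (simp add: distrib_right)
next
  case (step2 i)
  then show ?case using ev_diff[OF assms(1) loc_const_mult[OF assms(2)] assms(2)] by (simp add: left_diff_distrib)
qed (simp add: ev_0[OF assms(1)])

lemma ev_sum:
  assumes "e \<in> EV" "finite I" "\<And>i. i \<in> I \<Longrightarrow> loc_const X (f i)"
  shows "e (\<lambda>x. \<Sum>i\<in>I. f i x) = (\<Sum>i\<in>I. e (f i))"
  using assms(2,3)
proof (induction I rule: finite_induct)
  case (insert i I)
  then show ?case using ev_add[OF assms(1), of "f i" "\<lambda>x. \<Sum>i\<in>I. f i x"] loc_const_sum[of I X f] by simp
qed (simp add: ev_0[OF assms(1)])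

lemma ev_Sn: "e \<in> EV \<Longrightarrow> loc_const X f \<Longrightarrow> e (\<lambda>x. f ((S ^^ n) x)) = e f"
proof (induction n)
  case (Suc n)
  then show ?case using ev_S[OF Suc.prems(1) loc_const_Sn[OF Suc.prems(2), of n]] by (simp add: funpow_swap1)
qed simp

text \<open>Shifting the part of \<open>f\<close> on level \<open>j\<close> down by \<open>j\<close>
  steps does not change its mean and concentrates \<open>f\<close> on the base, where the value
  becomes the tower sum.\<close>

lemma ev_ts:
  assumes e: "e \<in> EV" and f: "loc_const X f" and g: "loc_const X g" and eq: "\<And>z. z \<in> Z N \<Longrightarrow> ts N f z = ts N g z"
  shows "e f = e g"
proof -
  obtain R where R: "\<forall>x\<in>XX. rt N x \<le> R" using B.return_time_bound by blast
  define hat where "hat f x = (if x \<in> Z N then ts N f x else 0)" for f :: "'a \<Rightarrow> int" and x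
  have lcpo: "loc_const X (po N)" using loc_const_comp[OF B.loc_const_tower_cell, of snd] by (simp add: tower_cell_def)
  have *: "e f = e (hat f)" if f: "loc_const X f" for f
  proof -
    define u where "u j x = (if po N x = j then f x else 0)" for j x
    have lcu: "loc_const X (u j)" for j
      unfolding u_def by (rule loc_const_comp2[OF lcpo f, where F = "\<lambda>p v. if p = j then v else 0"])
    have 1: "(\<Sum>j<R. u j x) = f x" if x: "x \<in> XX" for x
    proof -
      have "po N x < R" using B.tower_base_props[OF x, of N] R B.Z_sub order_less_le_trans by blast
      then show ?thesis by (simp add: u_def)
    qed
    have 2: "(\<Sum>j<R. u j ((S ^^ j) x)) = hat f x" if x: "x \<in> XX" for x
    proof (cases "x \<in> Z N")
      case True
      have uj: "u j ((S ^^ j) x) = (if j < rt N x then f ((S ^^ j) x) else 0)" for j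
      proof (cases "j < rt N x")
        case False
        have "po N ((S ^^ j) x) \<noteq> j"
        proof
          assume p: "po N ((S ^^ j) x) = j"
          note b = B.tower_base_props[OF Sn_in[OF x, of j], of N]
          have "ba N ((S ^^ j) x) = x" using b(3) p Sn_inj[OF x B.Z_sub[OF b(1)], of j] by simp
          then show False using b(2) p False by simp
        qed
        then show ?thesis using False by (simp add: u_def)
      qed (use B.tower_base_eq[OF True] in \<open>simp add: u_def\<close>)
      have "(\<Sum>j<R. u j ((S ^^ j) x)) = (\<Sum>j\<in>{j\<in>{..<R}. j < rt N x}. f ((S ^^ j) x))"
        unfolding uj by (rule sum.inter_filter[symmetric]) simp
      also have "{j\<in>{..<R}. j < rt N x} = {..<rt N x}" using R x by auto
      finally show ?thesis using True by (simp add: hat_def tower_sum_def)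
    next
      case False
      have "po N ((S ^^ j) x) \<noteq> j" for j
      proof
        assume p: "po N ((S ^^ j) x) = j"
        note b = B.tower_base_props[OF Sn_in[OF x, of j], of N]
        have "ba N ((S ^^ j) x) = x" using b(3) p Sn_inj[OF x B.Z_sub[OF b(1)], of j] by simp
        then show False using b(1) False by simp
      qed
      then show ?thesis using False by (simp add: u_def hat_def)
    qed
    have "e f = e (\<lambda>x. \<Sum>j<R. u j x)" by (rule ev_cong[OF e]) (simp only: 1)
    also have "\<dots> = (\<Sum>j<R. e (u j))" using lcu by (intro ev_sum[OF e]) auto
    also have "\<dots> = (\<Sum>j<R. e (\<lambda>x. u j ((S ^^ j) x)))" by (simp only: ev_Sn[OF e lcu])
    also have "\<dots> = e (\<lambda>x. \<Sum>j<R. u j ((S ^^ j) x))" using loc_const_Sn[OF lcu] by (intro ev_sum[OF e, symmetric]) auto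
    also have "\<dots> = e (hat f)" by (rule ev_cong[OF e 2])
    finally show ?thesis .
  qed
  have "hat f = hat g" using eq by (auto simp: hat_def)
  then show ?thesis using *[OF f] *[OF g] by simp
qed

text \<open>A tower of height at least \<open>2 * N\<close> splits into two stretches whose sums are
  positive integers. Two copies of every column type are wanted because the bottom and the top of a
  tower go into different columns, possibly of the same type.\<close>

lemma ts_ge2:
  assumes f: "loc_const X f" and pos: "\<And>e. e \<in> EV \<Longrightarrow> 0 < e f"
  shows "\<exists>N. \<forall>n\<ge>N. \<forall>z\<in>Z n. 2 \<le> ts n f z"
proof -
  obtain N where N: "\<And>n x. n \<ge> N \<Longrightarrow> x \<in> XX \<Longrightarrow> 0 < (\<Sum>i<n. f ((S ^^ i) x))"
  proof -
    have "\<exists>N. \<forall>n\<ge>N. \<forall>x\<in>XX. 0 < (\<Sum>i<n. f ((S ^^ i) x))" by (rule ev_ev[OF f]) (rule pos)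
    then show ?thesis using that by blast
  qed
  have split: "(\<Sum>j<a + m. F j) = (\<Sum>j<a. F j) + (\<Sum>j<m. F (j + a))" for a m and F :: "nat \<Rightarrow> int"
    by (induction m) (simp_all add: add.commute)
  have "2 \<le> ts n f z" if n: "n \<ge> 2 * N" and z: "z \<in> Z n" for n z
  proof -
    have r: "rt n z = N + (rt n z - N)" "rt n z - N \<ge> N" using rt_ge[OF z] n by simp_all
    have zX: "z \<in> XX" using B.Z_sub[OF z] .
    have "ts n f z = (\<Sum>i<N. f ((S ^^ i) z)) + (\<Sum>i<rt n z - N. f ((S ^^ i) ((S ^^ N) z)))"
      unfolding tower_sum_def using split[of "\<lambda>j. f ((S ^^ j) z)" N "rt n z - N"] r(1) by (simp add: Sn_add)
    then show ?thesis using N[OF _ zX, of N] N[OF r(2) Sn_in[OF zX, of N]] by simp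
  qed
  then show ?thesis by blast
qed

end

section \<open>The back-and-forth tower_refines\<close>

lemma loc_const_dep:
  assumes "finite D" "loc_const X p" "\<And>x. x \<in> topspace X \<Longrightarrow> p x \<in> D" "\<And>w. w \<in> D \<Longrightarrow> loc_const X (G w)"
  shows "loc_const X (\<lambda>x. G (p x) x)"
proof (rule loc_constI)
  show "finite (\<Union>w\<in>D. G w ` topspace X)" using assms(1,4) by (auto simp: loc_const_def)
  show "G (p x) x \<in> (\<Union>w\<in>D. G w ` topspace X)" if "x \<in> topspace X" for x using assms(3) that by auto
  fix c
  have "{x\<in>topspace X. G (p x) x = c} = (\<Union>w\<in>D. {x\<in>topspace X. p x = w} \<inter> {x\<in>topspace X. G w x = c})"
    using assms(3) by auto
  then show "clopen_in X {x\<in>topspace X. G (p x) x = c}"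
    using assms by (auto intro!: clopen_in_UN clopen_in_Int simp: loc_const_def)
qed

context tower_sequence
begin

lemma lv_ev_finite:
  assumes "finite I" "\<And>i. i \<in> I \<Longrightarrow> loc_const X (f i)" shows "\<exists>N. \<forall>n\<ge>N. \<forall>i\<in>I. lv n (f i)"
  using assms
proof (induction I rule: finite_induct)
  case (insert i I)
  then obtain N where N: "\<forall>n\<ge>N. \<forall>i\<in>I. lv n (f i)" by auto
  obtain N' where "\<forall>n\<ge>N'. lv n (f i)" using lv_ev insert.prems by blast
  then show ?case using N by (intro exI[of _ "max N N'"]) auto
qed auto

lemma ts_sum: "ts n (\<lambda>x. \<Sum>v\<in>V. a v * f v x) z = (\<Sum>v\<in>V. a v * ts n (f v) z)"
  unfolding tower_sum_def sum_distrib_left by (rule sum.swap)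

lemma ts_word_sum:
  assumes f: "lv M f" and z: "z \<in> Z M" and N: "\<And>z. z \<in> Z M \<Longrightarrow> N (wo M z) = ts M f z"
  shows "ts M f z = ts M (\<lambda>x. \<Sum>v\<in>wo M ` Z M. N v * bottom_ind (ce M) v x) z"
proof -
  have "ts M (\<lambda>x. \<Sum>v\<in>wo M ` Z M. N v * bottom_ind (ce M) v x) z = (\<Sum>v\<in>wo M ` Z M. if v = wo M z then N v else 0)"
    unfolding ts_sum ts_natural[OF z] by (intro sum.cong) auto
  also have "\<dots> = N (wo M z)" using B.finite_words[of "k M" M] z by (simp add: sum.delta)
  finally show ?thesis using N[OF z] by simp
qed

lemma inv_S: assumes "x \<in> XX" shows "inv_into XX S x \<in> XX" "S (inv_into XX S x) = x" "inv_into XX S (S x) = x"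
  using S_bij assms by (simp_all add: bij_betw_def inv_into_into f_inv_into_f)

lemma loc_const_inv: assumes "loc_const X h" shows "loc_const X (\<lambda>z. h (inv_into XX S z))"
proof (rule loc_constI)
  show "finite (h ` XX)" using assms by (simp add: loc_const_def)
  show "h (inv_into XX S x) \<in> h ` XX" if "x \<in> XX" for x using inv_S that by blast
  fix c
  have "{x\<in>XX. h (inv_into XX S x) = c} = S ` {x\<in>XX. h x = c}"
  proof
    show "{x\<in>XX. h (inv_into XX S x) = c} \<subseteq> S ` {x\<in>XX. h x = c}"
    proof
      fix x assume "x \<in> {x\<in>XX. h (inv_into XX S x) = c}"
      then show "x \<in> S ` {x\<in>XX. h x = c}"
        using inv_S[of x] by (intro image_eqI[of _ _ "inv_into XX S x"]) auto
    qed
    show "S ` {x\<in>XX. h x = c} \<subseteq> {x\<in>XX. h (inv_into XX S x) = c}" using inv_S S_in by auto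
  qed
  then show "clopen_in X {x\<in>XX. h (inv_into XX S x) = c}"
    using clopen_in_image[OF hom, of "{x\<in>XX. h x = c}"] assms by (simp add: loc_const_def)
qed

end

lemma (in valued_towers) ts_ge2_finite:
  assumes "finite V" "\<And>v. v \<in> V \<Longrightarrow> loc_const X (f v)" "\<And>v e. v \<in> V \<Longrightarrow> e \<in> EV \<Longrightarrow> 0 < e (f v)"
  shows "\<exists>N. \<forall>n\<ge>N. \<forall>v\<in>V. \<forall>z\<in>Z n. 2 \<le> ts n (f v) z"
  using assms
proof (induction V rule: finite_induct)
  case (insert i V)
  then obtain N where N: "\<forall>n\<ge>N. \<forall>v\<in>V. \<forall>z\<in>Z n. 2 \<le> ts n (f v) z" by auto
  obtain N' where "\<forall>n\<ge>N'. \<forall>z\<in>Z n. 2 \<le> ts n (f i) z" using ts_ge2[of "f i"] insert.prems by auto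
  then show ?case using N by (intro exI[of _ "max N N'"]) auto
qed auto

text \<open>\<open>\<xi> v\<close> is a generic perturbation \<open>\<tau> v\<close> of \<open>t v\<close> plus the correction \<open>\<Sum>c. P c v * (b c - (\<Sum>w. N c w * \<tau> w))\<close>;
  the latter makes the identities exact because \<open>P\<close> is a right inverse of \<open>N\<close>.\<close>

lemma (in valued_towers) column_counts_ex:
  fixes b :: "'c \<Rightarrow> 'a \<Rightarrow> int" and t :: "'v \<Rightarrow> 'a \<Rightarrow> int" and N :: "'c \<Rightarrow> 'v \<Rightarrow> int"
  assumes C: "finite C" and V: "finite V"
    and lcb: "\<And>c. c \<in> C \<Longrightarrow> loc_const X (b c)" and lct: "\<And>v. v \<in> V \<Longrightarrow> loc_const X (t v)"
    and NP: "\<And>c d. c \<in> C \<Longrightarrow> d \<in> C \<Longrightarrow> (\<Sum>v\<in>V. N c v * P d v) = (if c = d then 1 else 0)"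
    and \<phi>: "\<And>c. c \<in> C \<Longrightarrow> inv_functional (\<phi> c)" "\<And>c d. c \<in> C \<Longrightarrow> d \<in> C \<Longrightarrow> \<phi> c (b d) = (if c = d then 1 else 0)"
    and et: "\<And>e c. e \<in> EV \<Longrightarrow> c \<in> C \<Longrightarrow> (\<Sum>v\<in>V. real_of_int (N c v) * e (t v)) = e (b c)"
  shows "\<exists>\<xi> Q. (\<forall>v\<in>V. loc_const X (\<xi> v) \<and> inv_functional (Q v) \<and> (\<forall>w\<in>V. Q v (\<xi> w) = (if v = w then 1 else 0)) \<and>
      (\<forall>e\<in>EV. e (\<xi> v) = e (t v))) \<and> (\<forall>c\<in>C. \<forall>x. (\<Sum>v\<in>V. N c v * \<xi> v x) = b c x)"
proof -
  obtain n1 where n1: "\<forall>n\<ge>n1. \<forall>c\<in>C. lv n (b c)" using lv_ev_finite[OF C, of b] lcb by blast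
  obtain n2 where n2: "\<forall>n\<ge>n2. \<forall>v\<in>V. lv n (t v)" using lv_ev_finite[OF V, of t] lct by blast
  define n where "n = max n1 n2"
  have lvb: "lv n (b c)" if "c \<in> C" for c using n1 that by (simp add: n_def)
  have lvt: "lv n (t v)" if "v \<in> V" for v using n2 that by (simp add: n_def)
  obtain \<tau> \<psi> where F: "\<forall>w\<in>V. loc_const X (\<tau> w) \<and> inv_functional (\<psi> w) \<and> (\<forall>g. lv n g \<longrightarrow> \<psi> w g = 0) \<and>
     (\<forall>v\<in>V. \<psi> w (\<tau> v) = (if v = w then 1 else 0)) \<and>
     (\<exists>h. loc_const X h \<and> \<tau> w = (\<lambda>x. t w x + (h x - h (S x))))"
    using independent_perturbations[OF V, of n t] lvt by blast
  have lc\<tau>: "loc_const X (\<tau> v)" and I\<psi>: "inv_functional (\<psi> v)" if "v \<in> V" for v using F that by blast+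
  have \<psi>\<tau>: "\<psi> v (\<tau> u) = (if u = v then 1 else 0)" if "v \<in> V" "u \<in> V" for u v using F that by blast
  have \<psi>b: "\<psi> v (b c) = 0" if "v \<in> V" "c \<in> C" for v c using F that lvb by blast
  have e\<tau>: "e (\<tau> v) = e (t v)" if v: "v \<in> V" "e \<in> EV" for v e
  proof -
    obtain h where h: "loc_const X h" "\<tau> v = (\<lambda>x. t v x + (h x - h (S x)))" using F v(1) by blast
    have hS: "loc_const X (\<lambda>x. h (S x))" using loc_const_Sn[OF h(1), of 1] by simp
    show ?thesis
      using ev_add[OF v(2) lct[OF v(1)] loc_const_diff[OF h(1) hS]] ev_diff[OF v(2) h(1) hS] ev_S[OF v(2) h(1)] h(2)
      by simp
  qed
  define \<sigma> where "\<sigma> c x = (\<Sum>w\<in>V. N c w * \<tau> w x)" for c x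
  define \<beta> where "\<beta> c x = b c x - \<sigma> c x" for c x
  define \<xi> where "\<xi> v x = \<tau> v x + (\<Sum>c\<in>C. P c v * \<beta> c x)" for v x
  \<comment> \<open>\<open>\<eta> c\<close> is \<open>\<phi> c\<close> corrected to vanish on every
    \<open>\<tau> w\<close>, so its value at \<open>\<xi> u\<close> is \<open>P c u\<close>. As
    \<open>\<psi> v (\<xi> u)\<close> falls short of the Kronecker delta by the sum of
    \<open>P d u * N d v\<close> over \<open>d\<close>, the functional \<open>Q v\<close> adds
    exactly this sum back.\<close>
  define \<eta> where "\<eta> c f = \<phi> c f + (-1) * (\<Sum>w\<in>V. \<phi> c (\<tau> w) * \<psi> w f)" for c f
  define Q where "Q v f = \<psi> v f + 1 * (\<Sum>c\<in>C. N c v * \<eta> c f)" for v f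
  have lcN: "loc_const X (\<lambda>x. N c w * \<tau> w x)" if "w \<in> V" for c w using loc_const_mult[OF lc\<tau>[OF that]] .
  have lc\<sigma>: "loc_const X (\<sigma> c)" for c unfolding \<sigma>_def by (rule loc_const_sum[OF V]) (rule lcN)
  have lc\<beta>: "loc_const X (\<beta> c)" if "c \<in> C" for c unfolding \<beta>_def by (rule loc_const_diff[OF lcb[OF that] lc\<sigma>])
  have lcP: "loc_const X (\<lambda>x. P c v * \<beta> c x)" if "c \<in> C" for c v using loc_const_mult[OF lc\<beta>[OF that]] .
  have lcS: "loc_const X (\<lambda>x. \<Sum>c\<in>C. P c v * \<beta> c x)" for v by (rule loc_const_sum[OF C]) (rule lcP)
  have lc\<xi>: "loc_const X (\<xi> v)" if "v \<in> V" for v unfolding \<xi>_def by (rule loc_const_add[OF lc\<tau>[OF that] lcS])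
  have inv_functional\<xi>: "\<rho> (\<xi> u) = \<rho> (\<tau> u) + (\<Sum>c\<in>C. P c u * (\<rho> (b c) - (\<Sum>w\<in>V. N c w * \<rho> (\<tau> w))))"
    if \<rho>: "inv_functional \<rho>" and u: "u \<in> V" for \<rho> u
  proof -
    have 1: "\<rho> (\<sigma> c) = (\<Sum>w\<in>V. N c w * \<rho> (\<tau> w))" for c
      unfolding \<sigma>_def using inv_functional_sum[OF \<rho> V, of "\<lambda>w x. N c w * \<tau> w x"] lcN inv_functional_mult[OF \<rho> lc\<tau>] by simp
    have 2: "\<rho> (\<beta> c) = \<rho> (b c) - (\<Sum>w\<in>V. N c w * \<rho> (\<tau> w))" if "c \<in> C" for c
      unfolding \<beta>_def using inv_functional_diff[OF \<rho> lcb[OF that] lc\<sigma>] 1 by simp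
    have "\<rho> (\<lambda>x. \<Sum>c\<in>C. P c u * \<beta> c x) = (\<Sum>c\<in>C. P c u * \<rho> (\<beta> c))"
      using inv_functional_sum[OF \<rho> C, of "\<lambda>c x. P c u * \<beta> c x"] lcP inv_functional_mult[OF \<rho> lc\<beta>] by simp
    then show ?thesis unfolding \<xi>_def using inv_functional_add[OF \<rho> lc\<tau>[OF u] lcS] 2 by simp
  qed
  have I\<eta>: "inv_functional (\<eta> c)" if "c \<in> C" for c
    unfolding \<eta>_def by (rule inv_functional_comb[OF \<phi>(1)[OF that] inv_functional_sum_comb[OF V]]) (rule I\<psi>)
  have IQ: "inv_functional (Q v)" if "v \<in> V" for v
    unfolding Q_def by (rule inv_functional_comb[OF I\<psi>[OF that] inv_functional_sum_comb[OF C]]) (rule I\<eta>)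
  have \<eta>\<tau>: "\<eta> c (\<tau> u) = 0" if "c \<in> C" "u \<in> V" for c u
  proof -
    have "(\<Sum>w\<in>V. \<phi> c (\<tau> w) * \<psi> w (\<tau> u)) = (\<Sum>w\<in>V. if w = u then \<phi> c (\<tau> w) else 0)"
      using \<psi>\<tau> that(2) by (intro sum.cong) auto
    then show ?thesis unfolding \<eta>_def using V that(2) by (simp add: sum.delta)
  qed
  have \<eta>b: "\<eta> c (b d) = (if c = d then 1 else 0)" if "c \<in> C" "d \<in> C" for c d
    unfolding \<eta>_def using \<phi>(2)[OF that] \<psi>b that(2) by simp
  have \<eta>\<xi>: "\<eta> c (\<xi> u) = P c u" if c: "c \<in> C" and u: "u \<in> V" for c u
  proof -
    have "\<eta> c (\<xi> u) = (\<Sum>d\<in>C. P d u * (if c = d then 1 else 0))"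
      using inv_functional\<xi>[OF I\<eta>[OF c] u] \<eta>\<tau>[OF c] \<eta>b[OF c] u by simp
    also have "\<dots> = (\<Sum>d\<in>C. if d = c then P d u else 0)" by (intro sum.cong) auto
    finally show ?thesis using C c by (simp add: sum.delta)
  qed
  have \<psi>\<xi>: "\<psi> v (\<xi> u) = (if u = v then 1 else 0) - (\<Sum>d\<in>C. P d u * N d v)" if v: "v \<in> V" and u: "u \<in> V" for u v
  proof -
    have "(\<Sum>w\<in>V. N c w * \<psi> v (\<tau> w)) = N c v" for c
    proof -
      have "(\<Sum>w\<in>V. N c w * \<psi> v (\<tau> w)) = (\<Sum>w\<in>V. if w = v then N c w else 0)"
        using \<psi>\<tau>[OF v] by (intro sum.cong) auto
      then show ?thesis using V v by (simp add: sum.delta)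
    qed
    then have "\<psi> v (\<xi> u) = \<psi> v (\<tau> u) + (\<Sum>d\<in>C. P d u * (0 - N d v))"
      using inv_functional\<xi>[OF I\<psi>[OF v] u] \<psi>b[OF v] by simp
    then show ?thesis using \<psi>\<tau>[OF v u] by (simp add: sum_negf)
  qed
  have Q\<xi>: "Q v (\<xi> u) = (if v = u then 1 else 0)" if "v \<in> V" "u \<in> V" for u v
  proof -
    have "(\<Sum>c\<in>C. N c v * \<eta> c (\<xi> u)) = (\<Sum>c\<in>C. P c u * N c v)"
      using \<eta>\<xi> that(2) by (intro sum.cong) (auto simp: mult.commute)
    then show ?thesis unfolding Q_def using \<psi>\<xi>[OF that] by simp
  qed
  have id: "(\<Sum>v\<in>V. N c v * \<xi> v x) = b c x" if c: "c \<in> C" for c x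
  proof -
    have "(\<Sum>v\<in>V. N c v * \<xi> v x) = \<sigma> c x + (\<Sum>v\<in>V. \<Sum>d\<in>C. N c v * P d v * \<beta> d x)"
      unfolding \<xi>_def \<sigma>_def by (simp add: distrib_left sum.distrib sum_distrib_left mult.assoc)
    also have "(\<Sum>v\<in>V. \<Sum>d\<in>C. N c v * P d v * \<beta> d x) = (\<Sum>d\<in>C. (\<Sum>v\<in>V. N c v * P d v) * \<beta> d x)"
      by (subst sum.swap) (simp add: sum_distrib_right)
    also have "\<dots> = (\<Sum>d\<in>C. if d = c then \<beta> d x else 0)" using NP[OF c] by (intro sum.cong) auto
    also have "\<dots> = \<beta> c x" using C c by (simp add: sum.delta)
    finally show ?thesis by (simp add: \<beta>_def)
  qed
  have e\<xi>: "e (\<xi> v) = e (t v)" if v: "v \<in> V" and e: "e \<in> EV" for v e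
  proof -
    have 1: "e (\<beta> c) = 0" if c: "c \<in> C" for c
    proof -
      have "e (\<sigma> c) = (\<Sum>w\<in>V. real_of_int (N c w) * e (t w))"
        unfolding \<sigma>_def using ev_sum[OF e V, of "\<lambda>w x. N c w * \<tau> w x"] lcN ev_mult[OF e lc\<tau>] e\<tau>[OF _ e] by simp
      then show ?thesis unfolding \<beta>_def using ev_diff[OF e lcb[OF c] lc\<sigma>] et[OF e c] by simp
    qed
    have "e (\<lambda>x. \<Sum>c\<in>C. P c v * \<beta> c x) = 0"
      using ev_sum[OF e C, of "\<lambda>c x. P c v * \<beta> c x"] lcP ev_mult[OF e lc\<beta>] 1 by simp
    then show ?thesis unfolding \<xi>_def using ev_add[OF e lc\<tau>[OF v] lcS] e\<tau>[OF v e] by simp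
  qed
  show ?thesis using lc\<xi> IQ Q\<xi> e\<xi> id by (intro exI[of _ \<xi>] exI[of _ Q]) blast
qed

locale tower_pair = A: valued_towers X S Z k EV + B: valued_towers X T W l EV
  for X :: "'a topology" and S Z k T W l EV
begin

abbreviation "XX \<equiv> topspace X"

text \<open>Steps into \<open>Y\<close> always leave a tower and are invisible to \<open>E\<close>; both sides must realise the same label pairs there.\<close>

definition links :: "('a \<Rightarrow> 'l) \<Rightarrow> ('a \<Rightarrow> 'l) \<Rightarrow> bool" where
  "links la lb \<longleftrightarrow>
     (\<forall>x\<in>XX. S x \<in> A.Y \<longrightarrow> (\<exists>y\<in>XX. T y \<in> B.Y \<and> lb y = la x \<and> lb (T y) = la (S x))) \<and>
     (\<forall>y\<in>XX. T y \<in> B.Y \<longrightarrow> (\<exists>x\<in>XX. S x \<in> A.Y \<and> la x = lb y \<and> la (S x) = lb (T y)))"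

text \<open>The dual functionals make the span of the bottom indicators a direct summand of the
  integer-valued functions modulo vanishing tower sums, which is what lets the next step solve its
  linear equations over the integers. Equality of means then makes the solutions positive on high
  towers.\<close>

definition matching where
  "matching la EA lb EB C kk \<longleftrightarrow> (\<exists>m. A.column_system m la EA C kk) \<and> (\<exists>m. B.column_system m lb EB C kk) \<and>
     (\<exists>\<phi>. \<forall>c\<in>C. A.inv_functional (\<phi> c) \<and> (\<forall>d\<in>C. \<phi> c (bottom_ind la d) = (if c = d then 1 else 0))) \<and>
     (\<exists>\<phi>. \<forall>c\<in>C. B.inv_functional (\<phi> c) \<and> (\<forall>d\<in>C. \<phi> c (bottom_ind lb d) = (if c = d then 1 else 0))) \<and>
     (\<forall>e\<in>EV. \<forall>c\<in>C. e (bottom_ind la c) = e (bottom_ind lb c)) \<and> links la lb"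

text \<open>By the second clause, the partial map between orbits that equal labels define inside two matched columns
  persists under refinement.\<close>

definition matching_refines where
  "matching_refines la EA lb EB la' EA' lb' EB' \<longleftrightarrow>
     (\<forall>x\<in>XX. \<forall>x'\<in>XX. la' x = lb' x' \<longrightarrow> la x = lb x') \<and>
     (\<forall>x\<in>XX. \<forall>x'\<in>XX. \<forall>y\<in>XX. \<forall>y'\<in>XX. la' x = lb' x' \<longrightarrow> EA x y \<longrightarrow> EB x' y' \<longrightarrow> la y = lb y' \<longrightarrow> la' y = lb' y') \<and>
     (\<forall>x\<in>XX. \<forall>y\<in>XX. EA x y \<longrightarrow> EA' x y) \<and> (\<forall>x\<in>XX. \<forall>y\<in>XX. EB x y \<longrightarrow> EB' x y)"

end

section \<open>One half-step of the back-and-forth argument\<close>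

context tower_pair
begin

text \<open>On the \<open>A\<close> side whole towers become the new columns, and on the
  \<open>B\<close> side each sufficiently high tower is regrouped into copies of them. The old
  columns inside a tower of \<open>B\<close> are matched with the old columns inside the copies, so
  the new labels refine the old ones. The number of copies is dictated by \<open>\<xi>\<close>, and
  bottom and top are pinned by the steps into \<open>Y\<close>.\<close>

lemma back_and_forth:
  fixes C :: "bool list list set"
  assumes st: "matching la EA lb EB C kk"
  shows "\<exists>la' EA' lb' EB' (C' :: bool list list set) kk'. matching la' EA' lb' EB' C' kk' \<and> matching_refines la EA lb EB la' EA' lb' EB' \<and>
      (\<forall>x\<in>XX. \<forall>y\<in>XX. la' x = la' y \<longrightarrow> A.profile N x = A.profile N y) \<and>
      (\<forall>x\<in>XX. \<forall>y\<in>XX. A.ba N x = A.ba N y \<longrightarrow> EA' x y)"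
proof -
  obtain mA mB \<phi>A \<phi>B where sA0: "A.column_system mA la EA C kk" and sB: "B.column_system mB lb EB C kk"
    and \<phi>A: "\<And>c. c \<in> C \<Longrightarrow> A.inv_functional (\<phi>A c)" "\<And>c d. c \<in> C \<Longrightarrow> d \<in> C \<Longrightarrow> \<phi>A c (bottom_ind la d) = (if c = d then 1 else 0)"
    and \<phi>B: "\<And>c. c \<in> C \<Longrightarrow> B.inv_functional (\<phi>B c)" "\<And>c d. c \<in> C \<Longrightarrow> d \<in> C \<Longrightarrow> \<phi>B c (bottom_ind lb d) = (if c = d then 1 else 0)"
    and eq: "\<And>e c. e \<in> EV \<Longrightarrow> c \<in> C \<Longrightarrow> e (bottom_ind la c) = e (bottom_ind lb c)" and li: "links la lb"
    using st unfolding matching_def by blast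
  define M where "M = max mA N"
  have sA: "A.column_system M la EA C kk" by (rule A.column_system_mono[OF sA0]) (simp add: M_def)
  have colA: "column_labels XX la EA C kk" and lvA: "A.lv M la" and finC: "finite C"
    and SA1: "\<And>x y. x \<in> XX \<Longrightarrow> y \<in> XX \<Longrightarrow> EA x y \<Longrightarrow> A.ba M x = A.ba M y"
    and SA3: "\<And>z z' p q. z \<in> Z M \<Longrightarrow> z' \<in> Z M \<Longrightarrow> A.wo M z = A.wo M z' \<Longrightarrow> p < A.rt M z \<Longrightarrow> q < A.rt M z \<Longrightarrow>
        EA ((S ^^ p) z) ((S ^^ q) z) \<Longrightarrow> EA ((S ^^ p) z') ((S ^^ q) z')"
    using sA unfolding A.column_system_def by blast+
  have lvB0: "B.lv mB lb" and SB1: "\<And>x y. x \<in> XX \<Longrightarrow> y \<in> XX \<Longrightarrow> EB x y \<Longrightarrow> B.ba mB x = B.ba mB y"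
    using sB unfolding B.column_system_def by blast+
  have lcla: "loc_const X la" using A.B.cell_const_loc_const[OF lvA] .
  have lclb: "loc_const X lb" using B.B.cell_const_loc_const[OF lvB0] .
  define V where "V = A.wo M ` Z M"
  have finV: "finite V" unfolding V_def by (rule A.B.finite_words)
  have "\<exists>z. z \<in> Z M \<and> A.wo M z = v" if "v \<in> V" for v using that by (auto simp: V_def)
  then obtain zv where zv: "\<And>v. v \<in> V \<Longrightarrow> zv v \<in> Z M \<and> A.wo M (zv v) = v" by metis
  have zvX: "zv v \<in> XX" if "v \<in> V" for v using zv[OF that] A.B.Z_sub by blast
  have zvS: "(S ^^ j) (zv v) \<in> XX" if "v \<in> V" for v j using A.Sn_in[OF zvX[OF that]] .
  have zvr: "A.rt M (zv v) = length v" if "v \<in> V" for v using zv[OF that] A.length_tower_word by metis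
  have zvce: "A.ce M ((S ^^ j) (zv v)) = (v, j)" if "v \<in> V" "j < length v" for v j
    using A.B.tower_cell_Z[of "zv v" M j] zv[OF that(1)] zvr[OF that(1)] that(2) by simp
  have ceV: "fst (A.ce M x) \<in> V \<and> snd (A.ce M x) < length (fst (A.ce M x))" if "x \<in> XX" for x
    using A.B.tower_base_props[OF that, of M] by (simp add: V_def A.tower_cell_def)
  have laz: "la x = la ((S ^^ snd (A.ce M x)) (zv (fst (A.ce M x))))" if x: "x \<in> XX" for x
    using lvA x zvce[of "fst (A.ce M x)" "snd (A.ce M x)"] ceV[OF x] zvS unfolding A.cell_const_def by (metis prod.collapse)
  \<comment> \<open>The number of old columns of type \<open>c\<close> in a tower of
    \<open>A\<close> with word \<open>v\<close>.\<close>
  define Nn where "Nn c v = A.ts M (bottom_ind la c) (zv v)" for c v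
  define t where "t v = (bottom_ind (A.ce M) v :: 'a \<Rightarrow> int)" for v
  have lcce: "loc_const X (A.ce M)" by (rule A.B.loc_const_tower_cell)
  have lct: "loc_const X (t v)" for v unfolding t_def by (rule A.loc_const_bottom_ind[OF lcce])
  have lcbA: "loc_const X (bottom_ind la c)" and lcbB: "loc_const X (bottom_ind lb c)" for c by (rule A.loc_const_bottom_ind[OF lcla], rule A.loc_const_bottom_ind[OF lclb])
  have lvbA: "A.lv M (bottom_ind la c)" for c unfolding A.cell_const_def
  proof (intro ballI impI)
    fix x y assume "x \<in> XX" "y \<in> XX" "A.ce M x = A.ce M y"
    then have "la x = la y" using lvA unfolding A.cell_const_def by blast
    then show "bottom_ind la c x = bottom_ind la c y" by (simp only: bottom_ind_def)
  qed
  have decomp: "A.ts M (bottom_ind la c) z = A.ts M (\<lambda>x. \<Sum>v\<in>V. Nn c v * t v x) z" if z: "z \<in> Z M" for c z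
    unfolding V_def t_def
  proof (rule A.ts_word_sum[OF lvbA z])
    fix z assume z: "z \<in> Z M"
    have "A.wo M z \<in> V" using z by (simp add: V_def)
    then show "Nn c (A.wo M z) = A.ts M (bottom_ind la c) z"
      unfolding Nn_def using A.B.tower_sum_word[OF lvbA] zv z by blast
  qed
  have lcsum: "loc_const X (\<lambda>x. \<Sum>v\<in>V. Nn c v * t v x)" for c
    by (rule loc_const_sum[OF finV]) (rule A.loc_const_mult[OF lct])
  \<comment> \<open>Applying the old dual functionals to the expansion of the old bottom indicators
    in the new ones shows that \<open>P\<close> is an integral right inverse of
    \<open>Nn\<close>.\<close>
  define P where "P c v = \<phi>A c (t v)" for c v
  have NP: "(\<Sum>v\<in>V. Nn c v * P d v) = (if c = d then 1 else 0)" if c: "c \<in> C" and d: "d \<in> C" for c d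
  proof -
    have "\<phi>A d (bottom_ind la c) = \<phi>A d (\<lambda>x. \<Sum>v\<in>V. Nn c v * t v x)"
      by (rule A.inv_functional_cong_ts[OF \<phi>A(1)[OF d] lcbA lcsum decomp])
    also have "\<dots> = (\<Sum>v\<in>V. \<phi>A d (\<lambda>x. Nn c v * t v x))"
      by (rule A.inv_functional_sum[OF \<phi>A(1)[OF d] finV]) (rule A.loc_const_mult[OF lct])
    also have "\<dots> = (\<Sum>v\<in>V. Nn c v * P d v)" by (simp only: A.inv_functional_mult[OF \<phi>A(1)[OF d] lct] P_def)
    finally show ?thesis using \<phi>A(2)[OF d c] by auto
  qed
  have et: "(\<Sum>v\<in>V. real_of_int (Nn c v) * e (t v)) = e (bottom_ind lb c)" if e: "e \<in> EV" and c: "c \<in> C" for e c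
  proof -
    have "e (bottom_ind la c) = e (\<lambda>x. \<Sum>v\<in>V. Nn c v * t v x)" by (rule A.ev_ts[OF e lcbA lcsum decomp])
    also have "\<dots> = (\<Sum>v\<in>V. e (\<lambda>x. Nn c v * t v x))"
      by (rule A.ev_sum[OF e finV]) (rule A.loc_const_mult[OF lct])
    also have "\<dots> = (\<Sum>v\<in>V. real_of_int (Nn c v) * e (t v))" by (simp only: A.ev_mult[OF e lct])
    finally show ?thesis using eq[OF e c] by simp
  qed
  obtain \<xi> Q where \<xi>: "\<And>v. v \<in> V \<Longrightarrow> loc_const X (\<xi> v)" and Q: "\<And>v. v \<in> V \<Longrightarrow> B.inv_functional (Q v)"
    "\<And>v w. v \<in> V \<Longrightarrow> w \<in> V \<Longrightarrow> Q v (\<xi> w) = (if v = w then 1 else 0)"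
    and e\<xi>: "\<And>v e. v \<in> V \<Longrightarrow> e \<in> EV \<Longrightarrow> e (\<xi> v) = e (t v)"
    and id\<xi>: "\<And>c x. c \<in> C \<Longrightarrow> (\<Sum>v\<in>V. Nn c v * \<xi> v x) = bottom_ind lb c x"
  proof -
    have "\<exists>\<xi> Q. (\<forall>v\<in>V. loc_const X (\<xi> v) \<and> B.inv_functional (Q v) \<and> (\<forall>w\<in>V. Q v (\<xi> w) = (if v = w then 1 else 0)) \<and>
      (\<forall>e\<in>EV. e (\<xi> v) = e (t v))) \<and> (\<forall>c\<in>C. \<forall>x. (\<Sum>v\<in>V. Nn c v * \<xi> v x) = bottom_ind lb c x)"
      by (rule B.column_counts_ex[OF finC finV lcbB lct NP \<phi>B et])
    then show ?thesis using that by blast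
  qed
  have tpos: "0 < e (t v)" if v: "v \<in> V" and e: "e \<in> EV" for v e
  proof -
    define U where "U = {x\<in>XX. A.ce M x = (v, 0)}"
    have "clopen_in X U" unfolding U_def using lcce by (simp add: loc_const_def)
    moreover have "zv v \<in> U"
      using A.B.tower_cell_Z[of "zv v" M 0] A.B.return_time_pos[OF zvX[OF v], of M] zv[OF v] zvX[OF v] by (simp add: U_def)
    ultimately have "0 < e (ind U)" using A.ev_pos[OF e] by blast
    also have "e (ind U) = e (t v)" by (rule A.ev_cong[OF e]) (simp add: U_def t_def bottom_ind_def)
    finally show ?thesis .
  qed
  have \<xi>pos: "0 < e (\<xi> v)" if "v \<in> V" "e \<in> EV" for v e using tpos[OF that] e\<xi>[OF that] by simp

  define op where "op x = (lb x, lb (T x))" for x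
  have lcop: "loc_const X op" unfolding op_def using loc_const_Pair[OF lclb B.loc_const_Sn[OF lclb, of 1]] by simp
  \<comment> \<open>\<open>Om w\<close> lists the new label pairs found on the \<open>A\<close> side
    at steps into \<open>A.Y\<close> with old label pair \<open>w\<close>; \<open>Aw w\<close> is
    the set of steps into \<open>B.Y\<close> on the \<open>B\<close> side with that old pair.
    Because \<open>B.Y\<close> is perfect, a nonempty \<open>Aw w\<close> is infinite, and the
    elements of the finite set \<open>Om w\<close> can all be distributed over it.\<close>
  define Om where "Om w = {(A.ce M x, A.ce M (S x)) | x. x \<in> XX \<and> S x \<in> A.Y \<and> (la x, la (S x)) = w}" for w
  have finOm: "finite (Om w)" for w
  proof (rule finite_subset)
    show "Om w \<subseteq> A.ce M ` XX \<times> A.ce M ` XX" using A.S_in by (auto simp: Om_def)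
    show "finite (A.ce M ` XX \<times> A.ce M ` XX)" using lcce by (simp add: loc_const_def)
  qed
  define Aw where "Aw w = {x\<in>XX. T x \<in> B.Y \<and> op x = w}" for w
  have "\<exists>g. Aw w \<noteq> {} \<longrightarrow> loc_const X g \<and> (\<forall>x. g x \<in> Om w) \<and> g ` Aw w = Om w" for w
  proof (cases "Aw w = {}")
    case False
    then obtain x0 where x0: "x0 \<in> XX" "T x0 \<in> B.Y" "op x0 = w" by (auto simp: Aw_def)
    then obtain a where a: "a \<in> XX" "S a \<in> A.Y" "la a = lb x0" "la (S a) = lb (T x0)"
      using li unfolding links_def by blast
    then have "(A.ce M a, A.ce M (S a)) \<in> Om w" using x0(3) unfolding Om_def op_def by blast
    then have neOm: "Om w \<noteq> {}" by blast
    define Q' where "Q' = T ` {x\<in>XX. op x = w}"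
    have "clopen_in X Q'" unfolding Q'_def by (intro clopen_in_image[OF B.hom] loc_const_Collect[OF lcop, of "\<lambda>c. c = w"])
    moreover have "T x0 \<in> Q' \<inter> B.Y" using x0 by (auto simp: Q'_def)
    ultimately have "infinite (Q' \<inter> B.Y)" by (rule B.Y_perfect)
    moreover have "Q' \<inter> B.Y \<subseteq> T ` Aw w" by (auto simp: Q'_def Aw_def)
    ultimately have "infinite (Aw w)" using finite_subset finite_imageI by metis
    moreover have "Aw w \<subseteq> XX" by (auto simp: Aw_def)
    ultimately show ?thesis using A.loc_const_split[of "Aw w" "Om w"] finOm neOm by blast
  qed simp
  then obtain G where G: "\<And>w. Aw w \<noteq> {} \<Longrightarrow> loc_const X (G w) \<and> (\<forall>x. G w x \<in> Om w) \<and> G w ` Aw w = Om w" by metis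
  \<comment> \<open>\<open>undefined\<close> covers the label pairs that no step into
    \<open>B.Y\<close> carries; it keeps \<open>G' w\<close> locally constant for every
    \<open>w\<close>.\<close>
  define G' where "G' w x = (if Aw w \<noteq> {} then G w x else undefined)" for w x
  \<comment> \<open>The new labels prescribed for \<open>x\<close> and \<open>T x\<close> when the
    step from \<open>x\<close> enters the base.\<close>
  define La where "La x = G' (op x) x" for x
  have lcG': "loc_const X (G' w)" for w using G[of w] by (cases "Aw w = {}") (simp_all add: G'_def[abs_def])
  have lcLa: "loc_const X La"
    unfolding La_def
  proof (rule loc_const_dep[of "op ` XX" X op G'])
    show "finite (op ` XX)" using lcop by (simp add: loc_const_def)
  qed (use lcop lcG' in auto)
  have LaOm: "La x \<in> Om (op x)" if "Aw (op x) \<noteq> {}" for x using G[OF that] that by (simp add: La_def G'_def)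
  have LaAw: "La ` Aw w = Om w" if "Aw w \<noteq> {}" for w
  proof -
    have "La ` Aw w = G w ` Aw w" using that by (intro image_cong) (auto simp: La_def G'_def Aw_def)
    then show ?thesis using G[OF that] by simp
  qed
  \<comment> \<open>Where no label pair is on offer, the step does not enter \<open>B.Y\<close>; by
    compactness it does not enter \<open>W n\<close> either once \<open>n\<close> is large.\<close>
  define U where "U = {x\<in>XX. Aw (op x) = {}}"
  have cU: "clopen_in X U" unfolding U_def by (rule loc_const_Collect[OF lcop])
  have "T ` U \<inter> B.Y = {}"
  proof -
    have False if "x \<in> U" "T x \<in> B.Y" for x
    proof -
      have "x \<in> Aw (op x)" using that by (simp add: U_def Aw_def)
      then show False using that(1) by (simp add: U_def)
    qed
    then show ?thesis by blast
  qed
  then obtain n1 where n1: "\<forall>n\<ge>n1. T ` U \<inter> W n = {}" using B.avoid_Y[OF clopen_in_image[OF B.hom cU]] by blast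
  let ?Ti = "inv_into XX T"
  obtain n2 where n2: "\<forall>n\<ge>n2. B.lv n La" using B.lv_ev[OF lcLa] by blast
  obtain n3 where n3: "\<forall>n\<ge>n3. B.lv n (\<lambda>z. La (?Ti z))" using B.lv_ev[OF B.loc_const_inv[OF lcLa]] by blast
  obtain n4 where n4: "\<forall>n\<ge>n4. \<forall>v\<in>V. B.lv n (\<xi> v)" using B.lv_ev_finite[OF finV, of \<xi>] \<xi> by blast
  obtain n5 where n5: "\<forall>n\<ge>n5. \<forall>v\<in>V. \<forall>z\<in>W n. 2 \<le> B.ts n (\<xi> v) z"
    using B.ts_ge2_finite[OF finV, of \<xi>] \<xi> \<xi>pos by blast
  obtain R where R: "\<forall>x\<in>XX. B.rt mB x \<le> R" using B.B.return_time_bound by blast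
  \<comment> \<open>The bound \<open>Suc (Suc R)\<close> makes the towers higher than those over
    \<open>W mB\<close>, so that bottom and top of a tower never share an old column; the other
    bounds make all functions in play constant on cells and provide two columns of every
    type.\<close>
  define M' where "M' = Max {mB, n1, n2, n3, n4, n5, Suc (Suc R)}"
  have M': "mB \<le> M'" "n1 \<le> M'" "n2 \<le> M'" "n3 \<le> M'" "n4 \<le> M'" "n5 \<le> M'" "Suc (Suc R) \<le> M'"
    unfolding M'_def by (rule Max_ge, simp, blast)+
  have sB': "B.column_system M' lb EB C kk" by (rule B.column_system_mono[OF sB M'(1)])
  have lvB: "B.lv M' lb" and SBM: "\<And>x y. x \<in> XX \<Longrightarrow> y \<in> XX \<Longrightarrow> EB x y \<Longrightarrow> B.ba M' x = B.ba M' y"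
    and SB3: "\<And>z z' p q. z \<in> W M' \<Longrightarrow> z' \<in> W M' \<Longrightarrow> B.wo M' z = B.wo M' z' \<Longrightarrow> p < B.rt M' z \<Longrightarrow> q < B.rt M' z \<Longrightarrow>
        EB ((T ^^ p) z) ((T ^^ q) z) \<Longrightarrow> EB ((T ^^ p) z') ((T ^^ q) z')"
    using sB' unfolding B.column_system_def by blast+
  have lvLa: "B.lv M' La" and lvLaT: "B.lv M' (\<lambda>z. La (?Ti z))"
    and lv\<xi>: "\<And>v. v \<in> V \<Longrightarrow> B.lv M' (\<xi> v)" and ts2: "\<And>v z. v \<in> V \<Longrightarrow> z \<in> W M' \<Longrightarrow> 2 \<le> B.ts M' (\<xi> v) z"
    and UW: "T ` U \<inter> W M' = {}"
    using n1 n2 n3 n4 n5 M' by blast+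
  have link: "\<exists>a\<in>XX. S a \<in> A.Y \<and> la a = lb x \<and> la (S a) = lb (T x) \<and> La x = (A.ce M a, A.ce M (S a))"
    if x: "x \<in> XX" "T x \<in> W M'" for x
  proof -
    have "x \<notin> U" using UW x(2) by blast
    then have "La x \<in> Om (op x)" using LaOm x(1) by (simp add: U_def)
    then show ?thesis unfolding Om_def op_def by auto
  qed
  have "\<exists>z. z \<in> W M' \<and> B.wo M' z = u" if "u \<in> B.wo M' ` W M'" for u using that by auto
  then obtain \<rho> where \<rho>: "\<And>u. u \<in> B.wo M' ` W M' \<Longrightarrow> \<rho> u \<in> W M' \<and> B.wo M' (\<rho> u) = u" by metis
  define nn where "nn u v = nat (B.ts M' (\<xi> v) (\<rho> u))" for u v
  \<comment> \<open>The model of a tower of \<open>B\<close> with word \<open>u\<close>: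
    \<open>nn u v\<close> disjoint copies of the tower of \<open>A\<close> with word
    \<open>v\<close>, a point being given by word, copy and level. \<open>F\<close> transports the
    relation of old columns to the copies.\<close>
  define Qs where "Qs u = (SIGMA v:V. {..<nn u v} \<times> {..<length v})" for u
  define lq where "lq q = la ((S ^^ snd (snd q)) (zv (fst q)))" for q :: "bool list list \<times> nat \<times> nat"
  define F where "F q q' \<longleftrightarrow> fst q = fst q' \<and> fst (snd q) = fst (snd q') \<and>
      EA ((S ^^ snd (snd q)) (zv (fst q))) ((S ^^ snd (snd q')) (zv (fst q)))"
    for q q' :: "bool list list \<times> nat \<times> nat"
  have colz: "column_labels {..<length v} (\<lambda>j. la ((S ^^ j) (zv v))) (\<lambda>i j. EA ((S ^^ i) (zv v)) ((S ^^ j) (zv v))) C kk"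
    if v: "v \<in> V" for v
    using A.column_system_labels[OF sA conjunct1[OF zv[OF v]]] zvr[OF v] by simp
  have colQ: "column_labels (Qs u) lq F C kk" for u
  proof (rule column_labelsI)
    fix q assume q: "q \<in> Qs u"
    obtain v i j where qq: "q = (v, i, j)" by (cases q)
    have v: "v \<in> V" and i: "i < nn u v" and j: "j \<in> {..<length v}" using q qq by (auto simp: Qs_def)
    note D = column_labelsD[OF colz[OF v]]
    show "F q q" using D(1)[OF j] by (simp add: F_def qq)
    show "fst (lq q) \<in> C \<and> snd (lq q) < kk (fst (lq q))" using D(4)[OF j] by (simp add: lq_def qq)
    show "\<exists>q'\<in>Qs u. F q q' \<and> lq q' = (fst (lq q), i')" if "i' < kk (fst (lq q))" for i'
    proof -
      have "\<exists>j'\<in>{..<length v}. EA ((S ^^ j) (zv v)) ((S ^^ j') (zv v)) \<and>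
          la ((S ^^ j') (zv v)) = (fst (la ((S ^^ j) (zv v))), i')"
        using D(7)[OF j, of i'] that by (simp add: lq_def qq)
      then obtain j' where "j' < length v" "EA ((S ^^ j) (zv v)) ((S ^^ j') (zv v))"
        "la ((S ^^ j') (zv v)) = (fst (la ((S ^^ j) (zv v))), i')" by auto
      then show ?thesis using v i by (intro bexI[of _ "(v, i, j')"]) (simp_all add: Qs_def F_def lq_def qq)
    qed
    fix q' assume q': "q' \<in> Qs u" "F q q'"
    obtain j' where qq': "q' = (v, i, j')" using q'(2) qq by (cases q') (auto simp: F_def)
    have j': "j' \<in> {..<length v}" using q'(1) qq' by (auto simp: Qs_def)
    have E: "EA ((S ^^ j) (zv v)) ((S ^^ j') (zv v))" using q'(2) qq qq' by (simp add: F_def)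
    show "F q' q" using D(2)[OF j j' E] by (simp add: F_def qq qq')
    show "fst (lq q) = fst (lq q')" using D(5)[OF j j' E] by (simp add: lq_def qq qq')
    show "q = q'" if "lq q = lq q'" using D(6)[OF j j' E] that by (simp add: lq_def qq qq')
    show "F q r" if r: "r \<in> Qs u" "F q' r" for r
    proof -
      obtain j'' where rr: "r = (v, i, j'')" using r(2) qq' by (cases r) (auto simp: F_def)
      have j'': "j'' \<in> {..<length v}" using r(1) rr by (auto simp: Qs_def)
      have "EA ((S ^^ j') (zv v)) ((S ^^ j'') (zv v))" using r(2) qq' rr by (simp add: F_def)
      then show ?thesis using D(3)[OF j j' j'' E] by (simp add: F_def qq rr)
    qed
  qed
  have finQ: "finite (Qs u)" for u unfolding Qs_def using finV by (intro finite_SigmaI) auto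
  have nn2: "2 \<le> nn u v" if "u \<in> B.wo M' ` W M'" "v \<in> V" for u v
    using ts2[OF that(2), of "\<rho> u"] \<rho>[OF that(1)] by (simp add: nn_def)
  have \<Theta>ex: "\<exists>\<Theta>. bij_betw \<Theta> {..<length u} (Qs u) \<and> (\<forall>p\<in>{..<length u}. lq (\<Theta> p) = lb ((T ^^ p) (\<rho> u))) \<and>
      (\<forall>p\<in>{..<length u}. \<forall>p'\<in>{..<length u}. EB ((T ^^ p) (\<rho> u)) ((T ^^ p') (\<rho> u)) \<longleftrightarrow> F (\<Theta> p) (\<Theta> p')) \<and>
      (fst (\<Theta> 0), snd (snd (\<Theta> 0))) = snd (La (?Ti (\<rho> u))) \<and>
      (fst (\<Theta> (length u - 1)), snd (snd (\<Theta> (length u - 1)))) = fst (La ((T ^^ (length u - 1)) (\<rho> u)))"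
    if u: "u \<in> B.wo M' ` W M'" for u
  proof -
    define r where "r = \<rho> u"
    have rW: "r \<in> W M'" and ru: "B.wo M' r = u" using \<rho>[OF u] by (simp_all add: r_def)
    have rX: "r \<in> XX" using B.B.Z_sub[OF rW] .
    have len: "B.rt M' r = length u" using ru B.length_tower_word by metis
    have big: "Suc (Suc R) \<le> length u" using B.rt_ge[OF rW] M'(7) len by simp
    have colP: "column_labels {..<length u} (\<lambda>p. lb ((T ^^ p) r)) (\<lambda>p q. EB ((T ^^ p) r) ((T ^^ q) r)) C kk"
      using B.column_system_labels[OF sB' rW] len by simp
    \<comment> \<open>Here the exact identity for \<open>\<xi>\<close> is needed: summed along the
      tower, it equates the number of old columns of each type with the number in the model.\<close>
    have card: "card {p\<in>{..<length u}. lb ((T ^^ p) r) = (c, 0)} = card {q\<in>Qs u. lq q = (c, 0)}" if c: "c \<in> C" for c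
    proof -
      have "int (card {p\<in>{..<length u}. lb ((T ^^ p) r) = (c, 0)}) = B.ts M' (bottom_ind lb c) r"
        using B.ts_bottom_ind[OF rW, of lb c] unfolding len by (rule sym)
      also have "\<dots> = B.ts M' (\<lambda>x. \<Sum>v\<in>V. Nn c v * \<xi> v x) r" using id\<xi>[OF c] by (simp add: B.tower_sum_def)
      also have "\<dots> = (\<Sum>v\<in>V. Nn c v * B.ts M' (\<xi> v) r)" by (rule B.ts_sum)
      also have "\<dots> = (\<Sum>v\<in>V. int (nn u v * card {j\<in>{..<length v}. la ((S ^^ j) (zv v)) = (c, 0)}))"
      proof (rule sum.cong[OF refl])
        fix v assume v: "v \<in> V"
        have "Nn c v = int (card {j\<in>{..<length v}. la ((S ^^ j) (zv v)) = (c, 0)})"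
          unfolding Nn_def using A.ts_bottom_ind[OF conjunct1[OF zv[OF v]]] zvr[OF v] by simp
        moreover have "B.ts M' (\<xi> v) r = int (nn u v)" using ts2[OF v rW] by (simp add: nn_def r_def)
        ultimately show "Nn c v * B.ts M' (\<xi> v) r = int (nn u v * card {j\<in>{..<length v}. la ((S ^^ j) (zv v)) = (c, 0)})"
          by simp
      qed
      also have "\<dots> = int (card (SIGMA v:V. {..<nn u v} \<times> {j\<in>{..<length v}. la ((S ^^ j) (zv v)) = (c, 0)}))"
        using finV by (simp add: card_SigmaI)
      also have "(SIGMA v:V. {..<nn u v} \<times> {j\<in>{..<length v}. la ((S ^^ j) (zv v)) = (c, 0)}) = {q\<in>Qs u. lq q = (c, 0)}"
        by (auto simp: Qs_def lq_def)
      finally show ?thesis by simp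
    qed
    have TiX: "?Ti r \<in> XX" "T (?Ti r) = r" using B.inv_S[OF rX] by simp_all
    obtain a where a: "a \<in> XX" "S a \<in> A.Y" "la (S a) = lb r" "La (?Ti r) = (A.ce M a, A.ce M (S a))"
      using link[OF TiX(1)] TiX(2) rW by auto
    define v0 where "v0 = fst (A.ce M (S a))"
    have SaZ: "S a \<in> Z M" using a(2) A.Y_sub by blast
    have SaX: "S a \<in> XX" using A.S_in[OF a(1)] .
    have ceSa: "A.ce M (S a) = (v0, 0)" using A.B.tower_base_Z[OF SaZ] by (simp add: v0_def A.tower_cell_def)
    have v0: "v0 \<in> V" "0 < length v0" using ceV[OF SaX] ceSa by auto
    define q0 where "q0 = (v0, 0::nat, 0::nat)"
    have q0: "q0 \<in> Qs u" using v0 nn2[OF u v0(1)] by (simp add: q0_def Qs_def)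
    have lq0: "lb ((T ^^ 0) r) = lq q0" using laz[OF SaX] ceSa a(3) by (simp add: lq_def q0_def)
    define p1 where "p1 = length u - 1"
    define xl where "xl = (T ^^ p1) r"
    have xlX: "xl \<in> XX" unfolding xl_def using B.Sn_in[OF rX] .
    have "B.rt M' r = Suc p1" using len big by (simp add: p1_def)
    then have "T xl = (T ^^ B.rt M' r) r" by (simp add: xl_def)
    then have TxlW: "T xl \<in> W M'" using B.B.return_time_in[OF rX] by simp
    obtain b where b: "b \<in> XX" "la b = lb xl" "La xl = (A.ce M b, A.ce M (S b))" using link[OF xlX TxlW] by auto
    define v1 where "v1 = fst (A.ce M b)"
    define j1 where "j1 = snd (A.ce M b)"
    have v1: "v1 \<in> V" "j1 < length v1" using ceV[OF b(1)] by (simp_all add: v1_def j1_def)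
    \<comment> \<open>Copy 1, while \<open>q0\<close> uses copy 0: the two points lie in different
      columns even if \<open>v1 = v0\<close>.\<close>
    define q1 where "q1 = (v1, 1::nat, j1)"
    have q1: "q1 \<in> Qs u" using v1 nn2[OF u v1(1)] by (simp add: q1_def Qs_def)
    have lq1: "lb ((T ^^ p1) r) = lq q1" using laz[OF b(1)] b(2) by (simp add: lq_def q1_def v1_def j1_def xl_def)
    have nE: "\<not> EB ((T ^^ 0) r) ((T ^^ p1) r)"
    proof
      assume "EB ((T ^^ 0) r) ((T ^^ p1) r)"
      then have "B.ba mB r = B.ba mB xl" using SB1[OF rX xlX] by (simp add: xl_def)
      moreover have "B.ba mB r = r" using B.B.tower_base_Z[of r mB] rW B.Z_mono[OF M'(1)] by blast
      ultimately have xr: "xl = (T ^^ B.po mB xl) r" "B.po mB xl < B.rt mB r"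
        using B.B.tower_base_props[OF xlX, of mB] by simp_all
      have "B.po mB xl < B.rt M' r" using xr(2) R rX big len by (metis Suc_leD le_less_trans less_le_trans lessI order_less_imp_le not_le)
      moreover have "p1 < B.rt M' r" using len big by (simp add: p1_def)
      ultimately have "B.po mB xl = p1" using B.B.tower_unique[OF rW rW] xr(1) unfolding xl_def by metis
      then have "p1 < R" using xr(2) R rX by (metis less_le_trans)
      then show False using big by (simp add: p1_def)
    qed
    have nF: "\<not> F q0 q1" by (simp add: F_def q0_def q1_def)
    have "0 < length u" using big by linarith
    then have p01: "0 \<in> {..<length u}" "p1 \<in> {..<length u}" unfolding p1_def lessThan_iff by linarith+
    from column_bijection_ex[OF colP _ colQ finQ card p01 nE q0 q1 nF lq0 lq1]
    obtain \<Theta> where \<Theta>: "bij_betw \<Theta> {..<length u} (Qs u)" "\<forall>p\<in>{..<length u}. lq (\<Theta> p) = lb ((T ^^ p) r)"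
      "\<forall>p\<in>{..<length u}. \<forall>p'\<in>{..<length u}. EB ((T ^^ p) r) ((T ^^ p') r) \<longleftrightarrow> F (\<Theta> p) (\<Theta> p')"
      "\<Theta> 0 = q0" "\<Theta> p1 = q1" by auto
    have "(fst (\<Theta> 0), snd (snd (\<Theta> 0))) = snd (La (?Ti r))" using \<Theta>(4) a(4) ceSa by (simp add: q0_def)
    moreover have "(fst (\<Theta> p1), snd (snd (\<Theta> p1))) = fst (La ((T ^^ p1) r))"
      using \<Theta>(5) b(3) by (simp add: q1_def v1_def j1_def xl_def)
    ultimately show ?thesis using \<Theta>(1-3) unfolding r_def p1_def by blast
  qed
  define Us where "Us = B.wo M' ` W M'"
  have "\<forall>u\<in>Us. \<exists>\<Theta>. bij_betw \<Theta> {..<length u} (Qs u) \<and> (\<forall>p\<in>{..<length u}. lq (\<Theta> p) = lb ((T ^^ p) (\<rho> u))) \<and>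
      (\<forall>p\<in>{..<length u}. \<forall>p'\<in>{..<length u}. EB ((T ^^ p) (\<rho> u)) ((T ^^ p') (\<rho> u)) \<longleftrightarrow> F (\<Theta> p) (\<Theta> p')) \<and>
      (fst (\<Theta> 0), snd (snd (\<Theta> 0))) = snd (La (?Ti (\<rho> u))) \<and>
      (fst (\<Theta> (length u - 1)), snd (snd (\<Theta> (length u - 1)))) = fst (La ((T ^^ (length u - 1)) (\<rho> u)))"
    unfolding Us_def by (intro ballI \<Theta>ex)
  from bchoice[OF this] obtain \<Theta> where \<Theta>all: "\<forall>u\<in>Us. bij_betw (\<Theta> u) {..<length u} (Qs u) \<and>
      (\<forall>p\<in>{..<length u}. lq (\<Theta> u p) = lb ((T ^^ p) (\<rho> u))) \<and>
      (\<forall>p\<in>{..<length u}. \<forall>p'\<in>{..<length u}. EB ((T ^^ p) (\<rho> u)) ((T ^^ p') (\<rho> u)) \<longleftrightarrow> F (\<Theta> u p) (\<Theta> u p')) \<and>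
      (fst (\<Theta> u 0), snd (snd (\<Theta> u 0))) = snd (La (?Ti (\<rho> u))) \<and>
      (fst (\<Theta> u (length u - 1)), snd (snd (\<Theta> u (length u - 1)))) = fst (La ((T ^^ (length u - 1)) (\<rho> u)))"
    by (rule exE)
  have \<Theta>: "bij_betw (\<Theta> u) {..<length u} (Qs u)"
    and \<Theta>0: "(fst (\<Theta> u 0), snd (snd (\<Theta> u 0))) = snd (La (?Ti (\<rho> u)))"
    and \<Theta>1: "(fst (\<Theta> u (length u - 1)), snd (snd (\<Theta> u (length u - 1)))) = fst (La ((T ^^ (length u - 1)) (\<rho> u)))"
    if "u \<in> Us" for u using bspec[OF \<Theta>all that] by simp_all
  have \<Theta>l: "lq (\<Theta> u p) = lb ((T ^^ p) (\<rho> u))" if "u \<in> Us" "p < length u" for u p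
    using bspec[OF \<Theta>all that(1)] that(2) by simp
  have \<Theta>F: "EB ((T ^^ p) (\<rho> u)) ((T ^^ p') (\<rho> u)) \<longleftrightarrow> F (\<Theta> u p) (\<Theta> u p')"
    if "u \<in> Us" "p < length u" "p' < length u" for u p p'
    using bspec[OF \<Theta>all that(1)] that(2,3) by simp
  have \<rho>W: "\<rho> u \<in> W M'" and \<rho>u: "B.wo M' (\<rho> u) = u" if "u \<in> Us" for u
    using \<rho>[of u] that by (simp_all add: Us_def)
  have lenV: "0 < length v" if "v \<in> V" for v
    using zvr[OF that] A.B.return_time_pos[OF zvX[OF that], of M] by simp

  \<comment> \<open>The place of \<open>x\<close> in the model of its tower. Forgetting the copy
    gives the new label; word and copy together give the new column.\<close>
  define TH where "TH x = \<Theta> (fst (B.ce M' x)) (snd (B.ce M' x))" for x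
  define lb' where "lb' x = (fst (TH x), snd (snd (TH x)))" for x
  define EB' where "EB' x y \<longleftrightarrow> B.ba M' x = B.ba M' y \<and> fst (TH x) = fst (TH y) \<and> fst (snd (TH x)) = fst (snd (TH y))" for x y
  define EA' where "EA' x y \<longleftrightarrow> A.ba M x = A.ba M y" for x y
  have B_lvD: "f x = f y" if "B.lv M' f" "x \<in> XX" "y \<in> XX" "B.ce M' x = B.ce M' y" for f :: "'a \<Rightarrow> 'z" and x y
    using that unfolding B.cell_const_def by blast
  have tower_base: "B.ba M' x \<in> W M'" "B.wo M' (B.ba M' x) \<in> Us" "B.po M' x < length (B.wo M' (B.ba M' x))"
    "x = (T ^^ B.po M' x) (B.ba M' x)" "B.ce M' x = (B.wo M' (B.ba M' x), B.po M' x)"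
    "TH x = \<Theta> (B.wo M' (B.ba M' x)) (B.po M' x)" if "x \<in> XX" for x
    using B.B.tower_base_props[OF that, of M'] by (simp_all add: Us_def B.tower_cell_def TH_def)
  have TH_col: "TH ((T ^^ p) z) = \<Theta> (B.wo M' z) p" "B.ba M' ((T ^^ p) z) = z" if "z \<in> W M'" "p < B.rt M' z" for z p
    using B.B.tower_base_eq[OF that] by (simp_all add: TH_def B.tower_cell_def)
  have ce\<rho>: "B.ce M' ((T ^^ p) (\<rho> u)) = (u, p)" if "u \<in> Us" "p < length u" for u p
  proof -
    have "p < B.rt M' (\<rho> u)" using that \<rho>u[OF that(1)] B.length_tower_word by metis
    then show ?thesis using B.B.tower_base_eq[OF \<rho>W[OF that(1)], of p] \<rho>u[OF that(1)] by (simp add: B.tower_cell_def)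
  qed
  have \<rho>X: "(T ^^ p) (\<rho> u) \<in> XX" if "u \<in> Us" for u p using B.Sn_in[OF B.B.Z_sub[OF \<rho>W[OF that]]] .
  have THQ: "TH x \<in> Qs (B.wo M' (B.ba M' x))" if x: "x \<in> XX" for x
    using bij_betwE[OF \<Theta>[OF tower_base(2)[OF x]]] tower_base(3,6)[OF x] by simp
  have THV: "fst (TH x) \<in> V" "snd (snd (TH x)) < length (fst (TH x))" if x: "x \<in> XX" for x
    using THQ[OF x] by (auto simp: Qs_def)
  have K: "lb x = lq (TH x)" if x: "x \<in> XX" for x
  proof -
    have "lb x = lb ((T ^^ B.po M' x) (\<rho> (B.wo M' (B.ba M' x))))"
      by (rule B_lvD[OF lvB x \<rho>X[OF tower_base(2)[OF x]]]) (simp only: ce\<rho>[OF tower_base(2,3)[OF x]] tower_base(5)[OF x])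
    then show ?thesis using \<Theta>l[OF tower_base(2,3)[OF x]] tower_base(6)[OF x] by simp
  qed
  have K2: "F (TH x) (TH y)" if x: "x \<in> XX" and y: "y \<in> XX" and E: "EB x y" for x y
  proof -
    have b: "B.ba M' x = B.ba M' y" by (rule SBM[OF x y E])
    define z where "z = B.ba M' x"
    define u where "u = B.wo M' z"
    have z: "z \<in> W M'" "u \<in> Us" "x = (T ^^ B.po M' x) z" "y = (T ^^ B.po M' y) z"
      using tower_base[OF x] tower_base[OF y] b by (simp_all add: z_def u_def)
    have p: "B.po M' x < length u" "B.po M' y < length u" "length u = B.rt M' z"
      using tower_base(3)[OF x] tower_base(3)[OF y] b by (simp_all add: z_def u_def)
    have "EB ((T ^^ B.po M' x) z) ((T ^^ B.po M' y) z)" using E z(3,4) by simp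
    then have "EB ((T ^^ B.po M' x) (\<rho> u)) ((T ^^ B.po M' y) (\<rho> u))"
      using SB3[OF z(1) \<rho>W[OF z(2)], of "B.po M' x" "B.po M' y"] \<rho>u[OF z(2)] p u_def by simp
    then have "F (\<Theta> u (B.po M' x)) (\<Theta> u (B.po M' y))" using \<Theta>F[OF z(2) p(1,2)] by simp
    then show ?thesis using tower_base(6)[OF x] tower_base(6)[OF y] b by (simp add: u_def z_def)
  qed

  have colB: "column_labels XX lb' EB' V length"
  proof (rule column_labelsI)
    fix x assume x: "x \<in> XX"
    show "fst (lb' x) \<in> V \<and> snd (lb' x) < length (fst (lb' x))" using THV[OF x] by (simp add: lb'_def)
    show "x = y" if y: "y \<in> XX" and E: "EB' x y" and l: "lb' x = lb' y" for y
    proof -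
      have b: "B.ba M' x = B.ba M' y" using E by (simp add: EB'_def)
      have "TH x = TH y" using E l by (simp add: EB'_def lb'_def prod_eq_iff)
      then have "\<Theta> (B.wo M' (B.ba M' x)) (B.po M' x) = \<Theta> (B.wo M' (B.ba M' x)) (B.po M' y)"
        using tower_base(6)[OF x] tower_base(6)[OF y] b by simp
      then have "B.po M' x = B.po M' y"
        using bij_betw_imp_inj_on[OF \<Theta>[OF tower_base(2)[OF x]]] tower_base(3)[OF x] tower_base(3)[OF y] b by (simp add: inj_on_def)
      then show ?thesis using tower_base(4)[OF x] tower_base(4)[OF y] b by simp
    qed
    fix i assume i: "i < length (fst (lb' x))"
    define u where "u = B.wo M' (B.ba M' x)"
    have u: "u \<in> Us" using tower_base(2)[OF x] by (simp add: u_def)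
    have "(fst (TH x), fst (snd (TH x)), i) \<in> Qs u"
      using THQ[OF x] i by (auto simp: Qs_def lb'_def u_def)
    then obtain p where p: "p < length u" "\<Theta> u p = (fst (TH x), fst (snd (TH x)), i)"
      using bij_betw_imp_surj_on[OF \<Theta>[OF u]] by (metis imageE lessThan_iff)
    have "p < B.rt M' (B.ba M' x)" using p(1) by (simp add: u_def)
    note t = TH_col[OF tower_base(1)[OF x] this]
    show "\<exists>y\<in>XX. EB' x y \<and> lb' y = (fst (lb' x), i)"
      using t p(2) B.Sn_in[OF B.B.Z_sub[OF tower_base(1)[OF x]], of p]
      by (intro bexI[of _ "(T ^^ p) (B.ba M' x)"]) (simp_all add: EB'_def lb'_def u_def)
  qed (simp_all add: EB'_def lb'_def)

  have cardw: "card {p\<in>{..<length u}. (fst (\<Theta> u p), snd (snd (\<Theta> u p))) = (w, 0)} = nn u w"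
    if u: "u \<in> Us" and w: "w \<in> V" for u w
  proof -
    have "bij_betw (\<Theta> u) {p\<in>{..<length u}. (fst (\<Theta> u p), snd (snd (\<Theta> u p))) = (w, 0)} ((\<lambda>i. (w, i, 0::nat)) ` {..<nn u w})"
      unfolding bij_betw_def
    proof
      show "inj_on (\<Theta> u) {p \<in> {..<length u}. (fst (\<Theta> u p), snd (snd (\<Theta> u p))) = (w, 0)}"
        using bij_betw_imp_inj_on[OF \<Theta>[OF u]] by (rule inj_on_subset) blast
      show "\<Theta> u ` {p \<in> {..<length u}. (fst (\<Theta> u p), snd (snd (\<Theta> u p))) = (w, 0)} = (\<lambda>i. (w, i, 0)) ` {..<nn u w}" (is "?l = ?r")
      proof
        show "?l \<subseteq> ?r"
        proof
          fix q assume "q \<in> ?l"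
          then obtain p where p: "p < length u" "q = \<Theta> u p" "fst q = w" "snd (snd q) = 0" by auto
          have "q \<in> Qs u" using bij_betwE[OF \<Theta>[OF u]] p by simp
          then have "fst (snd q) < nn u w" using p(3) by (auto simp: Qs_def)
          moreover have "q = (w, fst (snd q), 0)" using p(3,4) by (simp add: prod_eq_iff)
          ultimately show "q \<in> ?r" by blast
        qed
        show "?r \<subseteq> ?l"
        proof
          fix q assume "q \<in> ?r"
          then obtain i where i: "i < nn u w" "q = (w, i, 0)" by auto
          have "q \<in> Qs u" using i w lenV[OF w] by (simp add: Qs_def)
          then obtain p where p: "p < length u" "\<Theta> u p = q"
            using bij_betw_imp_surj_on[OF \<Theta>[OF u]] by (metis imageE lessThan_iff)
          then show "q \<in> ?l" using i(2) by (intro image_eqI[of _ _ p]) simp_all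
        qed
      qed
    qed
    then have "card {p\<in>{..<length u}. (fst (\<Theta> u p), snd (snd (\<Theta> u p))) = (w, 0)} = card ((\<lambda>i. (w, i, 0::nat)) ` {..<nn u w})"
      by (rule bij_betw_same_card)
    also have "\<dots> = nn u w" by (subst card_image) (auto simp: inj_on_def)
    finally show ?thesis .
  qed
  \<comment> \<open>The new columns of type \<open>w\<close> in a tower are counted by the tower sum
    of \<open>\<xi> w\<close>. Hence the functionals \<open>Q\<close> are dual to the new bottom
    indicators, and the means on the two sides agree.\<close>
  have tsw: "B.ts M' (bottom_ind lb' w) z = B.ts M' (\<xi> w) z" if w: "w \<in> V" and z: "z \<in> W M'" for w z
  proof -
    define u where "u = B.wo M' z"
    have u: "u \<in> Us" using z by (simp add: Us_def u_def)
    have len: "B.rt M' z = length u" by (simp add: u_def)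
    have "{j\<in>{..<B.rt M' z}. lb' ((T ^^ j) z) = (w, 0)} = {p\<in>{..<length u}. (fst (\<Theta> u p), snd (snd (\<Theta> u p))) = (w, 0)}"
    proof (intro Collect_cong conj_cong)
      show "j \<in> {..<B.rt M' z} \<longleftrightarrow> j \<in> {..<length u}" for j by (simp only: len)
      fix j assume "j \<in> {..<length u}"
      then have "j < B.rt M' z" unfolding len by simp
      then show "lb' ((T ^^ j) z) = (w, 0) \<longleftrightarrow> (fst (\<Theta> u j), snd (snd (\<Theta> u j))) = (w, 0)"
        using TH_col(1)[OF z] by (simp add: lb'_def u_def)
    qed
    then have "B.ts M' (bottom_ind lb' w) z = int (nn u w)" using B.ts_bottom_ind[OF z, of lb' w] cardw[OF u w] by simp
    also have "\<dots> = B.ts M' (\<xi> w) (\<rho> u)" using ts2[OF w \<rho>W[OF u]] by (simp add: nn_def)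
    also have "\<dots> = B.ts M' (\<xi> w) z" using B.B.tower_sum_word[OF lv\<xi>[OF w]] z \<rho>W[OF u] \<rho>u[OF u] u_def by blast
    finally show ?thesis .
  qed
  have lvlb': "B.lv M' lb'" unfolding B.cell_const_def by (simp add: lb'_def TH_def)
  have lclb': "loc_const X lb'" by (rule B.B.cell_const_loc_const[OF lvlb'])

  have sideB: "B.column_system M' lb' EB' V length"
    unfolding B.column_system_def
  proof (intro conjI ballI impI allI)
    fix w assume w: "w \<in> V"
    obtain z where z: "z \<in> W M'" using B.neZ by blast
    define u where "u = B.wo M' z"
    have u: "u \<in> Us" using z by (simp add: u_def Us_def)
    have "0 < nn u w" using nn2[of u w] u w by (simp add: Us_def)
    then have "{p\<in>{..<length u}. (fst (\<Theta> u p), snd (snd (\<Theta> u p))) = (w, 0)} \<noteq> {}"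
      using cardw[OF u w] by (metis card.empty less_irrefl)
    then obtain p where p: "p < length u" "(fst (\<Theta> u p), snd (snd (\<Theta> u p))) = (w, 0)" by blast
    have "p < B.rt M' z" using p(1) by (simp add: u_def)
    from TH_col(1)[OF z this] show "\<exists>x\<in>XX. lb' x = (w, 0)"
      using p(2) B.Sn_in[OF B.B.Z_sub[OF z], of p] by (intro bexI[of _ "(T ^^ p) z"]) (simp_all add: lb'_def u_def)
  next
    fix z z' p q assume *: "z \<in> W M'" "z' \<in> W M'" "B.wo M' z = B.wo M' z'" "p < B.rt M' z" "q < B.rt M' z"
      "EB' ((T ^^ p) z) ((T ^^ q) z)"
    have r: "B.rt M' z' = B.rt M' z" using *(3) by (simp add: B.tower_word_eq)
    show "EB' ((T ^^ p) z') ((T ^^ q) z')"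
      using *(6) TH_col[OF *(1,4)] TH_col[OF *(1,5)] TH_col[OF *(2), of p] TH_col[OF *(2), of q] *(3,4,5) r
      by (simp add: EB'_def)
  qed (use lvlb' colB finV in \<open>simp_all add: EB'_def\<close>)
  have sideA: "A.column_system M (A.ce M) EA' V length"
    using A.natural_column_system[of M] unfolding EA'_def[abs_def] V_def .

  \<comment> \<open>\<open>La\<close> was made constant on cells, also after moving back by one
    step; therefore the pinning carried out on representatives holds for every step into the
    base.\<close>
  have linkT: "lb' (T x) = snd (La x)" "lb' x = fst (La x)" if x: "x \<in> XX" "T x \<in> W M'" for x
  proof -
    have TX: "T x \<in> XX" using B.S_in[OF x(1)] .
    define u where "u = B.wo M' (T x)"
    have u: "u \<in> Us" using x(2) by (simp add: u_def Us_def)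
    have c: "B.ce M' (T x) = (u, 0)" using B.B.tower_base_Z[OF x(2)] by (simp add: B.tower_cell_def u_def)
    have lu: "0 < length u" using B.B.return_time_pos[OF TX, of M'] by (simp add: u_def)
    have c\<rho>: "B.ce M' (\<rho> u) = (u, 0)" using ce\<rho>[OF u lu] by simp
    have \<rho>XX: "\<rho> u \<in> XX" using \<rho>X[OF u, of 0] by simp
    have "La (?Ti (T x)) = La (?Ti (\<rho> u))" by (rule B_lvD[OF lvLaT TX \<rho>XX]) (simp only: c c\<rho>)
    then have "La x = La (?Ti (\<rho> u))" using B.inv_S(3)[OF x(1)] by simp
    then show "lb' (T x) = snd (La x)" using \<Theta>0[OF u] c by (simp add: lb'_def TH_def)
    define v where "v = B.wo M' (B.ba M' x)"
    have v: "v \<in> Us" using tower_base(2)[OF x(1)] by (simp add: v_def)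
    have "Suc (B.po M' x) = length v" using B.B.tower_level_last[OF x] by (simp add: v_def)
    then have p: "B.po M' x = length v - 1" "length v - 1 < length v" by linarith+
    have c: "B.ce M' x = (v, length v - 1)" using tower_base(5)[OF x(1)] p(1) v_def by metis
    have "La x = La ((T ^^ (length v - 1)) (\<rho> v))"
      by (rule B_lvD[OF lvLa x(1) \<rho>X[OF v]]) (simp only: c ce\<rho>[OF v p(2)])
    then show "lb' x = fst (La x)" using \<Theta>1[OF v] c by (simp add: lb'_def TH_def)
  qed
  have links': "links (A.ce M) lb'"
    unfolding links_def
  proof (intro conjI ballI impI)
    fix x assume x: "x \<in> XX" "S x \<in> A.Y"
    define w where "w = (la x, la (S x))"
    have om: "(A.ce M x, A.ce M (S x)) \<in> Om w" unfolding Om_def w_def using x by blast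
    obtain y where "y \<in> XX" "T y \<in> B.Y" "lb y = la x" "lb (T y) = la (S x)" using li x unfolding links_def by blast
    then have "Aw w \<noteq> {}" by (auto simp: Aw_def op_def w_def)
    then obtain y where y: "y \<in> Aw w" "La y = (A.ce M x, A.ce M (S x))" using om LaAw by (metis imageE)
    have yX: "y \<in> XX" "T y \<in> B.Y" using y(1) by (simp_all add: Aw_def)
    moreover have "T y \<in> W M'" using yX(2) B.Y_sub by blast
    ultimately show "\<exists>y\<in>XX. T y \<in> B.Y \<and> lb' y = A.ce M x \<and> lb' (T y) = A.ce M (S x)"
      using linkT[of y] y(2) by (intro bexI[of _ y]) simp_all
  next
    fix y assume y: "y \<in> XX" "T y \<in> B.Y"
    have TW: "T y \<in> W M'" using y(2) B.Y_sub by blast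
    have "Aw (op y) \<noteq> {}" using y by (auto simp: Aw_def)
    then have "La y \<in> Om (op y)" by (rule LaOm)
    then obtain a where "a \<in> XX" "S a \<in> A.Y" "La y = (A.ce M a, A.ce M (S a))" by (auto simp: Om_def)
    then show "\<exists>x\<in>XX. S x \<in> A.Y \<and> A.ce M x = lb' y \<and> A.ce M (S x) = lb' (T y)"
      using linkT[OF y(1) TW] by (intro bexI[of _ a]) simp_all
  qed

  have dualB: "Q v (bottom_ind lb' w) = (if v = w then 1 else 0)" if v: "v \<in> V" and w: "w \<in> V" for v w
  proof -
    have "Q v (bottom_ind lb' w) = Q v (\<xi> w)"
      by (rule B.inv_functional_cong_ts[OF Q(1)[OF v] B.loc_const_bottom_ind[OF lclb'] \<xi>[OF w]]) (rule tsw[OF w])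
    then show ?thesis using Q(2)[OF v w] by simp
  qed
  have evB: "e (bottom_ind (A.ce M) v) = e (bottom_ind lb' v)" if e: "e \<in> EV" and v: "v \<in> V" for e v
  proof -
    have "e (bottom_ind lb' v) = e (\<xi> v)"
      by (rule B.ev_ts[OF e B.loc_const_bottom_ind[OF lclb'] \<xi>[OF v]]) (rule tsw[OF v])
    then show ?thesis using e\<xi>[OF v e] by (simp add: t_def)
  qed
  have "matching (A.ce M) EA' lb' EB' V length"
    unfolding matching_def
  proof (intro conjI)
    show "\<exists>m. A.column_system m (A.ce M) EA' V length" using sideA by blast
    show "\<exists>m. B.column_system m lb' EB' V length" using sideB by blast
    show "\<exists>\<phi>. \<forall>c\<in>V. A.inv_functional (\<phi> c) \<and> (\<forall>d\<in>V. \<phi> c (bottom_ind (A.ce M) d) = (if c = d then 1 else 0))"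
      unfolding V_def by (rule A.natural_dual)
    show "\<exists>\<phi>. \<forall>c\<in>V. B.inv_functional (\<phi> c) \<and> (\<forall>d\<in>V. \<phi> c (bottom_ind lb' d) = (if c = d then 1 else 0))"
      using Q(1) dualB by (intro exI[of _ Q]) blast
    show "\<forall>e\<in>EV. \<forall>c\<in>V. e (bottom_ind (A.ce M) c) = e (bottom_ind lb' c)" using evB by blast
    show "links (A.ce M) lb'" by (rule links')
  qed
  moreover have "matching_refines la EA lb EB (A.ce M) EA' lb' EB'"
    unfolding matching_refines_def
  proof (intro conjI ballI impI)
    fix x x' assume x: "x \<in> XX" "x' \<in> XX" "A.ce M x = lb' x'"
    have "fst (A.ce M x) = fst (TH x')" "snd (A.ce M x) = snd (snd (TH x'))" using x(3) by (simp_all add: lb'_def)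
    then show "la x = lb x'" using laz[OF x(1)] K[OF x(2)] by (simp add: lq_def)
  next
    fix x x' y y' assume x: "x \<in> XX" "x' \<in> XX" and y: "y \<in> XX" "y' \<in> XX" and l: "A.ce M x = lb' x'"
      and EA: "EA x y" and EB: "EB x' y'" and ll: "la y = lb y'"
    define v where "v = fst (A.ce M x)"
    define j where "j = snd (A.ce M x)"
    define j' where "j' = snd (A.ce M y)"
    define j'' where "j'' = snd (snd (TH y'))"
    have v: "v \<in> V" "j < length v" using ceV[OF x(1)] by (simp_all add: v_def j_def)
    have b: "A.ba M x = A.ba M y" by (rule SA1[OF x(1) y(1) EA])
    have cy: "fst (A.ce M y) = v" "j' < length v" using ceV[OF y(1)] b by (simp_all add: v_def j'_def A.tower_cell_def)
    have T1: "fst (TH x') = v" "snd (snd (TH x')) = j" using l by (simp_all add: lb'_def v_def j_def)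
    note F = K2[OF x(2) y(2) EB]
    have T2: "fst (TH y') = v" using F T1(1) by (simp add: F_def)
    have j'': "j'' < length v" using THV(2)[OF y(2)] T2 by (simp add: j''_def)
    have E1: "EA ((S ^^ j) (zv v)) ((S ^^ j'') (zv v))" using F unfolding F_def T1 j''_def by blast
    have E2: "EA ((S ^^ j) (zv v)) ((S ^^ j') (zv v))"
    proof (rule SA3[of "A.ba M x" "zv v" j j'])
      note bx = A.B.tower_base_props[OF x(1), of M] and by' = A.B.tower_base_props[OF y(1), of M]
      show "A.ba M x \<in> Z M" using bx by simp
      show "zv v \<in> Z M" using zv[OF v(1)] by simp
      show "A.wo M (A.ba M x) = A.wo M (zv v)" using zv[OF v(1)] by (simp add: v_def A.tower_cell_def)
      show "j < A.rt M (A.ba M x)" using bx by (simp add: j_def A.tower_cell_def)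
      show "j' < A.rt M (A.ba M x)" using by' b by (simp add: j'_def A.tower_cell_def)
      show "EA ((S ^^ j) (A.ba M x)) ((S ^^ j') (A.ba M x))"
        using EA bx(3) by'(3) b by (simp add: j_def j'_def A.tower_cell_def)
    qed
    have "la ((S ^^ j') (zv v)) = la y" using laz[OF y(1)] cy(1) by (simp add: j'_def)
    also have "\<dots> = la ((S ^^ j'') (zv v))" using ll K[OF y(2)] T2 by (simp add: lq_def j''_def)
    finally have la: "la ((S ^^ j') (zv v)) = la ((S ^^ j'') (zv v))" .
    note D = column_labelsD[OF colz[OF v(1)]]
    have J: "j \<in> {..<length v}" "j' \<in> {..<length v}" "j'' \<in> {..<length v}" using v(2) cy(2) j'' by simp_all
    have "EA ((S ^^ j') (zv v)) ((S ^^ j'') (zv v))" by (rule D(3)[OF J(2,1,3) D(2)[OF J(1,2) E2] E1])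
    \<comment> \<open>Both levels lie in one old column of the tower with word \<open>v\<close> and
      carry the same old label; within a column labels are injective.\<close>
    then have "j' = j''" using D(6)[OF J(2,3)] la by blast
    then show "A.ce M y = lb' y'" using cy(1) T2 by (simp add: lb'_def prod_eq_iff j'_def j''_def)
  next
    fix x y assume "x \<in> XX" "y \<in> XX" "EA x y"
    then show "EA' x y" using SA1 by (simp add: EA'_def)
  next
    fix x y assume xy: "x \<in> XX" "y \<in> XX" "EB x y"
    then show "EB' x y" using SBM K2[OF xy] by (simp add: EB'_def F_def)
  qed
  moreover have "A.profile N x = A.profile N y" if "x \<in> XX" "y \<in> XX" "A.ce M x = A.ce M y" for x y
  proof -
    have "N \<le> k M" using A.k_ge[of M] by (simp add: M_def)
    then show ?thesis using A.profile_mono[OF A.B.profile_tower_cell[OF that]] by blast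
  qed
  moreover have "EA' x y" if "x \<in> XX" "y \<in> XX" "A.ba N x = A.ba N y" for x y
  proof -
    have "A.column_system M (A.ce N) (\<lambda>x y. A.ba N x = A.ba N y) (A.wo N ` Z N) length"
      by (rule A.column_system_mono[OF A.natural_column_system]) (simp add: M_def)
    then show ?thesis using that unfolding A.column_system_def EA'_def by blast
  qed
  ultimately show ?thesis
    by (intro exI[of _ "A.ce M"] exI[of _ EA'] exI[of _ lb'] exI[of _ EB'] exI[of _ V] exI[of _ length]) blast
qed

end

section \<open>The limit homeomorphism\<close>

context minimal_system
begin

lemma orbit_sym: "x \<in> XX \<Longrightarrow> y \<in> full_orbit X S x \<Longrightarrow> x \<in> full_orbit X S y"
  using full_orbit_iff by metis

lemma orbit_trans:
  assumes x: "x \<in> XX" and y: "y \<in> full_orbit X S x" and z: "z \<in> full_orbit X S y"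
  shows "z \<in> full_orbit X S x"
proof -
  have yX: "y \<in> XX" and ny: "\<exists>n. y = (S ^^ n) x \<or> x = (S ^^ n) y" using y full_orbit_iff[OF x] by blast+
  have zX: "z \<in> XX" and nz: "\<exists>n. z = (S ^^ n) y \<or> y = (S ^^ n) z" using z full_orbit_iff[OF yX] by blast+
  have cmp: "\<exists>n. v = (S ^^ n) u \<or> u = (S ^^ n) v" if "u \<in> XX" "v \<in> XX" "(S ^^ a) u = (S ^^ b) v" for u v a b
  proof (cases "a \<le> b")
    case True
    have "(S ^^ a) u = (S ^^ a) ((S ^^ (b - a)) v)" using that(3) True Sn_add[of a "b - a" v] by simp
    then show ?thesis using Sn_inj[OF that(1) Sn_in[OF that(2)]] by blast
  next
    case False
    have "(S ^^ b) ((S ^^ (a - b)) u) = (S ^^ b) v" using that(3) False Sn_add[of b "a - b" u] by simp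
    then show ?thesis using Sn_inj[OF Sn_in[OF that(1)] that(2)] by blast
  qed
  obtain n m where "y = (S ^^ n) x \<or> x = (S ^^ n) y" "z = (S ^^ m) y \<or> y = (S ^^ m) z" using ny nz by blast
  then consider "z = (S ^^ (m + n)) x" | "(S ^^ n) x = (S ^^ m) z" | "x = (S ^^ n) y" "z = (S ^^ m) y"
    | "x = (S ^^ (n + m)) z"
    by (metis Sn_add)
  then have "\<exists>n. z = (S ^^ n) x \<or> x = (S ^^ n) z"
  proof cases
    case 3
    have "(S ^^ m) x = (S ^^ n) z" using 3 Sn_add[of m n y] Sn_add[of n m y] by (simp add: add.commute)
    then show ?thesis using cmp[OF x zX] by blast
  qed (use cmp[OF x zX] in blast)+
  then show ?thesis using full_orbit_iff[OF x] zX by blast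
qed

lemma orbit_S: "x \<in> XX \<Longrightarrow> S x \<in> full_orbit X S x"
  unfolding full_orbit_iff using S_in by (intro conjI exI[of _ 1]) simp_all

lemma orbit_refl: "x \<in> XX \<Longrightarrow> x \<in> full_orbit X S x"
  unfolding full_orbit_iff by (intro conjI exI[of _ 0]) simp_all

lemma (in base_set) orbit_tower_base:
  assumes x: "x \<in> XX" and y: "y \<in> XX" and b: "tower_base Z x = tower_base Z y" shows "y \<in> full_orbit X S x"
proof -
  note bx = tower_base_props[OF x] and by' = tower_base_props[OF y]
  have zX: "tower_base Z x \<in> XX" using Z_sub[OF bx(1)] .
  have 1: "x \<in> full_orbit X S (tower_base Z x)" unfolding full_orbit_iff[OF zX] using x bx(3) by blast
  have 2: "y \<in> full_orbit X S (tower_base Z x)" unfolding full_orbit_iff[OF zX] using y by'(3) b by metis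
  show ?thesis by (rule orbit_trans[OF x orbit_sym[OF zX 1] 2])
qed

end

context tower_sequence
begin

lemma init_column_system: "column_system 0 (\<lambda>x. (c, 0)) (=) {c} (\<lambda>_. 1)"
proof -
  have "column_labels XX (\<lambda>x. (c, 0 :: nat)) (=) {c} (\<lambda>_. 1)" by (rule column_labelsI) auto
  moreover have "(S ^^ p) z' = (S ^^ q) z'"
    if "z \<in> Z 0" "p < rt 0 z" "q < rt 0 z" "(S ^^ p) z = (S ^^ q) z" for z z' p q
    using B.tower_unique[of z 0 z p q] that by simp
  moreover have "\<exists>x. x \<in> XX" using nonempty by blast
  ultimately show ?thesis unfolding column_system_def cell_const_def by blast
qed

lemma init_dual: "\<exists>\<phi>. inv_functional \<phi> \<and> \<phi> (bottom_ind (\<lambda>x. (c, 0)) c) = 1"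
proof -
  obtain z where z: "z \<in> Z 0" using neZ by blast
  have zX: "z \<in> XX" using z Z0 by simp
  have r: "rt 0 z = 1" using Z0 S_in[OF zX] by (intro B.return_time_eqI) auto
  obtain \<phi> where \<phi>: "inv_functional \<phi>" "\<forall>f. lv 0 f \<longrightarrow> \<phi> f = ts 0 f z" using functional_ex[OF z] by blast
  have "lv 0 (bottom_ind (\<lambda>x. (c, 0)) c)" by (simp add: cell_const_def bottom_ind_def)
  then have "\<phi> (bottom_ind (\<lambda>x. (c, 0)) c) = 1" using \<phi>(2) r by (simp add: tower_sum_def bottom_ind_def)
  then show ?thesis using \<phi>(1) by blast
qed

lemma preimage_Y_nonempty: "\<exists>x\<in>XX. S x \<in> Y"
proof -
  obtain y where y: "y \<in> Y" using Y_nonempty by blast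
  then have "y \<in> XX" using Y_sub by blast
  then show ?thesis using Sn_surj[of y 1] y by auto
qed

end

context tower_pair
begin

lemma swap: "tower_pair X T W l S Z k EV"
  by unfold_locales

text \<open>The trivial start: every point is its own column and all points share one label, so
  equal means and links hold for trivial reasons.\<close>

lemma init_matching: "matching (\<lambda>x. (c, 0)) (=) (\<lambda>x. (c, 0)) (=) {c} (\<lambda>_. 1)"
  unfolding matching_def
proof (intro conjI)
  show "\<exists>m. A.column_system m (\<lambda>x. (c, 0)) (=) {c} (\<lambda>_. 1)" by (rule exI) (rule A.init_column_system)
  show "\<exists>m. B.column_system m (\<lambda>x. (c, 0)) (=) {c} (\<lambda>_. 1)" by (rule exI) (rule B.init_column_system)
  obtain \<phi> where "A.inv_functional \<phi> \<and> \<phi> (bottom_ind (\<lambda>x. (c, 0)) c) = 1" using A.init_dual[of c] by (rule exE)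
  then show "\<exists>\<phi>. \<forall>d\<in>{c}. A.inv_functional (\<phi> d) \<and> (\<forall>d'\<in>{c}. \<phi> d (bottom_ind (\<lambda>x. (c, 0)) d') = (if d = d' then 1 else 0))"
    by (intro exI[of _ "\<lambda>_. \<phi>"]) simp
  obtain \<phi> where "B.inv_functional \<phi> \<and> \<phi> (bottom_ind (\<lambda>x. (c, 0)) c) = 1" using B.init_dual[of c] by (rule exE)
  then show "\<exists>\<phi>. \<forall>d\<in>{c}. B.inv_functional (\<phi> d) \<and> (\<forall>d'\<in>{c}. \<phi> d (bottom_ind (\<lambda>x. (c, 0)) d') = (if d = d' then 1 else 0))"
    by (intro exI[of _ "\<lambda>_. \<phi>"]) simp
  show "links (\<lambda>x. (c, 0)) (\<lambda>x. (c, 0))" unfolding links_def using A.preimage_Y_nonempty B.preimage_Y_nonempty by simp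
qed simp

lemma matching_swap: "tower_pair.matching X T W l S Z k EV lb EB la EA C kk \<longleftrightarrow> matching la EA lb EB C kk"
proof -
  interpret sw: tower_pair X T W l S Z k EV by (rule swap)
  have "sw.links lb la \<longleftrightarrow> links la lb" unfolding sw.links_def links_def by blast
  moreover have "(\<forall>e\<in>EV. \<forall>c\<in>C. e (bottom_ind lb c) = e (bottom_ind la c)) \<longleftrightarrow> (\<forall>e\<in>EV. \<forall>c\<in>C. e (bottom_ind la c) = e (bottom_ind lb c))"
    by (metis (no_types))
  ultimately show ?thesis unfolding sw.matching_def matching_def by blast
qed

lemma matching_refines_swap: "tower_pair.matching_refines X lb EB la EA lb' EB' la' EA' \<longleftrightarrow> matching_refines la EA lb EB la' EA' lb' EB'"
proof -
  interpret sw: tower_pair X T W l S Z k EV by (rule swap)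
  have "(\<forall>x\<in>XX. \<forall>x'\<in>XX. lb' x = la' x' \<longrightarrow> lb x = la x') \<longleftrightarrow> (\<forall>x\<in>XX. \<forall>x'\<in>XX. la' x = lb' x' \<longrightarrow> la x = lb x')" (is "?L \<longleftrightarrow> ?R")
  proof
    assume L: ?L
    show ?R
    proof (intro ballI impI)
      fix x x' assume "x \<in> XX" "x' \<in> XX" "la' x = lb' x'"
      then show "la x = lb x'" using L[rule_format, of x' x] by simp
    qed
  next
    assume R: ?R
    show ?L
    proof (intro ballI impI)
      fix x x' assume "x \<in> XX" "x' \<in> XX" "lb' x = la' x'"
      then show "lb x = la x'" using R[rule_format, of x' x] by simp
    qed
  qed
  moreover have "(\<forall>x\<in>XX. \<forall>x'\<in>XX. \<forall>y\<in>XX. \<forall>y'\<in>XX. lb' x = la' x' \<longrightarrow> EB x y \<longrightarrow> EA x' y' \<longrightarrow> lb y = la y' \<longrightarrow> lb' y = la' y') \<longleftrightarrow>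
    (\<forall>x\<in>XX. \<forall>x'\<in>XX. \<forall>y\<in>XX. \<forall>y'\<in>XX. la' x = lb' x' \<longrightarrow> EA x y \<longrightarrow> EB x' y' \<longrightarrow> la y = lb y' \<longrightarrow> la' y = lb' y')"
    (is "?L \<longleftrightarrow> ?R")
  proof
    assume L: ?L
    show ?R
    proof (intro ballI impI)
      fix x x' y y' assume "x \<in> XX" "x' \<in> XX" "y \<in> XX" "y' \<in> XX" "la' x = lb' x'" "EA x y" "EB x' y'" "la y = lb y'"
      then show "la' y = lb' y'" using L[rule_format, of x' x y' y] by simp
    qed
  next
    assume R: ?R
    show ?L
    proof (intro ballI impI)
      fix x x' y y' assume "x \<in> XX" "x' \<in> XX" "y \<in> XX" "y' \<in> XX" "lb' x = la' x'" "EB x y" "EA x' y'" "lb y = la y'"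
      then show "lb' y = la' y'" using R[rule_format, of x' x y' y] by simp
    qed
  qed
  ultimately show ?thesis unfolding sw.matching_refines_def matching_refines_def by blast
qed

lemma matching_refines_trans:
  assumes "matching_refines la EA lb EB la' EA' lb' EB'" "matching_refines la' EA' lb' EB' la'' EA'' lb'' EB''"
  shows "matching_refines la EA lb EB la'' EA'' lb'' EB''"
  unfolding matching_refines_def
proof (intro conjI ballI impI)
  fix x x' y y' assume X: "x \<in> XX" "x' \<in> XX" "y \<in> XX" "y' \<in> XX" and *: "la'' x = lb'' x'" "EA x y" "EB x' y'" "la y = lb y'"
  have 1: "la' x = lb' x'" using assms(2) X *(1) unfolding matching_refines_def by blast
  then have 2: "la' y = lb' y'" using assms(1) X *(2-4) unfolding matching_refines_def by blast
  have "EA' x y" "EB' x' y'" using assms(1) X *(2,3) unfolding matching_refines_def by blast+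
  then show "la'' y = lb'' y'" using assms(2) X *(1) 2 unfolding matching_refines_def by blast
next
  fix x x' assume x: "x \<in> XX" "x' \<in> XX" "la'' x = lb'' x'"
  have "la' x = lb' x'" using assms(2) x unfolding matching_refines_def by blast
  then show "la x = lb x'" using assms(1) x unfolding matching_refines_def by blast
next
  fix x y assume "x \<in> XX" "y \<in> XX" "EA x y"
  then show "EA'' x y" using assms unfolding matching_refines_def by blast
next
  fix x y assume "x \<in> XX" "y \<in> XX" "EB x y"
  then show "EB'' x y" using assms unfolding matching_refines_def by blast
qed

text \<open>Both sides have the same column types, each type occurs, and a column contains all its
  levels.\<close>

lemma label_realised:
  assumes st: "matching la EA lb EB C kk" and x: "x \<in> XX" shows "\<exists>y\<in>XX. lb y = la x"
proof -
  have cA: "column_labels XX la EA C kk" and cB: "column_labels XX lb EB C kk" and ex: "\<forall>c\<in>C. \<exists>x\<in>XX. lb x = (c, 0)"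
    using st unfolding matching_def A.column_system_def B.column_system_def by blast+
  have l: "fst (la x) \<in> C" "snd (la x) < kk (fst (la x))" using column_labelsD(4)[OF cA x] by simp_all
  then obtain y where y: "y \<in> XX" "lb y = (fst (la x), 0)" using ex by blast
  then obtain q where "q \<in> XX" "lb q = (fst (la x), snd (la x))" using column_labelsD(7)[OF cB y(1), of "snd (la x)"] l by auto
  then show ?thesis by (intro bexI[of _ q]) simp_all
qed

text \<open>The first two clauses make the limit map bijective and continuous; the last two let
  every tower of either system end up inside a single column.\<close>

definition fine_at where
  "fine_at N la EA lb EB \<longleftrightarrow>
     (\<forall>x\<in>XX. \<forall>y\<in>XX. la x = la y \<longrightarrow> A.profile N x = A.profile N y) \<and>
     (\<forall>x\<in>XX. \<forall>y\<in>XX. lb x = lb y \<longrightarrow> A.profile N x = A.profile N y) \<and>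
     (\<forall>x\<in>XX. \<forall>y\<in>XX. A.ba N x = A.ba N y \<longrightarrow> EA x y) \<and>
     (\<forall>x\<in>XX. \<forall>y\<in>XX. B.ba N x = B.ba N y \<longrightarrow> EB x y)"

lemma double_step:
  fixes C :: "bool list list set"
  assumes st: "matching la EA lb EB C kk"
  shows "\<exists>la' EA' lb' EB' (C' :: bool list list set) kk'. matching la' EA' lb' EB' C' kk' \<and>
      matching_refines la EA lb EB la' EA' lb' EB' \<and> fine_at N la' EA' lb' EB'"
proof -
  interpret sw: tower_pair X T W l S Z k EV by (rule swap)
  obtain la' EA' lb' EB' and C' :: "bool list list set" and kk' where 1: "matching la' EA' lb' EB' C' kk'"
    "matching_refines la EA lb EB la' EA' lb' EB'" "\<forall>x\<in>XX. \<forall>y\<in>XX. la' x = la' y \<longrightarrow> A.profile N x = A.profile N y"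
    "\<forall>x\<in>XX. \<forall>y\<in>XX. A.ba N x = A.ba N y \<longrightarrow> EA' x y"
    using back_and_forth[OF st, of N] by blast
  have "sw.matching lb' EB' la' EA' C' kk'" using 1(1) matching_swap by blast
  from sw.back_and_forth[OF this, of N]
  obtain la'' EA'' lb'' EB'' and C'' :: "bool list list set" and kk'' where 2: "sw.matching lb'' EB'' la'' EA'' C'' kk''"
    "sw.matching_refines lb' EB' la' EA' lb'' EB'' la'' EA''" "\<forall>x\<in>XX. \<forall>y\<in>XX. lb'' x = lb'' y \<longrightarrow> A.profile N x = A.profile N y"
    "\<forall>x\<in>XX. \<forall>y\<in>XX. B.ba N x = B.ba N y \<longrightarrow> EB'' x y"
    by blast
  have st'': "matching la'' EA'' lb'' EB'' C'' kk''" using 2(1) matching_swap by blast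
  have tr: "matching_refines la' EA' lb' EB' la'' EA'' lb'' EB''" using 2(2) matching_refines_swap by blast
  have "A.profile N x = A.profile N y" if x: "x \<in> XX" and y: "y \<in> XX" and l: "la'' x = la'' y" for x y
  proof -
    \<comment> \<open>Refinement compares labels across the two sides only, so equality of two
      labels \<open>la''\<close> is passed down through a point \<open>x'\<close> of the other
      side.\<close>
    obtain x' where x': "x' \<in> XX" "lb'' x' = la'' x" using label_realised[OF st'' x] by blast
    have d: "la' u = lb' x'" if "u \<in> XX" "la'' u = lb'' x'" for u
      using tr that x'(1) unfolding matching_refines_def by blast
    have "la' x = la' y" using d[OF x] d[OF y] x'(2) l by simp
    then show ?thesis using 1(3) x y by blast
  qed
  moreover have "EA'' x y" if "x \<in> XX" "y \<in> XX" "A.ba N x = A.ba N y" for x y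
    using tr 1(4) that unfolding matching_refines_def by blast
  ultimately have "fine_at N la'' EA'' lb'' EB''" using 2(3,4) unfolding fine_at_def by blast
  then show ?thesis using st'' matching_refines_trans[OF 1(2) tr]
    by (intro exI[of _ la''] exI[of _ EA''] exI[of _ lb''] exI[of _ EB''] exI[of _ C''] exI[of _ kk'']) blast
qed

definition matching_chain where
  "matching_chain la EA lb EB \<longleftrightarrow> (\<forall>n. (\<exists>(C :: bool list list set) kk. matching (la n) (EA n) (lb n) (EB n) C kk) \<and>
     matching_refines (la n) (EA n) (lb n) (EB n) (la (Suc n)) (EA (Suc n)) (lb (Suc n)) (EB (Suc n)) \<and>
     fine_at n (la (Suc n)) (EA (Suc n)) (lb (Suc n)) (EB (Suc n)))"

lemma matching_chain_ex: "\<exists>la EA lb EB. matching_chain la EA lb EB"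
proof -
  define P where "P p \<longleftrightarrow> (\<exists>(C :: bool list list set) kk. matching (fst p) (fst (snd p)) (fst (snd (snd p))) (snd (snd (snd p))) C kk)" for p
  define Q where "Q n p q \<longleftrightarrow> matching_refines (fst p) (fst (snd p)) (fst (snd (snd p))) (snd (snd (snd p)))
      (fst q) (fst (snd q)) (fst (snd (snd q))) (snd (snd (snd q))) \<and>
     fine_at n (fst q) (fst (snd q)) (fst (snd (snd q))) (snd (snd (snd q)))"
    for n and p q :: "('a \<Rightarrow> bool list list \<times> nat) \<times> ('a \<Rightarrow> 'a \<Rightarrow> bool) \<times> ('a \<Rightarrow> bool list list \<times> nat) \<times> ('a \<Rightarrow> 'a \<Rightarrow> bool)"
  have "\<exists>f. \<forall>n. P (f n) \<and> Q n (f n) (f (Suc n))"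
  proof (rule dependent_nat_choice)
    have "P (\<lambda>x. ([], 0), (=), \<lambda>x. ([], 0), (=))"
      unfolding P_def fst_conv snd_conv by (rule exI, rule exI) (rule init_matching)
    then show "\<exists>p. P p" by (rule exI)
    fix p n assume "P p"
    then obtain C :: "bool list list set" and kk where
      "matching (fst p) (fst (snd p)) (fst (snd (snd p))) (snd (snd (snd p))) C kk" unfolding P_def by (elim exE)
    from double_step[OF this, of n] obtain la' EA' lb' EB' and C' :: "bool list list set" and kk' where
      *: "matching la' EA' lb' EB' C' kk' \<and> matching_refines (fst p) (fst (snd p)) (fst (snd (snd p))) (snd (snd (snd p))) la' EA' lb' EB' \<and>
      fine_at n la' EA' lb' EB'" by (elim exE)
    have "P (la', EA', lb', EB')" unfolding P_def fst_conv snd_conv using conjunct1[OF *] by (intro exI)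
    moreover have "Q n p (la', EA', lb', EB')" unfolding Q_def fst_conv snd_conv using conjunct2[OF *] .
    ultimately show "\<exists>q. P q \<and> Q n p q" by (intro exI[of _ "(la', EA', lb', EB')"] conjI)
  qed
  then obtain f where f: "\<forall>n. P (f n) \<and> Q n (f n) (f (Suc n))" by (rule exE)
  have "matching_chain (\<lambda>n. fst (f n)) (\<lambda>n. fst (snd (f n))) (\<lambda>n. fst (snd (snd (f n)))) (\<lambda>n. snd (snd (snd (f n))))"
    unfolding matching_chain_def using f[unfolded P_def Q_def] .
  then show ?thesis by (intro exI)
qed

lemma matching_chain_swap: "tower_pair.matching_chain X T W l S Z k EV lb EB la EA \<longleftrightarrow> matching_chain la EA lb EB"
proof -
  interpret sw: tower_pair X T W l S Z k EV by (rule swap)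
  have "sw.fine_at n lb EB la EA \<longleftrightarrow> fine_at n la EA lb EB" for n la EA lb EB
    unfolding sw.fine_at_def fine_at_def by blast
  note fin = this
  show ?thesis
    unfolding sw.matching_chain_def matching_chain_def matching_swap
    by (simp only: fin matching_refines_swap[of "la n" "EA n" "lb n" "EB n" "la (Suc n)" "EA (Suc n)" "lb (Suc n)" "EB (Suc n)" for n])
qed

lemma matching_chain_down:
  assumes ch: "matching_chain la EA lb EB" and x: "x \<in> XX" "x' \<in> XX" and mn: "m \<le> n" and e: "la n x = lb n x'"
  shows "la m x = lb m x'"
  using mn e
proof (induction n rule: dec_induct)
  case (step n)
  have "la n x = lb n x'" using ch x step.prems unfolding matching_chain_def matching_refines_def by blast
  then show ?case by (rule step.IH)
qed

lemma match_ex: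
  assumes ch: "matching_chain la EA lb EB" and x: "x \<in> XX"
  shows "\<exists>x'\<in>XX. \<forall>n. la n x = lb n x'"
proof -
  define F where "F n = {x'\<in>XX. lb n x' = la n x}" for n
  have "(\<Inter>n. F n) \<noteq> {}"
  proof (rule A.clopen_in_nest)
    fix n
    obtain C :: "bool list list set" and kk where st: "matching (la n) (EA n) (lb n) (EB n) C kk"
      using ch unfolding matching_chain_def by blast
    then obtain m where "B.lv m (lb n)" unfolding matching_def B.column_system_def by blast
    then show "clopen_in X (F n)" unfolding F_def by (rule loc_const_Collect[OF B.B.cell_const_loc_const])
    show "F n \<noteq> {}" using label_realised[OF st x] by (auto simp: F_def)
    show "F (Suc n) \<subseteq> F n"
    proof
      fix x' assume "x' \<in> F (Suc n)"
      then have "x' \<in> XX" "la (Suc n) x = lb (Suc n) x'" by (simp_all add: F_def)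
      then show "x' \<in> F n" using matching_chain_down[OF ch x, of x' n "Suc n"] by (simp add: F_def)
    qed
  qed
  then obtain u where u: "\<And>n. u \<in> F n" by blast
  then have "u \<in> XX" "\<forall>n. la n x = lb n u" by (simp_all add: F_def)
  then show ?thesis by (rule bexI[rotated])
qed

lemma match_unique:
  assumes ch: "matching_chain la EA lb EB" and y: "y \<in> XX" "y' \<in> XX" and e: "\<And>n. lb n y = lb n y'"
  shows "y = y'"
proof (rule ccontr)
  assume "y \<noteq> y'"
  then obtain K where K: "\<forall>k\<ge>K. A.profile k y \<noteq> A.profile k y'" using A.profile_separate[OF y] by blast
  moreover have "A.profile K y = A.profile K y'" using ch y e unfolding matching_chain_def fine_at_def by blast
  ultimately show False by blast
qed

text \<open>The column of \<open>x'\<close> contains a point \<open>u\<close> with the label of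
  \<open>y\<close>. The second clause of \<open>matching_refines\<close> keeps their labels equal at
  all later stages, so \<open>u\<close> is the partner \<open>y'\<close>; and columns lie inside
  towers, hence inside orbits.\<close>

lemma match_col:
  assumes ch: "matching_chain la EA lb EB" and x: "x \<in> XX" "x' \<in> XX" "\<And>n. la n x = lb n x'"
    and y: "y \<in> XX" "y' \<in> XX" "\<And>n. la n y = lb n y'" and E: "EA N x y"
  shows "y' \<in> full_orbit X T x'"
proof -
  obtain C :: "bool list list set" and kk where st: "matching (la N) (EA N) (lb N) (EB N) C kk"
    using ch unfolding matching_chain_def by blast
  obtain m where cA: "column_labels XX (la N) (EA N) C kk" and sB: "B.column_system m (lb N) (EB N) C kk"
    using st unfolding matching_def A.column_system_def by blast
  have cB: "column_labels XX (lb N) (EB N) C kk" and bB: "\<forall>x\<in>XX. \<forall>y\<in>XX. EB N x y \<longrightarrow> B.ba m x = B.ba m y"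
    using sB unfolding B.column_system_def by blast+
  have "fst (lb N x') = fst (la N y)" using column_labelsD(5)[OF cA x(1) y(1) E] x(3) by simp
  moreover have "snd (la N y) < kk (fst (la N y))" using column_labelsD(4)[OF cA y(1)] by simp
  ultimately obtain u where u: "u \<in> XX" "EB N x' u" "lb N u = la N y"
    using column_labelsD(7)[OF cB x(2), of "snd (la N y)"] by auto
  have mono: "EA n x y \<and> EB n x' u \<and> la n y = lb n u" if "N \<le> n" for n
    using that
  proof (induction n rule: dec_induct)
    case (step n)
    have t: "matching_refines (la n) (EA n) (lb n) (EB n) (la (Suc n)) (EA (Suc n)) (lb (Suc n)) (EB (Suc n))"
      using ch unfolding matching_chain_def by blast
    show ?case using t step.IH x y(1) u(1) unfolding matching_refines_def by blast
  qed (use E u in simp)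
  have "la n y = lb n u" for n
    using matching_chain_down[OF ch y(1) u(1), of n "max n N"] mono[of "max n N"] by simp
  then have "lb n u = lb n y'" for n using y(3)[of n] by metis
  then have "u = y'" by (rule match_unique[OF ch u(1) y(2)])
  then have "B.ba m x' = B.ba m y'" using bB x(2) u by blast
  then show ?thesis by (rule B.B.orbit_tower_base[OF x(2) y(2)])
qed

text \<open>Off \<open>Y\<close> the step stays in one tower and so eventually in one column. For a
  step into \<open>Y\<close> the labels of both ends are realised at each stage by a step of the
  other system, and compactness produces one step that works at all stages.\<close>

lemma match_S:
  assumes ch: "matching_chain la EA lb EB" and x: "x \<in> XX" "x' \<in> XX" "\<And>n. la n x = lb n x'"
    and y: "y' \<in> XX" "\<And>n. la n (S x) = lb n y'"
  shows "y' \<in> full_orbit X T x'"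
proof (cases "S x \<in> A.Y")
  case False
  then obtain N where "A.ba N x = A.ba N (S x)" using A.same_tower_ev[OF x(1)] by blast
  then have "EA (Suc N) x (S x)" using ch x(1) A.S_in[OF x(1)] unfolding matching_chain_def fine_at_def by blast
  then show ?thesis by (rule match_col[OF ch x A.S_in[OF x(1)] y])
next
  case True
  define F where "F n = {u\<in>XX. lb n u = la n x \<and> lb n (T u) = la n (S x)}" for n
  have "(\<Inter>n. F n) \<noteq> {}"
  proof (rule A.clopen_in_nest)
    fix n
    obtain C :: "bool list list set" and kk where st: "matching (la n) (EA n) (lb n) (EB n) C kk"
      using ch unfolding matching_chain_def by blast
    then obtain m where "B.lv m (lb n)" unfolding matching_def B.column_system_def by blast
    then have "loc_const X (lb n)" by (rule B.B.cell_const_loc_const)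
    then have "loc_const X (\<lambda>u. (lb n u, lb n (T u)))" using loc_const_Pair[OF _ B.loc_const_Sn[of "lb n" 1]] by simp
    from loc_const_Collect[OF this, of "\<lambda>c. fst c = la n x \<and> snd c = la n (S x)"] show "clopen_in X (F n)" by (simp add: F_def)
    have "links (la n) (lb n)" using st unfolding matching_def by blast
    then show "F n \<noteq> {}" using True x(1) unfolding links_def F_def by blast
    show "F (Suc n) \<subseteq> F n"
    proof
      fix u assume "u \<in> F (Suc n)"
      then have u: "u \<in> XX" "la (Suc n) x = lb (Suc n) u" "la (Suc n) (S x) = lb (Suc n) (T u)" by (simp_all add: F_def)
      then show "u \<in> F n"
        using matching_chain_down[OF ch x(1), of u n "Suc n"] matching_chain_down[OF ch A.S_in[OF x(1)] B.S_in[OF u(1)], of n "Suc n"]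
        by (simp add: F_def)
    qed
  qed
  then obtain u where u: "\<And>n. u \<in> F n" by blast
  have uX: "u \<in> XX" using u[of 0] by (simp add: F_def)
  have "u = x'" using match_unique[OF ch uX x(2)] u x(3) by (simp add: F_def)
  moreover have "T u = y'" using match_unique[OF ch B.S_in[OF uX] y(1)] u y(2) by (simp add: F_def)
  ultimately show ?thesis using B.orbit_S[OF uX] by simp
qed

lemma orbit_homeo:
  "\<exists>h. homeomorphic_map X X h \<and> (\<forall>x\<in>XX. \<forall>y\<in>XX. y \<in> full_orbit X S x \<longleftrightarrow> h y \<in> full_orbit X T (h x))"
proof -
  interpret sw: tower_pair X T W l S Z k EV by (rule swap)
  obtain la EA lb EB where ch: "matching_chain la EA lb EB" using matching_chain_ex by blast
  have sch: "sw.matching_chain lb EB la EA" using ch matching_chain_swap by blast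
  have "\<forall>x. \<exists>x'. x \<in> XX \<longrightarrow> x' \<in> XX \<and> (\<forall>n. la n x = lb n x')" using match_ex[OF ch] by blast
  from choice[OF this] obtain h where h0: "\<forall>x. x \<in> XX \<longrightarrow> h x \<in> XX \<and> (\<forall>n. la n x = lb n (h x))" by (rule exE)
  then have h: "\<And>x. x \<in> XX \<Longrightarrow> h x \<in> XX" "\<And>x n. x \<in> XX \<Longrightarrow> la n x = lb n (h x)" by blast+
  have inj: "inj_on h XX"
  proof (rule inj_onI)
    fix x y assume xy: "x \<in> XX" "y \<in> XX" "h x = h y"
    have "la n x = la n y" for n using h(2)[OF xy(1), of n] h(2)[OF xy(2), of n] xy(3) by simp
    then show "x = y" using sw.match_unique[OF sch xy(1,2)] by blast
  qed
  have surj: "h ` XX = XX"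
  proof
    show "h ` XX \<subseteq> XX" using h(1) by blast
    show "XX \<subseteq> h ` XX"
    proof
      fix x' assume x': "x' \<in> XX"
      obtain x where x: "x \<in> XX" "\<forall>n. lb n x' = la n x" using sw.match_ex[OF sch x'] by blast
      have "lb n x' = lb n (h x)" for n using x h(2)[OF x(1), of n] by simp
      then have "x' = h x" using match_unique[OF ch x' h(1)[OF x(1)]] by blast
      then show "x' \<in> h ` XX" using x(1) by blast
    qed
  qed
  have lcla: "loc_const X (la n)" for n
  proof -
    obtain C :: "bool list list set" and kk where "matching (la n) (EA n) (lb n) (EB n) C kk"
      using ch unfolding matching_chain_def by blast
    then obtain m where "A.lv m (la n)" unfolding matching_def A.column_system_def by blast
    then show ?thesis by (rule A.B.cell_const_loc_const)
  qed
  have "continuous_map X X h"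
    unfolding continuous_map_def
  proof (intro conjI allI impI)
    show "h \<in> XX \<rightarrow> XX" using h(1) by blast
    fix U assume U: "openin X U"
    show "openin X {x\<in>XX. h x \<in> U}"
    proof (subst openin_subopen, intro ballI)
      fix x assume "x \<in> {x\<in>XX. h x \<in> U}"
      then have x: "x \<in> XX" "h x \<in> U" by simp_all
      obtain V where V: "clopen_in X V" "h x \<in> V" "V \<subseteq> U" using A.clopen_in_base[OF U x(2)] by blast
      obtain i where i: "A.clopen_enum i = V" using A.clopen_enum_surj[OF V(1)] by blast
      \<comment> \<open>Profiles of length \<open>n\<close> see the clopen sets of index below
        \<open>n\<close>, and \<open>fine_at n\<close> concerns the labels of stage
        \<open>Suc n\<close>.\<close>
      define n where "n = Suc i"
      have "{y\<in>XX. la (Suc n) y = la (Suc n) x} \<subseteq> {x\<in>XX. h x \<in> U}"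
      proof
        fix y assume "y \<in> {y\<in>XX. la (Suc n) y = la (Suc n) x}"
        then have y: "y \<in> XX" "la (Suc n) y = la (Suc n) x" by simp_all
        then have "lb (Suc n) (h y) = lb (Suc n) (h x)" using h(2)[OF x(1), of "Suc n"] h(2)[OF y(1), of "Suc n"] by metis
        then have "A.profile n (h y) = A.profile n (h x)" using ch h(1)[OF x(1)] h(1)[OF y(1)] unfolding matching_chain_def fine_at_def by blast
        then have "h y \<in> A.clopen_enum i \<longleftrightarrow> h x \<in> A.clopen_enum i" unfolding A.profile_eq n_def by simp
        then have "h y \<in> V" using V(2) i by simp
        then show "y \<in> {x\<in>XX. h x \<in> U}" using V(3) y(1) by blast
      qed
      moreover have "openin X {y\<in>XX. la (Suc n) y = la (Suc n) x}"
        using loc_const_Collect[OF lcla[of "Suc n"], of "\<lambda>c. c = la (Suc n) x"] by (simp only: clopen_in_def)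
      ultimately show "\<exists>T. openin X T \<and> x \<in> T \<and> T \<subseteq> {x\<in>XX. h x \<in> U}"
        using x(1) by (intro exI[of _ "{y\<in>XX. la (Suc n) y = la (Suc n) x}"]) simp
    qed
  qed
  then have hom: "homeomorphic_map X X h"
    using continuous_imp_homeomorphic_map[OF _ A.compact A.Hausdorff surj inj] by blast
  have SS: "h (S x) \<in> full_orbit X T (h x)" if x: "x \<in> XX" for x
    using match_S[OF ch x h(1)[OF x] h(2)[OF x] h(1)[OF A.S_in[OF x]] h(2)[OF A.S_in[OF x]]] .
  have TT: "y \<in> full_orbit X S x" if x: "x \<in> XX" "y \<in> XX" "h y = T (h x)" for x y
  proof (rule sw.match_S[OF sch h(1)[OF x(1)] x(1) _ x(2)])
    show "lb n (h x) = la n x" for n using h(2)[OF x(1)] by simp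
    show "lb n (T (h x)) = la n y" for n using h(2)[OF x(2)] x(3) by simp
  qed
  have Sn: "h ((S ^^ n) x) \<in> full_orbit X T (h x)" if x: "x \<in> XX" for x n
  proof (induction n)
    case (Suc n)
    have "h ((S ^^ Suc n) x) \<in> full_orbit X T (h ((S ^^ n) x))" using SS[OF A.Sn_in[OF x, of n]] by simp
    then show ?case using B.orbit_trans[OF h(1)[OF x] Suc] by blast
  qed (use B.orbit_refl[OF h(1)[OF x]] in simp)
  have Tn: "y \<in> full_orbit X S x" if x: "x \<in> XX" "y \<in> XX" "h y = (T ^^ n) (h x)" for x y n
    using x
  proof (induction n arbitrary: y)
    case 0
    then have "y = x" using inj by (auto simp: inj_on_def)
    then show ?case using A.orbit_refl[OF x(1)] by simp
  next
    case (Suc n)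
    have "(T ^^ n) (h x) \<in> XX" using B.Sn_in[OF h(1)[OF x(1)]] .
    then have "(T ^^ n) (h x) \<in> h ` XX" unfolding surj .
    then obtain u where u: "u \<in> XX" "h u = (T ^^ n) (h x)" by (metis imageE)
    have "u \<in> full_orbit X S x" using Suc.IH[OF x(1) u] .
    moreover have "y \<in> full_orbit X S u" using TT[OF u(1) Suc.prems(2)] Suc.prems(3) u(2) by simp
    ultimately show ?case using A.orbit_trans[OF x(1)] by blast
  qed
  have "y \<in> full_orbit X S x \<longleftrightarrow> h y \<in> full_orbit X T (h x)" if x: "x \<in> XX" and y: "y \<in> XX" for x y
  proof
    assume "y \<in> full_orbit X S x"
    then obtain n where "y = (S ^^ n) x \<or> x = (S ^^ n) y" using A.full_orbit_iff[OF x] by blast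
    then show "h y \<in> full_orbit X T (h x)"
      using Sn[OF x, of n] B.orbit_sym[OF h(1)[OF y]] Sn[OF y, of n] by blast
  next
    assume "h y \<in> full_orbit X T (h x)"
    then obtain n where "h y = (T ^^ n) (h x) \<or> h x = (T ^^ n) (h y)" using B.full_orbit_iff[OF h(1)[OF x]] by blast
    then show "y \<in> full_orbit X S x"
      using Tn[OF x y, of n] A.orbit_sym[OF y] Tn[OF y x, of n] by blast
  qed
  then show ?thesis using hom by blast
qed

end

section \<open>Invariant means on clopen sets\<close>

text \<open>Induction on the number of functionals: if \<open>e j\<close> does not vanish on the
  common kernel of the others, a function \<open>g\<close> in that kernel fixes the coefficient of
  \<open>e j\<close>, and what remains of \<open>\<phi>\<close> vanishes on the kernel.\<close>

lemma functional_in_span: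
  fixes V :: "('a \<Rightarrow> real) set"
  assumes add: "\<And>f g a. f \<in> V \<Longrightarrow> g \<in> V \<Longrightarrow> (\<lambda>x. f x + a * g x) \<in> V"
    and fin: "finite I"
    and e: "\<And>i f g a. i \<in> I \<Longrightarrow> f \<in> V \<Longrightarrow> g \<in> V \<Longrightarrow> e i (\<lambda>x. f x + a * g x) = e i f + a * e i g"
    and \<phi>: "\<And>f g a. f \<in> V \<Longrightarrow> g \<in> V \<Longrightarrow> \<phi> (\<lambda>x. f x + a * g x) = \<phi> f + a * (\<phi> g :: real)"
    and ker: "\<And>f. f \<in> V \<Longrightarrow> (\<And>i. i \<in> I \<Longrightarrow> e i f = 0) \<Longrightarrow> \<phi> f = 0"
  shows "\<exists>a. \<forall>f\<in>V. \<phi> f = (\<Sum>i\<in>I. a i * e i f)"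
  using fin e \<phi> ker
proof (induction I arbitrary: \<phi> rule: finite_induct)
  case empty
  then show ?case by simp
next
  case (insert j I)
  show ?case
  proof (cases "\<forall>f\<in>V. (\<forall>i\<in>I. e i f = 0) \<longrightarrow> e j f = 0")
    case True
    have "\<phi> f = 0" if "f \<in> V" "\<And>i. i \<in> I \<Longrightarrow> e i f = 0" for f
      using insert.prems(3)[of f] True that by auto
    then have "\<exists>a. \<forall>f\<in>V. \<phi> f = (\<Sum>i\<in>I. a i * e i f)"
      using insert.IH[of \<phi>] insert.prems(1,2) by simp
    then obtain a where a: "\<forall>f\<in>V. \<phi> f = (\<Sum>i\<in>I. a i * e i f)" by (rule exE)
    have "(\<Sum>i\<in>insert j I. (a(j := 0)) i * e i f) = (\<Sum>i\<in>I. a i * e i f)" for f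
      using insert.hyps by (simp add: sum.insert) (intro sum.cong, auto)
    then show ?thesis using a by (intro exI[of _ "a(j := 0)"]) simp
  next
    case False
    then obtain g where g: "g \<in> V" "\<forall>i\<in>I. e i g = 0" "e j g \<noteq> 0" by blast
    define t where "t = \<phi> g / e j g"
    define \<psi> where "\<psi> f = \<phi> f - t * e j f" for f
    have "\<psi> (\<lambda>x. f x + a * h x) = \<psi> f + a * \<psi> h" if "f \<in> V" "h \<in> V" for f h a
      using insert.prems(1)[of j f h a] insert.prems(2)[of f h a] that by (simp add: \<psi>_def algebra_simps)
    moreover have "\<psi> f = 0" if f: "f \<in> V" "\<And>i. i \<in> I \<Longrightarrow> e i f = 0" for f
    proof -
      define s where "s = - (e j f / e j g)"
      have "\<phi> (\<lambda>x. f x + s * g x) = 0"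
      proof (rule insert.prems(3)[OF add[OF f(1) g(1)]])
        fix i assume i: "i \<in> insert j I"
        then show "e i (\<lambda>x. f x + s * g x) = 0"
          using insert.prems(1)[OF i f(1) g(1), of s] f(2) g(2,3) by (auto simp: s_def)
      qed
      then show ?thesis using insert.prems(2)[OF f(1) g(1), of s] by (simp add: \<psi>_def s_def t_def)
    qed
    ultimately have "\<exists>a. \<forall>f\<in>V. \<psi> f = (\<Sum>i\<in>I. a i * e i f)"
      using insert.IH[OF insert.prems(1), of \<psi>] by simp
    then obtain a where a: "\<forall>f\<in>V. \<psi> f = (\<Sum>i\<in>I. a i * e i f)" by blast
    have "(\<Sum>i\<in>insert j I. (a(j := t)) i * e i f) = t * e j f + (\<Sum>i\<in>I. a i * e i f)" for f
      using insert.hyps by (simp add: sum.insert) (intro sum.cong, auto)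
    then show ?thesis using a by (intro exI[of _ "a(j := t)"]) (simp add: \<psi>_def algebra_simps)
  qed
qed

definition content_integral :: "'a topology \<Rightarrow> ('a set \<Rightarrow> real) \<Rightarrow> ('a \<Rightarrow> real) \<Rightarrow> real" where
  "content_integral X m f = (\<Sum>c\<in>f ` topspace X. c * m {x\<in>topspace X. f x = c})"

context minimal_system
begin

text \<open>The value 0 off the clopen sets makes contents that agree on clopen sets equal as
  functions, also when they belong to different maps on \<open>X\<close>.\<close>

definition invariant_content :: "('a set \<Rightarrow> real) \<Rightarrow> bool" where
  "invariant_content m \<longleftrightarrow> (\<forall>A. 0 \<le> m A) \<and> (\<forall>A. \<not> clopen_in X A \<longrightarrow> m A = 0) \<and>
     (\<forall>A B. clopen_in X A \<longrightarrow> clopen_in X B \<longrightarrow> A \<inter> B = {} \<longrightarrow> m (A \<union> B) = m A + m B) \<and>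
     (\<forall>A. clopen_in X A \<longrightarrow> m {x\<in>XX. S x \<in> A} = m A)"

definition invariant_mean :: "('a set \<Rightarrow> real) \<Rightarrow> bool" where
  "invariant_mean m \<longleftrightarrow> invariant_content m \<and> m XX = 1"

definition extreme_mean :: "('a set \<Rightarrow> real) \<Rightarrow> bool" where
  "extreme_mean m \<longleftrightarrow> invariant_mean m \<and> (\<forall>m1 m2 t. invariant_mean m1 \<longrightarrow> invariant_mean m2 \<longrightarrow> 0 < t \<longrightarrow> t < 1 \<longrightarrow>
     (\<forall>A. m A = t * m1 A + (1 - t) * m2 A) \<longrightarrow> m1 = m)"

lemma invariant_contentD:
  assumes "invariant_content m"
  shows "0 \<le> m A" "\<not> clopen_in X A \<Longrightarrow> m A = 0"
    "clopen_in X A \<Longrightarrow> clopen_in X B \<Longrightarrow> A \<inter> B = {} \<Longrightarrow> m (A \<union> B) = m A + m B"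
    "clopen_in X A \<Longrightarrow> m {x\<in>XX. S x \<in> A} = m A"
  using assms unfolding invariant_content_def by blast+

lemma invariant_content_empty: "invariant_content m \<Longrightarrow> m {} = 0"
  using invariant_contentD(3)[of m "{}" "{}"] by simp

lemma invariant_content_Diff: assumes "invariant_content m" "clopen_in X A" "clopen_in X B" "B \<subseteq> A" shows "m (A - B) = m A - m B"
proof -
  have "m (A - B \<union> B) = m (A - B) + m B" by (rule invariant_contentD(3)[OF assms(1) clopen_in_Diff[OF assms(2,3)] assms(3)]) blast
  moreover have "A - B \<union> B = A" using assms(4) by blast
  ultimately show ?thesis by simp
qed

lemma invariant_content_mono: "invariant_content m \<Longrightarrow> clopen_in X A \<Longrightarrow> clopen_in X B \<Longrightarrow> B \<subseteq> A \<Longrightarrow> m B \<le> m A"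
  using invariant_content_Diff[of m A B] invariant_contentD(1)[of m "A - B"] by simp

lemma invariant_content_le: "invariant_content m \<Longrightarrow> m A \<le> m XX"
  using invariant_content_mono[OF _ clopen_in_topspace, of m A] invariant_contentD(1,2)[of m] clopen_in_subset[of X A] by (cases "clopen_in X A") auto

lemma invariant_content_UN:
  assumes m: "invariant_content m" and "finite I" "\<And>i. i \<in> I \<Longrightarrow> clopen_in X (A i)" "disjoint_family_on A I"
  shows "m (\<Union>i\<in>I. A i) = (\<Sum>i\<in>I. m (A i))"
  using assms(2-4)
proof (induction I rule: finite_induct)
  case empty
  then show ?case using invariant_content_empty[OF m] by simp
next
  case (insert i I)
  have "m (A i \<union> (\<Union>i\<in>I. A i)) = m (A i) + m (\<Union>i\<in>I. A i)"
  proof (rule invariant_contentD(3)[OF m])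
    show "clopen_in X (\<Union>i\<in>I. A i)" using insert by (intro clopen_in_UN) auto
    have "A i \<inter> A j = {}" if "j \<in> I" for j
      using insert.prems(2) insert.hyps(2) that unfolding disjoint_family_on_def by (metis insertCI)
    then show "A i \<inter> (\<Union>i\<in>I. A i) = {}" by blast
  qed (use insert.prems in auto)
  moreover have "disjoint_family_on A I" using insert.prems(2) by (simp add: disjoint_family_on_def)
  ultimately show ?case using insert by simp
qed

lemma content_integral_comp:
  assumes m: "invariant_content m" and g: "loc_const X g"
  shows "content_integral X m (\<lambda>x. F (g x)) = (\<Sum>v\<in>g ` XX. F v * m {x\<in>XX. g x = v})"
proof -
  have fin: "finite (g ` XX)" using g by (simp add: loc_const_def)
  have "m {x\<in>XX. F (g x) = c} = (\<Sum>v\<in>{v\<in>g ` XX. F v = c}. m {x\<in>XX. g x = v})" for c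
  proof -
    have "{x\<in>XX. F (g x) = c} = (\<Union>v\<in>{v\<in>g ` XX. F v = c}. {x\<in>XX. g x = v})" by auto
    moreover have "m (\<Union>v\<in>{v\<in>g ` XX. F v = c}. {x\<in>XX. g x = v}) = (\<Sum>v\<in>{v\<in>g ` XX. F v = c}. m {x\<in>XX. g x = v})"
      using fin g by (intro invariant_content_UN[OF m]) (auto simp: loc_const_def disjoint_family_on_def)
    ultimately show ?thesis by simp
  qed
  then have "content_integral X m (\<lambda>x. F (g x)) = (\<Sum>c\<in>F ` g ` XX. \<Sum>v\<in>{v\<in>g ` XX. F v = c}. F v * m {x\<in>XX. g x = v})"
    unfolding content_integral_def by (simp add: sum_distrib_left image_image)
  also have "\<dots> = (\<Sum>v\<in>g ` XX. F v * m {x\<in>XX. g x = v})"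
    by (rule sum.image_gen[OF fin, symmetric])
  finally show ?thesis .
qed

lemma content_integral_lin:
  assumes m: "invariant_content m" and f: "loc_const X f" and g: "loc_const X g"
  shows "content_integral X m (\<lambda>x. f x + a * g x) = content_integral X m f + a * content_integral X m g"
proof -
  let ?p = "\<lambda>x. (f x, g x)"
  have p: "loc_const X ?p" by (rule loc_const_Pair[OF f g])
  show ?thesis
    using content_integral_comp[OF m p, of "\<lambda>(u, v). u + a * v"] content_integral_comp[OF m p, of fst] content_integral_comp[OF m p, of snd]
    by (simp add: split_beta distrib_right sum.distrib sum_distrib_left mult.assoc)
qed

lemma content_integral_S: assumes m: "invariant_content m" and f: "loc_const X f" shows "content_integral X m (\<lambda>x. f (S x)) = content_integral X m f"
proof -
  have im: "(\<lambda>x. f (S x)) ` XX = f ` XX" using S_bij by (auto simp: bij_betw_def image_image[symmetric])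
  have "m {x\<in>XX. f (S x) = c} = m {x\<in>XX. f x = c}" for c
  proof -
    have "{x\<in>XX. f (S x) = c} = {x\<in>XX. S x \<in> {x\<in>XX. f x = c}}" using S_in by auto
    then show ?thesis using invariant_contentD(4)[OF m, of "{x\<in>XX. f x = c}"] f by (simp add: loc_const_def)
  qed
  then show ?thesis unfolding content_integral_def im by simp
qed

lemma content_integral_ind: assumes m: "invariant_content m" and A: "clopen_in X A" shows "content_integral X m (\<lambda>x. real_of_int (ind A x)) = m A"
proof -
  have "content_integral X m (\<lambda>x. real_of_int (ind A x)) = (\<Sum>v\<in>(\<lambda>x. x \<in> A) ` XX. (if v then 1 else 0) * m {x\<in>XX. (x \<in> A) = v})"
    using content_integral_comp[OF m loc_const_ind[OF A], of "\<lambda>v. if v then 1 else 0"]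
    by (simp add: if_distrib[of real_of_int] cong: if_cong)
  also have "\<dots> = (\<Sum>v\<in>{True, False}. (if v then 1 else 0) * m {x\<in>XX. (x \<in> A) = v})"
  proof (rule sum.mono_neutral_left)
    show "\<forall>v\<in>{True, False} - (\<lambda>x. x \<in> A) ` XX. (if v then 1 else 0) * m {x\<in>XX. (x \<in> A) = v} = 0"
    proof
      fix v assume "v \<in> {True, False} - (\<lambda>x. x \<in> A) ` XX"
      then have "{x\<in>XX. (x \<in> A) = v} = {}" by blast
      then have "m {x\<in>XX. (x \<in> A) = v} = 0" using invariant_content_empty[OF m] by (simp only:)
      then show "(if v then 1 else 0) * m {x\<in>XX. (x \<in> A) = v} = 0" by (simp only: mult_zero_right)
    qed
  qed auto
  also have "\<dots> = m {x\<in>XX. x \<in> A}" by simp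
  also have "{x\<in>XX. x \<in> A} = A" using clopen_in_subset[OF A] by blast
  finally show ?thesis .
qed

text \<open>By minimality finitely many preimages of \<open>A\<close> cover the space; if
  \<open>A\<close> had mean 0, so would all of them and the space.\<close>

lemma invariant_mean_pos:
  assumes m: "invariant_mean m" and A: "clopen_in X A" "A \<noteq> {}" shows "0 < m A"
proof (rule ccontr)
  assume "\<not> 0 < m A"
  have p: "invariant_content m" and m1: "m XX = 1" using m by (simp_all add: invariant_mean_def)
  have mA: "m A = 0" using invariant_contentD(1)[OF p, of A] \<open>\<not> 0 < m A\<close> by simp
  have c: "clopen_in X {x\<in>XX. (S ^^ i) x \<in> A}" for i by (rule clopen_in_vimage[OF Sn_hom A(1)])
  have z: "m {x\<in>XX. (S ^^ i) x \<in> A} = 0" for i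
  proof (induction i)
    case 0
    have "{x\<in>XX. x \<in> A} = A" using clopen_in_subset[OF A(1)] by blast
    then show ?case using mA by simp
  next
    case (Suc i)
    have "{x\<in>XX. (S ^^ Suc i) x \<in> A} = {x\<in>XX. S x \<in> {x\<in>XX. (S ^^ i) x \<in> A}}" using S_in by (auto simp: funpow_swap1)
    then show ?case using invariant_contentD(4)[OF p c[of i]] Suc by simp
  qed
  obtain L where L: "\<forall>x\<in>XX. \<exists>i<L. (S ^^ i) x \<in> A" using uniform_hitting_time[OF A] by blast
  have cU: "clopen_in X (\<Union>i<n. {x\<in>XX. (S ^^ i) x \<in> A})" for n using c by (intro clopen_in_UN) auto
  have "m (\<Union>i<n. {x\<in>XX. (S ^^ i) x \<in> A}) = 0" for n
  proof (induction n)
    case 0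
    then show ?case using invariant_content_empty[OF p] by simp
  next
    case (Suc n)
    let ?U = "\<Union>i<n. {x\<in>XX. (S ^^ i) x \<in> A}" and ?V = "{x\<in>XX. (S ^^ n) x \<in> A}"
    have "m (?U \<union> (?V - ?U)) = m ?U + m (?V - ?U)" using cU c by (intro invariant_contentD(3)[OF p] clopen_in_Diff) auto
    moreover have "m (?V - ?U) \<le> m ?V" using cU c by (intro invariant_content_mono[OF p] clopen_in_Diff) auto
    moreover have "?U \<union> (?V - ?U) = (\<Union>i<Suc n. {x\<in>XX. (S ^^ i) x \<in> A})" by (auto simp: less_Suc_eq)
    ultimately show ?case using Suc z[of n] invariant_contentD(1)[OF p, of "?V - ?U"] by simp
  qed
  from this[of L] have "m XX = 0"
  proof -
    assume z: "m (\<Union>i<L. {x\<in>XX. (S ^^ i) x \<in> A}) = 0"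
    have "(\<Union>i<L. {x\<in>XX. (S ^^ i) x \<in> A}) = XX" using L by auto
    then show "m XX = 0" using z by (simp only:)
  qed
  then show False using m1 by simp
qed

lemma compact_unit: "compact {m :: 'a set \<Rightarrow> real. \<forall>A. 0 \<le> m A \<and> m A \<le> 1}"
proof -
  have "compactin (product_topology (\<lambda>i. euclidean) UNIV) (PiE UNIV (\<lambda>_ :: 'a set. {0..1::real}))"
    by (subst compactin_PiE) simp
  then have "compact (PiE UNIV (\<lambda>_ :: 'a set. {0..1::real}))" by (simp add: euclidean_product_topology)
  moreover have "PiE UNIV (\<lambda>_ :: 'a set. {0..1::real}) = {m. \<forall>A. 0 \<le> m A \<and> m A \<le> 1}"
    by (auto simp: PiE_def Pi_def)
  ultimately show ?thesis by simp
qed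

lemma continuous_content_integral: "continuous_on K (\<lambda>m. content_integral X m f)"
  unfolding content_integral_def
  by (intro continuous_on_sum continuous_on_mult continuous_on_const continuous_on_subset[OF continuous_on_product_coordinates]) simp

lemma continuous_eval: "continuous_on UNIV (\<lambda>m :: 'a set \<Rightarrow> real. m A)"
  by (rule continuous_on_product_coordinates)

text \<open>The defect \<open>d > 0\<close> accommodates empirical averages along finite orbit segments.\<close>

definition almost_invariant_means :: "real \<Rightarrow> ('a set \<Rightarrow> real) set" where
  "almost_invariant_means d = {m. (\<forall>A. 0 \<le> m A \<and> m A \<le> 1) \<and> (\<forall>A. \<not> clopen_in X A \<longrightarrow> m A = 0) \<and>
     (\<forall>A B. clopen_in X A \<longrightarrow> clopen_in X B \<longrightarrow> A \<inter> B = {} \<longrightarrow> m (A \<union> B) = m A + m B) \<and>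
     (\<forall>A. clopen_in X A \<longrightarrow> \<bar>m {x\<in>XX. S x \<in> A} - m A\<bar> \<le> d) \<and> m XX = 1}"

lemma compact_almost_invariant_means: "compact (almost_invariant_means d)" and closed_almost_invariant_means: "closed (almost_invariant_means d)"
proof -
  let ?D = "{m :: 'a set \<Rightarrow> real. (\<forall>A. \<not> clopen_in X A \<longrightarrow> m A = 0) \<and>
     (\<forall>A B. clopen_in X A \<longrightarrow> clopen_in X B \<longrightarrow> A \<inter> B = {} \<longrightarrow> m (A \<union> B) = m A + m B) \<and>
     (\<forall>A. clopen_in X A \<longrightarrow> \<bar>m {x\<in>XX. S x \<in> A} - m A\<bar> \<le> d) \<and> m XX = 1}"
  have D: "closed ?D"
    by (intro closed_Collect_conj closed_Collect_all closed_Collect_imp open_Collect_const closed_Collect_eq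
        closed_Collect_le continuous_intros continuous_eval)
  have U: "closed {m :: 'a set \<Rightarrow> real. \<forall>A. 0 \<le> m A \<and> m A \<le> 1}"
    by (intro closed_Collect_conj closed_Collect_all closed_Collect_le continuous_intros continuous_eval)
  have e: "almost_invariant_means d = {m. \<forall>A. 0 \<le> m A \<and> m A \<le> 1} \<inter> ?D" unfolding almost_invariant_means_def by blast
  show "compact (almost_invariant_means d)" unfolding e by (rule compact_Int_closed[OF compact_unit D])
  show "closed (almost_invariant_means d)" unfolding e by (rule closed_Int[OF U D])
qed

lemma almost_invariant_means_0: "almost_invariant_means 0 = {m. invariant_mean m}"
proof -
  have "m A \<le> 1" if "invariant_mean m" for m A using invariant_content_le[of m A] that by (simp add: invariant_mean_def)
  then show ?thesis unfolding almost_invariant_means_def invariant_mean_def invariant_content_def by auto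
qed

lemma content_integral_convex:
  assumes "\<And>A. m A = t * m1 A + (1 - t) * m2 A" shows "content_integral X m f = t * content_integral X m1 f + (1 - t) * content_integral X m2 f"
  unfolding content_integral_def sum_distrib_left sum.distrib[symmetric] assms by (intro sum.cong refl) (simp add: algebra_simps)

lemma compact_nested:
  fixes F :: "nat \<Rightarrow> ('a set \<Rightarrow> real) set"
  assumes "\<And>n. compact (F n)" "\<And>n. closed (F n)" "\<And>n. F n \<noteq> {}" "\<And>n. F (Suc n) \<subseteq> F n"
  shows "(\<Inter>n. F n) \<noteq> {}"
proof -
  have dec: "F n \<subseteq> F m" if "m \<le> n" for m n using lift_Suc_antimono_le[of F, OF assms(4) that] .
  have "F 0 \<inter> (\<Inter>n\<in>UNIV. F n) \<noteq> {}"
  proof (rule compact_imp_fip_image[OF assms(1,2)])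
    fix I :: "nat set" assume I: "finite I"
    have "F (Max (insert 0 I)) \<subseteq> F 0 \<inter> (\<Inter>i\<in>I. F i)" using I by (intro Int_greatest INT_greatest dec) auto
    then show "F 0 \<inter> (\<Inter>i\<in>I. F i) \<noteq> {}" using assms(3)[of "Max (insert 0 I)"] by blast
  qed
  then show ?thesis by blast
qed

text \<open>Maximise first the negative of the integral of \<open>f\<close> and then, successively,
  the values on all clopen sets. Each step selects a compact face of the set of means. A mean that
  survives all steps is extreme, because the parts of a convex decomposition stay in every face and
  so have the same values.\<close>

lemma extreme_mean_le:
  assumes m0: "invariant_mean m0" shows "\<exists>m. extreme_mean m \<and> content_integral X m f \<le> content_integral X m0 f"
proof -
  define \<phi> where "\<phi> n m = (case n of 0 \<Rightarrow> - content_integral X m f | Suc i \<Rightarrow> m (clopen_enum i))" for n and m :: "'a set \<Rightarrow> real"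
  define G where "G = rec_nat {m. invariant_mean m} (\<lambda>n K. {m\<in>K. \<forall>m'\<in>K. \<phi> n m' \<le> \<phi> n m})"
  have G0: "G 0 = {m. invariant_mean m}" and GS: "G (Suc n) = {m\<in>G n. \<forall>m'\<in>G n. \<phi> n m' \<le> \<phi> n m}" for n
    by (simp_all add: G_def)
  have c\<phi>: "continuous_on UNIV (\<phi> n)" for n
    unfolding \<phi>_def by (cases n) (auto intro!: continuous_on_minus continuous_content_integral continuous_eval)
  have cl: "closed {m. \<forall>m'\<in>K. \<phi> n m' \<le> \<phi> n m}" for n K
  proof -
    have "{m. \<forall>m'\<in>K. \<phi> n m' \<le> \<phi> n m} = (\<Inter>m'\<in>K. {m. \<phi> n m' \<le> \<phi> n m})" by blast
    then show ?thesis using c\<phi> by (simp add: closed_INT closed_Collect_le)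
  qed
  have K: "compact (G n) \<and> closed (G n) \<and> G n \<noteq> {}" for n
  proof (induction n)
    case 0
    show ?case using compact_almost_invariant_means[of 0] closed_almost_invariant_means[of 0] m0 unfolding G0 almost_invariant_means_0 by blast
  next
    case (Suc n)
    have e: "G (Suc n) = G n \<inter> {m. \<forall>m'\<in>G n. \<phi> n m' \<le> \<phi> n m}" unfolding GS by blast
    obtain m where "m \<in> G n" "\<forall>m'\<in>G n. \<phi> n m' \<le> \<phi> n m"
      using continuous_attains_sup[of "G n" "\<phi> n"] Suc continuous_on_subset[OF c\<phi>] by blast
    then have "G (Suc n) \<noteq> {}" unfolding GS by blast
    then show ?case using Suc cl unfolding e by (simp add: compact_Int_closed closed_Int)
  qed
  have "(\<Inter>n. G n) \<noteq> {}" by (rule compact_nested) (use K GS in auto)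
  then obtain m where m: "\<And>n. m \<in> G n" by blast
  have mm: "invariant_mean m" using m[of 0] G0 by simp
  have "extreme_mean m"
    unfolding extreme_mean_def
  proof (intro conjI allI impI)
    fix m1 m2 t assume m12: "invariant_mean m1" "invariant_mean m2" and t: "0 < t" "t < (1::real)"
      and eq: "\<forall>A. m A = t * m1 A + (1 - t) * m2 A"
    have lin: "\<phi> n m = t * \<phi> n m1 + (1 - t) * \<phi> n m2" for n
      using eq content_integral_convex[of m t m1 m2 f] by (cases n) (simp_all add: \<phi>_def algebra_simps)
    have le: "u = w \<and> v = w" if "w = t * u + (1 - t) * v" "u \<le> w" "v \<le> w" for u v w :: real
    proof -
      have "t * (w - u) + (1 - t) * (w - v) = 0" using that(1) by (simp add: algebra_simps)
      moreover have "0 \<le> t * (w - u)" "0 \<le> (1 - t) * (w - v)" using that t by simp_all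
      ultimately have "t * (w - u) = 0" "(1 - t) * (w - v) = 0" by linarith+
      then show ?thesis using t by simp
    qed
    have G12: "m1 \<in> G n \<and> m2 \<in> G n \<and> \<phi> n m1 = \<phi> n m" for n
    proof (induction n)
      case 0
      have "m1 \<in> G 0" "m2 \<in> G 0" using m12 G0 by simp_all
      moreover from this have "\<phi> 0 m1 \<le> \<phi> 0 m" "\<phi> 0 m2 \<le> \<phi> 0 m" using m[of "Suc 0"] unfolding GS by blast+
      ultimately show ?case using le[OF lin[of 0]] by blast
    next
      case (Suc n)
      have "\<phi> n m1 \<le> \<phi> n m" "\<phi> n m2 \<le> \<phi> n m" using Suc m[of "Suc n"] unfolding GS by blast+
      then have "\<phi> n m1 = \<phi> n m" "\<phi> n m2 = \<phi> n m" using le[OF lin[of n]] by blast+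
      then have "m1 \<in> G (Suc n)" "m2 \<in> G (Suc n)" using Suc m[of "Suc n"] unfolding GS by simp_all
      moreover from this have "\<phi> (Suc n) m1 \<le> \<phi> (Suc n) m" "\<phi> (Suc n) m2 \<le> \<phi> (Suc n) m"
        using m[of "Suc (Suc n)"] unfolding GS[of "Suc n"] by blast+
      ultimately show ?case using le[OF lin[of "Suc n"]] by blast
    qed
    show "m1 = m"
    proof
      fix A show "m1 A = m A"
      proof (cases "clopen_in X A")
        case True
        then obtain i where "clopen_enum i = A" using clopen_enum_surj by blast
        then show ?thesis using G12[of "Suc i"] by (simp add: \<phi>_def)
      next
        case False
        then show ?thesis using m12(1) mm invariant_contentD(2)[of m1 A] invariant_contentD(2)[of m A] by (simp add: invariant_mean_def)
      qed
    qed
  qed (rule mm)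
  moreover have "content_integral X m f \<le> content_integral X m0 f"
    using m[of "Suc 0"] m0 unfolding GS G0 by (simp add: \<phi>_def)
  ultimately show ?thesis by blast
qed

text \<open>The Krylov-Bogolyubov argument: averages over long orbit segments with nonpositive sums
  are almost invariant, and nested compact sets provide a limit that is invariant.\<close>

lemma invariant_mean_of_sums:
  assumes f: "loc_const X (f :: 'a \<Rightarrow> real)" and bad: "\<And>N. \<exists>n\<ge>N. \<exists>x\<in>XX. (\<Sum>i<n. f ((S ^^ i) x)) \<le> 0"
  shows "\<exists>m. invariant_mean m \<and> content_integral X m f \<le> 0"
proof -
  define D where "D N = almost_invariant_means (1 / real (Suc N)) \<inter> {m. content_integral X m f \<le> 0}" for N
  have clD: "closed {m. content_integral X m f \<le> 0}"
    by (intro closed_Collect_le continuous_content_integral continuous_on_const)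
  have "(\<Inter>N. D N) \<noteq> {}"
  proof (rule compact_nested)
    fix N
    show "compact (D N)" unfolding D_def by (rule compact_Int_closed[OF compact_almost_invariant_means clD])
    show "closed (D N)" unfolding D_def by (rule closed_Int[OF closed_almost_invariant_means clD])
    have "1 / real (Suc (Suc N)) \<le> 1 / real (Suc N)" by (simp add: frac_le)
    then have "almost_invariant_means (1 / real (Suc (Suc N))) \<subseteq> almost_invariant_means (1 / real (Suc N))"
      unfolding almost_invariant_means_def using order_trans by blast
    then show "D (Suc N) \<subseteq> D N" unfolding D_def by blast
    obtain n x where n: "n \<ge> Suc N" and x: "x \<in> XX" and s: "(\<Sum>i<n. f ((S ^^ i) x)) \<le> 0" using bad[of "Suc N"] by blast
    have n0: "0 < real n" using n by simp
    define b where "b i A = (if (S ^^ i) x \<in> A then 1 else 0 :: real)" for i A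
    \<comment> \<open>The average over the orbit segment; its defect of invariance telescopes to two
      boundary terms and is at most 1/n.\<close>
    define u where "u A = (if clopen_in X A then (\<Sum>i<n. b i A) / real n else 0)" for A
    have "u \<in> almost_invariant_means (1 / real (Suc N))"
      unfolding almost_invariant_means_def
    proof (intro CollectI conjI allI impI)
      fix A
      show "0 \<le> u A" by (auto simp: u_def b_def intro!: divide_nonneg_nonneg sum_nonneg)
      have "(\<Sum>i<n. b i A) \<le> (\<Sum>i<n. 1)" by (rule sum_mono) (simp add: b_def)
      then show "u A \<le> 1" using n0 by (simp add: u_def)
      show "\<not> clopen_in X A \<Longrightarrow> u A = 0" by (simp add: u_def)
      show "u (A \<union> B) = u A + u B" if "clopen_in X A" "clopen_in X B" "A \<inter> B = {}" for B
      proof -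
        have "b i (A \<union> B) = b i A + b i B" for i using that(3) by (auto simp: b_def)
        then show ?thesis using that(1,2) by (simp add: u_def clopen_in_Un sum.distrib add_divide_distrib)
      qed
      show "\<bar>u {x\<in>XX. S x \<in> A} - u A\<bar> \<le> 1 / real (Suc N)" if A: "clopen_in X A"
      proof -
        have c: "clopen_in X {x\<in>XX. S x \<in> A}" by (rule clopen_in_vimage[OF hom A])
        have "b i {x\<in>XX. S x \<in> A} = b (Suc i) A" for i using Sn_in[OF x, of i] by (simp add: b_def)
        then have "u {x\<in>XX. S x \<in> A} - u A = (\<Sum>i<n. b (Suc i) A - b i A) / real n"
          using A c by (simp add: u_def sum_subtractf diff_divide_distrib)
        also have "(\<Sum>i<n. b (Suc i) A - b i A) = b n A - b 0 A" by (rule sum_lessThan_telescope)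
        finally have "\<bar>u {x\<in>XX. S x \<in> A} - u A\<bar> \<le> 1 / real n"
          using n0 by (simp add: b_def)
        also have "\<dots> \<le> 1 / real (Suc N)" using n by (intro divide_left_mono) auto
        finally show ?thesis .
      qed
      have "b i XX = 1" for i using Sn_in[OF x] by (simp add: b_def)
      then show "u XX = 1" using n0 by (simp add: u_def)
    qed
    moreover have "content_integral X u f \<le> 0"
    proof -
      have fin: "finite (f ` XX)" using f by (simp add: loc_const_def)
      have "content_integral X u f = (\<Sum>c\<in>f ` XX. \<Sum>i<n. c * b i {x\<in>XX. f x = c}) / real n"
        using f by (simp add: content_integral_def u_def loc_const_def sum_distrib_left sum_divide_distrib)
      also have "(\<Sum>c\<in>f ` XX. \<Sum>i<n. c * b i {x\<in>XX. f x = c}) = (\<Sum>i<n. \<Sum>c\<in>f ` XX. c * b i {x\<in>XX. f x = c})"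
        by (rule sum.swap)
      also have "\<dots> = (\<Sum>i<n. f ((S ^^ i) x))"
      proof (rule sum.cong[OF refl])
        fix i
        have "(\<Sum>c\<in>f ` XX. c * b i {x\<in>XX. f x = c}) = (\<Sum>c\<in>f ` XX. if c = f ((S ^^ i) x) then c else 0)"
          using Sn_in[OF x, of i] by (intro sum.cong) (auto simp: b_def)
        also have "\<dots> = f ((S ^^ i) x)" using fin Sn_in[OF x, of i] by (simp add: sum.delta)
        finally show "(\<Sum>c\<in>f ` XX. c * b i {x\<in>XX. f x = c}) = f ((S ^^ i) x)" .
      qed
      finally show ?thesis using s n0 by (simp add: divide_le_0_iff)
    qed
    ultimately show "D N \<noteq> {}" unfolding D_def by blast
  qed
  then obtain m where m: "\<And>N. m \<in> D N" by blast
  have "m \<in> almost_invariant_means 0"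
    unfolding almost_invariant_means_def
  proof (intro CollectI conjI)
    show "\<forall>A. clopen_in X A \<longrightarrow> \<bar>m {x\<in>XX. S x \<in> A} - m A\<bar> \<le> 0"
    proof (intro allI impI)
      fix A assume A: "clopen_in X A"
      have "\<bar>m {x\<in>XX. S x \<in> A} - m A\<bar> \<le> 1 / real (Suc N)" for N
        using m[of N] A unfolding D_def almost_invariant_means_def by blast
      then have "\<not> 0 < \<bar>m {x\<in>XX. S x \<in> A} - m A\<bar>"
        using nat_approx_posE by (metis not_less)
      then show "\<bar>m {x\<in>XX. S x \<in> A} - m A\<bar> \<le> 0" by simp
    qed
  qed (use m[of 0] in \<open>unfold D_def almost_invariant_means_def, blast+\<close>)
  then show ?thesis using m[of 0] almost_invariant_means_0 by (intro exI[of _ m]) (simp add: D_def)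
qed

text \<open>Failure would produce an invariant mean with nonpositive integral, and then an extreme
  one.\<close>

lemma eventually_positive:
  assumes f: "loc_const X (f :: 'a \<Rightarrow> real)" and pos: "\<And>m. extreme_mean m \<Longrightarrow> 0 < content_integral X m f"
  shows "\<exists>N. \<forall>n\<ge>N. \<forall>x\<in>XX. 0 < (\<Sum>i<n. f ((S ^^ i) x))"
proof (rule ccontr)
  assume "\<not> ?thesis"
  then have "\<And>N. \<exists>n\<ge>N. \<exists>x\<in>XX. (\<Sum>i<n. f ((S ^^ i) x)) \<le> 0" by (meson not_less)
  then obtain m0 where m0: "invariant_mean m0" "content_integral X m0 f \<le> 0" using invariant_mean_of_sums[OF f] by blast
  obtain m where "extreme_mean m" "content_integral X m f \<le> content_integral X m0 f" using extreme_mean_le[OF m0(1)] by blast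
  then show False using pos[of m] m0(2) by simp
qed

text \<open>The normalisations of \<open>w\<close> and of the difference between
  \<open>\<mu>\<close> and \<open>w\<close> exhibit \<open>\<mu>\<close> as a convex
  combination.\<close>

lemma extreme_mean_sub:
  assumes \<mu>: "extreme_mean \<mu>" and w: "invariant_content w" and le: "\<And>A. w A \<le> \<mu> A" and c: "0 < w XX"
  shows "w A = w XX * \<mu> A"
proof -
  have m: "invariant_mean \<mu>" using \<mu> by (simp add: extreme_mean_def)
  then have p: "invariant_content \<mu>" and m1: "\<mu> XX = 1" by (simp_all add: invariant_mean_def)
  have c1: "w XX \<le> 1" using le[of XX] m1 by simp
  have d: "invariant_content (\<lambda>A. \<mu> A - w A)"
    unfolding invariant_content_def using le invariant_contentD[OF p] invariant_contentD[OF w] by (auto simp: algebra_simps)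
  show ?thesis
  proof (cases "w XX = 1")
    case True
    have "\<mu> A - w A \<le> \<mu> XX - w XX" using invariant_content_le[OF d] .
    then show ?thesis using True m1 le[of A] by simp
  next
    case False
    have m1': "invariant_mean (\<lambda>A. w A / w XX)"
      unfolding invariant_mean_def invariant_content_def using invariant_contentD[OF w] c by (auto simp: add_divide_distrib)
    have m2': "invariant_mean (\<lambda>A. (\<mu> A - w A) / (1 - w XX))"
      unfolding invariant_mean_def invariant_content_def using invariant_contentD[OF d] c1 False m1 by (auto simp: add_divide_distrib[symmetric])
    have "\<mu> A = w XX * (w A / w XX) + (1 - w XX) * ((\<mu> A - w A) / (1 - w XX))" for A using c False by simp
    then have "(\<lambda>A. w A / w XX) = \<mu>"
      using \<mu> m1' m2' c c1 False unfolding extreme_mean_def by (auto dest!: spec)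
    then have "w A / w XX = \<mu> A" by (rule fun_cong)
    then show ?thesis using c by (simp add: field_simps)
  qed
qed

text \<open>The infimum \<open>w\<close> is the lattice meet of \<open>\<mu>\<close> and
  \<open>\<nu>\<close>, again an invariant content. Lying below both, a nonzero meet would be a
  multiple of each of the two extreme means, which would make them equal. So the meet vanishes on
  the whole space, and a set \<open>B\<close> that nearly attains the infimum separates the
  two.\<close>

lemma extreme_mean_singular:
  assumes \<mu>: "extreme_mean \<mu>" and \<nu>: "extreme_mean \<nu>" and ne: "\<mu> \<noteq> \<nu>" and e: "0 < e"
  shows "\<exists>B. clopen_in X B \<and> \<mu> B < e \<and> \<nu> (XX - B) < e"
proof -
  have p: "invariant_content \<mu>" "invariant_content \<nu>" and one: "\<mu> XX = 1" "\<nu> XX = 1" using \<mu> \<nu> by (simp_all add: extreme_mean_def invariant_mean_def)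
  define J where "J A = {\<mu> B + \<nu> (A - B) | B. clopen_in X B \<and> B \<subseteq> A}" for A
  define w where "w A = (if clopen_in X A then Inf (J A) else 0)" for A
  have bdd: "bdd_below (J A)" for A
    by (rule bdd_belowI[of _ 0]) (auto simp: J_def intro: add_nonneg_nonneg invariant_contentD(1)[OF p(1)] invariant_contentD(1)[OF p(2)])
  have wle: "w A \<le> \<mu> B + \<nu> (A - B)" if "clopen_in X A" "clopen_in X B" "B \<subseteq> A" for A B
    unfolding w_def using that bdd[of A] by (auto simp: J_def intro!: cInf_lower)
  have wge: "c \<le> w A" if "clopen_in X A" "\<And>B. clopen_in X B \<Longrightarrow> B \<subseteq> A \<Longrightarrow> c \<le> \<mu> B + \<nu> (A - B)" for A c
  proof -
    have "J A \<noteq> {}" using that(1) by (auto simp: J_def)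
    then have "c \<le> Inf (J A)" by (rule cInf_greatest) (use that(2) in \<open>auto simp: J_def\<close>)
    then show ?thesis using that(1) by (simp add: w_def)
  qed
  have w0: "0 \<le> w A" for A
    using wge[of A 0] invariant_contentD(1)[OF p(1)] invariant_contentD(1)[OF p(2)] by (cases "clopen_in X A") (auto simp: w_def[of A] intro: add_nonneg_nonneg)
  have wa: "w (A \<union> A') = w A + w A'" if A: "clopen_in X A" "clopen_in X A'" "A \<inter> A' = {}" for A A'
  proof (rule antisym)
    have sub: "w (A \<union> A') \<le> \<mu> B + \<nu> (A - B) + (\<mu> B' + \<nu> (A' - B'))"
      if B: "clopen_in X B" "B \<subseteq> A" "clopen_in X B'" "B' \<subseteq> A'" for B B'
    proof -
      have "w (A \<union> A') \<le> \<mu> (B \<union> B') + \<nu> ((A \<union> A') - (B \<union> B'))"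
        using A B by (intro wle clopen_in_Un) auto
      also have "\<mu> (B \<union> B') = \<mu> B + \<mu> B'" using A B by (intro invariant_contentD(3)[OF p(1)]) auto
      also have "(A \<union> A') - (B \<union> B') = (A - B) \<union> (A' - B')" using A(3) B by blast
      also have "\<nu> \<dots> = \<nu> (A - B) + \<nu> (A' - B')" using A B by (intro invariant_contentD(3)[OF p(2)] clopen_in_Diff) auto
      finally show ?thesis by simp
    qed
    have "w (A \<union> A') - w A' \<le> w A"
    proof (rule wge[OF A(1)])
      fix B assume B: "clopen_in X B" "B \<subseteq> A"
      have "w (A \<union> A') - (\<mu> B + \<nu> (A - B)) \<le> w A'"
        using sub[OF B] by (intro wge[OF A(2)]) (simp add: algebra_simps)
      then show "w (A \<union> A') - w A' \<le> \<mu> B + \<nu> (A - B)" by simp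
    qed
    then show "w (A \<union> A') \<le> w A + w A'" by simp
    show "w A + w A' \<le> w (A \<union> A')"
    proof (rule wge[OF clopen_in_Un[OF A(1,2)]])
      fix B assume B: "clopen_in X B" "B \<subseteq> A \<union> A'"
      have "\<mu> B = \<mu> (B \<inter> A) + \<mu> (B \<inter> A')"
        using invariant_contentD(3)[OF p(1) clopen_in_Int[OF B(1) A(1)] clopen_in_Int[OF B(1) A(2)]] A(3) B(2)
        by (metis Int_Un_distrib Int_absorb2 inf.left_commute inf_bot_right inf_assoc)
      moreover have "\<nu> (A \<union> A' - B) = \<nu> (A - B \<inter> A) + \<nu> (A' - B \<inter> A')"
      proof -
        have "A \<union> A' - B = (A - B \<inter> A) \<union> (A' - B \<inter> A')" by blast
        then show ?thesis using A B by (simp only:) (intro invariant_contentD(3)[OF p(2)] clopen_in_Diff clopen_in_Int, auto)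
      qed
      moreover have "w A \<le> \<mu> (B \<inter> A) + \<nu> (A - B \<inter> A)" using A B by (intro wle clopen_in_Int) auto
      moreover have "w A' \<le> \<mu> (B \<inter> A') + \<nu> (A' - B \<inter> A')" using A B by (intro wle clopen_in_Int) auto
      ultimately show "w A + w A' \<le> \<mu> B + \<nu> (A \<union> A' - B)" by simp
    qed
  qed
  let ?v = "\<lambda>A. {x\<in>XX. S x \<in> A}"
  have wi: "w (?v A) = w A" if A: "clopen_in X A" for A
  proof (rule antisym)
    have cv: "clopen_in X (?v B)" if "clopen_in X B" for B by (rule clopen_in_vimage[OF hom that])
    have vv: "\<mu> (?v B) + \<nu> (?v A - ?v B) = \<mu> B + \<nu> (A - B)" if B: "clopen_in X B" for B
    proof -
      have "?v A - ?v B = ?v (A - B)" by blast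
      then show ?thesis using invariant_contentD(4)[OF p(1) B] invariant_contentD(4)[OF p(2) clopen_in_Diff[OF A B]] by simp
    qed
    show "w (?v A) \<le> w A"
    proof (rule wge[OF A])
      fix B assume B: "clopen_in X B" "B \<subseteq> A"
      have "w (?v A) \<le> \<mu> (?v B) + \<nu> (?v A - ?v B)" using B by (intro wle cv A) auto
      then show "w (?v A) \<le> \<mu> B + \<nu> (A - B)" using vv[OF B(1)] by simp
    qed
    show "w A \<le> w (?v A)"
    proof (rule wge[OF cv[OF A]])
      fix B assume B: "clopen_in X B" "B \<subseteq> ?v A"
      have SB: "clopen_in X (S ` B)" by (rule clopen_in_image[OF hom B(1)])
      have "?v (S ` B) = B" using S_inj B clopen_in_subset[OF B(1)] by blast
      moreover have "w A \<le> \<mu> (S ` B) + \<nu> (A - S ` B)" using B SB by (intro wle A) auto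
      ultimately show "w A \<le> \<mu> B + \<nu> (?v A - B)" using vv[OF SB] by simp
    qed
  qed
  have wp: "invariant_content w" unfolding invariant_content_def using w0 wa wi by (simp add: w_def)
  have w\<mu>: "w A \<le> \<mu> A" for A
    using wle[of A A] invariant_content_empty[OF p(2)] invariant_contentD(1)[OF p(1), of A] by (cases "clopen_in X A") (auto simp: w_def)
  have w\<nu>: "w A \<le> \<nu> A" for A
    using wle[of A "{}"] invariant_content_empty[OF p(1)] invariant_contentD(1)[OF p(2), of A] by (cases "clopen_in X A") (auto simp: w_def)
  have "\<not> 0 < w XX"
  proof
    assume c: "0 < w XX"
    have "\<mu> A = \<nu> A" for A using extreme_mean_sub[OF \<mu> wp w\<mu> c, of A] extreme_mean_sub[OF \<nu> wp w\<nu> c, of A] c by simp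
    then show False using ne by blast
  qed
  then have "\<not> e \<le> w XX" using e by simp
  then obtain B where B: "clopen_in X B" "B \<subseteq> XX" "\<mu> B + \<nu> (XX - B) < e" using wge[OF clopen_in_topspace, of e] by (meson not_less)
  then show ?thesis using invariant_contentD(1)[OF p(1), of B] invariant_contentD(1)[OF p(2), of "XX - B"] by (intro exI[of _ B]) simp
qed

end

section \<open>Extreme means and ergodic measures\<close>

context minimal_system
begin

text \<open>The clopen sets form a countable base, so every open set is a countable union of
  them.\<close>

lemma sigma_sets_clopen: "sigma_sets XX {U. openin X U} = sigma_sets XX {A. clopen_in X A}"
proof (rule sigma_sets_eqI)
  fix U assume "U \<in> {U. openin X U}"
  then have U: "openin X U" by simp
  have "U = (\<Union>i. if clopen_enum i \<subseteq> U then clopen_enum i else {})"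
  proof
    show "U \<subseteq> (\<Union>i. if clopen_enum i \<subseteq> U then clopen_enum i else {})"
    proof
      fix x assume "x \<in> U"
      then obtain V where V: "clopen_in X V" "x \<in> V" "V \<subseteq> U" using clopen_in_base[OF U] by blast
      then obtain i where "clopen_enum i = V" using clopen_enum_surj by blast
      then show "x \<in> (\<Union>i. if clopen_enum i \<subseteq> U then clopen_enum i else {})" using V by (intro UN_I[of i]) auto
    qed
  qed (auto split: if_splits)
  moreover have "(\<Union>i. if clopen_enum i \<subseteq> U then clopen_enum i else {}) \<in> sigma_sets XX {A. clopen_in X A}"
    by (rule sigma_sets.Union) (auto intro: sigma_sets.Basic sigma_sets.Empty clopen_in_clopen_enum)
  ultimately show "U \<in> sigma_sets XX {A. clopen_in X A}" by simp
qed (auto simp: clopen_in_def)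

lemma Int_stable_clopen: "Int_stable {A. clopen_in X A}"
  by (auto simp: Int_stable_def intro: clopen_in_Int)

lemma clopen_in_Pow: "{A. clopen_in X A} \<subseteq> Pow XX"
  using clopen_in_subset by blast

text \<open>By compactness a decreasing sequence of clopen sets with empty intersection is
  eventually empty, so the Caratheodory extension applies. Invariance passes to the extension
  because the clopen sets form an intersection-stable generator.\<close>

lemma invariant_mean_extends:
  assumes m: "invariant_mean m"
  shows "\<exists>M. invariant_Borel_prob X S M \<and> (\<forall>A. clopen_in X A \<longrightarrow> emeasure M A = ennreal (m A))"
proof -
  have p: "invariant_content m" and m1: "m XX = 1" using m by (simp_all add: invariant_mean_def)
  let ?G = "{A. clopen_in X A}"
  have ring: "ring_of_sets XX ?G"
    unfolding ring_of_sets_iff using clopen_in_subset by (auto intro: clopen_in_Un clopen_in_Diff)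
  have "\<exists>\<mu> :: 'a set \<Rightarrow> ennreal. (\<forall>s\<in>?G. \<mu> s = ennreal (m s)) \<and> measure_space XX (sigma_sets XX ?G) \<mu>"
  proof (rule ring_of_sets.caratheodory_empty_continuous[OF ring])
    show "positive ?G (\<lambda>s. ennreal (m s))" using invariant_content_empty[OF p] by (simp add: positive_def)
    show "additive ?G (\<lambda>s. ennreal (m s))"
      unfolding additive_def using invariant_contentD(1,3)[OF p] by (simp add: ennreal_plus)
    fix A :: "nat \<Rightarrow> 'a set" assume A: "range A \<subseteq> ?G" "decseq A" "(\<Inter>i. A i) = {}"
    have "\<exists>n. A n = {}"
    proof (rule ccontr)
      assume "\<nexists>n. A n = {}"
      then have "(\<Inter>n. A n) \<noteq> {}" using A(1,2) by (intro clopen_in_nest) (auto simp: decseq_Suc_iff)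
      then show False using A(3) by simp
    qed
    then obtain N where N: "A N = {}" by blast
    have "ennreal (m (A n)) = 0" if "n \<ge> N" for n
    proof -
      have "A n = {}" using decseqD[OF A(2) that] N by blast
      then show ?thesis using invariant_content_empty[OF p] by simp
    qed
    then show "(\<lambda>i. ennreal (m (A i))) \<longlonglongrightarrow> 0"
      by (intro tendsto_eventually eventually_sequentiallyI) blast
  qed simp
  then obtain \<mu> :: "'a set \<Rightarrow> ennreal" where \<mu>: "\<forall>s\<in>?G. \<mu> s = ennreal (m s)" and ms: "measure_space XX (sigma_sets XX ?G) \<mu>"
    by blast
  define M where "M = measure_of XX (sigma_sets XX ?G) \<mu>"
  have sub: "sigma_sets XX ?G \<subseteq> Pow XX" using clopen_in_Pow sigma_sets_into_sp by blast
  have sp: "space M = XX" unfolding M_def using sub by (rule space_measure_of)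
  have se: "sets M = sigma_sets XX ?G"
    unfolding M_def using sub clopen_in_Pow by (simp add: sets_measure_of sigma_sets_sigma_sets_eq)
  have em: "emeasure M A = ennreal (m A)" if "clopen_in X A" for A
  proof -
    have "emeasure M A = \<mu> A"
      unfolding M_def using ms that by (intro emeasure_measure_of_sigma) (auto simp: measure_space_def)
    then show ?thesis using \<mu> that by simp
  qed
  have pr: "prob_space M" by (rule prob_spaceI) (simp add: sp em m1)
  have vS: "S -` A \<inter> space M = {x\<in>XX. S x \<in> A}" for A using sp by blast
  have cv: "clopen_in X {x\<in>XX. S x \<in> A}" if "clopen_in X A" for A by (rule clopen_in_vimage[OF hom that])
  have SM: "S \<in> M \<rightarrow>\<^sub>M M"
  proof (rule measurable_sigma_sets[OF se clopen_in_Pow])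
    show "S \<in> space M \<rightarrow> XX" using S_in sp by simp
    show "S -` A \<inter> space M \<in> sets M" if "A \<in> ?G" for A
      unfolding vS se using cv that by (intro sigma_sets.Basic) simp
  qed
  have "M = distr M M S"
  proof (rule measure_eqI_generator_eq[OF Int_stable_clopen clopen_in_Pow])
    fix A assume "A \<in> ?G"
    then have A: "clopen_in X A" by simp
    then have "A \<in> sets M" unfolding se by auto
    then have "emeasure (distr M M S) A = emeasure M {x\<in>XX. S x \<in> A}"
      using SM by (simp add: emeasure_distr vS)
    then show "emeasure M A = emeasure (distr M M S) A" using em A cv invariant_contentD(4)[OF p A] by simp
  next
    show "range (\<lambda>_::nat. XX) \<subseteq> ?G" by auto
  qed (use em m1 se in auto)
  from this[symmetric] show ?thesis
    unfolding invariant_Borel_prob_def using sp se pr SM em sigma_sets_clopen by (intro exI[of _ M]) simp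
qed

lemma invariant_measure:
  assumes M: "invariant_Borel_prob X S M"
  shows "clopen_in X A \<Longrightarrow> A \<in> sets M" "A \<in> sets M \<Longrightarrow> {x\<in>XX. S x \<in> A} \<in> sets M"
    "A \<in> sets M \<Longrightarrow> emeasure M {x\<in>XX. S x \<in> A} = emeasure M A"
    "closedin X A \<Longrightarrow> A \<in> sets M" "sets M = sigma_sets XX {A. clopen_in X A}"
proof -
  have sp: "space M = XX" and se: "sets M = sigma_sets XX {U. openin X U}" and SM: "S \<in> M \<rightarrow>\<^sub>M M" and d: "distr M M S = M"
    using M unfolding invariant_Borel_prob_def by blast+
  show "clopen_in X A \<Longrightarrow> A \<in> sets M" unfolding se clopen_in_def by auto
  show "sets M = sigma_sets XX {A. clopen_in X A}" using se sigma_sets_clopen by simp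
  show "A \<in> sets M" if "closedin X A"
  proof -
    have "XX - (XX - A) \<in> sigma_sets XX {U. openin X U}"
      using that by (intro sigma_sets.Compl sigma_sets.Basic) (simp add: closedin_def)
    moreover have "XX - (XX - A) = A" using closedin_subset[OF that] by blast
    ultimately show ?thesis by (simp add: se)
  qed
  have v: "S -` A \<inter> space M = {x\<in>XX. S x \<in> A}" using sp by blast
  show "{x\<in>XX. S x \<in> A} \<in> sets M" if "A \<in> sets M" using measurable_sets[OF SM that] v by simp
  show "emeasure M {x\<in>XX. S x \<in> A} = emeasure M A" if "A \<in> sets M"
    using emeasure_distr[OF SM that] d v by simp
qed

text \<open>An invariant set \<open>A\<close> of intermediate measure splits \<open>m\<close> into
  the means conditioned on \<open>A\<close> and on its complement. Extremality makes conditioning on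
  \<open>A\<close> trivial on clopen sets, hence on Borel sets, and the complement of
  \<open>A\<close> gives a contradiction.\<close>

lemma extreme_mean_ergodic:
  assumes m: "extreme_mean m" and M: "invariant_Borel_prob X S M" and em: "\<And>A. clopen_in X A \<Longrightarrow> emeasure M A = ennreal (m A)"
  shows "ergodic_measure X S M"
  unfolding ergodic_measure_def
proof (intro conjI ballI impI M)
  note iM = invariant_measure[OF M]
  fix A assume A: "A \<in> sets M" "S -` A \<inter> space M = A"
  have sp: "space M = XX" and pr: "prob_space M" using M by (simp_all add: invariant_Borel_prob_def)
  interpret prob_space M by (rule pr)
  have mm: "invariant_mean m" and p: "invariant_content m" using m by (simp_all add: extreme_mean_def invariant_mean_def)
  have me: "measure M C = m C" if "clopen_in X C" for C
    using em[OF that] invariant_contentD(1)[OF p] by (simp add: measure_def)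
  have SA: "S x \<in> A \<longleftrightarrow> x \<in> A" if "x \<in> XX" for x using A(2) that sp by blast
  have AX: "A \<subseteq> XX" using sets.sets_into_space[OF A(1)] sp by simp
  show "measure M A = 0 \<or> measure M A = 1"
  proof (rule ccontr)
    assume "\<not> (measure M A = 0 \<or> measure M A = 1)"
    then have t: "0 < measure M A" "measure M A < 1"
      using measure_nonneg[of M A] prob_le_1[of A] by linarith+
    have invariant_mean_cond: "invariant_mean (\<lambda>C. if clopen_in X C then measure M (C \<inter> D) / measure M D else 0)"
      if D: "D \<in> sets M" "0 < measure M D" "\<And>x. x \<in> XX \<Longrightarrow> S x \<in> D \<longleftrightarrow> x \<in> D" for D
      unfolding invariant_mean_def invariant_content_def
    proof (intro conjI allI impI)
      have DX: "D \<subseteq> XX" using sets.sets_into_space[OF D(1)] sp by simp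
      show "(if clopen_in X XX then measure M (XX \<inter> D) / measure M D else 0) = 1"
        using D(2) DX by (simp add: Int_absorb1)
      fix C
      show "0 \<le> (if clopen_in X C then measure M (C \<inter> D) / measure M D else 0)" by simp
      show "\<not> clopen_in X C \<Longrightarrow> (if clopen_in X C then measure M (C \<inter> D) / measure M D else 0) = 0" by simp
      show "(if clopen_in X (C \<union> B) then measure M ((C \<union> B) \<inter> D) / measure M D else 0) =
          (if clopen_in X C then measure M (C \<inter> D) / measure M D else 0) + (if clopen_in X B then measure M (B \<inter> D) / measure M D else 0)"
        if "clopen_in X C" "clopen_in X B" "C \<inter> B = {}" for B
      proof -
        have "measure M ((C \<inter> D) \<union> (B \<inter> D)) = measure M (C \<inter> D) + measure M (B \<inter> D)"
          using that D(1) iM(1) by (intro finite_measure_Union) auto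
        then show ?thesis using that by (simp add: clopen_in_Un Int_Un_distrib2 add_divide_distrib)
      qed
      show "(if clopen_in X {x\<in>XX. S x \<in> C} then measure M ({x\<in>XX. S x \<in> C} \<inter> D) / measure M D else 0) =
          (if clopen_in X C then measure M (C \<inter> D) / measure M D else 0)" if C: "clopen_in X C"
      proof -
        have "{x\<in>XX. S x \<in> C} \<inter> D = {x\<in>XX. S x \<in> C \<inter> D}" using D(3) DX by blast
        then have "measure M ({x\<in>XX. S x \<in> C} \<inter> D) = measure M (C \<inter> D)"
          using iM(3)[of "C \<inter> D"] D(1) iM(1)[OF C] by (simp add: measure_def)
        then show ?thesis using C clopen_in_vimage[OF hom C] by simp
      qed
    qed
    have cA: "measure M (XX - A) = 1 - measure M A" using prob_compl[OF A(1)] sp by simp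
    have m1: "invariant_mean (\<lambda>C. if clopen_in X C then measure M (C \<inter> A) / measure M A else 0)"
      using invariant_mean_cond[OF A(1) t(1)] SA by blast
    have m2: "invariant_mean (\<lambda>C. if clopen_in X C then measure M (C \<inter> (XX - A)) / measure M (XX - A) else 0)"
      using A(1) SA S_in cA t(2) sets.compl_sets[OF A(1)] sp by (intro invariant_mean_cond) auto
    have "m C = measure M A * (if clopen_in X C then measure M (C \<inter> A) / measure M A else 0) +
        (1 - measure M A) * (if clopen_in X C then measure M (C \<inter> (XX - A)) / measure M (XX - A) else 0)" for C
    proof (cases "clopen_in X C")
      case True
      have "measure M ((C \<inter> A) \<union> (C \<inter> (XX - A))) = measure M (C \<inter> A) + measure M (C \<inter> (XX - A))"
        using iM(1)[OF True] A(1) sets.compl_sets[OF A(1)] sp by (intro finite_measure_Union) auto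
      moreover have "(C \<inter> A) \<union> (C \<inter> (XX - A)) = C" using clopen_in_subset[OF True] by blast
      ultimately show ?thesis using True t cA me[OF True] by simp
    qed (use invariant_contentD(2)[OF p] in simp)
    then have eq: "(\<lambda>C. if clopen_in X C then measure M (C \<inter> A) / measure M A else 0) = m"
      using m m1 m2 t unfolding extreme_mean_def by blast
    have "measure M (C \<inter> A) / measure M A = m C" if "clopen_in X C" for C
      using fun_cong[OF eq, of C] that by simp
    then have CA: "measure M (A \<inter> C) / measure M A = measure M C" if "clopen_in X C" for C
      using me[OF that] that by (simp add: Int_commute[of A])
    have em0: "emeasure M A \<noteq> 0" using t(1) by (simp add: emeasure_eq_measure)
    have "M = uniform_measure M A"
    proof (rule measure_eqI_generator_eq[OF Int_stable_clopen clopen_in_Pow])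
      have pu: "prob_space (uniform_measure M A)" using em0 by (intro prob_space_uniform_measure) auto
      then interpret U: prob_space "uniform_measure M A" .
      fix C assume "C \<in> {A. clopen_in X A}"
      then have C: "clopen_in X C" by simp
      have "measure (uniform_measure M A) C = measure M (A \<inter> C) / measure M A"
        using em0 iM(1)[OF C] by (intro measure_uniform_measure) auto
      then show "emeasure M C = emeasure (uniform_measure M A) C"
        using CA[OF C] by (simp add: emeasure_eq_measure U.emeasure_eq_measure)
    next
      show "range (\<lambda>_::nat. XX) \<subseteq> {A. clopen_in X A}" by auto
    qed (use iM(5) in simp_all)
    then have "measure M (XX - A) = measure (uniform_measure M A) (XX - A)" by (rule arg_cong)
    also have "\<dots> = measure M (A \<inter> (XX - A)) / measure M A"
      using em0 sets.compl_sets[OF A(1)] sp by (intro measure_uniform_measure) auto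
    finally show False using cA t by simp
  qed
qed

text \<open>Restriction to clopen sets recovers an extreme mean from its ergodic extension.\<close>

lemma finite_extreme_means:
  assumes "finite {M. ergodic_measure X S M}" shows "finite {m. extreme_mean m}"
proof -
  have "m \<in> (\<lambda>M A. if clopen_in X A then measure M A else 0) ` {M. ergodic_measure X S M}" if m: "extreme_mean m" for m
  proof -
    have mm: "invariant_mean m" and p: "invariant_content m" using m by (simp_all add: extreme_mean_def invariant_mean_def)
    obtain M where M: "invariant_Borel_prob X S M" "\<forall>A. clopen_in X A \<longrightarrow> emeasure M A = ennreal (m A)"
      using invariant_mean_extends[OF mm] by blast
    have "m = (\<lambda>A. if clopen_in X A then measure M A else 0)"
      using M(2) invariant_contentD(1,2)[OF p] by (auto simp: measure_def)
    moreover have "ergodic_measure X S M" using extreme_mean_ergodic[OF m M(1)] M(2) by blast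
    ultimately show ?thesis by blast
  qed
  then have "{m. extreme_mean m} \<subseteq> (\<lambda>M A. if clopen_in X A then measure M A else 0) ` {M. ergodic_measure X S M}" by blast
  then show ?thesis by (rule finite_subset[OF _ finite_imageI[OF assms]])
qed

text \<open>Sets separating \<open>e0\<close> from the individual means are intersected; halving the
  tolerance at every step keeps the total loss for \<open>e0\<close> below \<open>d\<close>.\<close>

lemma extreme_mean_separate:
  assumes "finite F" "\<And>e. e \<in> F \<Longrightarrow> extreme_mean e \<and> e \<noteq> e0" "extreme_mean e0" "0 < d"
  shows "\<exists>B. clopen_in X B \<and> e0 (XX - B) < d \<and> (\<forall>e\<in>F. e B < d)"
  using assms(1,2,4)
proof (induction F arbitrary: d rule: finite_induct)
  case empty
  have "invariant_content e0" using assms(3) by (simp add: extreme_mean_def invariant_mean_def)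
  then show ?case using invariant_content_empty[of e0] empty by (intro exI[of _ XX]) simp
next
  case (insert e F)
  have p: "invariant_content e'" if "extreme_mean e'" for e' using that by (simp add: extreme_mean_def invariant_mean_def)
  obtain B where B: "clopen_in X B" "e0 (XX - B) < d / 2" "\<forall>e\<in>F. e B < d / 2"
    using insert.IH[of "d / 2"] insert.prems by auto
  obtain B' where B': "clopen_in X B'" "e B' < d / 2" "e0 (XX - B') < d / 2"
    using extreme_mean_singular[of e e0 "d / 2"] insert.prems assms(3) by auto
  have c: "clopen_in X (B \<inter> B')" by (rule clopen_in_Int[OF B(1) B'(1)])
  have "e0 (XX - B \<inter> B') = e0 ((XX - B) \<union> (B - B'))" using clopen_in_subset[OF B(1)] by (intro arg_cong[of _ _ e0]) blast
  also have "\<dots> = e0 (XX - B) + e0 (B - B')"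
    using B(1) B'(1) by (intro invariant_contentD(3)[OF p[OF assms(3)]] clopen_in_Diff) auto
  also have "e0 (B - B') \<le> e0 (XX - B')"
    using B(1) B'(1) clopen_in_subset[OF B(1)] by (intro invariant_content_mono[OF p[OF assms(3)]] clopen_in_Diff) auto
  finally have "e0 (XX - B \<inter> B') < d" using B(2) B'(3) by simp
  moreover have "e' (B \<inter> B') < d" if e': "e' \<in> insert e F" for e'
  proof (cases "e' = e")
    case True
    then show ?thesis using invariant_content_mono[OF p B'(1) c, of e] insert.prems(1)[of e] B'(2) insert.prems(2) by auto
  next
    case False
    then have "e' \<in> F" using e' by simp
    then show ?thesis using invariant_content_mono[OF p B(1) c, of e'] insert.prems(1)[of e'] B(3) insert.prems(2) by force
  qed
  ultimately show ?case using c by blast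
qed

text \<open>A function with integral 0 for all extreme means has integral 0 for \<open>m\<close>, by
  minimising both it and its negative; linear algebra then yields the coefficients. A negative
  coefficient would make \<open>m\<close> negative on a clopen set that is almost full for its own
  extreme mean and almost null for the others.\<close>

lemma invariant_mean_decomposition:
  assumes fin: "finite {e. extreme_mean e}" and m: "invariant_mean m"
  shows "\<exists>a. (\<forall>e. extreme_mean e \<longrightarrow> 0 \<le> a e) \<and> (\<forall>A. clopen_in X A \<longrightarrow> m A = (\<Sum>e\<in>{e. extreme_mean e}. a e * e A))"
proof -
  let ?E = "{e. extreme_mean e}"
  have p: "invariant_content e" if "extreme_mean e" for e using that by (simp add: extreme_mean_def invariant_mean_def)
  have pm: "invariant_content m" using m by (simp add: invariant_mean_def)
  have lca: "loc_const X (\<lambda>x. f x + a * g x)" if "loc_const X f" "loc_const X g" for f g :: "'a \<Rightarrow> real" and a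
    using loc_const_comp2[OF that, of "\<lambda>u v. u + a * v"] .
  have "\<exists>a. \<forall>f\<in>{f. loc_const X f}. content_integral X m f = (\<Sum>e\<in>?E. a e * content_integral X e f)"
  proof (rule functional_in_span[OF _ fin])
    show "(\<lambda>x. f x + a * g x) \<in> {f. loc_const X f}" if "f \<in> {f. loc_const X f}" "g \<in> {f. loc_const X f}" for f g :: "'a \<Rightarrow> real" and a
      using lca that by simp
    show "content_integral X e (\<lambda>x. f x + a * g x) = content_integral X e f + a * content_integral X e g"
      if "e \<in> ?E" "f \<in> {f. loc_const X f}" "g \<in> {f. loc_const X f}" for e f g a
      using that by (intro content_integral_lin p) auto
    show "content_integral X m (\<lambda>x. f x + a * g x) = content_integral X m f + a * content_integral X m g"
      if "f \<in> {f. loc_const X f}" "g \<in> {f. loc_const X f}" for f g a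
      using that by (intro content_integral_lin pm) auto
    fix f :: "'a \<Rightarrow> real" assume f: "f \<in> {f. loc_const X f}" and z: "\<And>e. e \<in> ?E \<Longrightarrow> content_integral X e f = 0"
    have 1: "0 \<le> content_integral X m f" using extreme_mean_le[OF m, of f] z by force
    \<comment> \<open>f + (-2) f is the negative of f, written in the form to which
      \<open>content_integral_lin\<close> applies.\<close>
    have c: "content_integral X e (\<lambda>x. f x + (-2) * f x) = content_integral X e f + (-2) * content_integral X e f" if "invariant_content e" for e
      using content_integral_lin[OF that, of f f "-2"] f by simp
    obtain e where e: "extreme_mean e" "content_integral X e (\<lambda>x. f x + (-2) * f x) \<le> content_integral X m (\<lambda>x. f x + (-2) * f x)"
      using extreme_mean_le[OF m] by blast
    then have "0 \<le> - content_integral X m f" using c[OF p[OF e(1)]] c[OF pm] z[of e] by simp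
    then show "content_integral X m f = 0" using 1 by simp
  qed
  then obtain a where a: "\<And>f. loc_const X f \<Longrightarrow> content_integral X m f = (\<Sum>e\<in>?E. a e * content_integral X e f)" by auto
  have ma: "m A = (\<Sum>e\<in>?E. a e * e A)" if A: "clopen_in X A" for A
  proof -
    have "loc_const X (\<lambda>x. real_of_int (ind A x))" by (rule loc_const_comp[OF loc_const_ind_int[OF A], of real_of_int])
    from a[OF this] have "m A = (\<Sum>e\<in>?E. a e * content_integral X e (\<lambda>x. real_of_int (ind A x)))" using content_integral_ind[OF pm A] by simp
    also have "\<dots> = (\<Sum>e\<in>?E. a e * e A)" using content_integral_ind[OF p A] by (intro sum.cong) auto
    finally show ?thesis .
  qed
  have "0 \<le> a e0" if e0: "extreme_mean e0" for e0
  proof (rule ccontr)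
    assume "\<not> 0 \<le> a e0"
    then have neg: "a e0 < 0" by simp
    define s where "s = (\<Sum>e\<in>?E - {e0}. \<bar>a e\<bar>)"
    have s0: "0 \<le> s" by (simp add: s_def sum_nonneg)
    \<comment> \<open>Chosen so that the upper bound \<open>a e0 * (1 - d) + s * d\<close> for
      \<open>m B\<close> equals \<open>a e0 / 2\<close>.\<close>
    define d where "d = - a e0 / (2 * (s - a e0))"
    have den: "0 < s - a e0" using neg s0 by simp
    then have d0: "0 < d" unfolding d_def using neg by (intro divide_pos_pos mult_pos_pos) auto
    have "\<exists>B. clopen_in X B \<and> e0 (XX - B) < d \<and> (\<forall>e\<in>?E - {e0}. e B < d)"
      by (rule extreme_mean_separate[OF _ _ e0 d0]) (use fin in auto)
    then obtain B where B: "clopen_in X B" "e0 (XX - B) < d" "\<forall>e\<in>?E - {e0}. e B < d" by blast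
    have "e0 B = 1 - e0 (XX - B)"
      using invariant_content_Diff[OF p[OF e0] clopen_in_topspace B(1) clopen_in_subset[OF B(1)]] e0 by (simp add: extreme_mean_def invariant_mean_def)
    then have b0: "a e0 * e0 B \<le> a e0 * (1 - d)" using B(2) neg by (intro mult_left_mono_neg) auto
    have "(\<Sum>e\<in>?E - {e0}. a e * e B) \<le> (\<Sum>e\<in>?E - {e0}. \<bar>a e\<bar> * d)"
    proof (rule sum_mono)
      fix e assume e: "e \<in> ?E - {e0}"
      have "a e * e B \<le> \<bar>a e\<bar> * e B" using invariant_contentD(1)[OF p, of e B] e by (intro mult_right_mono) auto
      also have "\<dots> \<le> \<bar>a e\<bar> * d" using less_imp_le[OF bspec[OF B(3) e]] by (intro mult_left_mono) auto
      finally show "a e * e B \<le> \<bar>a e\<bar> * d" .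
    qed
    also have "\<dots> = s * d" by (simp add: s_def sum_distrib_right)
    finally have "m B \<le> a e0 * (1 - d) + s * d"
      using ma[OF B(1)] b0 fin e0 sum.remove[of ?E e0 "\<lambda>e. a e * e B"] by simp
    also have "\<dots> = a e0 + d * (s - a e0)" by (simp add: algebra_simps)
    also have "\<dots> = a e0 / 2" using den unfolding d_def by (simp add: divide_simps)
    finally show False using neg invariant_contentD(1)[OF pm, of B] by simp
  qed
  then show ?thesis using ma by blast
qed

end

text \<open>Nothing is assumed about the regularity of the jump function, but the set where
  \<open>S\<close> agrees with a given power of \<open>T\<close> is closed, and these sets are
  disjoint by aperiodicity. On each piece \<open>S\<close> moves sets by a power of
  \<open>T\<close>, which preserves measure; summing over countably many pieces calls for the
  countably additive extension.\<close>

lemma speedup_invariant_mean: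
  assumes T: "minimal_system X T" and S: "minimal_system X S"
    and sp: "\<And>x. x \<in> topspace X \<Longrightarrow> \<exists>k>0. S x = (T ^^ k) x" and m: "minimal_system.invariant_mean X T m"
  shows "minimal_system.invariant_mean X S m"
proof -
  interpret T: minimal_system X T by (rule T)
  interpret S: minimal_system X S by (rule S)
  let ?XX = "topspace X"
  obtain M where M: "invariant_Borel_prob X T M" "\<forall>A. clopen_in X A \<longrightarrow> emeasure M A = ennreal (m A)"
    using T.invariant_mean_extends[OF m] by blast
  note iM = T.invariant_measure[OF M(1)]
  have cl: "closedin X ((T ^^ k) ` D)" if "closedin X D" for D k
    using homeomorphic_map_closedness_eq[OF T.Sn_hom[of k], of D] that by blast
  have emT: "emeasure M ((T ^^ k) ` D) = emeasure M D" if D: "closedin X D" for D k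
  proof (induction k)
    case (Suc k)
    let ?D = "(T ^^ k) ` D"
    have DX: "?D \<subseteq> ?XX" using cl[OF D] closedin_subset by blast
    have "{x\<in>?XX. T x \<in> T ` ?D} = ?D" using T.S_inj DX by blast
    moreover have "T ` ?D = (T ^^ Suc k) ` D" by (simp add: image_comp)
    ultimately show ?case using iM(3)[OF iM(4)[OF cl[OF D, of "Suc k"]]] Suc by simp
  qed simp
  have "m {x\<in>?XX. S x \<in> A} = m A" if A: "clopen_in X A" for A
  proof -
    \<comment> \<open>\<open>Suc k\<close> runs over the positive jumps.\<close>
    define D where "D k = {x\<in>?XX. S x \<in> A} \<inter> {x\<in>?XX. S x = (T ^^ Suc k) x}" for k
    have cv: "clopen_in X {x\<in>?XX. S x \<in> A}" by (rule clopen_in_vimage[OF S.hom A])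
    have clD: "closedin X (D k)" for k
      unfolding D_def
    proof (rule closedin_Int)
      show "closedin X {x\<in>?XX. S x \<in> A}" using cv by (simp add: clopen_in_def)
      show "closedin X {x\<in>?XX. S x = (T ^^ Suc k) x}"
        by (intro closedin_continuous_maps_eq[OF T.Hausdorff] homeomorphic_imp_continuous_map S.hom T.Sn_hom)
    qed
    have "x \<in> (\<Union>k. D k)" if x: "x \<in> {x\<in>?XX. S x \<in> A}" for x
    proof -
      obtain k where "0 < k" "S x = (T ^^ k) x" using sp x by blast
      then show ?thesis using x by (intro UN_I[of "k - 1"]) (simp_all add: D_def)
    qed
    then have U: "(\<Union>k. D k) = {x\<in>?XX. S x \<in> A}" by (auto simp: D_def)
    have DS: "(T ^^ Suc k) ` D k = S ` D k" for k by (intro image_cong) (auto simp: D_def)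
    have "disjoint_family D"
      unfolding disjoint_family_on_def
    proof (intro ballI impI)
      have "False" if "j < k" "x \<in> D j" "x \<in> D k" for j k x
      proof -
        have x: "x \<in> ?XX" "(T ^^ Suc j) x = (T ^^ Suc k) x" using that(2,3) by (simp_all add: D_def)
        have e: "Suc k = (k - j) + Suc j" using that(1) by simp
        have "(T ^^ (k - j)) ((T ^^ Suc j) x) = (T ^^ Suc k) x" unfolding e T.Sn_add ..
        then show False using T.aperiodic[OF T.Sn_in[OF x(1), of "Suc j"], of "k - j"] that(1) x(2) by simp
      qed
      then show "D j \<inter> D k = {}" if "j \<noteq> k" for j k using that by (metis disjoint_iff linorder_neqE_nat)
    qed
    note dD = this
    have dS: "disjoint_family (\<lambda>k. S ` D k)"
      unfolding disjoint_family_on_def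
    proof (intro ballI impI)
      fix j k :: nat assume "j \<noteq> k"
      then have "D j \<inter> D k = {}" using dD unfolding disjoint_family_on_def by blast
      then show "S ` D j \<inter> S ` D k = {}" using S.S_inj unfolding D_def by blast
    qed
    have UA: "(\<Union>k. S ` D k) = A"
    proof -
      have "(\<Union>k. S ` D k) = S ` {x\<in>?XX. S x \<in> A}" unfolding U[symmetric] by blast
      also have "\<dots> = A" using S.Sn_surj[of _ 1] clopen_in_subset[OF A] by (auto simp: image_iff)
      finally show ?thesis .
    qed
    have sD: "range D \<subseteq> sets M" using iM(4)[OF clD] by blast
    have sS: "range (\<lambda>k. S ` D k) \<subseteq> sets M" using iM(4)[OF cl[OF clD]] unfolding DS[symmetric] by blast
    have "emeasure M {x\<in>?XX. S x \<in> A} = (\<Sum>k. emeasure M (D k))" using suminf_emeasure[OF sD dD] U by simp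
    also have "\<dots> = (\<Sum>k. emeasure M (S ` D k))" unfolding DS[symmetric] emT[OF clD] ..
    also have "\<dots> = emeasure M A" using suminf_emeasure[OF sS dS] UA by simp
    finally have "ennreal (m {x\<in>?XX. S x \<in> A}) = ennreal (m A)" using M(2) A cv by simp
    moreover have "0 \<le> m B" for B using m T.invariant_contentD(1) by (simp add: T.invariant_mean_def)
    ultimately show ?thesis by simp
  qed
  then show ?thesis using m unfolding S.invariant_mean_def S.invariant_content_def T.invariant_mean_def T.invariant_content_def by blast
qed

text \<open>Choosing an element of each \<open>supp m\<close> is an injection into the extreme
  \<open>S\<close>-means. If the numbers agree it is onto, which leaves each support only the chosen
  element; a mean with one component equals that component.\<close>

lemma extreme_mean_count:
  assumes T: "minimal_system X T" and S: "minimal_system X S" and sub: "\<And>m. minimal_system.invariant_mean X T m \<Longrightarrow> minimal_system.invariant_mean X S m"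
    and finS: "finite {m. minimal_system.extreme_mean X S m}"
  shows "card {m. minimal_system.extreme_mean X T m} \<le> card {m. minimal_system.extreme_mean X S m}"
    and "card {m. minimal_system.extreme_mean X S m} \<le> card {m. minimal_system.extreme_mean X T m} \<Longrightarrow> {m. minimal_system.extreme_mean X T m} = {m. minimal_system.extreme_mean X S m}"
proof -
  interpret T: minimal_system X T by (rule T)
  interpret S: minimal_system X S by (rule S)
  let ?ES = "{m. S.extreme_mean m}" and ?ET = "{m. T.extreme_mean m}"
  \<comment> \<open>Membership is domination of a positive multiple of \<open>e\<close> by
    \<open>m\<close>; unlike a positive coefficient, this does not refer to a chosen
    decomposition.\<close>
  define supp where "supp m = {e. S.extreme_mean e \<and> (\<exists>a>0. \<forall>A. clopen_in X A \<longrightarrow> a * e A \<le> m A)}" for m :: "'a set \<Rightarrow> real"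
  have one: "e T.XX = 1" if "S.extreme_mean e" for e using that by (simp add: S.extreme_mean_def S.invariant_mean_def)
  have dec: "\<exists>a. (\<forall>e. S.extreme_mean e \<longrightarrow> 0 \<le> a e) \<and> (\<forall>A. clopen_in X A \<longrightarrow> m A = (\<Sum>e\<in>?ES. a e * e A))" if "T.extreme_mean m" for m
    using S.invariant_mean_decomposition[OF finS sub] that by (simp add: T.extreme_mean_def)
  have in_supp: "e \<in> supp m" if "S.extreme_mean e" "0 < a e" and d: "\<forall>e. S.extreme_mean e \<longrightarrow> 0 \<le> a e"
      "\<forall>A. clopen_in X A \<longrightarrow> m A = (\<Sum>e\<in>?ES. a e * e A)" for e a m
  proof -
    have "a e * e A \<le> m A" if A: "clopen_in X A" for A
    proof -
      have "0 \<le> a e' * e' A" if "S.extreme_mean e'" for e'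
        using d(1) S.invariant_contentD(1)[of e' A] that by (simp add: S.extreme_mean_def S.invariant_mean_def)
      then have "a e * e A \<le> (\<Sum>e\<in>?ES. a e * e A)" using finS \<open>S.extreme_mean e\<close> by (intro member_le_sum) auto
      then show ?thesis using d(2) A by simp
    qed
    then show ?thesis unfolding supp_def using that(1,2) by blast
  qed
  have ne: "supp m \<noteq> {}" if m: "T.extreme_mean m" for m
  proof
    assume e: "supp m = {}"
    obtain a where a: "\<forall>e. S.extreme_mean e \<longrightarrow> 0 \<le> a e" "\<forall>A. clopen_in X A \<longrightarrow> m A = (\<Sum>e\<in>?ES. a e * e A)" using dec[OF m] by blast
    have "a e = 0" if "S.extreme_mean e" for e using in_supp[OF that _ a] a(1) that \<open>supp m = {}\<close> by force
    then have "m T.XX = 0" using a(2) by simp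
    then show False using m by (simp add: T.extreme_mean_def T.invariant_mean_def)
  qed
  have dj: "m = m'" if m: "T.extreme_mean m" "T.extreme_mean m'" and e: "e \<in> supp m" "e \<in> supp m'" for m m' e
  proof (rule ccontr)
    assume neq: "m \<noteq> m'"
    obtain a b where ab: "0 < a" "0 < b" "\<forall>A. clopen_in X A \<longrightarrow> a * e A \<le> m A" "\<forall>A. clopen_in X A \<longrightarrow> b * e A \<le> m' A"
      and ee: "S.extreme_mean e" using e unfolding supp_def by blast
    \<comment> \<open>Adding the estimates on \<open>B\<close> and on its complement gives
      \<open>min a b < 2 * d\<close>, against the choice of \<open>d\<close>.\<close>
    define d where "d = min a b / 2"
    have d: "0 < d" using ab by (simp add: d_def)
    obtain B where B: "clopen_in X B" "m B < d" "m' (T.XX - B) < d" using T.extreme_mean_singular[OF m neq d] by blast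
    have cB: "clopen_in X (T.XX - B)" using B(1) by (simp add: clopen_in_Diff)
    have "a * e B < d" "b * e (T.XX - B) < d" using ab(3,4) B cB by fastforce+
    moreover have pe: "S.invariant_content e" using ee by (simp add: S.extreme_mean_def S.invariant_mean_def)
    moreover have "min a b * e B \<le> a * e B" "min a b * e (T.XX - B) \<le> b * e (T.XX - B)"
      using S.invariant_contentD(1)[OF pe] by (intro mult_right_mono; simp)+
    ultimately have "min a b * e B + min a b * e (T.XX - B) < 2 * d" by simp
    moreover have "e (T.XX - B) = 1 - e B"
      using S.invariant_content_Diff[OF pe clopen_in_topspace B(1) clopen_in_subset[OF B(1)]] one[OF ee] by simp
    ultimately show False by (simp add: d_def algebra_simps)
  qed
  have "\<forall>m. \<exists>e. T.extreme_mean m \<longrightarrow> e \<in> supp m" using ne by blast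
  from choice[OF this] obtain s where s: "\<And>m. T.extreme_mean m \<Longrightarrow> s m \<in> supp m" by blast
  have sE: "s ` ?ET \<subseteq> ?ES" using s by (auto simp: supp_def)
  have inj: "inj_on s ?ET"
  proof (rule inj_onI)
    fix m m' assume "m \<in> ?ET" "m' \<in> ?ET" "s m = s m'"
    then show "m = m'" using dj[of m m' "s m"] s[of m] s[of m'] by simp
  qed
  show le: "card ?ET \<le> card ?ES" by (rule card_inj_on_le[OF inj sE finS])
  assume ge: "card ?ES \<le> card ?ET"
  have "card (s ` ?ET) = card ?ET" by (rule card_image[OF inj])
  then have surj: "s ` ?ET = ?ES" using le ge by (intro card_subset_eq[OF finS sE]) simp
  have "s m = m" if m: "T.extreme_mean m" for m
  proof -
    obtain a where a: "\<forall>e. S.extreme_mean e \<longrightarrow> 0 \<le> a e" "\<forall>A. clopen_in X A \<longrightarrow> m A = (\<Sum>e\<in>?ES. a e * e A)" using dec[OF m] by blast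
    have sm: "S.extreme_mean (s m)" using s[OF m] by (simp add: supp_def)
    have z: "a e = 0" if e: "S.extreme_mean e" "e \<noteq> s m" for e
    proof (rule ccontr)
      assume "a e \<noteq> 0"
      then have "e \<in> supp m" using in_supp[OF e(1) _ a] a(1) e(1) by force
      moreover obtain m' where m': "T.extreme_mean m'" "e = s m'" using surj e(1) by blast
      ultimately have "m = m'" using dj[OF m m'(1)] s[OF m'(1)] by simp
      then show False using e(2) m'(2) by simp
    qed
    have ma: "m A = a (s m) * s m A" if "clopen_in X A" for A
    proof -
      have "m A = (\<Sum>e\<in>?ES. if e = s m then a e * e A else 0)"
        using a(2) that z by (auto intro!: sum.cong)
      then show ?thesis using finS sm by (simp add: sum.delta)
    qed
    have "a (s m) = 1" using ma[OF clopen_in_topspace] m one[OF sm] by (simp add: T.extreme_mean_def T.invariant_mean_def)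
    show "s m = m"
    proof
      fix A
      show "s m A = m A"
      proof (cases "clopen_in X A")
        case True
        then show ?thesis using ma \<open>a (s m) = 1\<close> by simp
      next
        case False
        then show ?thesis using m sm T.invariant_contentD(2)[of m A] S.invariant_contentD(2)[of "s m" A]
          by (simp add: T.extreme_mean_def T.invariant_mean_def S.extreme_mean_def S.invariant_mean_def)
      qed
    qed
  qed
  then have "s ` ?ET = ?ET" by simp
  then show "?ET = ?ES" using surj by simp
qed

section \<open>Conjugacies and the main theorem\<close>

definition push_content :: "'a topology \<Rightarrow> 'b topology \<Rightarrow> ('a \<Rightarrow> 'b) \<Rightarrow> ('a set \<Rightarrow> real) \<Rightarrow> 'b set \<Rightarrow> real" where
  "push_content X Y \<phi> m A = (if clopen_in Y A then m {x\<in>topspace X. \<phi> x \<in> A} else 0)"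

lemma conj_inverse:
  assumes h: "homeomorphic_maps X Y \<phi> \<psi>" and c: "\<And>x. x \<in> topspace X \<Longrightarrow> \<phi> (S x) = R (\<phi> x)"
    and S: "S \<in> topspace X \<rightarrow> topspace X" and y: "y \<in> topspace Y"
  shows "\<psi> (R y) = S (\<psi> y)"
proof -
  have \<psi>: "\<psi> y \<in> topspace X" "\<phi> (\<psi> y) = y" and inv: "\<And>x. x \<in> topspace X \<Longrightarrow> \<psi> (\<phi> x) = x"
    using h y by (auto simp: homeomorphic_maps_def continuous_map_def)
  have "R y = \<phi> (S (\<psi> y))" using c[OF \<psi>(1)] \<psi>(2) by simp
  moreover have "S (\<psi> y) \<in> topspace X" using S \<psi>(1) by blast
  ultimately show ?thesis using inv by simp
qed

lemma push_invariant_mean: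
  assumes X: "minimal_system X S" and Y: "minimal_system Y R" and h: "homeomorphic_map X Y \<phi>"
    and c: "\<And>x. x \<in> topspace X \<Longrightarrow> \<phi> (S x) = R (\<phi> x)" and m: "minimal_system.invariant_mean X S m"
  shows "minimal_system.invariant_mean Y R (push_content X Y \<phi> m)"
proof -
  interpret X: minimal_system X S by (rule X)
  interpret Y: minimal_system Y R by (rule Y)
  have p: "X.invariant_content m" and m1: "m X.XX = 1" using m by (simp_all add: X.invariant_mean_def)
  let ?v = "\<lambda>A. {x\<in>topspace X. \<phi> x \<in> A}"
  have cv: "clopen_in X (?v A)" if "clopen_in Y A" for A by (rule clopen_in_vimage[OF h that])
  have \<phi>Y: "\<phi> x \<in> topspace Y" if "x \<in> topspace X" for x
    using h that by (auto simp: homeomorphic_eq_everything_map continuous_map_def)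
  show ?thesis
    unfolding Y.invariant_mean_def Y.invariant_content_def
  proof (intro conjI allI impI)
    have "?v Y.XX = X.XX" using \<phi>Y by blast
    then show "push_content X Y \<phi> m Y.XX = 1" using m1 by (simp add: push_content_def)
    fix A
    show "0 \<le> push_content X Y \<phi> m A" using X.invariant_contentD(1)[OF p] by (simp add: push_content_def)
    show "\<not> clopen_in Y A \<Longrightarrow> push_content X Y \<phi> m A = 0" by (simp add: push_content_def)
    show "push_content X Y \<phi> m (A \<union> B) = push_content X Y \<phi> m A + push_content X Y \<phi> m B" if "clopen_in Y A" "clopen_in Y B" "A \<inter> B = {}" for B
    proof -
      have "?v (A \<union> B) = ?v A \<union> ?v B" "?v A \<inter> ?v B = {}" using that(3) by blast+
      then show ?thesis using X.invariant_contentD(3)[OF p cv[OF that(1)] cv[OF that(2)]] that(1,2) by (simp add: push_content_def clopen_in_Un)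
    qed
    show "push_content X Y \<phi> m {y\<in>topspace Y. R y \<in> A} = push_content X Y \<phi> m A" if A: "clopen_in Y A"
    proof -
      have "?v {y\<in>topspace Y. R y \<in> A} = {x\<in>X.XX. S x \<in> ?v A}" using c \<phi>Y X.S_in by auto
      then show ?thesis using X.invariant_contentD(4)[OF p cv[OF A]] A clopen_in_vimage[OF Y.hom A] by (simp add: push_content_def)
    qed
  qed
qed

lemma push_content_inverse:
  assumes X: "minimal_system X S" and h: "homeomorphic_maps X Y \<phi> \<psi>" and m: "minimal_system.invariant_mean X S m"
  shows "push_content Y X \<psi> (push_content X Y \<phi> m) = m"
proof
  interpret X: minimal_system X S by (rule X)
  have p: "X.invariant_content m" using m by (simp add: X.invariant_mean_def)
  have inv: "\<And>x. x \<in> topspace X \<Longrightarrow> \<psi> (\<phi> x) = x" "\<And>x. x \<in> topspace X \<Longrightarrow> \<phi> x \<in> topspace Y"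
    using h by (auto simp: homeomorphic_maps_def continuous_map_def)
  have hm: "homeomorphic_map Y X \<psi>" using h homeomorphic_maps_map by blast
  fix A
  show "push_content Y X \<psi> (push_content X Y \<phi> m) A = m A"
  proof (cases "clopen_in X A")
    case True
    have "{x\<in>topspace X. \<phi> x \<in> {y\<in>topspace Y. \<psi> y \<in> A}} = A" using inv clopen_in_subset[OF True] by auto
    then show ?thesis using True clopen_in_vimage[OF hm True] by (simp add: push_content_def)
  qed (use X.invariant_contentD(2)[OF p] in \<open>simp add: push_content_def\<close>)
qed

lemma push_extreme_mean:
  assumes X: "minimal_system X S" and Y: "minimal_system Y R" and h: "homeomorphic_maps X Y \<phi> \<psi>"
    and c: "\<And>x. x \<in> topspace X \<Longrightarrow> \<phi> (S x) = R (\<phi> x)" and m: "minimal_system.extreme_mean X S m"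
  shows "minimal_system.extreme_mean Y R (push_content X Y \<phi> m)"
proof -
  interpret X: minimal_system X S by (rule X)
  interpret Y: minimal_system Y R by (rule Y)
  have hm: "homeomorphic_map X Y \<phi>" "homeomorphic_map Y X \<psi>" using h homeomorphic_maps_map by blast+
  have h': "homeomorphic_maps Y X \<psi> \<phi>" using h homeomorphic_maps_sym by blast
  have "S \<in> topspace X \<rightarrow> topspace X" using X.S_in by blast
  note c' = conj_inverse[OF h c this]
  have mm: "X.invariant_mean m" using m by (simp add: X.extreme_mean_def)
  show ?thesis
    unfolding Y.extreme_mean_def
  proof (intro conjI allI impI)
    show "Y.invariant_mean (push_content X Y \<phi> m)" by (rule push_invariant_mean[OF X Y hm(1) c mm])
    fix m1 m2 t assume m12: "Y.invariant_mean m1" "Y.invariant_mean m2" and t: "0 < t" "t < (1::real)"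
      and eq: "\<forall>A. push_content X Y \<phi> m A = t * m1 A + (1 - t) * m2 A"
    have "m A = t * push_content Y X \<psi> m1 A + (1 - t) * push_content Y X \<psi> m2 A" for A
    proof -
      have "m A = push_content Y X \<psi> (push_content X Y \<phi> m) A" using push_content_inverse[OF X h mm] by simp
      also have "\<dots> = t * push_content Y X \<psi> m1 A + (1 - t) * push_content Y X \<psi> m2 A" using eq by (simp add: push_content_def[of Y])
      finally show ?thesis .
    qed
    moreover have "X.invariant_mean (push_content Y X \<psi> m1)" "X.invariant_mean (push_content Y X \<psi> m2)"
      using push_invariant_mean[OF Y X hm(2) c' m12(1)] push_invariant_mean[OF Y X hm(2) c' m12(2)] by simp_all
    ultimately have "push_content Y X \<psi> m1 = m" using m t unfolding X.extreme_mean_def by blast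
    then show "m1 = push_content X Y \<phi> m" using push_content_inverse[OF Y h' m12(1)] by simp
  qed
qed

lemma extreme_mean_conj_bij:
  assumes X: "minimal_system X S" and Y: "minimal_system Y R" and h: "homeomorphic_maps X Y \<phi> \<psi>"
    and c: "\<And>x. x \<in> topspace X \<Longrightarrow> \<phi> (S x) = R (\<phi> x)"
  shows "bij_betw (push_content X Y \<phi>) {m. minimal_system.extreme_mean X S m} {m. minimal_system.extreme_mean Y R m}"
proof (rule bij_betwI[where g = "push_content Y X \<psi>"])
  interpret X: minimal_system X S by (rule X)
  interpret Y: minimal_system Y R by (rule Y)
  have h': "homeomorphic_maps Y X \<psi> \<phi>" using h homeomorphic_maps_sym by blast
  have "S \<in> topspace X \<rightarrow> topspace X" using X.S_in by blast
  note c' = conj_inverse[OF h c this]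
  show "push_content X Y \<phi> \<in> {m. X.extreme_mean m} \<rightarrow> {m. Y.extreme_mean m}" using push_extreme_mean[OF X Y h c] by blast
  show "push_content Y X \<psi> \<in> {m. Y.extreme_mean m} \<rightarrow> {m. X.extreme_mean m}" using push_extreme_mean[OF Y X h' c'] by blast
  show "push_content Y X \<psi> (push_content X Y \<phi> m) = m" if "m \<in> {m. X.extreme_mean m}" for m
    using that push_content_inverse[OF X h] by (simp add: X.extreme_mean_def)
  show "push_content X Y \<phi> (push_content Y X \<psi> m) = m" if "m \<in> {m. Y.extreme_mean m}" for m
    using that push_content_inverse[OF Y h'] by (simp add: Y.extreme_mean_def)
qed

section \<open>Transport of orbits and minimality, and the conclusion\<close>

lemma full_orbit_conj:
  assumes Y: "bij_betw R (topspace Y) (topspace Y)" and X: "bij_betw S (topspace X) (topspace X)"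
    and h: "h \<in> topspace Y \<rightarrow> topspace X" and c: "\<And>y. y \<in> topspace Y \<Longrightarrow> h (R y) = S (h y)" and y: "y \<in> topspace Y"
  shows "full_orbit X S (h y) = h ` full_orbit Y R y"
proof -
  have R: "R y \<in> topspace Y" if "y \<in> topspace Y" for y using Y that by (auto simp: bij_betw_def)
  have iR: "inv_into (topspace Y) R y \<in> topspace Y" "R (inv_into (topspace Y) R y) = y" if "y \<in> topspace Y" for y
    using Y that by (simp_all add: bij_betw_def inv_into_into f_inv_into_f)
  have 1: "(R ^^ n) y \<in> topspace Y \<and> h ((R ^^ n) y) = (S ^^ n) (h y)" for n
    by (induction n) (use y R c in auto)
  have ih: "inv_into (topspace X) S (h u) = h (inv_into (topspace Y) R u)" if u: "u \<in> topspace Y" for u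
  proof -
    have "S (h (inv_into (topspace Y) R u)) = h u" using c[OF iR(1)[OF u]] iR(2)[OF u] by simp
    moreover have "h (inv_into (topspace Y) R u) \<in> topspace X" using h iR(1)[OF u] by blast
    ultimately show ?thesis using X by (metis bij_betw_imp_inj_on inv_into_f_f)
  qed
  have 2: "(inv_into (topspace Y) R ^^ n) y \<in> topspace Y \<and>
      h ((inv_into (topspace Y) R ^^ n) y) = (inv_into (topspace X) S ^^ n) (h y)" for n
    by (induction n) (use y iR(1) in \<open>auto simp: ih[symmetric]\<close>)
  have "int_iterate X S n (h y) = h (int_iterate Y R n y)" for n
    using 1[of "nat n"] 2[of "nat (- n)"] by (simp add: int_iterate_def)
  then show ?thesis by (auto simp: full_orbit_def)
qed

text \<open>Of \<open>S\<close> only the pointwise intertwining is assumed; that it is a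
  homeomorphism comes from its agreement with \<open>h \<circ> (R \<circ> g)\<close> on the
  space.\<close>

lemma minimal_conj:
  assumes Y: "minimal_Cantor_system Y R" and X: "Cantor_space X" and hm: "homeomorphic_maps Y X h g"
    and c: "\<And>y. y \<in> topspace Y \<Longrightarrow> h (R y) = S (h y)"
  shows "minimal_Cantor_system X S"
proof -
  interpret Y: minimal_system Y R by unfold_locales (rule Y)
  have h: "homeomorphic_map Y X h" and g: "homeomorphic_map X Y g" using hm homeomorphic_maps_map by blast+
  have hY: "h \<in> topspace Y \<rightarrow> topspace X" "g \<in> topspace X \<rightarrow> topspace Y" and hg: "\<And>x. x \<in> topspace X \<Longrightarrow> h (g x) = x"
    using hm by (auto simp: homeomorphic_maps_def continuous_map_def)
  have "homeomorphic_map X X (h \<circ> (R \<circ> g))"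
    by (intro homeomorphic_map_compose[OF _ h] homeomorphic_map_compose[OF g Y.hom])
  moreover have "(h \<circ> (R \<circ> g)) x = S x" if x: "x \<in> topspace X" for x
  proof -
    have "g x \<in> topspace Y" using hY(2) x by blast
    then show ?thesis using c[of "g x"] hg[OF x] by simp
  qed
  ultimately have homS: "homeomorphic_map X X S" by (rule homeomorphic_map_eq) simp
  then have bS: "bij_betw S (topspace X) (topspace X)"
    using homeomorphic_imp_surjective_map homeomorphic_imp_injective_map unfolding bij_betw_def by blast
  have "X closure_of (full_orbit X S x) = topspace X" if x: "x \<in> topspace X" for x
  proof -
    have gx: "g x \<in> topspace Y" using hY(2) x by blast
    have "full_orbit X S x = h ` full_orbit Y R (g x)"
      using full_orbit_conj[OF Y.S_bij bS hY(1) c gx] hg[OF x] by simp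
    moreover have "full_orbit Y R (g x) \<subseteq> topspace Y" using Y.full_orbit_iff[OF gx] by blast
    ultimately have "X closure_of (full_orbit X S x) = h ` (Y closure_of (full_orbit Y R (g x)))"
      using homeomorphic_map_closure_of[OF h] by simp
    then show ?thesis using Y.dense[OF gx] homeomorphic_imp_surjective_map[OF h] by simp
  qed
  then show ?thesis using X homS by (simp add: minimal_Cantor_system_def)
qed

lemma valued_towers_extreme_means:
  assumes "tower_sequence X S Z k" and EV: "EV = (\<lambda>m f. content_integral X m (\<lambda>x. real_of_int (f x))) ` {m. minimal_system.extreme_mean X S m}"
  shows "valued_towers X S Z k EV"
proof -
  interpret tower_sequence X S Z k by fact
  have lcr: "loc_const X (\<lambda>x. real_of_int (f x))" if "loc_const X f" for f using loc_const_comp[OF that] .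
  have p: "invariant_content m" and mm: "invariant_mean m" if "extreme_mean m" for m using that by (simp_all add: extreme_mean_def invariant_mean_def)
  show ?thesis
  proof unfold_locales
    fix e assume "e \<in> EV"
    then obtain m where m: "extreme_mean m" "e = (\<lambda>f. content_integral X m (\<lambda>x. real_of_int (f x)))" using EV by blast
    show "e (\<lambda>x. f x + g x) = e f + e g" if "loc_const X f" "loc_const X g" for f g
      using content_integral_lin[OF p[OF m(1)] lcr[OF that(1)] lcr[OF that(2)], of 1] by (simp add: m(2))
    show "e (\<lambda>x. f (S x)) = e f" if "loc_const X f" for f
      using content_integral_S[OF p[OF m(1)] lcr[OF that]] by (simp add: m(2))
    show "0 < e (ind A)" if "clopen_in X A" "A \<noteq> {}" for A
      using content_integral_ind[OF p[OF m(1)] that(1)] invariant_mean_pos[OF mm[OF m(1)] that] by (simp add: m(2))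
    show "e f = e g" if eq: "\<And>x. x \<in> topspace X \<Longrightarrow> f x = g x" for f g
    proof -
      have "{x\<in>topspace X. real_of_int (f x) = c} = {x\<in>topspace X. real_of_int (g x) = c}" for c using eq by auto
      moreover have "(\<lambda>x. real_of_int (f x)) ` topspace X = (\<lambda>x. real_of_int (g x)) ` topspace X"
        using eq by (intro image_cong) auto
      ultimately show ?thesis by (simp add: m(2) content_integral_def)
    qed
  next
    fix f assume f: "loc_const X f" and pos: "\<And>e. e \<in> EV \<Longrightarrow> 0 < e f"
    have "\<exists>N. \<forall>n\<ge>N. \<forall>x\<in>XX. 0 < (\<Sum>i<n. real_of_int (f ((S ^^ i) x)))"
      by (rule eventually_positive[OF lcr[OF f]]) (use pos EV in blast)
    moreover have "0 < (\<Sum>i<n. real_of_int (f ((S ^^ i) x))) \<longleftrightarrow> 0 < (\<Sum>i<n. f ((S ^^ i) x))" for n x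
      by (simp flip: of_int_sum)
    ultimately show "\<exists>N. \<forall>n\<ge>N. \<forall>x\<in>topspace X. 0 < (\<Sum>i<n. f ((S ^^ i) x))" by simp
  qed
qed

lemma speedup_conj:
  assumes X: "minimal_Cantor_system X T" and Y: "minimal_Cantor_system Y R" and s: "speedup_of Y R X T"
  obtains S h g where "minimal_Cantor_system X S" "\<And>x. x \<in> topspace X \<Longrightarrow> \<exists>k>0. S x = (T ^^ k) x"
    "homeomorphic_maps Y X h g" "\<And>y. y \<in> topspace Y \<Longrightarrow> h (R y) = S (h y)"
proof -
  obtain p h where p: "\<forall>x\<in>topspace X. 0 < p x" and h: "homeomorphic_map Y X h"
    "\<forall>y\<in>topspace Y. h (R y) = (T ^^ p (h y)) (h y)"
    using s unfolding speedup_of_def top_conjugate_def by blast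
  obtain g where g: "homeomorphic_maps Y X h g" using h(1) homeomorphic_map_maps by blast
  define S where "S x = (T ^^ p x) x" for x
  have c: "\<And>y. y \<in> topspace Y \<Longrightarrow> h (R y) = S (h y)" using h(2) by (simp add: S_def)
  have "Cantor_space X" using X by (simp add: minimal_Cantor_system_def)
  then have "minimal_Cantor_system X S" by (rule minimal_conj[OF Y _ g c])
  moreover have "\<exists>k>0. S x = (T ^^ k) x" if "x \<in> topspace X" for x using p that unfolding S_def by blast
  ultimately show ?thesis using g c that by blast
qed

text \<open>Every invariant mean of \<open>T\<close> is invariant for the speedup map on
  \<open>X\<close>, so the injection of \<open>extreme_mean_count\<close> applies; the conjugacy
  carries the count over to \<open>R\<close>.\<close>

lemma speedup_extreme_mean_card:
  assumes X: "minimal_Cantor_system X T" and Y: "minimal_Cantor_system Y R" and s: "speedup_of Y R X T"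
    and fin: "finite {m. minimal_system.extreme_mean Y R m}"
  shows "card {m. minimal_system.extreme_mean X T m} \<le> card {m. minimal_system.extreme_mean Y R m}"
proof -
  obtain S h g where S: "minimal_Cantor_system X S" "\<And>x. x \<in> topspace X \<Longrightarrow> \<exists>k>0. S x = (T ^^ k) x"
    and h: "homeomorphic_maps Y X h g" "\<And>y. y \<in> topspace Y \<Longrightarrow> h (R y) = S (h y)"
    using speedup_conj[OF X Y s] by blast
  have m: "minimal_system X T" "minimal_system Y R" "minimal_system X S" using X Y S(1) by (simp_all add: minimal_system_def)
  have b: "bij_betw (push_content Y X h) {m. minimal_system.extreme_mean Y R m} {m. minimal_system.extreme_mean X S m}" by (rule extreme_mean_conj_bij[OF m(2,3) h])
  have "card {m. minimal_system.extreme_mean X T m} \<le> card {m. minimal_system.extreme_mean X S m}"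
    using extreme_mean_count(1)[OF m(1,3) speedup_invariant_mean[OF m(1,3) S(2)]] bij_betw_finite[OF b] fin by blast
  then show ?thesis using bij_betw_same_card[OF b] by simp
qed

theorem theorem7p3:
  fixes X1 :: "'a topology" and T1 :: "'a \<Rightarrow> 'a"
    and X2 :: "'b topology" and T2 :: "'b \<Rightarrow> 'b"
  assumes "minimal_Cantor_system X1 T1"
    and "minimal_Cantor_system X2 T2"
    and "finite {M. ergodic_measure X1 T1 M}"
    and "finite {M. ergodic_measure X2 T2 M}"
    and "speedup_equivalent X1 T1 X2 T2"
  shows "orbit_equivalent X1 T1 X2 T2"
proof -
  have m: "minimal_system X1 T1" "minimal_system X2 T2" using assms(1,2) by (simp_all add: minimal_system_def)
  interpret T: minimal_system X1 T1 by (rule m)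
  have f1: "finite {m. minimal_system.extreme_mean X1 T1 m}" by (rule T.finite_extreme_means[OF assms(3)])
  have f2: "finite {m. minimal_system.extreme_mean X2 T2 m}" by (rule minimal_system.finite_extreme_means[OF m(2) assms(4)])
  have sp: "speedup_of X1 T1 X2 T2" "speedup_of X2 T2 X1 T1" using assms(5) by (simp_all add: speedup_equivalent_def)
  obtain S h g where S: "minimal_Cantor_system X1 S" "\<And>x. x \<in> topspace X1 \<Longrightarrow> \<exists>k>0. S x = (T1 ^^ k) x"
    and h: "homeomorphic_maps X2 X1 h g" "\<And>y. y \<in> topspace X2 \<Longrightarrow> h (T2 y) = S (h y)"
    using speedup_conj[OF assms(1,2) sp(2)] by blast
  have mS: "minimal_system X1 S" using S(1) by (simp add: minimal_system_def)
  interpret S: minimal_system X1 S by (rule mS)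
  have b: "bij_betw (push_content X2 X1 h) {m. minimal_system.extreme_mean X2 T2 m} {m. S.extreme_mean m}" by (rule extreme_mean_conj_bij[OF m(2) mS h])
  \<comment> \<open>The conjugacy with \<open>T2\<close> and the speedup in the other direction give
    the reverse of the inequality that comes from \<open>S\<close> being a speedup of
    \<open>T1\<close>.\<close>
  have "card {m. S.extreme_mean m} = card {m. minimal_system.extreme_mean X2 T2 m}" using bij_betw_same_card[OF b] by simp
  also have "\<dots> \<le> card {m. T.extreme_mean m}" by (rule speedup_extreme_mean_card[OF assms(2,1) sp(1) f1])
  finally have E: "{m. T.extreme_mean m} = {m. S.extreme_mean m}"
    using extreme_mean_count(2)[OF m(1) mS speedup_invariant_mean[OF m(1) mS S(2)]] bij_betw_finite[OF b] f2 by blast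
  define EV where "EV = (\<lambda>m f. content_integral X1 m (\<lambda>x. real_of_int (f x))) ` {m. S.extreme_mean m}"
  obtain Z k where Z: "tower_sequence X1 S Z k" using S.tower_ex by blast
  obtain W l where W: "tower_sequence X1 T1 W l" using T.tower_ex by blast
  interpret tower_pair X1 S Z k T1 W l EV
    unfolding tower_pair_def using valued_towers_extreme_means[OF Z, of EV] valued_towers_extreme_means[OF W, of EV] E EV_def by simp
  obtain f where f: "homeomorphic_map X1 X1 f"
    and orb: "\<And>x y. x \<in> topspace X1 \<Longrightarrow> y \<in> topspace X1 \<Longrightarrow> y \<in> full_orbit X1 S x \<longleftrightarrow> f y \<in> full_orbit X1 T1 (f x)"
    using orbit_homeo by blast
  obtain f' where f': "homeomorphic_maps X1 X1 f f'" using f homeomorphic_map_maps by blast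
  have ff: "f \<in> topspace X1 \<rightarrow> topspace X1" "f' \<in> topspace X1 \<rightarrow> topspace X1"
    "\<And>x. x \<in> topspace X1 \<Longrightarrow> f' (f x) = x" "\<And>x. x \<in> topspace X1 \<Longrightarrow> f (f' x) = x"
    using f' by (auto simp: homeomorphic_maps_def continuous_map_def)
  \<comment> \<open>\<open>f\<close> maps orbits of \<open>S\<close> onto orbits of
    \<open>T1\<close>, so the conjugate of \<open>S\<close> by \<open>f\<close> has the orbits of
    \<open>T1\<close> while remaining conjugate to \<open>T2\<close>.\<close>
  define T' where "T' x = f (S (f' x))" for x
  have c: "f (S x) = T' (f x)" if "x \<in> topspace X1" for x using ff(3)[OF that] by (simp add: T'_def)
  have "minimal_Cantor_system X1 T'" by (rule minimal_conj[OF S(1) T.cantor f' c])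
  then interpret T': minimal_system X1 T' by (simp add: minimal_system_def)
  have "T' \<in> topspace X1 \<rightarrow> topspace X1" using T'.S_in by blast
  moreover have "top_conjugate X2 T2 X1 T'"
    unfolding top_conjugate_def
  proof (intro exI[of _ "f \<circ> h"] conjI ballI)
    have hm: "homeomorphic_map X2 X1 h" using h(1) homeomorphic_maps_map by blast
    show "homeomorphic_map X2 X1 (f \<circ> h)" by (rule homeomorphic_map_compose[OF hm f])
    fix y assume y: "y \<in> topspace X2"
    have "h y \<in> topspace X1" using hm y by (auto simp: homeomorphic_eq_everything_map continuous_map_def)
    then show "(f \<circ> h) (T2 y) = T' ((f \<circ> h) y)" using h(2)[OF y] c by simp
  qed
  moreover have "full_orbit X1 T' x = full_orbit X1 T1 x" if x: "x \<in> topspace X1" for x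
  proof -
    have u: "f' x \<in> topspace X1" using ff(2) x by blast
    have "full_orbit X1 T' x = f ` full_orbit X1 S (f' x)"
      using full_orbit_conj[OF S.S_bij T'.S_bij ff(1) c u] ff(4)[OF x] by simp
    also have "\<dots> = full_orbit X1 T1 x"
    proof
      show "f ` full_orbit X1 S (f' x) \<subseteq> full_orbit X1 T1 x"
        using orb[OF u] S.full_orbit_iff[OF u] ff(4)[OF x] by auto
      show "full_orbit X1 T1 x \<subseteq> f ` full_orbit X1 S (f' x)"
      proof
        fix z assume z: "z \<in> full_orbit X1 T1 x"
        then have zX: "z \<in> topspace X1" using T.full_orbit_iff[OF x] by blast
        then have "f' z \<in> full_orbit X1 S (f' x)" using orb[OF u, of "f' z"] z ff(2) ff(4)[OF x] ff(4)[OF zX] by auto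
        then show "z \<in> f ` full_orbit X1 S (f' x)" using ff(4)[OF zX] by (metis imageI)
      qed
    qed
    finally show ?thesis .
  qed
  ultimately show ?thesis unfolding orbit_equivalent_def by blast
qed

end
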